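(* Let $p$ be an odd prime, $\mathbb{F}$ a finite field of characteristic $p$, and $G$ a profinite group satisfying Mazur's finiteness condition $\Phi_p$. Let $\chi_1,\chi_2:G\to\mathbb{F}^*$ be distinct continuous characters, $\bar\rho_0=\chi_1\oplus\chi_2$ and $\chi=\chi_1\chi_2^{-1}$, and assume $H^1(G,\chi)\neq 0$ and $H^1(G,\chi^{-1})\neq 0$. Suppose there exists $i\in\{1,-1\}$ such that $\dim_{\mathbb{F}} H^1(G,\chi^i)=1$ and $H^2(G,\chi^i)=0$. Fix such an $i$ and let $x\in H^1(G,\chi^i)$ be non-zero. Then the map $\Psi_x:\mathcal{R}^{pd}_{\bar\rho_0}\to\mathcal{R}^{def}_{\bar\rho_x}$ induces an isomorphism $(\mathcal{R}^{pd}_{\bar\rho_0})^{red}\simeq(\mathcal{R}^{def}_{\bar\rho_x})^{red}$.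
   Context: All representations, pseudo-representations and cohomology groups are continuous; $H^j(G,\psi)$ denotes cohomology of $G$ with coefficients in $\mathbb{F}$ with $G$ acting through the character $\psi$. $W(\mathbb{F})$ is the ring of Witt vectors of $\mathbb{F}$. $\mathcal{C}$ is the category of complete Noetherian local $W(\mathbb{F})$-algebras with residue field $\mathbb{F}$ (local $W(\mathbb{F})$-algebra morphisms). $\mathcal{R}^{pd}_{\bar\rho_0}$ is the object of $\mathcal{C}$ representing the functor sending $R$ to the set of continuous $2$-dimensional pseudo-representations (in Chenevier's sense) $(t,d):G\to R$ reducing to $(\mathrm{tr}\bar\rho_0,\det\bar\rho_0)$ modulo $m_R$; let $(T^{univ},D^{univ})$ be its universal pseudo-representation. For non-zero $x\in H^1(G,\chi)$, $\bar\rho_x:G\to\mathrm{GL}_2(\mathbb{F})$ is the non-split extension $g\mapsto\begin{pmatrix}\chi_1(g)&\chi_2(g)x(g)\\0&\chi_2(g)\end{pmatrix}$; for non-zero $x\in H^1(G,\chi^{-1})$, $\bar\rho_x$ is the analogous non-split extension with $\chi_2$ as sub and $\chi_1$ as quotient. $\mathcal{R}^{def}_{\bar\rho_x}$ is Mazur's universal deformation ring of $\bar\rho_x$ in $\mathcal{C}$ (it exists since the centralizer of $\bar\rho_x$ is the scalars) with universal deformation $\rho^{univ}_x$, and $\Psi_x$ is the morphism classifying $(\mathrm{tr}\rho^{univ}_x,\det\rho^{univ}_x)$. For a local ring $R$, $R^{red}$ is its quotient by the nilradical. *)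

theory Defs
  imports
    "HOL-Analysis.T1_Spaces"
    "HOL-Algebra.QuotRing"
    "HOL-Algebra.Ring_Divisibility"
    "HOL-Algebra.Ideal_Product"
    "HOL-Algebra.Elementary_Groups"
    "HOL-Computational_Algebra.Primes"
    "HOL-Library.Poly_Mapping"
    "Jordan_Normal_Form.Missing_VectorSpace"
begin

section \<open>Profinite groups\<close>

definition topological_group :: "'g monoid \<Rightarrow> 'g topology \<Rightarrow> bool" where
  "topological_group G \<tau> \<longleftrightarrow>
     group G \<and> topspace \<tau> = carrier G \<and>
     continuous_map (prod_topology \<tau> \<tau>) \<tau> (\<lambda>(g, h). g \<otimes>\<^bsub>G\<^esub> h) \<and>
     continuous_map \<tau> \<tau> (\<lambda>g. inv\<^bsub>G\<^esub> g)"

definition profinite_group :: "'g monoid \<Rightarrow> 'g topology \<Rightarrow> bool" where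
  "profinite_group G \<tau> \<longleftrightarrow>
     topological_group G \<tau> \<and> compact_space \<tau> \<and> Hausdorff_space \<tau> \<and>
     (\<forall>S. connectedin \<tau> S \<longrightarrow> (\<exists>a. S \<subseteq> {a}))"

text \<open>Mazur's condition: every open subgroup has only finitely many continuous homomorphisms
  to \<open>\<int>/p\<close>.  They are taken extensional so that each of them is counted once.\<close>

definition mazur_finiteness :: "nat \<Rightarrow> 'g monoid \<Rightarrow> 'g topology \<Rightarrow> bool" where
  "mazur_finiteness p G \<tau> \<longleftrightarrow>
     (\<forall>H. subgroup H G \<and> openin \<tau> H \<longrightarrow>
        finite {f \<in> hom (G\<lparr>carrier := H\<rparr>) (integer_mod_group p) \<inter> extensional H.
                  continuous_map (subtopology \<tau> H)
                    (discrete_topology (carrier (integer_mod_group p))) f})"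


section \<open>Continuous cohomology with coefficients in a character\<close>

definition cont_character :: "'g monoid \<Rightarrow> 'g topology \<Rightarrow> 'k ring \<Rightarrow> ('g \<Rightarrow> 'k) \<Rightarrow> bool" where
  "cont_character G \<tau> F \<psi> \<longleftrightarrow>
     \<psi> \<in> hom G (units_of F) \<and> continuous_map \<tau> (discrete_topology (carrier F)) \<psi>"

definition char_ratio :: "'k ring \<Rightarrow> ('g \<Rightarrow> 'k) \<Rightarrow> ('g \<Rightarrow> 'k) \<Rightarrow> 'g \<Rightarrow> 'k" where
  "char_ratio F \<psi>\<^sub>1 \<psi>\<^sub>2 g = \<psi>\<^sub>1 g \<otimes>\<^bsub>F\<^esub> inv\<^bsub>F\<^esub> (\<psi>\<^sub>2 g)"

definition char_pow :: "'k ring \<Rightarrow> ('g \<Rightarrow> 'k) \<Rightarrow> int \<Rightarrow> 'g \<Rightarrow> 'k" where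
  "char_pow F \<psi> i g = \<psi> g [^]\<^bsub>F\<^esub> i"

text \<open>Inhomogeneous continuous cochains; cochains are extensional functions, so that equality
  of cochains is equality of functions.\<close>

definition cochains :: "'k ring \<Rightarrow> 'x topology \<Rightarrow> ('x \<Rightarrow> 'k) set" where
  "cochains F T =
     {f \<in> topspace T \<rightarrow>\<^sub>E carrier F. continuous_map T (discrete_topology (carrier F)) f}"

definition cobound0 :: "'g monoid \<Rightarrow> 'k ring \<Rightarrow> ('g \<Rightarrow> 'k) \<Rightarrow> 'k \<Rightarrow> 'g \<Rightarrow> 'k" where
  "cobound0 G F \<psi> a = (\<lambda>g\<in>carrier G. \<psi> g \<otimes>\<^bsub>F\<^esub> a \<ominus>\<^bsub>F\<^esub> a)"

definition cobound1 :: "'g monoid \<Rightarrow> 'k ring \<Rightarrow> ('g \<Rightarrow> 'k) \<Rightarrow> ('g \<Rightarrow> 'k) \<Rightarrow> 'g \<times> 'g \<Rightarrow> 'k" where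
  "cobound1 G F \<psi> c =
     (\<lambda>(g, h)\<in>carrier G \<times> carrier G.
        (\<psi> g \<otimes>\<^bsub>F\<^esub> c h \<ominus>\<^bsub>F\<^esub> c (g \<otimes>\<^bsub>G\<^esub> h)) \<oplus>\<^bsub>F\<^esub> c g)"

definition cobound2 ::
    "'g monoid \<Rightarrow> 'k ring \<Rightarrow> ('g \<Rightarrow> 'k) \<Rightarrow> ('g \<times> 'g \<Rightarrow> 'k) \<Rightarrow> 'g \<times> 'g \<times> 'g \<Rightarrow> 'k" where
  "cobound2 G F \<psi> c =
     (\<lambda>(g, h, k)\<in>carrier G \<times> carrier G \<times> carrier G.
        ((\<psi> g \<otimes>\<^bsub>F\<^esub> c (h, k) \<ominus>\<^bsub>F\<^esub> c (g \<otimes>\<^bsub>G\<^esub> h, k)) \<oplus>\<^bsub>F\<^esub> c (g, h \<otimes>\<^bsub>G\<^esub> k))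
          \<ominus>\<^bsub>F\<^esub> c (g, h))"

definition cocycles1 :: "'g monoid \<Rightarrow> 'g topology \<Rightarrow> 'k ring \<Rightarrow> ('g \<Rightarrow> 'k) \<Rightarrow> ('g \<Rightarrow> 'k) set" where
  "cocycles1 G \<tau> F \<psi> =
     {c \<in> cochains F \<tau>. \<forall>s\<in>carrier G \<times> carrier G. cobound1 G F \<psi> c s = \<zero>\<^bsub>F\<^esub>}"

definition coboundaries1 :: "'g monoid \<Rightarrow> 'k ring \<Rightarrow> ('g \<Rightarrow> 'k) \<Rightarrow> ('g \<Rightarrow> 'k) set" where
  "coboundaries1 G F \<psi> = cobound0 G F \<psi> ` carrier F"

definition cocycles2 ::
    "'g monoid \<Rightarrow> 'g topology \<Rightarrow> 'k ring \<Rightarrow> ('g \<Rightarrow> 'k) \<Rightarrow> ('g \<times> 'g \<Rightarrow> 'k) set" where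
  "cocycles2 G \<tau> F \<psi> =
     {c \<in> cochains F (prod_topology \<tau> \<tau>).
        \<forall>s\<in>carrier G \<times> carrier G \<times> carrier G. cobound2 G F \<psi> c s = \<zero>\<^bsub>F\<^esub>}"

definition coboundaries2 ::
    "'g monoid \<Rightarrow> 'g topology \<Rightarrow> 'k ring \<Rightarrow> ('g \<Rightarrow> 'k) \<Rightarrow> ('g \<times> 'g \<Rightarrow> 'k) set" where
  "coboundaries2 G \<tau> F \<psi> = cobound1 G F \<psi> ` cochains F \<tau>"

text \<open>A set \<open>Z\<close> of extensional \<open>F\<close>-valued functions on \<open>X\<close> with the pointwise
  operations.  The record \<^typ>\<open>('k, 'v) module\<close> extends rings, so its multiplicative fields are
  present but play no role.\<close>

definition fun_module :: "'k ring \<Rightarrow> 'x set \<Rightarrow> ('x \<Rightarrow> 'k) set \<Rightarrow> ('k, 'x \<Rightarrow> 'k) module" where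
  "fun_module F X Z =
     \<lparr>carrier = Z, mult = undefined, one = undefined,
      zero = (\<lambda>s\<in>X. \<zero>\<^bsub>F\<^esub>), add = (\<lambda>f f'. \<lambda>s\<in>X. f s \<oplus>\<^bsub>F\<^esub> f' s),
      smult = (\<lambda>a f. \<lambda>s\<in>X. a \<otimes>\<^bsub>F\<^esub> f s)\<rparr>"

definition quot_module :: "('k, 'v) module \<Rightarrow> 'v set \<Rightarrow> ('k, 'v set) module" where
  "quot_module V B =
     \<lparr>carrier = a_rcosets\<^bsub>V\<^esub> B, mult = undefined, one = undefined,
      zero = B, add = set_add V, smult = (\<lambda>a X. \<Union>v\<in>X. B +>\<^bsub>V\<^esub> (a \<odot>\<^bsub>V\<^esub> v))\<rparr>"

definition H1 ::
    "'g monoid \<Rightarrow> 'g topology \<Rightarrow> 'k ring \<Rightarrow> ('g \<Rightarrow> 'k) \<Rightarrow> ('k, ('g \<Rightarrow> 'k) set) module" where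
  "H1 G \<tau> F \<psi> =
     quot_module (fun_module F (carrier G) (cocycles1 G \<tau> F \<psi>)) (coboundaries1 G F \<psi>)"

definition H2 ::
    "'g monoid \<Rightarrow> 'g topology \<Rightarrow> 'k ring \<Rightarrow> ('g \<Rightarrow> 'k) \<Rightarrow> ('k, ('g \<times> 'g \<Rightarrow> 'k) set) module" where
  "H2 G \<tau> F \<psi> =
     quot_module (fun_module F (carrier G \<times> carrier G) (cocycles2 G \<tau> F \<psi>))
       (coboundaries2 G \<tau> F \<psi>)"


section \<open>Witt vectors\<close>

text \<open>Integral polynomials in the variables \<open>X\<^sub>0, X\<^sub>1, \<dots>\<close> (indexed by \<^term>\<open>Inl n\<close>) and
  \<open>Y\<^sub>0, Y\<^sub>1, \<dots>\<close> (indexed by \<^term>\<open>Inr n\<close>).\<close>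

type_synonym witt_poly = "((nat + nat) \<Rightarrow>\<^sub>0 nat) \<Rightarrow>\<^sub>0 int"

definition witt_var :: "nat + nat \<Rightarrow> witt_poly" where
  "witt_var v = Poly_Mapping.single (Poly_Mapping.single v 1) 1"

definition ghost :: "nat \<Rightarrow> nat \<Rightarrow> (nat \<Rightarrow> witt_poly) \<Rightarrow> witt_poly" where
  "ghost p n a = (\<Sum>i\<le>n. of_nat (p ^ i) * a i ^ (p ^ (n - i)))"

text \<open>The unique integral polynomials through which the ghost components become additive,
  respectively multiplicative (Witt's theorem).\<close>

definition witt_sum_poly :: "nat \<Rightarrow> nat \<Rightarrow> witt_poly" where
  "witt_sum_poly p = (THE S. \<forall>n. ghost p n S =
     ghost p n (\<lambda>i. witt_var (Inl i)) + ghost p n (\<lambda>i. witt_var (Inr i)))"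

definition witt_prod_poly :: "nat \<Rightarrow> nat \<Rightarrow> witt_poly" where
  "witt_prod_poly p = (THE P. \<forall>n. ghost p n P =
     ghost p n (\<lambda>i. witt_var (Inl i)) * ghost p n (\<lambda>i. witt_var (Inr i)))"

definition witt_eval :: "'k ring \<Rightarrow> (nat + nat \<Rightarrow> 'k) \<Rightarrow> witt_poly \<Rightarrow> 'k" where
  "witt_eval F v f =
     (\<Oplus>\<^bsub>F\<^esub>m\<in>Poly_Mapping.keys f. add_pow F (Poly_Mapping.lookup f m)
        (\<Otimes>\<^bsub>F\<^esub>j\<in>Poly_Mapping.keys m. v j [^]\<^bsub>F\<^esub> Poly_Mapping.lookup m j))"

definition witt_ring :: "nat \<Rightarrow> 'k ring \<Rightarrow> (nat \<Rightarrow> 'k) ring" where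
  "witt_ring p F =
     \<lparr>carrier = {a. \<forall>n. a n \<in> carrier F},
      mult = (\<lambda>a b n. witt_eval F (case_sum a b) (witt_prod_poly p n)),
      one = (\<lambda>n. if n = 0 then \<one>\<^bsub>F\<^esub> else \<zero>\<^bsub>F\<^esub>),
      zero = (\<lambda>n. \<zero>\<^bsub>F\<^esub>),
      add = (\<lambda>a b n. witt_eval F (case_sum a b) (witt_sum_poly p n))\<rparr>"


section \<open>Coefficient rings\<close>

definition local_ring :: "('r, 'm) ring_scheme \<Rightarrow> bool" where
  "local_ring R \<longleftrightarrow> cring R \<and> (\<exists>!M. maximalideal M R)"

definition max_ideal :: "('r, 'm) ring_scheme \<Rightarrow> 'r set" where
  "max_ideal R = (THE M. maximalideal M R)"

primrec ideal_power :: "('r, 'm) ring_scheme \<Rightarrow> 'r set \<Rightarrow> nat \<Rightarrow> 'r set" where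
  "ideal_power R I 0 = carrier R"
| "ideal_power R I (Suc n) = ideal_prod R (ideal_power R I n) I"

text \<open>Bijectivity of \<open>R \<rightarrow> lim R/I\<^sup>n\<close>: the first conjunct is injectivity, the second
  surjectivity.\<close>

definition adically_complete :: "('r, 'm) ring_scheme \<Rightarrow> 'r set \<Rightarrow> bool" where
  "adically_complete R I \<longleftrightarrow>
     (\<Inter>n. ideal_power R I n) = {\<zero>\<^bsub>R\<^esub>} \<and>
     (\<forall>s. (\<forall>n. s n \<in> carrier R) \<and> (\<forall>n. s (Suc n) \<ominus>\<^bsub>R\<^esub> s n \<in> ideal_power R I n) \<longrightarrow>
        (\<exists>l\<in>carrier R. \<forall>n. l \<ominus>\<^bsub>R\<^esub> s n \<in> ideal_power R I n))"

definition adic_topology :: "('r, 'm) ring_scheme \<Rightarrow> 'r topology" where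
  "adic_topology R =
     topology_generated_by {ideal_power R (max_ideal R) n +>\<^bsub>R\<^esub> r | n r. r \<in> carrier R}"

text \<open>The identification of the residue field of a \<open>W(F)\<close>-algebra with \<open>F\<close>, as a ring
  homomorphism from the algebra to \<open>F\<close>.  It is compatible with the projection \<open>W(F) \<rightarrow> F\<close> to
  the zeroth Witt component, which determines it.\<close>

definition is_residue_map ::
    "nat \<Rightarrow> 'k ring \<Rightarrow> (nat \<Rightarrow> 'k, 'r) module \<Rightarrow> ('r \<Rightarrow> 'k) \<Rightarrow> bool" where
  "is_residue_map p F R \<pi> \<longleftrightarrow>
     \<pi> \<in> ring_hom R F \<inter> extensional (carrier R) \<and> \<pi> ` carrier R = carrier F \<and>
     a_kernel R F \<pi> = max_ideal R \<and>
     (\<forall>a\<in>carrier (witt_ring p F). \<pi> (a \<odot>\<^bsub>R\<^esub> \<one>\<^bsub>R\<^esub>) = a 0)"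

definition residue_map :: "nat \<Rightarrow> 'k ring \<Rightarrow> (nat \<Rightarrow> 'k, 'r) module \<Rightarrow> 'r \<Rightarrow> 'k" where
  "residue_map p F R = (THE \<pi>. is_residue_map p F R \<pi>)"

text \<open>Objects and morphisms of the category of complete Noetherian local \<open>W(F)\<close>-algebras with
  residue field \<open>F\<close>.  Morphisms are extensional.\<close>

definition coeff_ring :: "nat \<Rightarrow> 'k ring \<Rightarrow> (nat \<Rightarrow> 'k, 'r) module \<Rightarrow> bool" where
  "coeff_ring p F R \<longleftrightarrow>
     algebra (witt_ring p F) R \<and> local_ring R \<and> noetherian_ring R \<and>
     adically_complete R (max_ideal R) \<and> (\<exists>\<pi>. is_residue_map p F R \<pi>)"

definition coeff_hom ::
    "nat \<Rightarrow> 'k ring \<Rightarrow> (nat \<Rightarrow> 'k, 'r) module \<Rightarrow> (nat \<Rightarrow> 'k, 's) module \<Rightarrow> ('r \<Rightarrow> 's) set" where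
  "coeff_hom p F R S =
     {\<phi> \<in> ring_hom R S \<inter> extensional (carrier R).
        \<phi> ` max_ideal R \<subseteq> max_ideal S \<and>
        (\<forall>a\<in>carrier (witt_ring p F). \<forall>r\<in>carrier R. \<phi> (a \<odot>\<^bsub>R\<^esub> r) = a \<odot>\<^bsub>S\<^esub> \<phi> r)}"


section \<open>Two by two matrices\<close>

datatype 'a mat2 = Mat2 (m11: 'a) (m12: 'a) (m21: 'a) (m22: 'a)

definition mat2_tr :: "('r, 'm) ring_scheme \<Rightarrow> 'r mat2 \<Rightarrow> 'r" where
  "mat2_tr R A = m11 A \<oplus>\<^bsub>R\<^esub> m22 A"

definition mat2_det :: "('r, 'm) ring_scheme \<Rightarrow> 'r mat2 \<Rightarrow> 'r" where
  "mat2_det R A = m11 A \<otimes>\<^bsub>R\<^esub> m22 A \<ominus>\<^bsub>R\<^esub> m12 A \<otimes>\<^bsub>R\<^esub> m21 A"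

definition mat2_mult :: "('r, 'm) ring_scheme \<Rightarrow> 'r mat2 \<Rightarrow> 'r mat2 \<Rightarrow> 'r mat2" where
  "mat2_mult R A B = Mat2
     (m11 A \<otimes>\<^bsub>R\<^esub> m11 B \<oplus>\<^bsub>R\<^esub> m12 A \<otimes>\<^bsub>R\<^esub> m21 B) (m11 A \<otimes>\<^bsub>R\<^esub> m12 B \<oplus>\<^bsub>R\<^esub> m12 A \<otimes>\<^bsub>R\<^esub> m22 B)
     (m21 A \<otimes>\<^bsub>R\<^esub> m11 B \<oplus>\<^bsub>R\<^esub> m22 A \<otimes>\<^bsub>R\<^esub> m21 B) (m21 A \<otimes>\<^bsub>R\<^esub> m12 B \<oplus>\<^bsub>R\<^esub> m22 A \<otimes>\<^bsub>R\<^esub> m22 B)"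

definition GL2 :: "('r, 'm) ring_scheme \<Rightarrow> 'r mat2 monoid" where
  "GL2 R =
     \<lparr>carrier = {A. set_mat2 A \<subseteq> carrier R \<and> mat2_det R A \<in> Units R},
      mult = mat2_mult R, one = Mat2 \<one>\<^bsub>R\<^esub> \<zero>\<^bsub>R\<^esub> \<zero>\<^bsub>R\<^esub> \<one>\<^bsub>R\<^esub>\<rparr>"


section \<open>Deformations of representations\<close>

text \<open>For a local ring \<open>R\<close>, continuity of all entries is continuity into the topological group
  \<open>GL\<^sub>2(R)\<close>, since inversion of units is continuous.\<close>

definition cont_rep2 ::
    "'g monoid \<Rightarrow> 'g topology \<Rightarrow> ('r, 'm) ring_scheme \<Rightarrow> 'r topology \<Rightarrow> ('g \<Rightarrow> 'r mat2) \<Rightarrow> bool" where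
  "cont_rep2 G \<tau> R T \<rho> \<longleftrightarrow>
     \<rho> \<in> hom G (GL2 R) \<and>
     (\<forall>e\<in>{m11, m12, m21, m22}. continuous_map \<tau> T (\<lambda>g. e (\<rho> g)))"

definition is_lift ::
    "nat \<Rightarrow> 'k ring \<Rightarrow> 'g monoid \<Rightarrow> 'g topology \<Rightarrow> ('g \<Rightarrow> 'k mat2) \<Rightarrow>
     (nat \<Rightarrow> 'k, 'r) module \<Rightarrow> ('g \<Rightarrow> 'r mat2) \<Rightarrow> bool" where
  "is_lift p F G \<tau> \<rho>bar R \<rho> \<longleftrightarrow>
     cont_rep2 G \<tau> R (adic_topology R) \<rho> \<and>
     (\<forall>g\<in>carrier G. map_mat2 (residue_map p F R) (\<rho> g) = \<rho>bar g)"

definition strictly_equivalent ::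
    "nat \<Rightarrow> 'k ring \<Rightarrow> 'g monoid \<Rightarrow> (nat \<Rightarrow> 'k, 'r) module \<Rightarrow>
     ('g \<Rightarrow> 'r mat2) \<Rightarrow> ('g \<Rightarrow> 'r mat2) \<Rightarrow> bool" where
  "strictly_equivalent p F G R \<rho> \<rho>' \<longleftrightarrow>
     (\<exists>P\<in>carrier (GL2 R).
        map_mat2 (residue_map p F R) P = \<one>\<^bsub>GL2 F\<^esub> \<and>
        (\<forall>g\<in>carrier G. \<rho>' g = P \<otimes>\<^bsub>GL2 R\<^esub> \<rho> g \<otimes>\<^bsub>GL2 R\<^esub> inv\<^bsub>GL2 R\<^esub> P))"

text \<open>Universal properties quantify over the test rings whose elements are of type
  \<^typ>\<open>nat set\<close>.  This is no restriction: an object \<open>R\<close> of the category embeds into the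
  countable product of the finite rings \<open>R/m\<^sup>n\<close>, hence has at most continuum many elements and
  is isomorphic to an object carried by a subset of \<^typ>\<open>nat set\<close>.

  \<open>\<rho>\<close> is a representative of the universal deformation, the latter being a strict equivalence
  class.\<close>

definition is_universal_deformation ::
    "nat \<Rightarrow> 'k ring \<Rightarrow> 'g monoid \<Rightarrow> 'g topology \<Rightarrow> ('g \<Rightarrow> 'k mat2) \<Rightarrow>
     (nat \<Rightarrow> 'k, 'r) module \<Rightarrow> ('g \<Rightarrow> 'r mat2) \<Rightarrow> bool" where
  "is_universal_deformation p F G \<tau> \<rho>bar R \<rho> \<longleftrightarrow>
     coeff_ring p F R \<and> is_lift p F G \<tau> \<rho>bar R \<rho> \<and>
     (\<forall>(A :: (nat \<Rightarrow> 'k, nat set) module) \<sigma>.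
        coeff_ring p F A \<and> is_lift p F G \<tau> \<rho>bar A \<sigma> \<longrightarrow>
        (\<exists>!\<phi>. \<phi> \<in> coeff_hom p F R A \<and>
               strictly_equivalent p F G A (\<lambda>g. map_mat2 \<phi> (\<rho> g)) \<sigma>))"


section \<open>Deformations of pseudo-representations\<close>

text \<open>Two-dimensional pseudo-representations (determinants) in the sense of Chenevier, given by
  their trace and determinant functions.\<close>

definition cont_pseudo_rep2 ::
    "'g monoid \<Rightarrow> 'g topology \<Rightarrow> ('r, 'm) ring_scheme \<Rightarrow> 'r topology \<Rightarrow>
     ('g \<Rightarrow> 'r) \<Rightarrow> ('g \<Rightarrow> 'r) \<Rightarrow> bool" where
  "cont_pseudo_rep2 G \<tau> R T t d \<longleftrightarrow>
     t \<in> carrier G \<rightarrow> carrier R \<and> d \<in> hom G (units_of R) \<and>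
     t \<one>\<^bsub>G\<^esub> = \<one>\<^bsub>R\<^esub> \<oplus>\<^bsub>R\<^esub> \<one>\<^bsub>R\<^esub> \<and>
     (\<forall>g\<in>carrier G. \<forall>h\<in>carrier G. t (g \<otimes>\<^bsub>G\<^esub> h) = t (h \<otimes>\<^bsub>G\<^esub> g)) \<and>
     (\<forall>g\<in>carrier G. \<forall>h\<in>carrier G.
        t g \<otimes>\<^bsub>R\<^esub> t h = t (g \<otimes>\<^bsub>G\<^esub> h) \<oplus>\<^bsub>R\<^esub> d g \<otimes>\<^bsub>R\<^esub> t (inv\<^bsub>G\<^esub> g \<otimes>\<^bsub>G\<^esub> h)) \<and>
     continuous_map \<tau> T t \<and> continuous_map \<tau> T d"

definition is_pseudo_lift ::
    "nat \<Rightarrow> 'k ring \<Rightarrow> 'g monoid \<Rightarrow> 'g topology \<Rightarrow> ('g \<Rightarrow> 'k mat2) \<Rightarrow>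
     (nat \<Rightarrow> 'k, 'r) module \<Rightarrow> ('g \<Rightarrow> 'r) \<Rightarrow> ('g \<Rightarrow> 'r) \<Rightarrow> bool" where
  "is_pseudo_lift p F G \<tau> \<rho>bar R t d \<longleftrightarrow>
     cont_pseudo_rep2 G \<tau> R (adic_topology R) t d \<and>
     (\<forall>g\<in>carrier G. residue_map p F R (t g) = mat2_tr F (\<rho>bar g) \<and>
                     residue_map p F R (d g) = mat2_det F (\<rho>bar g))"

definition is_universal_pseudo_deformation ::
    "nat \<Rightarrow> 'k ring \<Rightarrow> 'g monoid \<Rightarrow> 'g topology \<Rightarrow> ('g \<Rightarrow> 'k mat2) \<Rightarrow>
     (nat \<Rightarrow> 'k, 'r) module \<Rightarrow> ('g \<Rightarrow> 'r) \<Rightarrow> ('g \<Rightarrow> 'r) \<Rightarrow> bool" where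
  "is_universal_pseudo_deformation p F G \<tau> \<rho>bar R t d \<longleftrightarrow>
     coeff_ring p F R \<and> is_pseudo_lift p F G \<tau> \<rho>bar R t d \<and>
     (\<forall>(A :: (nat \<Rightarrow> 'k, nat set) module) t' d'.
        coeff_ring p F A \<and> is_pseudo_lift p F G \<tau> \<rho>bar A t' d' \<longrightarrow>
        (\<exists>!\<phi>. \<phi> \<in> coeff_hom p F R A \<and>
               (\<forall>g\<in>carrier G. \<phi> (t g) = t' g \<and> \<phi> (d g) = d' g)))"


section \<open>Residual representations\<close>

definition direct_sum_rep ::
    "'k ring \<Rightarrow> ('g \<Rightarrow> 'k) \<Rightarrow> ('g \<Rightarrow> 'k) \<Rightarrow> 'g \<Rightarrow> 'k mat2" where
  "direct_sum_rep F \<psi>\<^sub>1 \<psi>\<^sub>2 g = Mat2 (\<psi>\<^sub>1 g) \<zero>\<^bsub>F\<^esub> \<zero>\<^bsub>F\<^esub> (\<psi>\<^sub>2 g)"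

text \<open>The extension with sub \<open>\<psi>\<^sub>1\<close> and quotient \<open>\<psi>\<^sub>2\<close> attached to a cocycle \<open>c\<close> with values in
  \<open>\<psi>\<^sub>1\<psi>\<^sub>2\<inverse>\<close>.\<close>

definition extension_rep ::
    "'k ring \<Rightarrow> ('g \<Rightarrow> 'k) \<Rightarrow> ('g \<Rightarrow> 'k) \<Rightarrow> ('g \<Rightarrow> 'k) \<Rightarrow> 'g \<Rightarrow> 'k mat2" where
  "extension_rep F \<psi>\<^sub>1 \<psi>\<^sub>2 c g = Mat2 (\<psi>\<^sub>1 g) (\<psi>\<^sub>2 g \<otimes>\<^bsub>F\<^esub> c g) \<zero>\<^bsub>F\<^esub> (\<psi>\<^sub>2 g)"


section \<open>Reduced quotients\<close>

definition nilradical :: "('r, 'm) ring_scheme \<Rightarrow> 'r set" where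
  "nilradical R = {r \<in> carrier R. \<exists>n::nat. r [^]\<^bsub>R\<^esub> n = \<zero>\<^bsub>R\<^esub>}"

definition reduced_quotient :: "('r, 'm) ring_scheme \<Rightarrow> 'r set ring" where
  "reduced_quotient R = R Quot (nilradical R)"

text \<open>The map induced by \<open>\<phi>\<close> on reduced quotients; the image of a coset under
  \<open>r \<mapsto> \<phi>(r) + nil(S)\<close> is a singleton.\<close>

definition induced_reduced_map ::
    "('r, 'm) ring_scheme \<Rightarrow> ('s, 'n) ring_scheme \<Rightarrow> ('r \<Rightarrow> 's) \<Rightarrow> 'r set \<Rightarrow> 's set" where
  "induced_reduced_map R S \<phi> X = the_elem ((\<lambda>r. nilradical S +>\<^bsub>S\<^esub> \<phi> r) ` X)"

end

theory Submission
  imports Defs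
begin

text \<open>\<open>\<Psi>\<close> is surjective.  Modulo the ideal generated by \<open>\<Psi>(m)\<close> the universal deformation has
  constant trace and determinant.  As \<open>H\<^sup>1\<close> is one-dimensional, a lift with this property is
  strictly equivalent to the constant one, so the fibre of \<open>\<Psi>\<close> over the residue field is the residue
  field itself, and surjectivity follows from Nakayama's lemma and compactness.

  Every \<open>z\<close> in the kernel of \<open>\<Psi>\<close> satisfies \<open>z\<^sup>2 = 0\<close>.  By Hensel's lemma the characteristic polynomial of
  an element \<open>u\<close> with \<open>\<chi>\<^sub>1(u) \<noteq> \<chi>\<^sub>2(u)\<close> splits, and the universal pseudo-representation is
  expressed through diagonal entries \<open>a\<close>, \<open>d\<close> and products \<open>x(g,h) = b(g) c(h)\<close> of off-diagonal entries.
  Since \<open>H\<^sup>1\<close> is one-dimensional, \<open>x(g,h)\<close> is a multiple of \<open>x(r,h)\<close> for a single element \<open>r\<close>.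
  Let \<open>Ann\<close> be the annihilator of all \<open>x(r,h)\<close> and let \<open>J\<close> be the set of elements of \<open>m\<close> annihilated
  by \<open>Ann\<close>.  Modulo \<open>Ann\<close> the multiplier of \<open>x(r,h)\<close> is an honest upper right entry, so the
  pseudo-representation lifts to a deformation of the residual extension.  Modulo \<open>J\<close>, which contains all \<open>x(g,h)\<close>,
  it is a sum of two characters, and \<open>H\<^sup>2 = 0\<close> provides a lift again.  In both cases the projection factors
  through \<open>\<Psi>\<close>, whence \<open>z \<in> Ann \<inter> J\<close>.\<close>


section \<open>Locally constant behaviour\<close>

text \<open>The obstacle is that over \<open>Rpd\<close> only the products b(g) c(h) are defined,
  not b and c themselves; these would live in modules B and C with a pairing into the ring.
  One-dimensional H^1 makes B cyclic, so b(g) becomes a scalar relative to b(r), but one that is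
  defined only up to Ann. Hence matrices exist modulo Ann and not over the ring itself. This alone
  does not suffice: if all products vanish, Ann is everything. The quotient by J handles the
  reducible part; there the upper right entry has to be constructed from nothing, which is where H^2
  enters. Since Ann J = 0, an element of both ideals has square zero, and so the comparison is one
  of reduced rings. The universal properties speak about rings carried by sets of natural numbers.
  They are applied to finite quotients by open ideals, and exact statements are recovered from
  congruences modulo powers of the maximal ideal, by compactness or because these powers intersect
  in zero.\<close>

definition near :: "'x topology \<Rightarrow> ('x \<Rightarrow> 'x \<Rightarrow> bool) \<Rightarrow> bool" where
  "near T P \<longleftrightarrow> (\<forall>x\<in>topspace T. \<exists>U. openin T U \<and> x \<in> U \<and> (\<forall>y\<in>U. P x y))"

lemma nearE:
  assumes "near T P" "x \<in> topspace T"
  obtains U where "openin T U" "x \<in> U" "\<forall>y\<in>U. P x y"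
  using assms unfolding near_def by blast

lemma near_mono:
  assumes "near T P" "\<And>x y. x \<in> topspace T \<Longrightarrow> y \<in> topspace T \<Longrightarrow> P x y \<Longrightarrow> Q x y"
  shows "near T Q"
  unfolding near_def
proof
  fix x assume x: "x \<in> topspace T"
  then obtain U where U: "openin T U" "x \<in> U" "\<forall>y\<in>U. P x y"
    using assms(1) by (metis nearE)
  then have "\<forall>y\<in>U. Q x y" using assms(2)[OF x] openin_subset[OF U(1)] by blast
  then show "\<exists>U. openin T U \<and> x \<in> U \<and> (\<forall>y\<in>U. Q x y)" using U by blast
qed

lemma near_conj:
  assumes "near T P" "near T Q"
  shows "near T (\<lambda>x y. P x y \<and> Q x y)"
  unfolding near_def
proof
  fix x assume x: "x \<in> topspace T"
  obtain U V where U: "openin T U" "x \<in> U" "\<forall>y\<in>U. P x y" and V: "openin T V" "x \<in> V" "\<forall>y\<in>V. Q x y"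
    using assms x by (metis nearE)
  then show "\<exists>U. openin T U \<and> x \<in> U \<and> (\<forall>y\<in>U. P x y \<and> Q x y)"
    by (intro exI[of _ "U \<inter> V"]) auto
qed

lemma near_mono2:
  assumes "near T P" "near T Q"
    "\<And>x y. x \<in> topspace T \<Longrightarrow> y \<in> topspace T \<Longrightarrow> P x y \<Longrightarrow> Q x y \<Longrightarrow> R x y"
  shows "near T R"
  by (rule near_mono[OF near_conj[OF assms(1,2)]]) (use assms(3) in blast)

lemma near_pull:
  assumes "near T P" "continuous_map T' T f"
  shows "near T' (\<lambda>x y. P (f x) (f y))"
  unfolding near_def
proof
  fix x assume x: "x \<in> topspace T'"
  then have "f x \<in> topspace T" using assms(2) by (auto simp: continuous_map_def)
  then obtain U where U: "openin T U" "f x \<in> U" "\<forall>y\<in>U. P (f x) y"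
    using assms(1) by (metis nearE)
  then show "\<exists>U. openin T' U \<and> x \<in> U \<and> (\<forall>y\<in>U. P (f x) (f y))"
    using x assms(2) by (intro exI[of _ "{z \<in> topspace T'. f z \<in> U}"]) (auto simp: continuous_map_def)
qed

text \<open>This is the tube lemma: for fixed \<open>x\<close>, finitely many product neighbourhoods
  cover the fibre over \<open>x\<close>. Inside one of them everything is compared with its centre
  \<open>(x, k)\<close>, so \<open>Q x y z\<close> has to follow from comparing both
  \<open>(y, z)\<close> and \<open>(x, z)\<close> with that centre; this is the reason for the two
  premises on \<open>P\<close>.\<close>

lemma near_prod_compact:
  assumes "near (prod_topology T X) P" "compact_space X"
    "\<And>x y z k. P (x, k) (y, z) \<Longrightarrow> P (x, k) (x, z) \<Longrightarrow> Q x y z"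
  shows "near T (\<lambda>x y. \<forall>k\<in>topspace X. Q x y k)"
  unfolding near_def
proof
  fix x assume x: "x \<in> topspace T"
  have "\<exists>U V. openin T U \<and> openin X V \<and> x \<in> U \<and> k \<in> V \<and> (\<forall>y\<in>U. \<forall>z\<in>V. P (x, k) (y, z))"
    if k: "k \<in> topspace X" for k
  proof -
    obtain W where W: "openin (prod_topology T X) W" "(x, k) \<in> W" "\<forall>w\<in>W. P (x, k) w"
      using nearE[OF assms(1), of "(x, k)"] x k by auto
    obtain U V where UV: "openin T U" "openin X V" "x \<in> U" "k \<in> V" "U \<times> V \<subseteq> W"
      using W(1)[unfolded openin_prod_topology_alt, rule_format, OF W(2)] by (elim exE conjE)
    then have "\<forall>y\<in>U. \<forall>z\<in>V. P (x, k) (y, z)" using W(3) by blast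
    with UV(1-4) show ?thesis by blast
  qed
  then obtain U V where UV: "\<And>k. k \<in> topspace X \<Longrightarrow> openin T (U k) \<and> openin X (V k) \<and> x \<in> U k \<and> k \<in> V k
      \<and> (\<forall>y\<in>U k. \<forall>z\<in>V k. P (x, k) (y, z))"
    by metis
  have cov: "topspace X \<subseteq> \<Union>(V ` topspace X)" using UV by blast
  have op: "\<And>S. S \<in> V ` topspace X \<Longrightarrow> openin X S" using UV by blast
  have "\<exists>\<F>. finite \<F> \<and> \<F> \<subseteq> V ` topspace X \<and> topspace X \<subseteq> \<Union>\<F>"
    using assms(2) cov op unfolding compact_space_alt by blast
  then obtain \<F> where F: "finite \<F>" "\<F> \<subseteq> V ` topspace X" "topspace X \<subseteq> \<Union>\<F>" by blast
  obtain C where C: "finite C" "C \<subseteq> topspace X" "\<F> = V ` C"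
    using F(1,2) by (meson finite_subset_image)
  \<comment> \<open>With \<open>C\<close> empty the intersection over \<open>C\<close> would be the
    whole type; the factor \<open>topspace T\<close> covers this case.\<close>
  let ?U = "topspace T \<inter> \<Inter>(U ` C)"
  have "openin T ?U"
  proof (cases "C = {}")
    case False
    then have "openin T (\<Inter>(U ` C))" using C UV by (intro openin_Inter) auto
    then show ?thesis by blast
  qed auto
  moreover have "x \<in> ?U" using x C(2) UV by auto
  moreover have "Q x y z" if y: "y \<in> ?U" and z: "z \<in> topspace X" for y z
  proof -
    obtain k where k: "k \<in> C" "z \<in> V k" using F(3) C(3) z by auto
    have "P (x, k) (y, z)" "P (x, k) (x, z)" using UV[of k] k y C(2) by auto
    then show ?thesis by (rule assms(3))
  qed
  ultimately show "\<exists>U. openin T U \<and> x \<in> U \<and> (\<forall>y\<in>U. \<forall>k\<in>topspace X. Q x y k)" by blast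
qed

text \<open>Local constancy in the form \<open>near\<close> replaces continuity in most of what
  follows. Comparing always with the centre of the neighbourhood lets the same notion serve for
  equality and for congruences modulo an ideal.\<close>

lemma continuous_map_discrete_near:
  "continuous_map T (discrete_topology A) f \<longleftrightarrow> f \<in> topspace T \<rightarrow> A \<and> near T (\<lambda>x y. f y = f x)"
proof
  assume L: "continuous_map T (discrete_topology A) f"
  then have f: "f \<in> topspace T \<rightarrow> A" by (auto simp: continuous_map_def)
  have "near (discrete_topology A) (\<lambda>x y. y = x)"
    unfolding near_def
  proof
    fix x assume "x \<in> topspace (discrete_topology A)"
    then have "openin (discrete_topology A) {x}" by simp
    then show "\<exists>U. openin (discrete_topology A) U \<and> x \<in> U \<and> (\<forall>y\<in>U. y = x)" by blast
  qed
  from near_pull[OF this L] f show "f \<in> topspace T \<rightarrow> A \<and> near T (\<lambda>x y. f y = f x)" by simp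
next
  assume R: "f \<in> topspace T \<rightarrow> A \<and> near T (\<lambda>x y. f y = f x)"
  have "openin T {x \<in> topspace T. f x \<in> U}" for U
  proof (subst openin_subopen, intro ballI)
    fix x assume "x \<in> {x \<in> topspace T. f x \<in> U}"
    then have x: "x \<in> topspace T" "f x \<in> U" by auto
    obtain V where V: "openin T V" "x \<in> V" "\<forall>y\<in>V. f y = f x"
      using nearE[OF conjunct2[OF R] x(1)] by blast
    have "V \<subseteq> {x \<in> topspace T. f x \<in> U}"
      using openin_subset[OF V(1)] V(3) x(2) by auto
    then show "\<exists>V. openin T V \<and> x \<in> V \<and> V \<subseteq> {x \<in> topspace T. f x \<in> U}"
      using V(1,2) by blast
  qed
  then show "continuous_map T (discrete_topology A) f" using R by (auto simp: continuous_map_def)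
qed

section \<open>Powers of an ideal and adic topologies\<close>

lemma (in ring_hom_cring) hom_minus [simp]:
  "x \<in> carrier R \<Longrightarrow> y \<in> carrier R \<Longrightarrow> h (x \<ominus> y) = h x \<ominus>\<^bsub>S\<^esub> h y"
  by (simp add: a_minus_def)

context ideal
begin

lemma diff_closed: "x \<in> I \<Longrightarrow> y \<in> I \<Longrightarrow> x \<ominus> y \<in> I"
  by (simp add: a_minus_def)

end

context cring
begin

lemma ideal_diff_mult:
  assumes "ideal K R" "a \<in> carrier R" "a' \<in> carrier R" "b \<in> carrier R" "b' \<in> carrier R"
    "a' \<ominus> a \<in> K" "b' \<ominus> b \<in> K"
  shows "a' \<otimes> b' \<ominus> a \<otimes> b \<in> K"
proof -
  interpret K: ideal K R by fact
  have "a' \<otimes> b' \<ominus> a \<otimes> b = (a' \<ominus> a) \<otimes> b' \<oplus> a \<otimes> (b' \<ominus> b)"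
    using assms(2-5) by algebra
  then show ?thesis using assms by (simp add: K.I_l_closed K.I_r_closed)
qed

lemma ideal_diff_add:
  assumes "ideal K R" "a \<in> carrier R" "a' \<in> carrier R" "b \<in> carrier R" "b' \<in> carrier R"
    "a' \<ominus> a \<in> K" "b' \<ominus> b \<in> K"
  shows "(a' \<oplus> b') \<ominus> (a \<oplus> b) \<in> K"
proof -
  interpret K: ideal K R by fact
  have "(a' \<oplus> b') \<ominus> (a \<oplus> b) = (a' \<ominus> a) \<oplus> (b' \<ominus> b)"
    using assms(2-5) by algebra
  then show ?thesis using assms by simp
qed

lemma ideal_diff_minus:
  assumes "ideal K R" "a \<in> carrier R" "a' \<in> carrier R" "b \<in> carrier R" "b' \<in> carrier R"
    "a' \<ominus> a \<in> K" "b' \<ominus> b \<in> K"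
  shows "(a' \<ominus> b') \<ominus> (a \<ominus> b) \<in> K"
proof -
  interpret K: ideal K R by fact
  have "(a' \<ominus> b') \<ominus> (a \<ominus> b) = (a' \<ominus> a) \<ominus> (b' \<ominus> b)"
    using assms(2-5) by algebra
  then show ?thesis using assms by (simp add: K.diff_closed)
qed

lemma ideal_diff_trans:
  assumes "ideal K R" "a \<in> carrier R" "b \<in> carrier R" "c \<in> carrier R"
    "a \<ominus> b \<in> K" "b \<ominus> c \<in> K"
  shows "a \<ominus> c \<in> K"
proof -
  interpret K: ideal K R by fact
  have "a \<ominus> c = (a \<ominus> b) \<oplus> (b \<ominus> c)" using assms(2-4) by algebra
  then show ?thesis using assms by simp
qed

lemma ideal_diff_sym:
  assumes "ideal K R" "a \<in> carrier R" "b \<in> carrier R" "a \<ominus> b \<in> K"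
  shows "b \<ominus> a \<in> K"
proof -
  interpret K: ideal K R by fact
  have "b \<ominus> a = \<ominus> (a \<ominus> b)" using assms(2-3) by algebra
  then show ?thesis using assms by simp
qed

lemma ideal_power_ideal: "ideal I R \<Longrightarrow> ideal (ideal_power R I n) R"
  by (induction n) (auto intro: oneideal ideal_prod_is_ideal)

lemma ideal_power_Suc_mem:
  "x \<in> ideal_power R I n \<Longrightarrow> y \<in> I \<Longrightarrow> x \<otimes> y \<in> ideal_power R I (Suc n)"
  by (simp add: ideal_prod.prod)

lemma ideal_power_antimono:
  assumes "ideal I R" "n \<le> k" shows "ideal_power R I k \<subseteq> ideal_power R I n"
  using assms(2)
proof (induction k rule: dec_induct)
  case (step k)
  then show ?case using ideal_prod_inter[OF ideal_power_ideal[OF assms(1)] assms(1), of k] by auto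
qed simp

lemma ideal_power_1: assumes "ideal I R" shows "ideal_power R I (Suc 0) = I"
proof
  show "ideal_power R I (Suc 0) \<subseteq> I"
    using ideal_prod_inter[OF oneideal assms] by simp
  show "I \<subseteq> ideal_power R I (Suc 0)"
  proof
    fix x assume x: "x \<in> I"
    then have "\<one> \<otimes> x \<in> ideal_power R I (Suc 0)" by (simp add: ideal_prod.prod)
    then show "x \<in> ideal_power R I (Suc 0)"
      using x ideal.Icarr[OF assms] by simp
  qed
qed

lemma ideal_power_add_mem:
  assumes "ideal I R" "x \<in> ideal_power R I n" "y \<in> ideal_power R I k"
  shows "x \<otimes> y \<in> ideal_power R I (n + k)"
  using assms(3)
proof (induction k arbitrary: y)
  case 0
  then show ?case using ideal.I_r_closed[OF ideal_power_ideal[OF assms(1)] assms(2)] by simp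
next
  case (Suc k)
  interpret P: ideal "ideal_power R I (n + Suc k)" R by (rule ideal_power_ideal[OF assms(1)])
  have x: "x \<in> carrier R" using ideal.Icarr[OF ideal_power_ideal[OF assms(1)] assms(2)] .
  from Suc.prems have "y \<in> ideal_prod R (ideal_power R I k) I" by simp
  then have "y \<in> carrier R \<and> x \<otimes> y \<in> ideal_power R I (n + Suc k)"
  proof induction
    case (prod i j)
    have ij: "i \<in> carrier R" "j \<in> carrier R"
      using prod ideal.Icarr[OF ideal_power_ideal[OF assms(1)]] ideal.Icarr[OF assms(1)] by auto
    have "(x \<otimes> i) \<otimes> j \<in> ideal_power R I (Suc (n + k))"
      using Suc.IH[OF prod(1)] prod(2) by (rule ideal_power_Suc_mem)
    then show ?case using x ij by (simp add: m_assoc)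
  next
    case (sum s1 s2)
    then have "x \<otimes> s1 \<oplus> x \<otimes> s2 \<in> ideal_power R I (n + Suc k)" by (intro P.a_closed) auto
    then show ?case using sum x by (simp add: r_distr)
  qed
  then show ?case by simp
qed

end

lemma (in ring_hom_cring) hom_ideal_power:
  assumes "h ` I \<subseteq> J" "x \<in> ideal_power R I n" "I \<subseteq> carrier R"
  shows "h x \<in> ideal_power S J n"
  using assms(2)
proof (induction n arbitrary: x)
  case (Suc n)
  from Suc.prems have "x \<in> ideal_prod R (ideal_power R I n) I" by simp
  then have "x \<in> carrier R \<and> h x \<in> ideal_prod S (ideal_power S J n) J"
  proof induction
    case (prod i j)
    have ij: "i \<in> carrier R" "j \<in> carrier R"
    proof -
      show "j \<in> carrier R" using prod assms(3) by auto
      show "i \<in> carrier R"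
      proof (cases n)
        case 0 then show ?thesis using prod by simp
      next
        case (Suc l)
        have "y \<in> carrier R" if "y \<in> ideal_power R I k" for y k
          using that
        proof (induction k arbitrary: y)
          case (Suc k)
          from Suc.prems have "y \<in> ideal_prod R (ideal_power R I k) I" by simp
          then show ?case by induction (use Suc.IH assms(3) in auto)
        qed simp
        then show ?thesis using prod by blast
      qed
    qed
    then show ?case using Suc.IH[OF prod(1)] prod(2) assms(1) by (auto intro: ideal_prod.prod)
  next
    case (sum s1 s2)
    then show ?case by (auto intro: ideal_prod.sum)
  qed
  then show ?case by simp
qed simp

declare ideal_power.simps(2) [simp del]


section \<open>Local rings with a residue map\<close>

text \<open>A local ring is presented by its residue map: elements of non-zero residue are units, so
  the kernel \<open>mm\<close> is the only maximal ideal. This presentation also covers a field with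
  its identity map, where \<open>mm\<close> is zero.\<close>

locale local_map = ring_hom_cring R F \<pi>
  for R :: "('r, 'm) ring_scheme" (structure) and F :: "('k, 'n) ring_scheme" (structure) and \<pi> +
  assumes residue_field: "field F"
    and residue_surj: "\<pi> ` carrier R = carrier F"
    and residue_unit: "r \<in> carrier R \<Longrightarrow> \<pi> r \<noteq> \<zero>\<^bsub>F\<^esub> \<Longrightarrow> r \<in> Units R"
begin

abbreviation mm :: "'r set" where "mm \<equiv> a_kernel R F \<pi>"

abbreviation mpow :: "nat \<Rightarrow> 'r set" where "mpow n \<equiv> ideal_power R mm n"

lemma mm_iff: "r \<in> mm \<longleftrightarrow> r \<in> carrier R \<and> \<pi> r = \<zero>\<^bsub>F\<^esub>"
  unfolding a_kernel_def' by simp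

lemma mm_ideal: "ideal mm R"
  by (rule ring.kernel_is_ideal)

lemma mpow_ideal: "ideal (mpow n) R"
  by (rule R.ideal_power_ideal[OF mm_ideal])

lemma mpow_antimono: "n \<le> k \<Longrightarrow> mpow k \<subseteq> mpow n"
  by (rule R.ideal_power_antimono[OF mm_ideal])

lemma mpow_1: "mpow (Suc 0) = mm"
  by (rule R.ideal_power_1[OF mm_ideal])

lemma F_one_not_zero: "\<one>\<^bsub>F\<^esub> \<noteq> \<zero>\<^bsub>F\<^esub>"
  using field.axioms(1)[OF residue_field] by (simp add: domain.one_not_zero)

lemma proper_ideal_subset_mm:
  assumes "ideal J R" "J \<noteq> carrier R" shows "J \<subseteq> mm"
proof
  interpret J: ideal J R by fact
  fix x assume x: "x \<in> J"
  have "\<pi> x = \<zero>\<^bsub>F\<^esub>"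
  proof (rule ccontr)
    assume "\<pi> x \<noteq> \<zero>\<^bsub>F\<^esub>"
    then have u: "x \<in> Units R" using residue_unit x by simp
    then have "inv x \<otimes> x \<in> J" using x by (intro J.I_l_closed) auto
    then have "\<one> \<in> J" using u by simp
    then show False using J.one_imp_carrier assms(2) by simp
  qed
  then show "x \<in> mm" using x by (simp add: mm_iff)
qed

lemma mm_ne_carrier: "mm \<noteq> carrier R"
  using F_one_not_zero mm_iff[of \<one>] by auto

lemma mm_maximalideal: "maximalideal mm R"
proof (rule maximalidealI[OF mm_ideal])
  show "carrier R \<noteq> mm" using mm_ne_carrier by simp
  show "\<And>J. ideal J R \<Longrightarrow> mm \<subseteq> J \<Longrightarrow> J \<subseteq> carrier R \<Longrightarrow> J = mm \<or> J = carrier R"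
    using proper_ideal_subset_mm by blast
qed

lemma maximalideal_eq_mm: assumes "maximalideal J R" shows "J = mm"
proof -
  interpret J: maximalideal J R by fact
  have "J \<subseteq> mm" using proper_ideal_subset_mm[OF J.is_ideal] J.I_notcarr by simp
  moreover have "mm \<subseteq> carrier R" by (auto simp: mm_iff)
  ultimately have "mm = J \<or> mm = carrier R" by (rule J.I_maximal[OF mm_ideal])
  then show ?thesis using mm_ne_carrier by simp
qed

lemma max_ideal_eq: "max_ideal R = mm"
  unfolding max_ideal_def by (rule the_equality, rule mm_maximalideal, erule maximalideal_eq_mm)

lemma local_ring: "local_ring R"
  unfolding local_ring_def using R.is_cring mm_maximalideal maximalideal_eq_mm by blast

lemma lift_exists:
  assumes "z \<in> carrier F" obtains r where "r \<in> carrier R" "\<pi> r = z"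
  using assms residue_surj by (metis imageE)

lemma residue_eq_iff:
  assumes "r \<in> carrier R" "s \<in> carrier R" shows "\<pi> r = \<pi> s \<longleftrightarrow> r \<ominus> s \<in> mm"
proof -
  have "\<pi> r = \<pi> s \<longleftrightarrow> \<pi> r \<ominus>\<^bsub>F\<^esub> \<pi> s = \<zero>\<^bsub>F\<^esub>"
    using assms S.r_right_minus_eq by simp
  then show ?thesis using assms by (simp add: mm_iff)
qed

lemma unit_iff: "r \<in> carrier R \<Longrightarrow> r \<in> Units R \<longleftrightarrow> \<pi> r \<noteq> \<zero>\<^bsub>F\<^esub>"
proof
  assume "r \<in> carrier R" "r \<in> Units R"
  then have "\<pi> r \<otimes>\<^bsub>F\<^esub> \<pi> (inv r) = \<one>\<^bsub>F\<^esub>" by (metis R.Units_inv_closed R.Units_r_inv hom_mult hom_one)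
  then show "\<pi> r \<noteq> \<zero>\<^bsub>F\<^esub>" using F_one_not_zero \<open>r \<in> Units R\<close> by auto
qed (rule residue_unit)

lemma mem_add_PIdl:
  "x \<in> set_add R K (PIdl e) \<longleftrightarrow> (\<exists>k\<in>K. \<exists>r\<in>carrier R. x = k \<oplus> r \<otimes> e)"
  unfolding set_add_def' cgenideal_def by blast

text \<open>Climbing one residue field at a time from the ideals above \<open>m\<close> down to an arbitrary open
  ideal.\<close>

lemma open_ideal_induct:
  assumes noeth: "noetherian_ring R"
    and base: "\<And>K. ideal K R \<Longrightarrow> mm \<subseteq> K \<Longrightarrow> P K"
    and step: "\<And>K e. ideal K R \<Longrightarrow> e \<in> mm \<Longrightarrow> e \<notin> K \<Longrightarrow> (\<And>s. s \<in> mm \<Longrightarrow> s \<otimes> e \<in> K) \<Longrightarrow>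
       P (set_add R K (PIdl e)) \<Longrightarrow> P K"
    and K: "ideal K R" "mpow N \<subseteq> K"
  shows "P K"
proof (rule ccontr)
  assume nP: "\<not> P K"
  \<comment> \<open>A maximal counterexample exists because a non-empty chain of ideals in a
    Noetherian ring contains its union.\<close>
  define \<A> where "\<A> = {K. ideal K R \<and> mpow N \<subseteq> K \<and> \<not> P K}"
  have "\<exists>M\<in>\<A>. \<forall>X\<in>\<A>. M \<subseteq> X \<longrightarrow> X = M"
  proof (rule subset_Zorn_nonempty)
    show "\<A> \<noteq> {}" using nP K by (auto simp: \<A>_def)
    fix C assume C: "C \<noteq> {}" "subset.chain \<A> C"
    then have "subset.chain {I. ideal I R} C"
      unfolding pred_on.chain_def by (auto simp: \<A>_def)
    then have "\<Union>C \<in> C" using noetherian_ring.ideal_chain_is_trivial[OF noeth C(1)] by blast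
    then show "\<Union>C \<in> \<A>" using C(2) unfolding pred_on.chain_def by blast
  qed
  then obtain M where M: "M \<in> \<A>" and max: "\<And>X. X \<in> \<A> \<Longrightarrow> M \<subseteq> X \<Longrightarrow> X = M" by blast
  interpret M: ideal M R using M by (simp add: \<A>_def)
  have nm: "\<not> mm \<subseteq> M" using M base by (auto simp: \<A>_def)
  \<comment> \<open>\<open>e\<close> will be taken in the last power of \<open>mm\<close> not
    contained in \<open>M\<close>. Then \<open>mm e\<close> lies in \<open>M\<close>, so
    \<open>M + (e)\<close> exceeds \<open>M\<close> by one copy of the residue field. The exponent
    \<open>i\<close> is positive because \<open>mm\<close> is not contained in \<open>M\<close>, and
    this puts \<open>e\<close> into \<open>mm\<close>.\<close>
  define j where "j = (LEAST j. mpow j \<subseteq> M)"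
  have j: "mpow j \<subseteq> M" unfolding j_def by (rule LeastI[of _ N]) (use M in \<open>simp add: \<A>_def\<close>)
  have "j \<noteq> 0" using j nm mm_iff by auto
  then obtain i where i: "j = Suc i" by (cases j) auto
  have "i \<noteq> 0" using j nm i mpow_1 by auto
  have "\<not> mpow i \<subseteq> M" using not_less_Least[of i "\<lambda>j. mpow j \<subseteq> M"] i by (simp add: j_def)
  then obtain e where e: "e \<in> mpow i" "e \<notin> M" by blast
  have em: "e \<in> mm" using e(1) mpow_antimono[of 1 i] mpow_1 \<open>i \<noteq> 0\<close> by auto
  then have ec: "e \<in> carrier R" by (simp add: mm_iff)
  have se: "s \<otimes> e \<in> M" if s: "s \<in> mm" for s
  proof -
    have "e \<otimes> s \<in> mpow j" unfolding i by (rule R.ideal_power_Suc_mem[OF e(1) s])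
    then show ?thesis using j s ec R.m_comm by (auto simp: mm_iff)
  qed
  let ?K = "set_add R M (PIdl e)"
  have I: "ideal ?K R" by (rule R.add_ideals[OF M.is_ideal R.cgenideal_ideal[OF ec]])
  have sub: "M \<subseteq> ?K"
  proof
    fix x assume x: "x \<in> M"
    have "x \<oplus> \<zero> \<otimes> e \<in> ?K"
      unfolding mem_add_PIdl by (intro bexI[OF _ x] bexI[of _ \<zero>]) simp_all
    then show "x \<in> ?K" using x ec by simp
  qed
  have "\<zero> \<oplus> \<one> \<otimes> e \<in> ?K"
    unfolding mem_add_PIdl by (intro bexI[of _ \<zero>] bexI[of _ \<one>]) simp_all
  then have "e \<in> ?K" using ec by simp
  then have "?K \<notin> \<A>" using max[OF _ sub] e(2) by blast
  then have "P ?K" using I sub M by (auto simp: \<A>_def)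
  have "P M"
    by (rule step[OF M.is_ideal em e(2)]) (simp_all add: se \<open>P ?K\<close>)
  then show False using M by (simp add: \<A>_def)
qed

text \<open>Each enlargement by a copy of the residue field multiplies the number of classes by at
  most the size of \<open>F\<close>: if \<open>Y\<close> represents the ring modulo
  \<open>K + (e)\<close>, the elements \<open>y + l(z) e\<close> represent it modulo
  \<open>K\<close>.\<close>

lemma finite_reps:
  assumes noeth: "noetherian_ring R" and fin: "finite (carrier F)" and K: "ideal K R" "mpow N \<subseteq> K"
  shows "\<exists>Y. finite Y \<and> Y \<subseteq> carrier R \<and> (\<forall>r\<in>carrier R. \<exists>y\<in>Y. r \<ominus> y \<in> K)"
    (is "?P K")
proof -
  define l where "l = inv_into (carrier R) \<pi>"
  have l: "l z \<in> carrier R \<and> \<pi> (l z) = z" if "z \<in> carrier F" for z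
    using that residue_surj unfolding l_def by (metis f_inv_into_f inv_into_into)
  show ?thesis
  proof (rule open_ideal_induct[where P = ?P, OF noeth _ _ K])
    fix K assume K: "ideal K R" "mm \<subseteq> K"
    have "r \<ominus> l (\<pi> r) \<in> K" if "r \<in> carrier R" for r
      using that l[of "\<pi> r"] K residue_eq_iff[of r "l (\<pi> r)"] by auto
    then show "?P K" using l fin by (intro exI[of _ "l ` carrier F"]) auto
  next
    fix K e assume I: "ideal K R" and e: "e \<in> mm" "e \<notin> K" and me: "\<And>s. s \<in> mm \<Longrightarrow> s \<otimes> e \<in> K"
      and P: "?P (set_add R K (PIdl e))"
    interpret K: ideal K R by fact
    have ec: "e \<in> carrier R" using e by (simp add: mm_iff)
    obtain Y where Y: "finite Y" "Y \<subseteq> carrier R" "\<And>r. r \<in> carrier R \<Longrightarrow> \<exists>y\<in>Y. r \<ominus> y \<in> set_add R K (PIdl e)"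
      using P by metis
    let ?Y = "(\<lambda>(y, z). y \<oplus> l z \<otimes> e) ` (Y \<times> carrier F)"
    have "\<exists>y\<in>?Y. r \<ominus> y \<in> K" if r: "r \<in> carrier R" for r
    proof -
      obtain y k s where y: "y \<in> Y" and k: "k \<in> K" and s: "s \<in> carrier R" and eq: "r \<ominus> y = k \<oplus> s \<otimes> e"
        using Y(3)[OF r] unfolding mem_add_PIdl by blast
      have yc: "y \<in> carrier R" using y Y by blast
      have lc: "l (\<pi> s) \<in> carrier R" using l s by simp
      have "(s \<ominus> l (\<pi> s)) \<otimes> e \<in> K" using residue_eq_iff[of s "l (\<pi> s)"] l s by (intro me) auto
      then have "k \<oplus> (s \<ominus> l (\<pi> s)) \<otimes> e \<in> K" using k by simp
      moreover have "k \<oplus> (s \<ominus> l (\<pi> s)) \<otimes> e = (r \<ominus> y) \<ominus> l (\<pi> s) \<otimes> e"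
        unfolding eq using K.Icarr[OF k] s lc ec by algebra
      moreover have "\<dots> = r \<ominus> (y \<oplus> l (\<pi> s) \<otimes> e)" using r yc lc ec by algebra
      ultimately show ?thesis using y s by (intro bexI[of _ "y \<oplus> l (\<pi> s) \<otimes> e"]) auto
    qed
    moreover have "?Y \<subseteq> carrier R" using Y(2) l ec by auto
    ultimately show "?P K" using Y(1) fin by (intro exI[of _ ?Y]) auto
  qed
qed

end

locale complete_local_map = local_map +
  assumes noeth: "noetherian_ring R" and fin_residue: "finite (carrier F)"
    and complete: "adically_complete R mm"
begin

lemma mpow_Inter: assumes "\<And>n. x \<in> mpow n" shows "x = \<zero>"
  using complete assms unfolding adically_complete_def by blast

text \<open>The ring is compact, being complete with finite quotients modulo \<open>mpow n\<close>,
  and a set that is stable under adding \<open>mpow k\<close> is closed. Hensel's lemma, and the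
  passage from solutions modulo every power to exact solutions, rest on this.\<close>

lemma compactness:
  assumes sub: "\<And>n. S n \<subseteq> carrier R" and ne: "\<And>n. S n \<noteq> {}" and dec: "\<And>n. S (Suc n) \<subseteq> S n"
    and stable: "\<And>n. \<exists>k. \<forall>r\<in>S n. \<forall>y\<in>mpow k. r \<oplus> y \<in> S n"
  obtains r where "\<And>n. r \<in> S n"
proof -
  have mono: "S j \<subseteq> S i" if "i \<le> j" for i j using lift_Suc_antimono_le[of S, OF dec that] .
  \<comment> \<open>\<open>C r n\<close> says that the class of \<open>r\<close> modulo
    \<open>mpow n\<close> meets every \<open>S k\<close>; this is the invariant that can be refined
    from \<open>n\<close> to \<open>Suc n\<close>.\<close>
  define C where "C r n \<longleftrightarrow> r \<in> carrier R \<and> (\<forall>k. \<exists>y\<in>S k. y \<ominus> r \<in> mpow n)" for r n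
  have "\<exists>s. \<forall>n. C (s n) n \<and> s (Suc n) \<ominus> s n \<in> mpow n"
  proof (rule dependent_nat_choice)
    show "\<exists>x. C x 0" using ne sub by (intro exI[of _ \<zero>]) (fastforce simp: C_def)
  next
    fix r n assume r: "C r n"
    then have rc: "r \<in> carrier R" by (simp add: C_def)
    obtain Y where Y: "finite Y" "Y \<subseteq> carrier R" "\<forall>r\<in>carrier R. \<exists>y\<in>Y. r \<ominus> y \<in> mpow (Suc n)"
      using finite_reps[OF noeth fin_residue mpow_ideal[of "Suc n"] order_refl] by (elim exE conjE)
    have "\<forall>k. \<exists>y w. y \<in> S k \<and> y \<ominus> r \<in> mpow n \<and> w \<in> Y \<and> y \<ominus> w \<in> mpow (Suc n)"
      using r Y(3) sub unfolding C_def by (metis subsetD)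
    then obtain y w where yw: "\<And>k. y k \<in> S k" "\<And>k. y k \<ominus> r \<in> mpow n" "\<And>k. w k \<in> Y"
       "\<And>k. y k \<ominus> w k \<in> mpow (Suc n)" by metis
    have yc: "y k \<in> carrier R" and wc: "w k \<in> carrier R" for k using yw(1,3) sub Y(2) by blast+
    have "finite (range w)" using Y(1) yw(3) by (metis finite_subset image_subsetI)
    \<comment> \<open>There are finitely many classes modulo \<open>mpow (Suc n)\<close>, so one of
      them is met for infinitely many \<open>k\<close>; as the sets decrease, it meets all of
      them.\<close>
    then obtain k0 where inf: "infinite {k. w k = w k0}"
      using pigeonhole_infinite[of UNIV w] by auto
    have "C (w k0) (Suc n)"
      unfolding C_def
    proof (intro conjI allI wc)
      fix k
      obtain j where j: "j \<ge> k" "w j = w k0"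
        using inf unfolding infinite_nat_iff_unbounded_le by blast
      then show "\<exists>y\<in>S k. y \<ominus> w k0 \<in> mpow (Suc n)"
        using yw(1,4)[of j] mono[OF j(1)] by (metis subsetD)
    qed
    moreover have "w k0 \<ominus> r \<in> mpow n"
    proof (rule R.ideal_diff_trans[OF mpow_ideal wc yc rc _ yw(2)])
      show "w k0 \<ominus> y k0 \<in> mpow n"
        using R.ideal_diff_sym[OF mpow_ideal yc wc yw(4)] mpow_antimono[of n "Suc n"] by auto
    qed
    ultimately show "\<exists>y. C y (Suc n) \<and> y \<ominus> r \<in> mpow n" by blast
  qed
  then obtain s where s: "\<And>n. C (s n) n" "\<And>n. s (Suc n) \<ominus> s n \<in> mpow n" by blast
  have sc: "s n \<in> carrier R" for n using s(1) by (simp add: C_def)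
  then obtain l where l: "l \<in> carrier R" "\<And>n. l \<ominus> s n \<in> mpow n"
    using complete s(2) unfolding adically_complete_def by blast
  \<comment> \<open>The limit is only approximated by points of the sets, so stability is used:
    \<open>l\<close> differs from a point of \<open>S n\<close> by an element of
    \<open>mpow k\<close>.\<close>
  have "l \<in> S n" for n
  proof -
    obtain k where k: "\<And>r y. r \<in> S n \<Longrightarrow> y \<in> mpow k \<Longrightarrow> r \<oplus> y \<in> S n" using stable by blast
    obtain y where y: "y \<in> S n" "y \<ominus> s k \<in> mpow k" using s(1)[of k] by (auto simp: C_def)
    have yc: "y \<in> carrier R" using y sub by blast
    have "l \<ominus> y \<in> mpow k"
      by (rule R.ideal_diff_trans[OF mpow_ideal l(1) sc yc l(2) R.ideal_diff_sym[OF mpow_ideal yc sc y(2)]])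
    then have "y \<oplus> (l \<ominus> y) \<in> S n" using k y by blast
    moreover have "y \<oplus> (l \<ominus> y) = l" using yc l(1) by algebra
    ultimately show ?thesis by simp
  qed
  then show ?thesis using that by blast
qed

text \<open>Newton's iteration for \<open>X^2 - t X + d\<close>, started at a lift of the simple
  root \<open>z\<close>. The derivative has residue \<open>z - w\<close> throughout and so stays a
  unit. An exact root \<open>a\<close> comes from \<open>compactness\<close>, and the second root is
  \<open>t - a\<close>.\<close>

lemma hensel_quadratic:
  assumes t: "t \<in> carrier R" and d: "d \<in> carrier R" and z: "z \<in> carrier F" and w: "w \<in> carrier F"
    and zw: "z \<noteq> w" "\<pi> t = z \<oplus>\<^bsub>F\<^esub> w" "\<pi> d = z \<otimes>\<^bsub>F\<^esub> w"
  obtains a b where "a \<in> carrier R" "b \<in> carrier R" "\<pi> a = z" "\<pi> b = w" "a \<oplus> b = t" "a \<otimes> b = d"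
proof -
  define f where "f r = r \<otimes> r \<ominus> t \<otimes> r \<oplus> d" for r
  \<comment> \<open>The exponent is \<open>Suc n\<close> because any lift of \<open>z\<close> is
    already a root modulo \<open>mm\<close>.\<close>
  define S where "S n = {r \<in> carrier R. \<pi> r = z \<and> f r \<in> mpow (Suc n)}" for n
  have fc: "f r \<in> carrier R" if "r \<in> carrier R" for r using that t d by (simp add: f_def)
  have "S n \<noteq> {}" for n
  proof (induction n)
    case 0
    obtain r where r: "r \<in> carrier R" "\<pi> r = z" using lift_exists[OF z] .
    have "\<pi> (f r) = z \<otimes>\<^bsub>F\<^esub> z \<ominus>\<^bsub>F\<^esub> (z \<oplus>\<^bsub>F\<^esub> w) \<otimes>\<^bsub>F\<^esub> z \<oplus>\<^bsub>F\<^esub> z \<otimes>\<^bsub>F\<^esub> w"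
      using r t d zw by (simp add: f_def)
    also have "\<dots> = \<zero>\<^bsub>F\<^esub>" using z w by algebra
    finally show ?case using r mpow_1 mm_iff fc by (auto simp: S_def)
  next
    case (Suc n)
    then obtain r where r: "r \<in> carrier R" "\<pi> r = z" "f r \<in> mpow (Suc n)" by (auto simp: S_def)
    \<comment> \<open>\<open>g\<close> is the derivative at \<open>r\<close>, and \<open>h\<close>
      below is the Newton correction. The Taylor expansion of a quadratic polynomial is exact, so
      the new value of \<open>f\<close> is the square of \<open>h\<close>.\<close>
    define g where "g = r \<oplus> r \<ominus> t"
    have gc: "g \<in> carrier R" using r t by (simp add: g_def)
    have "\<pi> g = z \<ominus>\<^bsub>F\<^esub> w" using r t zw z w by (simp add: g_def) algebra
    then have "\<pi> g \<noteq> \<zero>\<^bsub>F\<^esub>" using zw(1) z w by simp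
    then have g: "g \<in> Units R" using unit_iff gc by simp
    define h where "h = inv g \<otimes> f r"
    have hc: "h \<in> carrier R" using g r fc by (simp add: h_def)
    have h: "h \<in> mpow (Suc n)"
      unfolding h_def using g r(3) by (intro ideal.I_l_closed[OF mpow_ideal]) auto
    have gh: "g \<otimes> h = f r"
      using R.m_assoc[OF gc R.Units_inv_closed[OF g] fc[OF r(1)]] g fc[OF r(1)] by (simp add: h_def)
    have "f (r \<ominus> h) = f r \<ominus> g \<otimes> h \<oplus> h \<otimes> h"
      unfolding f_def g_def using r(1) hc t d by algebra
    also have "\<dots> = h \<otimes> h" using gh hc fc[OF r(1)] by simp
    also have "\<dots> \<in> mpow (Suc n + Suc n)" by (rule R.ideal_power_add_mem[OF mm_ideal h h])
    finally have "f (r \<ominus> h) \<in> mpow (Suc (Suc n))" using mpow_antimono[of "Suc (Suc n)" "Suc n + Suc n"] by auto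
    moreover have "\<pi> (r \<ominus> h) = z"
    proof -
      have "h \<in> mm" using h mpow_antimono[of "Suc 0" "Suc n"] mpow_1 by auto
      then show ?thesis using r hc z by (simp add: mm_iff) algebra
    qed
    ultimately have "r \<ominus> h \<in> S (Suc n)" using r hc unfolding S_def by (intro CollectI conjI) simp_all
    then show ?case by blast
  qed
  moreover have "S (Suc n) \<subseteq> S n" for n
    using mpow_antimono[of "Suc n" "Suc (Suc n)"] by (auto simp: S_def)
  moreover have "\<exists>k. \<forall>r\<in>S n. \<forall>y\<in>mpow k. r \<oplus> y \<in> S n" for n
  proof (intro exI[of _ "Suc n"] ballI)
    fix r y assume r: "r \<in> S n" and y: "y \<in> mpow (Suc n)"
    have rc: "r \<in> carrier R" "\<pi> r = z" "f r \<in> mpow (Suc n)" using r by (auto simp: S_def)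
    have ym: "y \<in> carrier R" "\<pi> y = \<zero>\<^bsub>F\<^esub>"
      using y mpow_antimono[of "Suc 0" "Suc n"] mpow_1 mm_iff[of y] by auto
    have "f (r \<oplus> y) = f r \<oplus> (r \<oplus> r \<ominus> t \<oplus> y) \<otimes> y"
      unfolding f_def using rc(1) ym(1) t d by algebra
    also have "\<dots> \<in> mpow (Suc n)"
      using rc(1) ym(1) t y by (intro additive_subgroup.a_closed[OF ideal.axioms(1)[OF mpow_ideal] rc(3)] ideal.I_l_closed[OF mpow_ideal]) auto
    finally show "r \<oplus> y \<in> S n" using rc ym z by (simp add: S_def)
  qed
  moreover have "S n \<subseteq> carrier R" for n by (simp add: S_def)
  ultimately obtain a where a: "\<And>n. a \<in> S n" using compactness[of S] by metis
  have ac: "a \<in> carrier R" "\<pi> a = z" using a[of 0] by (auto simp: S_def)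
  have "f a \<in> mpow n" for n
    using a[of n] mpow_antimono[of n "Suc n"] by (auto simp: S_def)
  then have fa: "f a = \<zero>" by (rule mpow_Inter)
  have "a \<otimes> (t \<ominus> a) = d \<ominus> f a" unfolding f_def using ac t d by algebra
  then have "a \<otimes> (t \<ominus> a) = d" using fa d by (simp add: a_minus_def)
  moreover have "a \<oplus> (t \<ominus> a) = t" using ac t by algebra
  moreover have "\<pi> (t \<ominus> a) = w" using ac t zw z w by simp algebra
  ultimately show ?thesis using that[of a "t \<ominus> a"] ac t by simp
qed

end


section \<open>Continuity into the adic topology\<close>

context local_map
begin

lemma coset_iff:
  assumes "ideal K R" "r \<in> carrier R"
  shows "x \<in> K +> r \<longleftrightarrow> x \<in> carrier R \<and> x \<ominus> r \<in> K"
proof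
  interpret K: ideal K R by fact
  assume "x \<in> K +> r"
  then obtain k where k: "k \<in> K" "x = k \<oplus> r" unfolding a_r_coset_def' by (elim UN_E singletonE)
  moreover have "(k \<oplus> r) \<ominus> r = k" using K.Icarr[OF k(1)] assms(2) by algebra
  ultimately show "x \<in> carrier R \<and> x \<ominus> r \<in> K" using assms(2) by simp
next
  assume x: "x \<in> carrier R \<and> x \<ominus> r \<in> K"
  moreover have "x = (x \<ominus> r) \<oplus> r" using x assms(2) by algebra
  ultimately show "x \<in> K +> r" unfolding a_r_coset_def' by (metis UN_I singletonI)
qed

text \<open>The cosets of the powers of \<open>mm\<close> generate the topology, so continuity is
  checked on preimages of cosets. A coset of \<open>mpow n\<close> is the coset of each of its
  points, which turns the condition into congruences with the value at the centre.\<close>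

lemma continuous_adic_near:
  "continuous_map T (adic_topology R) f \<longleftrightarrow>
     f \<in> topspace T \<rightarrow> carrier R \<and> (\<forall>n. near T (\<lambda>x y. f y \<ominus> f x \<in> mpow n))"
proof
  let ?B = "{mpow n +> r | n r. r \<in> carrier R}"
  have gen: "adic_topology R = topology_generated_by ?B"
    by (simp add: adic_topology_def max_ideal_eq)
  have self: "r \<in> mpow n +> r" if "r \<in> carrier R" for r n
    using that additive_subgroup.zero_closed[OF ideal.axioms(1)[OF mpow_ideal[of n]]]
    by (simp add: coset_iff[OF mpow_ideal] a_minus_def R.r_neg)
  {
    assume L: "continuous_map T (adic_topology R) f"
    have f: "f x \<in> carrier R" if x: "x \<in> topspace T" for x
    proof -
      have "f x \<in> \<Union>?B" using L x unfolding gen continuous_on_generated_topo_iff by (metis (no_types, lifting) image_eqI subsetD)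
      then obtain n r where "r \<in> carrier R" "f x \<in> mpow n +> r" by (smt (verit) UnionE mem_Collect_eq)
      then show ?thesis using coset_iff[OF mpow_ideal] by (metis (no_types))
    qed
    have "near T (\<lambda>x y. f y \<ominus> f x \<in> mpow n)" for n
      unfolding near_def
    proof
      fix x assume x: "x \<in> topspace T"
      have "mpow n +> f x \<in> ?B" using f[OF x] by (metis (mono_tags, lifting) mem_Collect_eq)
      then have o: "openin T (f -` (mpow n +> f x) \<inter> topspace T)"
        using L unfolding gen continuous_on_generated_topo_iff by (metis (no_types, lifting))
      have "x \<in> f -` (mpow n +> f x) \<inter> topspace T" using x self[OF f[OF x]] by simp
      moreover have "\<forall>y\<in>f -` (mpow n +> f x) \<inter> topspace T. f y \<ominus> f x \<in> mpow n"
        using coset_iff[OF mpow_ideal f[OF x]] by simp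
      ultimately show "\<exists>U. openin T U \<and> x \<in> U \<and> (\<forall>y\<in>U. f y \<ominus> f x \<in> mpow n)" using o by metis
    qed
    then show "f \<in> topspace T \<rightarrow> carrier R \<and> (\<forall>n. near T (\<lambda>x y. f y \<ominus> f x \<in> mpow n))"
      using f by simp
  next
    assume Rs: "f \<in> topspace T \<rightarrow> carrier R \<and> (\<forall>n. near T (\<lambda>x y. f y \<ominus> f x \<in> mpow n))"
    then have f: "f x \<in> carrier R" if "x \<in> topspace T" for x using that by (simp add: Pi_def)
    have "openin T (f -` (mpow n +> r) \<inter> topspace T)" if r: "r \<in> carrier R" for n r
    proof (subst openin_subopen, intro ballI)
      fix x assume "x \<in> f -` (mpow n +> r) \<inter> topspace T"
      then have x: "x \<in> topspace T" "f x \<ominus> r \<in> mpow n" using coset_iff[OF mpow_ideal r] by simp_all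
      obtain U where U: "openin T U" "x \<in> U" "\<forall>y\<in>U. f y \<ominus> f x \<in> mpow n"
        using nearE[OF conjunct2[OF Rs, rule_format] x(1)] by metis
      have "U \<subseteq> f -` (mpow n +> r) \<inter> topspace T"
      proof
        fix y assume y: "y \<in> U"
        then have yt: "y \<in> topspace T" using openin_subset[OF U(1)] by (rule_tac subsetD)
        have "f y \<ominus> r \<in> mpow n"
          using R.ideal_diff_trans[OF mpow_ideal f[OF yt] f[OF x(1)] r] U(3) y x(2) by simp
        then show "y \<in> f -` (mpow n +> r) \<inter> topspace T"
          using yt f[OF yt] coset_iff[OF mpow_ideal r] by simp
      qed
      then show "\<exists>V. openin T V \<and> x \<in> V \<and> V \<subseteq> f -` (mpow n +> r) \<inter> topspace T"
        using U(1,2) by metis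
    qed
    moreover have "f ` topspace T \<subseteq> \<Union>?B"
    proof
      fix y assume "y \<in> f ` topspace T"
      then have y: "y \<in> carrier R" using f by (metis imageE)
      then have "mpow 0 +> y \<in> ?B" by (metis (mono_tags, lifting) mem_Collect_eq)
      then show "y \<in> \<Union>?B" using self[OF y] by (rule UnionI)
    qed
    ultimately show "continuous_map T (adic_topology R) f"
      unfolding gen continuous_on_generated_topo_iff by (smt (verit) mem_Collect_eq)
  }
qed

end

section \<open>Coefficient rings\<close>

text \<open>A non-unit generates a proper ideal. Among the ideals that contain \<open>r\<close> and
  miss one, the chain condition provides a maximal element; it is a maximal ideal, hence equal to
  \<open>max_ideal R\<close>.\<close>

lemma (in cring) local_ring_unit:
  assumes "local_ring R" "noetherian_ring R" "r \<in> carrier R" "r \<notin> max_ideal R"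
  shows "r \<in> Units R"
proof (rule ccontr)
  assume nu: "r \<notin> Units R"
  define \<A> where "\<A> = {J. ideal J R \<and> r \<in> J \<and> \<one> \<notin> J}"
  have "\<exists>M\<in>\<A>. \<forall>X\<in>\<A>. M \<subseteq> X \<longrightarrow> X = M"
  proof (rule subset_Zorn_nonempty)
    have "\<one> \<notin> PIdl r"
    proof
      assume "\<one> \<in> PIdl r"
      then obtain s where "s \<in> carrier R" "\<one> = s \<otimes> r" unfolding cgenideal_def by blast
      then have "r \<in> Units R" using assms(3) m_comm by (auto simp: Units_def)
      then show False using nu by simp
    qed
    then have "PIdl r \<in> \<A>"
      using cgenideal_ideal[OF assms(3)] cgenideal_self[OF assms(3)] by (simp add: \<A>_def)
    then show "\<A> \<noteq> {}" by blast
    fix C assume C: "C \<noteq> {}" "subset.chain \<A> C"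
    then have "subset.chain {I. ideal I R} C"
      unfolding pred_on.chain_def by (auto simp: \<A>_def)
    then have "\<Union>C \<in> C" using noetherian_ring.ideal_chain_is_trivial[OF assms(2) C(1)] by blast
    then show "\<Union>C \<in> \<A>" using C(2) unfolding pred_on.chain_def by blast
  qed
  then obtain M where M: "M \<in> \<A>" and max: "\<And>X. X \<in> \<A> \<Longrightarrow> M \<subseteq> X \<Longrightarrow> X = M" by blast
  have "maximalideal M R"
  proof (rule maximalidealI)
    show "ideal M R" using M by (simp add: \<A>_def)
    show "carrier R \<noteq> M" using M one_closed by (auto simp: \<A>_def)
    fix J assume J: "ideal J R" "M \<subseteq> J" "J \<subseteq> carrier R"
    show "J = M \<or> J = carrier R"
    proof (cases "\<one> \<in> J")
      case True
      then show ?thesis using ideal.one_imp_carrier[OF J(1)] by simp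
    next
      case False
      then have "J \<in> \<A>" using J M by (auto simp: \<A>_def)
      then show ?thesis using max J(2) by blast
    qed
  qed
  then have "max_ideal R = M"
    unfolding max_ideal_def using assms(1) by (intro the1_equality) (simp_all add: local_ring_def)
  then show False using M assms(4) by (simp add: \<A>_def)
qed

text \<open>Multiples of one by Witt vectors reach every residue class, and on them the value of a
  residue map is prescribed. Every \<open>r\<close> differs from such a multiple by an element of
  the maximal ideal, the common kernel.\<close>

lemma is_residue_map_unique:
  assumes "algebra (witt_ring p F) R" "is_residue_map p F R \<pi>" "is_residue_map p F R \<pi>'" "cring F"
  shows "\<pi> = \<pi>'"
proof
  interpret A: algebra "witt_ring p F" R by fact
  interpret F: cring F by fact
  have hom: "ring_hom_cring R F \<pi>" "ring_hom_cring R F \<pi>'"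
    using assms(2,3) A.cring_axioms F.cring_axioms
    unfolding is_residue_map_def ring_hom_cring_def ring_hom_cring_axioms_def by auto
  interpret h: ring_hom_cring R F \<pi> by (rule hom)
  interpret h': ring_hom_cring R F \<pi>' by (rule hom)
  fix r
  show "\<pi> r = \<pi>' r"
  proof (cases "r \<in> carrier R")
    case True
    \<comment> \<open>A Witt vector whose zeroth component is the residue of \<open>r\<close>; the
      constant sequence is a convenient choice.\<close>
    let ?w = "\<lambda>n::nat. \<pi> r"
    have w: "?w \<in> carrier (witt_ring p F)" using True by (simp add: witt_ring_def)
    let ?s = "?w \<odot>\<^bsub>R\<^esub> \<one>\<^bsub>R\<^esub>"
    have s: "?s \<in> carrier R" using w by simp
    have e: "\<pi> ?s = \<pi> r" "\<pi>' ?s = \<pi> r" using assms(2,3) w unfolding is_residue_map_def by blast+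
    have "\<pi> (r \<ominus>\<^bsub>R\<^esub> ?s) = \<zero>\<^bsub>F\<^esub>" using True s e by simp
    then have "r \<ominus>\<^bsub>R\<^esub> ?s \<in> a_kernel R F \<pi>" using True s unfolding a_kernel_def' by simp
    then have "r \<ominus>\<^bsub>R\<^esub> ?s \<in> a_kernel R F \<pi>'"
      using assms(2,3) unfolding is_residue_map_def by simp
    then have "\<pi>' r \<ominus>\<^bsub>F\<^esub> \<pi>' ?s = \<zero>\<^bsub>F\<^esub>" using True s unfolding a_kernel_def' by simp
    then show ?thesis using e True s by simp
  next
    case False
    then show ?thesis using assms(2,3) unfolding is_residue_map_def
      by (simp add: extensional_def)
  qed
qed

lemma residue_map_is_residue_map:
  assumes "coeff_ring p F R" "cring F"
  shows "is_residue_map p F R (residue_map p F R)"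
proof -
  obtain \<pi> where "is_residue_map p F R \<pi>" using assms(1) by (auto simp: coeff_ring_def)
  then show ?thesis
    using assms is_residue_map_unique unfolding residue_map_def coeff_ring_def
    by (metis the_equality)
qed

lemma coeff_ring_complete_local_map:
  assumes "coeff_ring p F R" "field F" "finite (carrier F)"
  shows "complete_local_map R F (residue_map p F R)"
proof -
  let ?\<pi> = "residue_map p F R"
  interpret F: field F by fact
  have c: "cring R" "local_ring R" "noetherian_ring R" "adically_complete R (max_ideal R)"
    using assms(1) by (auto simp: coeff_ring_def local_ring_def)
  interpret R: cring R by fact
  have rm: "is_residue_map p F R ?\<pi>" by (rule residue_map_is_residue_map[OF assms(1) F.is_cring])
  have k: "a_kernel R F ?\<pi> = max_ideal R" using rm by (simp add: is_residue_map_def)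
  have hr: "?\<pi> \<in> ring_hom R F" using rm by (simp add: is_residue_map_def)
  interpret h: ring_hom_cring R F ?\<pi>
    by unfold_locales (rule hr)
  have "local_map R F ?\<pi>"
  proof
    show "?\<pi> ` carrier R = carrier F" using rm by (simp add: is_residue_map_def)
    fix r assume r: "r \<in> carrier R" "?\<pi> r \<noteq> \<zero>\<^bsub>F\<^esub>"
    then have "r \<notin> max_ideal R" unfolding k[symmetric] a_kernel_def' by simp
    then show "r \<in> Units R" by (rule R.local_ring_unit[OF c(2,3) r(1)])
  qed
  then show ?thesis
    using c assms(3) k by (simp add: complete_local_map_def complete_local_map_axioms_def)
qed

text \<open>The same device as for uniqueness: \<open>r\<close> is a multiple of one by a Witt
  vector plus an element of the maximal ideal, and a morphism respects both parts.\<close>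

lemma coeff_hom_residue:
  assumes "coeff_ring p F R" "coeff_ring p F S" "cring F" "\<phi> \<in> coeff_hom p F R S" "r \<in> carrier R"
  shows "residue_map p F S (\<phi> r) = residue_map p F R r"
proof -
  let ?\<pi> = "residue_map p F R" and ?\<pi>' = "residue_map p F S"
  interpret A: algebra "witt_ring p F" R using assms(1) by (simp add: coeff_ring_def)
  interpret B: algebra "witt_ring p F" S using assms(2) by (simp add: coeff_ring_def)
  interpret F: cring F by fact
  have rm: "is_residue_map p F R ?\<pi>" "is_residue_map p F S ?\<pi>'"
    using assms(1-3) residue_map_is_residue_map by blast+
  interpret h: ring_hom_cring R F ?\<pi>
    using rm by unfold_locales (auto simp: is_residue_map_def)
  interpret h': ring_hom_cring S F ?\<pi>'
    using rm by unfold_locales (auto simp: is_residue_map_def)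
  interpret f: ring_hom_cring R S \<phi>
    using assms(4) by unfold_locales (auto simp: coeff_hom_def)
  let ?w = "\<lambda>n::nat. ?\<pi> r"
  have w: "?w \<in> carrier (witt_ring p F)" using assms(5) by (simp add: witt_ring_def)
  let ?s = "?w \<odot>\<^bsub>R\<^esub> \<one>\<^bsub>R\<^esub>"
  have s: "?s \<in> carrier R" using w by simp
  have e: "?\<pi> ?s = ?\<pi> r" "?\<pi>' (?w \<odot>\<^bsub>S\<^esub> \<one>\<^bsub>S\<^esub>) = ?\<pi> r" using rm w unfolding is_residue_map_def by blast+
  have fs: "\<phi> ?s = ?w \<odot>\<^bsub>S\<^esub> \<one>\<^bsub>S\<^esub>" using assms(4) w A.one_closed f.hom_one unfolding coeff_hom_def by auto
  have "?\<pi> (r \<ominus>\<^bsub>R\<^esub> ?s) = \<zero>\<^bsub>F\<^esub>" using assms(5) s e by simp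
  then have "r \<ominus>\<^bsub>R\<^esub> ?s \<in> a_kernel R F ?\<pi>" using assms(5) s unfolding a_kernel_def' by simp
  then have "\<phi> (r \<ominus>\<^bsub>R\<^esub> ?s) \<in> a_kernel S F ?\<pi>'"
    using assms(4) rm unfolding is_residue_map_def coeff_hom_def by auto
  then have "?\<pi>' (\<phi> r) \<ominus>\<^bsub>F\<^esub> ?\<pi>' (\<phi> ?s) = \<zero>\<^bsub>F\<^esub>" using assms(5) s unfolding a_kernel_def' by simp
  then show ?thesis using e fs assms(5) s by simp
qed

lemma coeff_hom_compose:
  assumes "\<phi> \<in> coeff_hom p F R S" "\<psi> \<in> coeff_hom p F S T"
    "algebra (witt_ring p F) R" "algebra (witt_ring p F) S"
    "max_ideal R \<subseteq> carrier R"
  shows "compose (carrier R) \<psi> \<phi> \<in> coeff_hom p F R T"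
proof -
  interpret A: algebra "witt_ring p F" R by fact
  interpret B: algebra "witt_ring p F" S by fact
  have h: "\<phi> \<in> ring_hom R S" "\<psi> \<in> ring_hom S T" using assms by (auto simp: coeff_hom_def)
  have c: "\<phi> x \<in> carrier S" if "x \<in> carrier R" for x using h(1) that by (rule ring_hom_closed)
  have "compose (carrier R) \<psi> \<phi> \<in> ring_hom R T"
    using h c by (intro ring_hom_memI)
      (auto simp: compose_eq ring_hom_closed ring_hom_mult ring_hom_add ring_hom_one)
  moreover have "compose (carrier R) \<psi> \<phi> ` max_ideal R \<subseteq> max_ideal T"
  proof
    fix y assume "y \<in> compose (carrier R) \<psi> \<phi> ` max_ideal R"
    then obtain x where x: "x \<in> max_ideal R" "y = compose (carrier R) \<psi> \<phi> x" by blast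
    then have "y = \<psi> (\<phi> x)" using assms(5) by (auto simp: compose_eq)
    then show "y \<in> max_ideal T" using x(1) assms(1,2) unfolding coeff_hom_def by blast
  qed
  moreover have "compose (carrier R) \<psi> \<phi> (a \<odot>\<^bsub>R\<^esub> r) = a \<odot>\<^bsub>T\<^esub> compose (carrier R) \<psi> \<phi> r"
    if "a \<in> carrier (witt_ring p F)" "r \<in> carrier R" for a r
    using that assms(1,2) c by (simp add: compose_eq coeff_hom_def)
  ultimately show ?thesis by (simp add: coeff_hom_def compose_def)
qed


text \<open>\<open>A\<close> is a bare record, and its ring laws are those of \<open>R\<close>
  transported along the surjection \<open>e\<close>. The application is a quotient ring whose
  elements are codes instead of cosets.\<close>

lemma cring_hom_image:
  assumes "cring R" and surj: "e ` carrier R = carrier A"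
    and m: "\<And>x y. x \<in> carrier R \<Longrightarrow> y \<in> carrier R \<Longrightarrow> e x \<otimes>\<^bsub>A\<^esub> e y = e (x \<otimes>\<^bsub>R\<^esub> y)"
    and a: "\<And>x y. x \<in> carrier R \<Longrightarrow> y \<in> carrier R \<Longrightarrow> e x \<oplus>\<^bsub>A\<^esub> e y = e (x \<oplus>\<^bsub>R\<^esub> y)"
    and o: "\<one>\<^bsub>A\<^esub> = e \<one>\<^bsub>R\<^esub>" and z: "\<zero>\<^bsub>A\<^esub> = e \<zero>\<^bsub>R\<^esub>"
  shows "cring A"
proof -
  interpret R: cring R by fact
  have ec: "x \<in> carrier R \<Longrightarrow> e x \<in> carrier A" for x using surj by blast
  have ex: "\<exists>x\<in>carrier R. X = e x" if "X \<in> carrier A" for X using that surj by blast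
  show ?thesis
  proof (rule cringI)
    show "abelian_group A"
    proof (rule abelian_groupI)
      fix X Y Z assume X: "X \<in> carrier A" and Y: "Y \<in> carrier A" and Z: "Z \<in> carrier A"
      obtain x y w where x: "x \<in> carrier R" "y \<in> carrier R" "w \<in> carrier R" "X = e x" "Y = e y" "Z = e w"
        using ex[OF X] ex[OF Y] ex[OF Z] by blast
      show "X \<oplus>\<^bsub>A\<^esub> Y \<oplus>\<^bsub>A\<^esub> Z = X \<oplus>\<^bsub>A\<^esub> (Y \<oplus>\<^bsub>A\<^esub> Z)" using x by (simp add: a R.a_assoc)
    next
      fix X Y assume X: "X \<in> carrier A" and Y: "Y \<in> carrier A"
      obtain x y where x: "x \<in> carrier R" "y \<in> carrier R" "X = e x" "Y = e y"
        using ex[OF X] ex[OF Y] by blast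
      show "X \<oplus>\<^bsub>A\<^esub> Y \<in> carrier A" using x by (simp add: a ec)
      show "X \<oplus>\<^bsub>A\<^esub> Y = Y \<oplus>\<^bsub>A\<^esub> X" using x by (simp add: a R.a_comm)
      show "\<zero>\<^bsub>A\<^esub> \<oplus>\<^bsub>A\<^esub> X = X" using x by (simp add: a z)
      have "e (\<ominus>\<^bsub>R\<^esub> x) \<oplus>\<^bsub>A\<^esub> X = \<zero>\<^bsub>A\<^esub>" using x by (simp add: a z R.l_neg)
      then show "\<exists>y\<in>carrier A. y \<oplus>\<^bsub>A\<^esub> X = \<zero>\<^bsub>A\<^esub>" using ec[of "\<ominus>\<^bsub>R\<^esub> x"] x by blast
    qed (simp add: z ec)
    show "comm_monoid A"
    proof (rule comm_monoidI)
      fix X Y Z assume X: "X \<in> carrier A" and Y: "Y \<in> carrier A" and Z: "Z \<in> carrier A"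
      obtain x y w where x: "x \<in> carrier R" "y \<in> carrier R" "w \<in> carrier R" "X = e x" "Y = e y" "Z = e w"
        using ex[OF X] ex[OF Y] ex[OF Z] by blast
      show "X \<otimes>\<^bsub>A\<^esub> Y \<otimes>\<^bsub>A\<^esub> Z = X \<otimes>\<^bsub>A\<^esub> (Y \<otimes>\<^bsub>A\<^esub> Z)" using x by (simp add: m R.m_assoc)
    next
      fix X Y assume X: "X \<in> carrier A" and Y: "Y \<in> carrier A"
      obtain x y where x: "x \<in> carrier R" "y \<in> carrier R" "X = e x" "Y = e y"
        using ex[OF X] ex[OF Y] by blast
      show "X \<otimes>\<^bsub>A\<^esub> Y \<in> carrier A" using x by (simp add: m ec)
      show "X \<otimes>\<^bsub>A\<^esub> Y = Y \<otimes>\<^bsub>A\<^esub> X" using x by (simp add: m R.m_comm)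
      show "\<one>\<^bsub>A\<^esub> \<otimes>\<^bsub>A\<^esub> X = X" using x by (simp add: m o)
    qed (simp add: o ec)
    fix X Y Z assume X: "X \<in> carrier A" and Y: "Y \<in> carrier A" and Z: "Z \<in> carrier A"
    obtain x y w where x: "x \<in> carrier R" "y \<in> carrier R" "w \<in> carrier R" "X = e x" "Y = e y" "Z = e w"
      using ex[OF X] ex[OF Y] ex[OF Z] by blast
    show "(X \<oplus>\<^bsub>A\<^esub> Y) \<otimes>\<^bsub>A\<^esub> Z = X \<otimes>\<^bsub>A\<^esub> Z \<oplus>\<^bsub>A\<^esub> Y \<otimes>\<^bsub>A\<^esub> Z"
      using x by (simp add: a m R.l_distr)
  qed
qed

lemma (in cring) finite_noetherian:
  assumes "finite (carrier R)" shows "noetherian_ring R"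
proof (rule noetherian_ringI)
  fix I assume I: "ideal I R"
  interpret I: ideal I R by fact
  have s: "I \<subseteq> carrier R" using I.a_subset .
  have "Idl I = I" using genideal_minimal[OF I] genideal_self[OF s] by blast
  then show "\<exists>A\<subseteq>carrier R. finite A \<and> I = Idl A" using s finite_subset[OF s assms] by blast
qed

text \<open>A sequence with differences \<open>s (Suc n) - s n\<close> in \<open>mpow n\<close> is
  constant from the index \<open>N\<close> on, so \<open>s N\<close> is its limit.\<close>

lemma (in local_map) nilpotent_complete:
  assumes "mpow N = {\<zero>}" shows "adically_complete R mm"
  unfolding adically_complete_def
proof (intro conjI allI impI)
  have z: "\<zero> \<in> mpow n" for n
    by (rule additive_subgroup.zero_closed[OF ideal.axioms(1)[OF mpow_ideal]])
  show "(\<Inter>n. mpow n) = {\<zero>}" using assms z by (metis (no_types, lifting) INT_lower UNIV_I INT_I insert_subset empty_subsetI subset_antisym)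
  fix s assume s: "(\<forall>n. s n \<in> carrier R) \<and> (\<forall>n. s (Suc n) \<ominus> s n \<in> mpow n)"
  then have sc: "s n \<in> carrier R" for n by simp
  have step: "s (n + k) \<ominus> s n \<in> mpow n" for n k
  proof (induction k)
    case 0
    then show ?case using sc z by (simp add: a_minus_def R.r_neg)
  next
    case (Suc k)
    have "s (Suc (n + k)) \<ominus> s (n + k) \<in> mpow n"
      using s mpow_antimono[of n "n + k"] by (metis subsetD le_add1)
    then show ?case using R.ideal_diff_trans[OF mpow_ideal sc sc sc _ Suc] by simp
  qed
  have "s N \<ominus> s n \<in> mpow n" for n
  proof (cases "n \<le> N")
    case True
    then show ?thesis using step[of n "N - n"] by simp
  next
    case False
    then have "s n \<ominus> s N \<in> mpow N" using step[of N "n - N"] by simp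
    then have "s n = s N" unfolding assms using sc by simp
    then show ?thesis using sc z by (simp add: a_minus_def R.r_neg)
  qed
  then show "\<exists>l\<in>carrier R. \<forall>n. l \<ominus> s n \<in> mpow n" using sc by metis
qed

lemma local_mapI:
  assumes "cring A" "field F" "\<pi> \<in> ring_hom A F" "\<pi> ` carrier A = carrier F"
    "\<And>r. r \<in> carrier A \<Longrightarrow> \<pi> r \<noteq> \<zero>\<^bsub>F\<^esub> \<Longrightarrow> r \<in> Units A"
  shows "local_map A F \<pi>"
  using assms fieldE(1)[OF assms(2)]
  by (simp add: local_map_def local_map_axioms_def ring_hom_cring_def ring_hom_cring_axioms_def)

text \<open>The universal properties speak about rings with elements of type \<open>nat set\<close>,
  whereas cosets of \<open>K\<close> are sets of elements of \<open>R\<close>. As \<open>K\<close>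
  contains a power of the maximal ideal, there are finitely many cosets; they can be numbered, and
  the structure is transported to the codes.\<close>

theorem coeff_ring_quotient:
  fixes F :: "'k ring" and R :: "(nat \<Rightarrow> 'k, 'r) module"
  assumes R: "coeff_ring p F R" and F: "field F" "finite (carrier F)"
    and K: "ideal K R" "ideal_power R (max_ideal R) N \<subseteq> K" "K \<subseteq> max_ideal R"
  obtains A :: "(nat \<Rightarrow> 'k, nat set) module" and q where
    "coeff_ring p F A" "q \<in> coeff_hom p F R A" "q ` carrier R = carrier A"
    "\<And>r. r \<in> carrier R \<Longrightarrow> q r = \<zero>\<^bsub>A\<^esub> \<longleftrightarrow> r \<in> K" "ideal_power A (max_ideal A) N = {\<zero>\<^bsub>A\<^esub>}"
proof -
  let ?W = "witt_ring p F"
  define \<pi> where "\<pi> = residue_map p F R"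
  interpret L: complete_local_map R F \<pi>
    unfolding \<pi>_def by (rule coeff_ring_complete_local_map[OF R F])
  interpret W: algebra ?W R using R by (simp add: coeff_ring_def)
  interpret K: ideal K R by fact
  have maxR: "max_ideal R = L.mm" by (rule L.max_ideal_eq)
  have res: "is_residue_map p F R \<pi>"
    unfolding \<pi>_def by (rule residue_map_is_residue_map[OF R L.S.is_cring])
  obtain Y where Y: "finite Y" "Y \<subseteq> carrier R" "\<And>r. r \<in> carrier R \<Longrightarrow> \<exists>y\<in>Y. r \<ominus>\<^bsub>R\<^esub> y \<in> K"
    using L.finite_reps[OF L.noeth L.fin_residue K(1), of N] K(2) maxR by metis
  define cos where "cos r = {s \<in> carrier R. s \<ominus>\<^bsub>R\<^esub> r \<in> K}" for r
  have cos: "cos r = cos s \<longleftrightarrow> r \<ominus>\<^bsub>R\<^esub> s \<in> K" if rs: "r \<in> carrier R" "s \<in> carrier R" for r s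
  proof
    assume e: "cos r = cos s"
    have "r \<in> cos r" using rs K.zero_closed by (simp add: cos_def a_minus_def L.R.r_neg)
    then have "r \<in> cos s" using e by simp
    then show "r \<ominus>\<^bsub>R\<^esub> s \<in> K" by (simp add: cos_def)
  next
    assume d: "r \<ominus>\<^bsub>R\<^esub> s \<in> K"
    show "cos r = cos s"
      unfolding cos_def
      using L.R.ideal_diff_trans[OF K(1) _ rs _ d]
        L.R.ideal_diff_trans[OF K(1) _ rs(2,1) _ L.R.ideal_diff_sym[OF K(1) rs d]] by blast
  qed
  have "cos ` carrier R \<subseteq> cos ` Y"
  proof
    fix X assume "X \<in> cos ` carrier R"
    then obtain r where r: "r \<in> carrier R" "X = cos r" by blast
    then obtain y where y: "y \<in> Y" "r \<ominus>\<^bsub>R\<^esub> y \<in> K" using Y(3) by metis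
    then have "X = cos y" using cos[of r y] r Y(2) by blast
    then show "X \<in> cos ` Y" using y by simp
  qed
  then have fin: "finite (cos ` carrier R)" using Y(1) finite_surj by blast
  then obtain code :: "'r set \<Rightarrow> nat" where code: "inj_on code (cos ` carrier R)"
    using finite_imp_inj_to_nat_seg by metis
  define e :: "'r \<Rightarrow> nat set" where "e r = {code (cos r)}" for r
  have e_eq: "e r = e s \<longleftrightarrow> r \<ominus>\<^bsub>R\<^esub> s \<in> K" if rs: "r \<in> carrier R" "s \<in> carrier R" for r s
    using inj_on_eq_iff[OF code, of "cos r" "cos s"] rs cos[OF rs] by (simp add: e_def)
  \<comment> \<open>\<open>dec\<close> picks a representative. The operations of \<open>A\<close> do
    not depend on the choice, because representatives of one class differ by an element of
    \<open>K\<close>.\<close>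
  define dec where "dec X = (SOME r. r \<in> carrier R \<and> e r = X)" for X
  have dec: "dec (e r) \<in> carrier R" "e (dec (e r)) = e r" if "r \<in> carrier R" for r
    using someI[of "\<lambda>s. s \<in> carrier R \<and> e s = e r" r] that by (simp_all add: dec_def)
  have dec_diff: "dec (e r) \<ominus>\<^bsub>R\<^esub> r \<in> K" if "r \<in> carrier R" for r
    using e_eq[OF dec(1)[OF that] that] dec[OF that] by simp
  define A :: "(nat \<Rightarrow> 'k, nat set) module" where
    "A = \<lparr>carrier = e ` carrier R, mult = (\<lambda>X Y. e (dec X \<otimes>\<^bsub>R\<^esub> dec Y)), one = e \<one>\<^bsub>R\<^esub>,
      zero = e \<zero>\<^bsub>R\<^esub>, add = (\<lambda>X Y. e (dec X \<oplus>\<^bsub>R\<^esub> dec Y)),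
      smult = (\<lambda>w X. e (w \<odot>\<^bsub>R\<^esub> dec X))\<rparr>"
  have eA: "e ` carrier R = carrier A" by (simp add: A_def)
  have em: "e x \<otimes>\<^bsub>A\<^esub> e y = e (x \<otimes>\<^bsub>R\<^esub> y)" if "x \<in> carrier R" "y \<in> carrier R" for x y
    using L.R.ideal_diff_mult[OF K(1) that(1) dec(1) that(2) dec(1) dec_diff dec_diff] that dec(1)
    by (simp add: A_def e_eq)
  have ea: "e x \<oplus>\<^bsub>A\<^esub> e y = e (x \<oplus>\<^bsub>R\<^esub> y)" if "x \<in> carrier R" "y \<in> carrier R" for x y
    using L.R.ideal_diff_add[OF K(1) that(1) dec(1) that(2) dec(1) dec_diff dec_diff] that dec(1)
    by (simp add: A_def e_eq)
  have eo: "\<one>\<^bsub>A\<^esub> = e \<one>\<^bsub>R\<^esub>" and ez: "\<zero>\<^bsub>A\<^esub> = e \<zero>\<^bsub>R\<^esub>" by (simp_all add: A_def)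
  have smultK: "w \<odot>\<^bsub>R\<^esub> k \<in> K" if "w \<in> carrier ?W" "k \<in> K" for w k
  proof -
    have "(w \<odot>\<^bsub>R\<^esub> \<one>\<^bsub>R\<^esub>) \<otimes>\<^bsub>R\<^esub> k \<in> K" using that by (intro K.I_l_closed) auto
    then show ?thesis using W.smult_assoc2[of w "\<one>\<^bsub>R\<^esub>" k] that K.Icarr by simp
  qed
  have es: "w \<odot>\<^bsub>A\<^esub> e x = e (w \<odot>\<^bsub>R\<^esub> x)" if w: "w \<in> carrier ?W" and x: "x \<in> carrier R" for w x
  proof -
    have "w \<odot>\<^bsub>R\<^esub> (dec (e x) \<ominus>\<^bsub>R\<^esub> x) \<in> K" using smultK[OF w dec_diff[OF x]] .
    moreover have "w \<odot>\<^bsub>R\<^esub> (dec (e x) \<ominus>\<^bsub>R\<^esub> x) = w \<odot>\<^bsub>R\<^esub> dec (e x) \<ominus>\<^bsub>R\<^esub> w \<odot>\<^bsub>R\<^esub> x"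
      using w x dec(1)[OF x] by (simp add: a_minus_def W.smult_r_distr W.smult_r_minus)
    ultimately show ?thesis using w x dec(1)[OF x] by (simp add: A_def e_eq)
  qed
  interpret A: cring A by (rule cring_hom_image[OF L.R.is_cring eA em ea eo ez])
  have ex: "\<exists>x\<in>carrier R. X = e x" if "X \<in> carrier A" for X using that eA by blast
  have ec: "e x \<in> carrier A" if "x \<in> carrier R" for x using that eA by blast
  have algA: "algebra ?W A"
  proof (rule algebra.intro[OF module.intro A.is_cring])
    show "cring ?W" by (rule W.R.is_cring)
    show "abelian_group A" by (rule A.abelian_group_axioms)
    show "module_axioms ?W A"
    proof
      fix w w' X X' assume w: "w \<in> carrier ?W" "w' \<in> carrier ?W" and X: "X \<in> carrier A" "X' \<in> carrier A"
      obtain x x' where x: "x \<in> carrier R" "X = e x" "x' \<in> carrier R" "X' = e x'" using X ex by metis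
      show "(w \<oplus>\<^bsub>?W\<^esub> w') \<odot>\<^bsub>A\<^esub> X = w \<odot>\<^bsub>A\<^esub> X \<oplus>\<^bsub>A\<^esub> w' \<odot>\<^bsub>A\<^esub> X"
        using w x by (simp add: es ea W.smult_l_distr)
      show "w \<odot>\<^bsub>A\<^esub> (X \<oplus>\<^bsub>A\<^esub> X') = w \<odot>\<^bsub>A\<^esub> X \<oplus>\<^bsub>A\<^esub> w \<odot>\<^bsub>A\<^esub> X'"
        using w x by (simp add: es ea W.smult_r_distr)
      show "(w \<otimes>\<^bsub>?W\<^esub> w') \<odot>\<^bsub>A\<^esub> X = w \<odot>\<^bsub>A\<^esub> (w' \<odot>\<^bsub>A\<^esub> X)"
        using w x by (simp add: es W.smult_assoc1)
      show "w \<odot>\<^bsub>A\<^esub> X \<in> carrier A" using w x by (simp add: es ec)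
    next
      fix X assume "X \<in> carrier A"
      then obtain x where "x \<in> carrier R" "X = e x" using ex by metis
      then show "\<one>\<^bsub>?W\<^esub> \<odot>\<^bsub>A\<^esub> X = X" by (simp add: es)
    qed
    show "algebra_axioms ?W A"
    proof
      fix w X X' assume w: "w \<in> carrier ?W" and X: "X \<in> carrier A" "X' \<in> carrier A"
      obtain x x' where x: "x \<in> carrier R" "X = e x" "x' \<in> carrier R" "X' = e x'" using X ex by metis
      show "(w \<odot>\<^bsub>A\<^esub> X) \<otimes>\<^bsub>A\<^esub> X' = w \<odot>\<^bsub>A\<^esub> (X \<otimes>\<^bsub>A\<^esub> X')"
        using w x by (simp add: es em W.smult_assoc2)
    qed
  qed
  define \<pi>A where "\<pi>A = (\<lambda>X\<in>carrier A. \<pi> (dec X))"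
  have piA: "\<pi>A (e r) = \<pi> r" if r: "r \<in> carrier R" for r
  proof -
    have "dec (e r) \<ominus>\<^bsub>R\<^esub> r \<in> L.mm" using dec_diff[OF r] K(3) maxR by blast
    then have "\<pi> (dec (e r)) = \<pi> r" using L.residue_eq_iff[OF dec(1)[OF r] r] by simp
    then show ?thesis using ec[OF r] by (simp add: \<pi>A_def)
  qed
  have homA: "\<pi>A \<in> ring_hom A F"
  proof (rule ring_hom_memI)
    fix X Y assume X: "X \<in> carrier A" "Y \<in> carrier A"
    obtain x y where x: "x \<in> carrier R" "X = e x" "y \<in> carrier R" "Y = e y" using X ex by metis
    show "\<pi>A X \<in> carrier F" using x by (simp add: piA)
    show "\<pi>A (X \<otimes>\<^bsub>A\<^esub> Y) = \<pi>A X \<otimes>\<^bsub>F\<^esub> \<pi>A Y" using x by (simp add: em piA)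
    show "\<pi>A (X \<oplus>\<^bsub>A\<^esub> Y) = \<pi>A X \<oplus>\<^bsub>F\<^esub> \<pi>A Y" using x by (simp add: ea piA)
  next
    show "\<pi>A \<one>\<^bsub>A\<^esub> = \<one>\<^bsub>F\<^esub>" by (simp add: eo piA)
  qed
  interpret LA: local_map A F \<pi>A
  proof (rule local_mapI[OF A.is_cring F(1) homA])
    show "\<pi>A ` carrier A = carrier F"
      using L.residue_surj unfolding eA[symmetric] by (simp add: image_image piA)
    fix X assume X: "X \<in> carrier A" "\<pi>A X \<noteq> \<zero>\<^bsub>F\<^esub>"
    obtain x where x: "x \<in> carrier R" "X = e x" using X ex by metis
    then have u: "x \<in> Units R" using X piA L.residue_unit by simp
    then have "e x \<otimes>\<^bsub>A\<^esub> e (inv\<^bsub>R\<^esub> x) = \<one>\<^bsub>A\<^esub>" "e (inv\<^bsub>R\<^esub> x) \<otimes>\<^bsub>A\<^esub> e x = \<one>\<^bsub>A\<^esub>"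
      using x by (simp_all add: em eo)
    moreover have "e (inv\<^bsub>R\<^esub> x) \<in> carrier A" using u by (intro ec) simp
    ultimately show "X \<in> Units A"
      using x X(1) unfolding Units_def
      by (intro CollectI conjI bexI[of _ "e (inv\<^bsub>R\<^esub> x)"]) (simp_all add: ec)
  qed
  have finA: "finite (carrier A)"
    using fin unfolding eA[symmetric] e_def by (simp add: image_image[symmetric, of "\<lambda>c. {code c}" cos])
  define q where "q = restrict e (carrier R)"
  have q: "q r = e r" if "r \<in> carrier R" for r using that by (simp add: q_def)
  have hq: "q \<in> ring_hom R A"
    by (rule ring_hom_memI) (auto simp: q em ea eo ec)
  interpret q: ring_hom_cring R A q by unfold_locales (rule hq)
  have qmm: "q r \<in> LA.mm \<longleftrightarrow> r \<in> L.mm" if "r \<in> carrier R" for r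
    using that by (simp only: LA.mm_iff L.mm_iff q piA ec)
  have qK: "q r = \<zero>\<^bsub>A\<^esub> \<longleftrightarrow> r \<in> K" if r: "r \<in> carrier R" for r
    using that e_eq[OF r L.R.zero_closed] by (simp add: q ez a_minus_def)
  \<comment> \<open>An element of a power of the maximal ideal of \<open>A\<close> lifts to the same
    power in \<open>R\<close>; for the exponent \<open>N\<close> this power lies in \<open>K\<close>
    and dies in \<open>A\<close>.\<close>
  have pow: "X \<in> q ` L.mpow n" if "X \<in> LA.mpow n" for X n
    using that
  proof (induction n arbitrary: X)
    case 0
    then show ?case using eA q by auto
  next
    case (Suc n)
    then have "X \<in> ideal_prod A (LA.mpow n) LA.mm" by (simp add: ideal_power.simps(2))
    then show ?case
    proof induction
      case (prod i j)
      obtain i' where i': "i' \<in> L.mpow n" "i = q i'" using Suc.IH[OF prod(1)] by blast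
      have "j \<in> carrier A" using prod(2) LA.mm_iff by simp
      then obtain j' where j': "j' \<in> carrier R" "j = q j'" using ex q by metis
      have "j' \<in> L.mm" using qmm[OF j'(1)] j' prod(2) by simp
      then have "i' \<otimes>\<^bsub>R\<^esub> j' \<in> L.mpow (Suc n)" by (rule L.R.ideal_power_Suc_mem[OF i'(1)])
      moreover have "i \<otimes>\<^bsub>A\<^esub> j = q (i' \<otimes>\<^bsub>R\<^esub> j')"
        using i' j' ideal.Icarr[OF L.mpow_ideal i'(1)] by simp
      ultimately show ?case by blast
    next
      case (sum s1 s2)
      then obtain a b where ab: "a \<in> L.mpow (Suc n)" "s1 = q a" "b \<in> L.mpow (Suc n)" "s2 = q b" by blast
      have "s1 \<oplus>\<^bsub>A\<^esub> s2 = q (a \<oplus>\<^bsub>R\<^esub> b)" using ab ideal.Icarr[OF L.mpow_ideal] by simp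
      moreover have "a \<oplus>\<^bsub>R\<^esub> b \<in> L.mpow (Suc n)"
        using ab additive_subgroup.a_closed[OF ideal.axioms(1)[OF L.mpow_ideal]] by simp
      ultimately show ?case by blast
    qed
  qed
  have zeroA: "LA.mpow N = {\<zero>\<^bsub>A\<^esub>}"
  proof
    show "LA.mpow N \<subseteq> {\<zero>\<^bsub>A\<^esub>}"
    proof
      fix X assume "X \<in> LA.mpow N"
      then obtain r where r: "r \<in> L.mpow N" "X = q r" using pow by blast
      then have "r \<in> K" using K(2) maxR by auto
      then show "X \<in> {\<zero>\<^bsub>A\<^esub>}" using qK r K.Icarr by simp
    qed
    show "{\<zero>\<^bsub>A\<^esub>} \<subseteq> LA.mpow N"
      using additive_subgroup.zero_closed[OF ideal.axioms(1)[OF LA.mpow_ideal]] by simp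
  qed
  have resA: "is_residue_map p F A \<pi>A"
    unfolding is_residue_map_def
  proof (intro conjI ballI)
    show "\<pi>A \<in> ring_hom A F \<inter> extensional (carrier A)" using homA by (simp add: \<pi>A_def)
    show "\<pi>A ` carrier A = carrier F" by (rule LA.residue_surj)
    show "LA.mm = max_ideal A" by (rule LA.max_ideal_eq[symmetric])
    fix w assume w: "w \<in> carrier ?W"
    then show "\<pi>A (w \<odot>\<^bsub>A\<^esub> \<one>\<^bsub>A\<^esub>) = w 0"
      using res by (simp add: eo es piA is_residue_map_def)
  qed
  have "coeff_ring p F A"
    unfolding coeff_ring_def
    using algA LA.local_ring A.finite_noetherian[OF finA] LA.nilpotent_complete[OF zeroA] resA
    by (auto simp: LA.max_ideal_eq)
  moreover have "q \<in> coeff_hom p F R A"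
    unfolding coeff_hom_def
  proof (intro CollectI conjI ballI)
    show "q \<in> ring_hom R A \<inter> extensional (carrier R)" using hq by (simp add: q_def)
    show "q ` max_ideal R \<subseteq> max_ideal A"
      using qmm L.mm_iff unfolding LA.max_ideal_eq maxR by blast
    show "q (w \<odot>\<^bsub>R\<^esub> r) = w \<odot>\<^bsub>A\<^esub> q r" if "w \<in> carrier ?W" "r \<in> carrier R" for w r
      using that by (simp add: q es)
  qed
  moreover have "q ` carrier R = carrier A" using eA by (simp add: q_def)
  moreover have "ideal_power A (max_ideal A) N = {\<zero>\<^bsub>A\<^esub>}" using zeroA LA.max_ideal_eq by simp
  ultimately show ?thesis using that qK by blast
qed


section \<open>Matrix coefficients of a two-dimensional pseudo-representation\<close>

text \<open>Formulas for matrix coefficients first appear multiplied by the unit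
  \<open>l1 - l2\<close>. The last premise is a polynomial identity that exhibits
  \<open>c (X - Y)\<close> as the difference of the two sides of a known equation.\<close>

lemma (in cring) unit_cancel_diff:
  assumes "c \<in> Units R" "X \<in> carrier R" "Y \<in> carrier R" "P \<in> carrier R" "P = Q" "c \<otimes> (X \<ominus> Y) = P \<ominus> Q"
  shows "X = Y"
proof -
  have "c \<otimes> (X \<ominus> Y) = \<zero>" using assms(4-6) by (simp add: a_minus_def r_neg)
  then have "c \<otimes> (X \<ominus> Y) = c \<otimes> \<zero>" using Units_closed[OF assms(1)] by simp
  then have "X \<ominus> Y = \<zero>" using assms(1-3) Units_l_cancel[of c "X \<ominus> Y" \<zero>] by simp
  then show ?thesis using assms(2,3) by simp
qed

lemma (in cring) eq_diff_conv:
  "x \<in> carrier R \<Longrightarrow> y \<in> carrier R \<Longrightarrow> z = x \<oplus> y \<Longrightarrow> y = z \<ominus> x"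
  "x \<in> carrier R \<Longrightarrow> y \<in> carrier R \<Longrightarrow> z = x \<oplus> y \<Longrightarrow> x = z \<ominus> y"
proof -
  assume "x \<in> carrier R" "y \<in> carrier R" "z = x \<oplus> y"
  then have "y = x \<oplus> y \<ominus> x" "x = x \<oplus> y \<ominus> y" by algebra+
  then show "y = z \<ominus> x" "x = z \<ominus> y" using \<open>z = x \<oplus> y\<close> by simp_all
qed

text \<open>An element \<open>u\<close> whose characteristic polynomial splits with eigenvalues \<open>l1\<close>, \<open>l2\<close> that
  stay distinct in the residue field plays the role of a diagonal matrix.  The functions \<open>a\<close>,
  \<open>d\<close> and \<open>(g, h) \<mapsto> x g h\<close> are the diagonal entries and the products \<open>b(g) c(h)\<close> of the off-diagonal
  ones.\<close>

locale split_pseudo_rep = R?: cring R + G: group G for R (structure) and G (structure) +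
  fixes T D u l1 l2
  assumes T_closed [simp]: "g \<in> carrier G \<Longrightarrow> T g \<in> carrier R"
    and D_closed [simp]: "g \<in> carrier G \<Longrightarrow> D g \<in> carrier R"
    and D_mult: "g \<in> carrier G \<Longrightarrow> h \<in> carrier G \<Longrightarrow> D (g \<otimes>\<^bsub>G\<^esub> h) = D g \<otimes> D h"
    and T_one: "T \<one>\<^bsub>G\<^esub> = \<one> \<oplus> \<one>"
    and T_comm: "g \<in> carrier G \<Longrightarrow> h \<in> carrier G \<Longrightarrow> T (g \<otimes>\<^bsub>G\<^esub> h) = T (h \<otimes>\<^bsub>G\<^esub> g)"
    and T_id: "g \<in> carrier G \<Longrightarrow> h \<in> carrier G \<Longrightarrow>
      T g \<otimes> T h = T (g \<otimes>\<^bsub>G\<^esub> h) \<oplus> D g \<otimes> T (inv\<^bsub>G\<^esub> g \<otimes>\<^bsub>G\<^esub> h)"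
    and u [simp]: "u \<in> carrier G"
    and l_closed [simp]: "l1 \<in> carrier R" "l2 \<in> carrier R"
    and T_u: "T u = l1 \<oplus> l2" and D_u: "D u = l1 \<otimes> l2"
    and l_unit: "l1 \<ominus> l2 \<in> Units R"
begin

abbreviation "dl \<equiv> l1 \<ominus> l2"

lemma dl_closed: "dl \<in> carrier R" by simp

lemma l_sum: "l1 \<oplus> l2 = dl \<oplus> (l2 \<oplus> l2)" using l_closed by algebra

text \<open>If \<open>u\<close> were diagonal with entries \<open>l1\<close> and \<open>l2\<close>,
  then \<open>T (u g)\<close> would be \<open>l1 a + l2 d\<close> and \<open>T g\<close> would be
  \<open>a + d\<close>. Solving this linear system gives \<open>a\<close> and \<open>d\<close>; the
  rule for the upper left entry of a product then dictates \<open>x\<close>.\<close>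

definition "a g = inv dl \<otimes> (T (u \<otimes>\<^bsub>G\<^esub> g) \<ominus> l2 \<otimes> T g)"
definition "d g = T g \<ominus> a g"
definition "x g h = a (g \<otimes>\<^bsub>G\<^esub> h) \<ominus> a g \<otimes> a h"

lemma a_closed [simp]: "g \<in> carrier G \<Longrightarrow> a g \<in> carrier R"
  using l_unit by (simp add: a_def)

lemma d_closed [simp]: "g \<in> carrier G \<Longrightarrow> d g \<in> carrier R"
  by (simp add: d_def)

lemma x_closed [simp]: "g \<in> carrier G \<Longrightarrow> h \<in> carrier G \<Longrightarrow> x g h \<in> carrier R"
  by (simp add: x_def)

lemma a_plus_d: "g \<in> carrier G \<Longrightarrow> a g \<oplus> d g = T g"
  unfolding d_def using a_closed T_closed by algebra

lemma T_u_mult: assumes "g \<in> carrier G"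
  shows "T (u \<otimes>\<^bsub>G\<^esub> g) = dl \<otimes> a g \<oplus> l2 \<otimes> T g"
proof -
  have "dl \<otimes> a g = T (u \<otimes>\<^bsub>G\<^esub> g) \<ominus> l2 \<otimes> T g"
    using assms l_unit R.m_assoc[of dl "inv dl" "T (u \<otimes>\<^bsub>G\<^esub> g) \<ominus> l2 \<otimes> T g", symmetric]
    by (simp add: a_def)
  moreover have "T (u \<otimes>\<^bsub>G\<^esub> g) = T (u \<otimes>\<^bsub>G\<^esub> g) \<ominus> l2 \<otimes> T g \<oplus> l2 \<otimes> T g"
    using T_closed[OF G.m_closed[OF u assms]] T_closed[OF assms] l_closed by algebra
  ultimately show ?thesis by simp
qed

text \<open>The multilinear trace identity of degree three for two by two matrices. It is free of
  the determinant: the traces \<open>P\<close>, \<open>Q\<close>, \<open>S\<close> that involve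
  inverses occur in four instances of \<open>T_id\<close> and are eliminated between them.\<close>

lemma T_triple:
  assumes [simp]: "g \<in> carrier G" "h \<in> carrier G" "k \<in> carrier G"
  shows "T (g \<otimes>\<^bsub>G\<^esub> h \<otimes>\<^bsub>G\<^esub> k) \<oplus> T (h \<otimes>\<^bsub>G\<^esub> g \<otimes>\<^bsub>G\<^esub> k) =
    T (g \<otimes>\<^bsub>G\<^esub> h) \<otimes> T k \<oplus> T (h \<otimes>\<^bsub>G\<^esub> k) \<otimes> T g \<oplus> T (g \<otimes>\<^bsub>G\<^esub> k) \<otimes> T h \<ominus> T g \<otimes> T h \<otimes> T k"
proof -
  define P where "P = T (inv\<^bsub>G\<^esub> g \<otimes>\<^bsub>G\<^esub> (h \<otimes>\<^bsub>G\<^esub> k))"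
  define Q where "Q = T (inv\<^bsub>G\<^esub> (g \<otimes>\<^bsub>G\<^esub> k) \<otimes>\<^bsub>G\<^esub> h)"
  define S where "S = T (inv\<^bsub>G\<^esub> g \<otimes>\<^bsub>G\<^esub> h)"
  have c: "P \<in> carrier R" "Q \<in> carrier R" "S \<in> carrier R" by (simp_all add: P_def Q_def S_def)
  have e1: "T g \<otimes> T (h \<otimes>\<^bsub>G\<^esub> k) = T (g \<otimes>\<^bsub>G\<^esub> h \<otimes>\<^bsub>G\<^esub> k) \<oplus> D g \<otimes> P"
    using T_id[of g "h \<otimes>\<^bsub>G\<^esub> k"] by (simp add: P_def G.m_assoc)
  have "T (g \<otimes>\<^bsub>G\<^esub> k \<otimes>\<^bsub>G\<^esub> h) = T (h \<otimes>\<^bsub>G\<^esub> g \<otimes>\<^bsub>G\<^esub> k)" using T_comm[of "g \<otimes>\<^bsub>G\<^esub> k" h] by (simp add: G.m_assoc)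
  then have e2: "T (g \<otimes>\<^bsub>G\<^esub> k) \<otimes> T h = T (h \<otimes>\<^bsub>G\<^esub> g \<otimes>\<^bsub>G\<^esub> k) \<oplus> D g \<otimes> D k \<otimes> Q"
    using T_id[of "g \<otimes>\<^bsub>G\<^esub> k" h] by (simp add: Q_def D_mult)
  have e3: "T g \<otimes> T h = T (g \<otimes>\<^bsub>G\<^esub> h) \<oplus> D g \<otimes> S"
    using T_id[of g h] by (simp add: S_def)
  have "T (k \<otimes>\<^bsub>G\<^esub> (inv\<^bsub>G\<^esub> g \<otimes>\<^bsub>G\<^esub> h)) = P"
    using T_comm[of k "inv\<^bsub>G\<^esub> g \<otimes>\<^bsub>G\<^esub> h"] by (simp add: P_def G.m_assoc)
  moreover have "T (inv\<^bsub>G\<^esub> k \<otimes>\<^bsub>G\<^esub> (inv\<^bsub>G\<^esub> g \<otimes>\<^bsub>G\<^esub> h)) = Q"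
    by (simp add: Q_def G.inv_mult_group G.m_assoc)
  ultimately have e4: "T k \<otimes> S = P \<oplus> D k \<otimes> Q"
    using T_id[of k "inv\<^bsub>G\<^esub> g \<otimes>\<^bsub>G\<^esub> h"] by (simp add: S_def)
  have "T g \<otimes> T h \<otimes> T k = T (g \<otimes>\<^bsub>G\<^esub> h) \<otimes> T k \<oplus> D g \<otimes> (T k \<otimes> S)"
    unfolding e3 using c T_closed[OF assms(3)] T_closed[OF G.m_closed[OF assms(1,2)]] D_closed[OF assms(1)]
    by algebra
  also have "\<dots> = T (g \<otimes>\<^bsub>G\<^esub> h) \<otimes> T k \<oplus> D g \<otimes> P \<oplus> D g \<otimes> D k \<otimes> Q"
    unfolding e4 using c T_closed[OF assms(3)] T_closed[OF G.m_closed[OF assms(1,2)]]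
      D_closed[OF assms(1)] D_closed[OF assms(3)] by algebra
  also have "D g \<otimes> P = T g \<otimes> T (h \<otimes>\<^bsub>G\<^esub> k) \<ominus> T (g \<otimes>\<^bsub>G\<^esub> h \<otimes>\<^bsub>G\<^esub> k)"
    by (rule R.eq_diff_conv(1)[OF _ _ e1]) (simp_all add: c)
  also have "D g \<otimes> D k \<otimes> Q = T (g \<otimes>\<^bsub>G\<^esub> k) \<otimes> T h \<ominus> T (h \<otimes>\<^bsub>G\<^esub> g \<otimes>\<^bsub>G\<^esub> k)"
    by (rule R.eq_diff_conv(1)[OF _ _ e2]) (simp_all add: c)
  finally have f: "T g \<otimes> T h \<otimes> T k = T (g \<otimes>\<^bsub>G\<^esub> h) \<otimes> T k \<oplus> (T g \<otimes> T (h \<otimes>\<^bsub>G\<^esub> k) \<ominus> T (g \<otimes>\<^bsub>G\<^esub> h \<otimes>\<^bsub>G\<^esub> k)) \<oplus>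
     (T (g \<otimes>\<^bsub>G\<^esub> k) \<otimes> T h \<ominus> T (h \<otimes>\<^bsub>G\<^esub> g \<otimes>\<^bsub>G\<^esub> k))" .
  have ring: "p \<oplus> q = s \<otimes> tk \<oplus> v \<otimes> tg \<oplus> w \<otimes> th \<ominus> (s \<otimes> tk \<oplus> (tg \<otimes> v \<ominus> p) \<oplus> (w \<otimes> th \<ominus> q))"
    if "p \<in> carrier R" "q \<in> carrier R" "s \<in> carrier R" "tk \<in> carrier R" "v \<in> carrier R" "tg \<in> carrier R"
      "w \<in> carrier R" "th \<in> carrier R" for p q s tk v tg w th
    using that by algebra
  show ?thesis unfolding f by (rule ring) simp_all
qed

text \<open>This is \<open>T_triple\<close> for \<open>u\<close>, \<open>g\<close>,
  \<open>h\<close>. In matrix terms it says that \<open>d (g h) - d g d h\<close> and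
  \<open>a (h g) - a h a g\<close> coincide, both being c(g) b(h).\<close>

lemma a_swap:
  assumes [simp]: "g \<in> carrier G" "h \<in> carrier G"
  shows "a (h \<otimes>\<^bsub>G\<^esub> g) = T (g \<otimes>\<^bsub>G\<^esub> h) \<ominus> T g \<otimes> T h \<oplus> T g \<otimes> a h \<oplus> T h \<otimes> a g \<ominus> a (g \<otimes>\<^bsub>G\<^esub> h)"
proof -
  define s tg th A B C E where "s = T (g \<otimes>\<^bsub>G\<^esub> h)" and "tg = T g" and "th = T h" and "A = a g"
    and "B = a h" and "C = a (g \<otimes>\<^bsub>G\<^esub> h)" and "E = a (h \<otimes>\<^bsub>G\<^esub> g)"
  note defs = s_def tg_def th_def A_def B_def C_def E_def
  have c: "s \<in> carrier R" "tg \<in> carrier R" "th \<in> carrier R" "A \<in> carrier R" "B \<in> carrier R"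
    "C \<in> carrier R" "E \<in> carrier R" by (simp_all add: defs)
  have "T (u \<otimes>\<^bsub>G\<^esub> g \<otimes>\<^bsub>G\<^esub> h) = dl \<otimes> C \<oplus> l2 \<otimes> s"
    using T_u_mult[of "g \<otimes>\<^bsub>G\<^esub> h"] by (simp add: defs G.m_assoc)
  moreover have "T (g \<otimes>\<^bsub>G\<^esub> u \<otimes>\<^bsub>G\<^esub> h) = dl \<otimes> E \<oplus> l2 \<otimes> s"
    using T_u_mult[of "h \<otimes>\<^bsub>G\<^esub> g"] T_comm[of g "u \<otimes>\<^bsub>G\<^esub> h"] T_comm[of g h] by (simp add: defs G.m_assoc)
  moreover have "T (u \<otimes>\<^bsub>G\<^esub> g) = dl \<otimes> A \<oplus> l2 \<otimes> tg" "T (u \<otimes>\<^bsub>G\<^esub> h) = dl \<otimes> B \<oplus> l2 \<otimes> th"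
    by (simp_all add: T_u_mult defs)
  ultimately have eq: "dl \<otimes> C \<oplus> l2 \<otimes> s \<oplus> (dl \<otimes> E \<oplus> l2 \<otimes> s) =
      (dl \<otimes> A \<oplus> l2 \<otimes> tg) \<otimes> th \<oplus> s \<otimes> (l1 \<oplus> l2) \<oplus> (dl \<otimes> B \<oplus> l2 \<otimes> th) \<otimes> tg \<ominus> (l1 \<oplus> l2) \<otimes> tg \<otimes> th"
    using T_triple[of u g h] by (simp add: T_u s_def tg_def th_def)
  \<comment> \<open>The identity is verified for an indeterminate \<open>q\<close> in place of
    \<open>dl\<close>, with \<open>l1 + l2\<close> written as \<open>q + 2 l2\<close>.\<close>
  have ring: "q \<otimes> (E \<ominus> (s \<ominus> tg \<otimes> th \<oplus> tg \<otimes> B \<oplus> th \<otimes> A \<ominus> C)) =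
      q \<otimes> C \<oplus> l2 \<otimes> s \<oplus> (q \<otimes> E \<oplus> l2 \<otimes> s) \<ominus>
      ((q \<otimes> A \<oplus> l2 \<otimes> tg) \<otimes> th \<oplus> s \<otimes> (q \<oplus> (l2 \<oplus> l2)) \<oplus> (q \<otimes> B \<oplus> l2 \<otimes> th) \<otimes> tg \<ominus> (q \<oplus> (l2 \<oplus> l2)) \<otimes> tg \<otimes> th)"
    if "q \<in> carrier R" for q
    using c l_closed that by algebra
  have "E = s \<ominus> tg \<otimes> th \<oplus> tg \<otimes> B \<oplus> th \<otimes> A \<ominus> C"
    by (rule R.unit_cancel_diff[OF l_unit _ _ _ eq]) (use c ring[OF dl_closed, folded l_sum] in simp_all)
  then show ?thesis by (simp add: defs)
qed

text \<open>Placing the diagonal element \<open>u\<close> between \<open>g\<close> and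
  \<open>h\<close> weights the two summands a(g) a(h) and b(g) c(h) of the upper left entry by
  \<open>l1\<close> and \<open>l2\<close>. The proof uses \<open>T_triple\<close> for
  \<open>u\<close>, \<open>g\<close>, \<open>u h\<close>, where repeated factors \<open>u\<close>
  are lowered by Cayley-Hamilton.\<close>

lemma a_u_mult:
  assumes [simp]: "g \<in> carrier G" "h \<in> carrier G"
  shows "a (g \<otimes>\<^bsub>G\<^esub> u \<otimes>\<^bsub>G\<^esub> h) = l2 \<otimes> a (g \<otimes>\<^bsub>G\<^esub> h) \<oplus> dl \<otimes> (a g \<otimes> a h)"
proof -
  define s tg th A B C E where "s = T (g \<otimes>\<^bsub>G\<^esub> h)" and "tg = T g" and "th = T h" and "A = a g"
    and "B = a h" and "C = a (g \<otimes>\<^bsub>G\<^esub> h)" and "E = a (h \<otimes>\<^bsub>G\<^esub> g)"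
  note defs = s_def tg_def th_def A_def B_def C_def E_def
  have c: "s \<in> carrier R" "tg \<in> carrier R" "th \<in> carrier R" "A \<in> carrier R" "B \<in> carrier R"
    "C \<in> carrier R" "E \<in> carrier R" by (simp_all add: defs)
  define P where "P = T (u \<otimes>\<^bsub>G\<^esub> g \<otimes>\<^bsub>G\<^esub> (u \<otimes>\<^bsub>G\<^esub> h))"
  define X where "X = a (g \<otimes>\<^bsub>G\<^esub> u \<otimes>\<^bsub>G\<^esub> h)"
  have cP: "P \<in> carrier R" "X \<in> carrier R" by (simp_all add: P_def X_def)
  have ug: "T (u \<otimes>\<^bsub>G\<^esub> g) = dl \<otimes> A \<oplus> l2 \<otimes> tg" and uh: "T (u \<otimes>\<^bsub>G\<^esub> h) = dl \<otimes> B \<oplus> l2 \<otimes> th"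
    by (simp_all add: T_u_mult defs)
  have uhg: "T (u \<otimes>\<^bsub>G\<^esub> (h \<otimes>\<^bsub>G\<^esub> g)) = dl \<otimes> E \<oplus> l2 \<otimes> s"
    using T_u_mult[of "h \<otimes>\<^bsub>G\<^esub> g"] T_comm[of g h] by (simp add: defs)
  have guh: "T (g \<otimes>\<^bsub>G\<^esub> u \<otimes>\<^bsub>G\<^esub> h) = dl \<otimes> E \<oplus> l2 \<otimes> s"
    using uhg T_comm[of g "u \<otimes>\<^bsub>G\<^esub> h"] by (simp add: G.m_assoc)
  \<comment> \<open>Cayley-Hamilton for \<open>u\<close>: this is \<open>T_id\<close> for
    \<open>u\<close> and \<open>u k\<close>.\<close>
  have CH: "T (u \<otimes>\<^bsub>G\<^esub> (u \<otimes>\<^bsub>G\<^esub> k)) = (l1 \<oplus> l2) \<otimes> T (u \<otimes>\<^bsub>G\<^esub> k) \<ominus> l1 \<otimes> l2 \<otimes> T k" if k: "k \<in> carrier G" for k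
  proof (rule R.eq_diff_conv(2))
    have "inv\<^bsub>G\<^esub> u \<otimes>\<^bsub>G\<^esub> (u \<otimes>\<^bsub>G\<^esub> k) = k" using k by (simp add: G.m_assoc[symmetric])
    then show "(l1 \<oplus> l2) \<otimes> T (u \<otimes>\<^bsub>G\<^esub> k) = T (u \<otimes>\<^bsub>G\<^esub> (u \<otimes>\<^bsub>G\<^esub> k)) \<oplus> l1 \<otimes> l2 \<otimes> T k"
      using T_id[of u "u \<otimes>\<^bsub>G\<^esub> k"] k by (simp add: T_u D_u)
  qed (use k in simp_all)
  have guuh: "T (g \<otimes>\<^bsub>G\<^esub> u \<otimes>\<^bsub>G\<^esub> (u \<otimes>\<^bsub>G\<^esub> h)) = (l1 \<oplus> l2) \<otimes> (dl \<otimes> E \<oplus> l2 \<otimes> s) \<ominus> l1 \<otimes> l2 \<otimes> s"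
    using CH[of "h \<otimes>\<^bsub>G\<^esub> g"] T_comm[of g "u \<otimes>\<^bsub>G\<^esub> (u \<otimes>\<^bsub>G\<^esub> h)"] uhg T_comm[of g h]
    by (simp add: G.m_assoc s_def)
  have "T (g \<otimes>\<^bsub>G\<^esub> (u \<otimes>\<^bsub>G\<^esub> h)) = dl \<otimes> E \<oplus> l2 \<otimes> s" using guh by (simp add: G.m_assoc)
  then have eqP: "P \<oplus> ((l1 \<oplus> l2) \<otimes> (dl \<otimes> E \<oplus> l2 \<otimes> s) \<ominus> l1 \<otimes> l2 \<otimes> s) =
    (dl \<otimes> A \<oplus> l2 \<otimes> tg) \<otimes> (dl \<otimes> B \<oplus> l2 \<otimes> th) \<oplus> (dl \<otimes> E \<oplus> l2 \<otimes> s) \<otimes> (l1 \<oplus> l2)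
    \<oplus> ((l1 \<oplus> l2) \<otimes> (dl \<otimes> B \<oplus> l2 \<otimes> th) \<ominus> l1 \<otimes> l2 \<otimes> th) \<otimes> tg \<ominus> (l1 \<oplus> l2) \<otimes> tg \<otimes> (dl \<otimes> B \<oplus> l2 \<otimes> th)"
    using T_triple[of u g "u \<otimes>\<^bsub>G\<^esub> h"] CH[of h]
    by (simp add: P_def[symmetric] ug uh guuh T_u tg_def[symmetric] th_def[symmetric])
  have P: "P = dl \<otimes> X \<oplus> l2 \<otimes> (dl \<otimes> E \<oplus> l2 \<otimes> s)"
    using T_u_mult[of "g \<otimes>\<^bsub>G\<^esub> u \<otimes>\<^bsub>G\<^esub> h"] guh by (simp add: P_def X_def G.m_assoc)
  have E: "E = s \<ominus> tg \<otimes> th \<oplus> tg \<otimes> B \<oplus> th \<otimes> A \<ominus> C" using a_swap[of g h] by (simp add: defs)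
  \<comment> \<open>The terms carrying the trace \<open>v\<close> of \<open>u\<close> cancel and
    leave \<open>P\<close> as a product plus a multiple of the determinant \<open>l1 l2\<close> of
    \<open>u\<close>.\<close>
  have cancel: "P = W \<otimes> H \<oplus> l1 \<otimes> l2 \<otimes> (s \<ominus> th \<otimes> tg)"
    if "P \<oplus> (v \<otimes> U \<ominus> l1 \<otimes> l2 \<otimes> s) = W \<otimes> H \<oplus> U \<otimes> v \<oplus> (v \<otimes> H \<ominus> l1 \<otimes> l2 \<otimes> th) \<otimes> tg \<ominus> v \<otimes> tg \<otimes> H"
      "v \<in> carrier R" "U \<in> carrier R" "W \<in> carrier R" "H \<in> carrier R" for v U W H
  proof -
    have "P = P \<oplus> (v \<otimes> U \<ominus> l1 \<otimes> l2 \<otimes> s) \<ominus> (v \<otimes> U \<ominus> l1 \<otimes> l2 \<otimes> s)"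
      using that(2-5) c cP l_closed by algebra
    also have "\<dots> = W \<otimes> H \<oplus> l1 \<otimes> l2 \<otimes> (s \<ominus> th \<otimes> tg)"
      unfolding that(1) using that(2-5) c cP l_closed by algebra
    finally show ?thesis .
  qed
  have "P = (dl \<otimes> A \<oplus> l2 \<otimes> tg) \<otimes> (dl \<otimes> B \<oplus> l2 \<otimes> th) \<oplus> l1 \<otimes> l2 \<otimes> (s \<ominus> th \<otimes> tg)"
    by (rule cancel[OF eqP]) (use c in simp_all)
  then have eq: "dl \<otimes> X \<oplus> l2 \<otimes> (dl \<otimes> E \<oplus> l2 \<otimes> s) =
      (dl \<otimes> A \<oplus> l2 \<otimes> tg) \<otimes> (dl \<otimes> B \<oplus> l2 \<otimes> th) \<oplus> l1 \<otimes> l2 \<otimes> (s \<ominus> th \<otimes> tg)"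
    using P by simp
  have l1: "l1 = dl \<oplus> l2" using l_closed by algebra
  have ring: "q \<otimes> (X \<ominus> (l2 \<otimes> C \<oplus> q \<otimes> (A \<otimes> B))) = q \<otimes> X \<oplus> l2 \<otimes> (q \<otimes> E \<oplus> l2 \<otimes> s) \<ominus>
      ((q \<otimes> A \<oplus> l2 \<otimes> tg) \<otimes> (q \<otimes> B \<oplus> l2 \<otimes> th) \<oplus> (q \<oplus> l2) \<otimes> l2 \<otimes> (s \<ominus> th \<otimes> tg))"
    if q: "q \<in> carrier R" for q
  proof -
    define f N AB where "f = s \<ominus> th \<otimes> tg" and "N = q \<otimes> (tg \<otimes> B \<oplus> th \<otimes> A) \<oplus> l2 \<otimes> (th \<otimes> tg)"
      and "AB = A \<otimes> B"
    note fN = this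
    have fc: "f \<in> carrier R" "N \<in> carrier R" "AB \<in> carrier R" using c q by (simp_all add: fN)
    have r1: "q \<otimes> E \<oplus> l2 \<otimes> s = q \<otimes> f \<oplus> l2 \<otimes> f \<oplus> N \<ominus> q \<otimes> C"
      unfolding E fN using q c l_closed by algebra
    have r2: "(q \<otimes> A \<oplus> l2 \<otimes> tg) \<otimes> (q \<otimes> B \<oplus> l2 \<otimes> th) = q \<otimes> (q \<otimes> AB) \<oplus> l2 \<otimes> N"
      unfolding fN using q c l_closed by algebra
    show ?thesis
      unfolding r1 r2 fN(1,3)[symmetric] using q fc c cP l_closed by algebra
  qed
  have "X = l2 \<otimes> C \<oplus> dl \<otimes> (A \<otimes> B)"
    by (rule R.unit_cancel_diff[OF l_unit _ _ _ eq]) (use c cP ring[OF dl_closed, folded l1] in simp_all)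
  then show ?thesis by (simp add: defs X_def)
qed

lemma d_mult:
  assumes [simp]: "g \<in> carrier G" "h \<in> carrier G"
  shows "d (g \<otimes>\<^bsub>G\<^esub> h) = d g \<otimes> d h \<oplus> x h g"
  unfolding d_def x_def a_swap[OF assms]
  using a_closed[OF assms(1)] a_closed[OF assms(2)] T_closed[OF assms(1)] T_closed[OF assms(2)]
    T_closed[OF G.m_closed[OF assms]] a_closed[OF G.m_closed[OF assms]] by algebra

lemma a_mult: "g \<in> carrier G \<Longrightarrow> h \<in> carrier G \<Longrightarrow> a (g \<otimes>\<^bsub>G\<^esub> h) = a g \<otimes> a h \<oplus> x g h"
  unfolding x_def using a_closed[of g] a_closed[of h] a_closed[OF G.m_closed, of g h] by algebra

lemma d_u_mult:
  assumes [simp]: "g \<in> carrier G" "h \<in> carrier G"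
  shows "d (g \<otimes>\<^bsub>G\<^esub> u \<otimes>\<^bsub>G\<^esub> h) = l2 \<otimes> d (g \<otimes>\<^bsub>G\<^esub> h) \<oplus> dl \<otimes> x h g"
proof -
  have T: "T (g \<otimes>\<^bsub>G\<^esub> u \<otimes>\<^bsub>G\<^esub> h) = dl \<otimes> a (h \<otimes>\<^bsub>G\<^esub> g) \<oplus> l2 \<otimes> T (g \<otimes>\<^bsub>G\<^esub> h)"
    using T_u_mult[of "h \<otimes>\<^bsub>G\<^esub> g"] T_comm[of g h] T_comm[of g "u \<otimes>\<^bsub>G\<^esub> h"] by (simp add: G.m_assoc)
  have ring: "q \<otimes> E \<oplus> l2 \<otimes> s \<ominus> (l2 \<otimes> C \<oplus> q \<otimes> (A \<otimes> B)) = l2 \<otimes> (s \<ominus> C) \<oplus> q \<otimes> (E \<ominus> B \<otimes> A)"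
    if "q \<in> carrier R" "s \<in> carrier R" "A \<in> carrier R" "B \<in> carrier R" "C \<in> carrier R" "E \<in> carrier R"
    for q s A B C E using that l_closed by algebra
  show ?thesis
    unfolding d_def a_u_mult[OF assms] x_def T by (rule ring) simp_all
qed

text \<open>The rule b(g h) = a(g) b(h) + b(g) d(h), multiplied by c(k). As b alone has no meaning
  here, the rule is read off from associativity: \<open>d (k u g h)\<close> is expanded in two ways,
  and \<open>l2\<close> times the same expansion without \<open>u\<close> is subtracted.\<close>

lemma x_mult_left:
  assumes [simp]: "g \<in> carrier G" "h \<in> carrier G" "k \<in> carrier G"
  shows "x (g \<otimes>\<^bsub>G\<^esub> h) k = a g \<otimes> x h k \<oplus> d h \<otimes> x g k"
proof -
  define X1 X2 p q r w dh ahk ag ah ak where "X1 = x (g \<otimes>\<^bsub>G\<^esub> h) k" and "X2 = x g k"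
    and "p = d (k \<otimes>\<^bsub>G\<^esub> g \<otimes>\<^bsub>G\<^esub> h)" and "q = d (k \<otimes>\<^bsub>G\<^esub> g)" and "r = a (h \<otimes>\<^bsub>G\<^esub> k \<otimes>\<^bsub>G\<^esub> g)"
    and "w = a (k \<otimes>\<^bsub>G\<^esub> g)" and "dh = d h"
    and "ahk = a (h \<otimes>\<^bsub>G\<^esub> k)" and "ag = a g" and "ah = a h" and "ak = a k"
  note defs = this
  have c: "X1 \<in> carrier R" "X2 \<in> carrier R" "p \<in> carrier R" "q \<in> carrier R" "r \<in> carrier R" "w \<in> carrier R"
    "dh \<in> carrier R" "ahk \<in> carrier R" "ag \<in> carrier R" "ah \<in> carrier R" "ak \<in> carrier R"
    by (simp_all add: defs)
  have e1: "l2 \<otimes> p \<oplus> dl \<otimes> X1 = (l2 \<otimes> q \<oplus> dl \<otimes> X2) \<otimes> dh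
      \<oplus> (l2 \<otimes> r \<oplus> dl \<otimes> (ahk \<otimes> ag) \<ominus> ah \<otimes> (l2 \<otimes> w \<oplus> dl \<otimes> (ak \<otimes> ag)))"
    using d_mult[of "k \<otimes>\<^bsub>G\<^esub> u \<otimes>\<^bsub>G\<^esub> g" h] d_u_mult[of k "g \<otimes>\<^bsub>G\<^esub> h"] d_u_mult[of k g]
      a_u_mult[of "h \<otimes>\<^bsub>G\<^esub> k" g] a_u_mult[of k g]
    by (simp add: defs x_def[of h "k \<otimes>\<^bsub>G\<^esub> (u \<otimes>\<^bsub>G\<^esub> g)"] G.m_assoc)
  have e2: "p = q \<otimes> dh \<oplus> (r \<ominus> ah \<otimes> w)"
    using d_mult[of "k \<otimes>\<^bsub>G\<^esub> g" h] by (simp add: defs x_def[of h "k \<otimes>\<^bsub>G\<^esub> g"] G.m_assoc)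
  have "X1 = ag \<otimes> (ahk \<ominus> ah \<otimes> ak) \<oplus> dh \<otimes> X2"
  proof (rule R.unit_cancel_diff[OF l_unit _ _ _ e1])
    have "v \<otimes> (X1 \<ominus> (ag \<otimes> (ahk \<ominus> ah \<otimes> ak) \<oplus> dh \<otimes> X2)) =
       l2 \<otimes> p \<oplus> v \<otimes> X1 \<ominus> ((l2 \<otimes> q \<oplus> v \<otimes> X2) \<otimes> dh
        \<oplus> (l2 \<otimes> r \<oplus> v \<otimes> (ahk \<otimes> ag) \<ominus> ah \<otimes> (l2 \<otimes> w \<oplus> v \<otimes> (ak \<otimes> ag))))" if "v \<in> carrier R" for v
      unfolding e2 using that c l_closed by algebra
    from this[OF dl_closed] show "dl \<otimes> (X1 \<ominus> (ag \<otimes> (ahk \<ominus> ah \<otimes> ak) \<oplus> dh \<otimes> X2)) =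
       l2 \<otimes> p \<oplus> dl \<otimes> X1 \<ominus> ((l2 \<otimes> q \<oplus> dl \<otimes> X2) \<otimes> dh
        \<oplus> (l2 \<otimes> r \<oplus> dl \<otimes> (ahk \<otimes> ag) \<ominus> ah \<otimes> (l2 \<otimes> w \<oplus> dl \<otimes> (ak \<otimes> ag))))" .
  qed (use c in simp_all)
  then show ?thesis by (simp add: defs x_def[of h k])
qed

text \<open>The rule c(h k) = c(h) a(k) + d(h) c(k), multiplied by b(g), obtained likewise from two
  expansions of \<open>d (h k u g)\<close>.\<close>

lemma x_mult_right:
  assumes [simp]: "g \<in> carrier G" "h \<in> carrier G" "k \<in> carrier G"
  shows "x g (h \<otimes>\<^bsub>G\<^esub> k) = a k \<otimes> x g h \<oplus> d h \<otimes> x g k"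
proof -
  define X1 X2 p q r w dh agh ag ah ak where "X1 = x g (h \<otimes>\<^bsub>G\<^esub> k)" and "X2 = x g k"
    and "p = d (h \<otimes>\<^bsub>G\<^esub> k \<otimes>\<^bsub>G\<^esub> g)" and "q = d (k \<otimes>\<^bsub>G\<^esub> g)" and "r = a (k \<otimes>\<^bsub>G\<^esub> g \<otimes>\<^bsub>G\<^esub> h)"
    and "w = a (k \<otimes>\<^bsub>G\<^esub> g)" and "dh = d h"
    and "agh = a (g \<otimes>\<^bsub>G\<^esub> h)" and "ag = a g" and "ah = a h" and "ak = a k"
  note defs = this
  have c: "X1 \<in> carrier R" "X2 \<in> carrier R" "p \<in> carrier R" "q \<in> carrier R" "r \<in> carrier R" "w \<in> carrier R"
    "dh \<in> carrier R" "agh \<in> carrier R" "ag \<in> carrier R" "ah \<in> carrier R" "ak \<in> carrier R"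
    by (simp_all add: defs)
  have e1: "l2 \<otimes> p \<oplus> dl \<otimes> X1 = dh \<otimes> (l2 \<otimes> q \<oplus> dl \<otimes> X2)
      \<oplus> (l2 \<otimes> r \<oplus> dl \<otimes> (ak \<otimes> agh) \<ominus> (l2 \<otimes> w \<oplus> dl \<otimes> (ak \<otimes> ag)) \<otimes> ah)"
    using d_mult[of h "k \<otimes>\<^bsub>G\<^esub> u \<otimes>\<^bsub>G\<^esub> g"] d_u_mult[of "h \<otimes>\<^bsub>G\<^esub> k" g] d_u_mult[of k g]
      a_u_mult[of k "g \<otimes>\<^bsub>G\<^esub> h"] a_u_mult[of k g]
    by (simp add: defs x_def[of "k \<otimes>\<^bsub>G\<^esub> (u \<otimes>\<^bsub>G\<^esub> g)" h] G.m_assoc)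
  have e2: "p = dh \<otimes> q \<oplus> (r \<ominus> w \<otimes> ah)"
    using d_mult[of h "k \<otimes>\<^bsub>G\<^esub> g"] by (simp add: defs x_def[of "k \<otimes>\<^bsub>G\<^esub> g" h] G.m_assoc)
  have "X1 = ak \<otimes> (agh \<ominus> ag \<otimes> ah) \<oplus> dh \<otimes> X2"
  proof (rule R.unit_cancel_diff[OF l_unit _ _ _ e1])
    have "v \<otimes> (X1 \<ominus> (ak \<otimes> (agh \<ominus> ag \<otimes> ah) \<oplus> dh \<otimes> X2)) =
       l2 \<otimes> p \<oplus> v \<otimes> X1 \<ominus> (dh \<otimes> (l2 \<otimes> q \<oplus> v \<otimes> X2)
        \<oplus> (l2 \<otimes> r \<oplus> v \<otimes> (ak \<otimes> agh) \<ominus> (l2 \<otimes> w \<oplus> v \<otimes> (ak \<otimes> ag)) \<otimes> ah))" if "v \<in> carrier R" for v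
      unfolding e2 using that c l_closed by algebra
    from this[OF dl_closed] show "dl \<otimes> (X1 \<ominus> (ak \<otimes> (agh \<ominus> ag \<otimes> ah) \<oplus> dh \<otimes> X2)) =
       l2 \<otimes> p \<oplus> dl \<otimes> X1 \<ominus> (dh \<otimes> (l2 \<otimes> q \<oplus> dl \<otimes> X2)
        \<oplus> (l2 \<otimes> r \<oplus> dl \<otimes> (ak \<otimes> agh) \<ominus> (l2 \<otimes> w \<oplus> dl \<otimes> (ak \<otimes> ag)) \<otimes> ah))" .
  qed (use c in simp_all)
  then show ?thesis by (simp add: defs x_def[of g h])
qed

lemma a_one: "a \<one>\<^bsub>G\<^esub> = \<one>"
proof -
  have "T u \<ominus> l2 \<otimes> T \<one>\<^bsub>G\<^esub> = l1 \<ominus> l2" unfolding T_u T_one using l_closed by algebra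
  then show ?thesis using l_unit by (simp add: a_def)
qed

lemma x_u: assumes [simp]: "k \<in> carrier G" shows "x u k = \<zero>"
proof -
  have *: "a (u \<otimes>\<^bsub>G\<^esub> h) = l1 \<otimes> a h" if h: "h \<in> carrier G" for h
  proof -
    have "l2 \<otimes> a h \<oplus> dl \<otimes> a h = l1 \<otimes> a h" using a_closed[OF h] l_closed by algebra
    then show ?thesis using a_u_mult[of "\<one>\<^bsub>G\<^esub>" h] h by (simp add: a_one)
  qed
  have "a u = l1" using *[of "\<one>\<^bsub>G\<^esub>"] by (simp add: a_one)
  then show ?thesis by (simp add: x_def *)
qed

text \<open>The determinant as ad - bc. \<open>T_id\<close> for the pairs \<open>(g, g u)\<close>
  and \<open>(g, g)\<close> gives two equations; subtracting \<open>l2\<close> times the second from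
  the first isolates \<open>dl\<close> times a formula for \<open>D g\<close>.\<close>

lemma D_eq: assumes [simp]: "g \<in> carrier G" shows "D g = a g \<otimes> d g \<ominus> x g g"
proof -
  define A tg X S where "A = a g" and "tg = T g" and "X = a (g \<otimes>\<^bsub>G\<^esub> g)" and "S = T (g \<otimes>\<^bsub>G\<^esub> g)"
  note defs = this
  have c: "A \<in> carrier R" "tg \<in> carrier R" "X \<in> carrier R" "S \<in> carrier R" "D g \<in> carrier R" by (simp_all add: defs)
  have k: "inv\<^bsub>G\<^esub> g \<otimes>\<^bsub>G\<^esub> (g \<otimes>\<^bsub>G\<^esub> u) = u" by (simp add: G.m_assoc[symmetric])
  have gu: "T (g \<otimes>\<^bsub>G\<^esub> u) = dl \<otimes> A \<oplus> l2 \<otimes> tg"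
    using T_u_mult[of g] T_comm[of g u] by (simp add: defs)
  have ggu: "T (g \<otimes>\<^bsub>G\<^esub> (g \<otimes>\<^bsub>G\<^esub> u)) = dl \<otimes> X \<oplus> l2 \<otimes> S"
    using T_u_mult[of "g \<otimes>\<^bsub>G\<^esub> g"] T_comm[of "g \<otimes>\<^bsub>G\<^esub> g" u] by (simp add: defs G.m_assoc)
  have e1: "tg \<otimes> (dl \<otimes> A \<oplus> l2 \<otimes> tg) = dl \<otimes> X \<oplus> l2 \<otimes> S \<oplus> D g \<otimes> (l1 \<oplus> l2)"
    using T_id[of g "g \<otimes>\<^bsub>G\<^esub> u"] by (simp add: gu ggu k T_u tg_def)
  have e2: "tg \<otimes> tg = S \<oplus> D g \<otimes> (\<one> \<oplus> \<one>)"
    using T_id[of g g] by (simp add: T_one defs)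
  have "tg \<otimes> (dl \<otimes> A \<oplus> l2 \<otimes> tg) \<ominus> l2 \<otimes> (tg \<otimes> tg)
     = dl \<otimes> X \<oplus> l2 \<otimes> S \<oplus> D g \<otimes> (l1 \<oplus> l2) \<ominus> l2 \<otimes> (S \<oplus> D g \<otimes> (\<one> \<oplus> \<one>))"
    (is "?P' = ?Q'") unfolding e1 e2 ..
  from this have "tg \<otimes> A = X \<oplus> D g"
  proof (rule R.unit_cancel_diff[OF l_unit, rotated 3])
    show "dl \<otimes> (tg \<otimes> A \<ominus> (X \<oplus> D g)) = ?P' \<ominus> ?Q'"
      using c l_closed by algebra
  qed (use c in simp_all)
  then have "D g = tg \<otimes> A \<ominus> X" by (rule R.eq_diff_conv(1)[rotated 2]) (simp_all add: c)
  also have "\<dots> = A \<otimes> (tg \<ominus> A) \<ominus> (X \<ominus> A \<otimes> A)" using c by algebra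
  finally show ?thesis by (simp add: defs d_def x_def)
qed

end


section \<open>Cohomology classes with coefficients in a character\<close>

text \<open>The module structure on the quotient is what makes the dimension of a cohomology group
  usable. Scalar multiplication is a union over a coset, and stability of \<open>B\<close> under
  scalars makes all members of that union equal.\<close>

lemma quot_module_module:
  assumes "module F V" "additive_subgroup B V"
    and B: "\<And>a v. a \<in> carrier F \<Longrightarrow> v \<in> B \<Longrightarrow> a \<odot>\<^bsub>V\<^esub> v \<in> B"
  shows "module F (quot_module V B)"
    and "\<And>a v. a \<in> carrier F \<Longrightarrow> v \<in> carrier V \<Longrightarrow>
      a \<odot>\<^bsub>quot_module V B\<^esub> (B +>\<^bsub>V\<^esub> v) = B +>\<^bsub>V\<^esub> (a \<odot>\<^bsub>V\<^esub> v)"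
proof -
  let ?Q = "quot_module V B"
  interpret V: module F V by fact
  interpret B: abelian_subgroup B V
    using assms(2) V.M.abelian_group_axioms by (rule abelian_subgroupI3)
  have smult: "a \<odot>\<^bsub>?Q\<^esub> (B +>\<^bsub>V\<^esub> v) = B +>\<^bsub>V\<^esub> (a \<odot>\<^bsub>V\<^esub> v)" if a: "a \<in> carrier F" and v: "v \<in> carrier V" for a v
  proof -
    have const: "B +>\<^bsub>V\<^esub> (a \<odot>\<^bsub>V\<^esub> w) = B +>\<^bsub>V\<^esub> (a \<odot>\<^bsub>V\<^esub> v)" if w: "w \<in> B +>\<^bsub>V\<^esub> v" for w
    proof -
      obtain b where b: "b \<in> B" "w = b \<oplus>\<^bsub>V\<^esub> v" using w unfolding a_r_coset_def' by blast
      then have "a \<odot>\<^bsub>V\<^esub> w = a \<odot>\<^bsub>V\<^esub> b \<oplus>\<^bsub>V\<^esub> a \<odot>\<^bsub>V\<^esub> v" using a v by (simp add: V.smult_r_distr)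
      then have "a \<odot>\<^bsub>V\<^esub> w \<in> B +>\<^bsub>V\<^esub> (a \<odot>\<^bsub>V\<^esub> v)" using B[OF a b(1)] unfolding a_r_coset_def' by blast
      then show ?thesis using B.a_repr_independence'[of "a \<odot>\<^bsub>V\<^esub> w" "a \<odot>\<^bsub>V\<^esub> v"] a v by simp
    qed
    have "(\<Union>w\<in>B +>\<^bsub>V\<^esub> v. B +>\<^bsub>V\<^esub> (a \<odot>\<^bsub>V\<^esub> w)) = B +>\<^bsub>V\<^esub> (a \<odot>\<^bsub>V\<^esub> v)"
      by (intro UN_constant_eq[OF B.a_rcos_self[OF v]] ballI const)
    then show ?thesis by (simp add: quot_module_def)
  qed
  show "\<And>a v. a \<in> carrier F \<Longrightarrow> v \<in> carrier V \<Longrightarrow>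
      a \<odot>\<^bsub>?Q\<^esub> (B +>\<^bsub>V\<^esub> v) = B +>\<^bsub>V\<^esub> (a \<odot>\<^bsub>V\<^esub> v)" by (rule smult)
  have car: "carrier ?Q = a_rcosets\<^bsub>V\<^esub> B" by (simp add: quot_module_def)
  have ex: "\<exists>v\<in>carrier V. X = B +>\<^bsub>V\<^esub> v" if "X \<in> carrier ?Q" for X
    using that unfolding car A_RCOSETS_def' by blast
  have ec: "B +>\<^bsub>V\<^esub> v \<in> carrier ?Q" if "v \<in> carrier V" for v
    using that unfolding car A_RCOSETS_def' by blast
  have add: "(B +>\<^bsub>V\<^esub> v) \<oplus>\<^bsub>?Q\<^esub> (B +>\<^bsub>V\<^esub> w) = B +>\<^bsub>V\<^esub> (v \<oplus>\<^bsub>V\<^esub> w)"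
    if "v \<in> carrier V" "w \<in> carrier V" for v w
    using B.a_rcos_sum[OF that] by (simp add: quot_module_def)
  have zero: "\<zero>\<^bsub>?Q\<^esub> = B +>\<^bsub>V\<^esub> \<zero>\<^bsub>V\<^esub>"
    using B.a_subset by (simp add: quot_module_def)
  have ab: "abelian_group ?Q"
  proof (rule abelian_groupI)
    fix X Y Z assume X: "X \<in> carrier ?Q" and Y: "Y \<in> carrier ?Q" and Z: "Z \<in> carrier ?Q"
    obtain u v w where v: "u \<in> carrier V" "X = B +>\<^bsub>V\<^esub> u" "v \<in> carrier V" "Y = B +>\<^bsub>V\<^esub> v"
      "w \<in> carrier V" "Z = B +>\<^bsub>V\<^esub> w"
      using ex[OF X] ex[OF Y] ex[OF Z] by blast
    show "X \<oplus>\<^bsub>?Q\<^esub> Y \<oplus>\<^bsub>?Q\<^esub> Z = X \<oplus>\<^bsub>?Q\<^esub> (Y \<oplus>\<^bsub>?Q\<^esub> Z)" using v by (simp add: add V.a_assoc)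
    show "X \<oplus>\<^bsub>?Q\<^esub> Y = Y \<oplus>\<^bsub>?Q\<^esub> X" using v by (simp add: add V.a_comm)
    show "X \<oplus>\<^bsub>?Q\<^esub> Y \<in> carrier ?Q" using v by (simp add: add ec)
  next
    fix X assume X: "X \<in> carrier ?Q"
    obtain v where v: "v \<in> carrier V" "X = B +>\<^bsub>V\<^esub> v" using ex[OF X] by blast
    show "\<zero>\<^bsub>?Q\<^esub> \<oplus>\<^bsub>?Q\<^esub> X = X" using v by (simp add: add zero)
    have "(B +>\<^bsub>V\<^esub> (\<ominus>\<^bsub>V\<^esub> v)) \<oplus>\<^bsub>?Q\<^esub> X = \<zero>\<^bsub>?Q\<^esub>" using v by (simp add: add zero V.l_neg)
    then show "\<exists>Y\<in>carrier ?Q. Y \<oplus>\<^bsub>?Q\<^esub> X = \<zero>\<^bsub>?Q\<^esub>" using ec[of "\<ominus>\<^bsub>V\<^esub> v"] v(1) by blast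
  next
    show "\<zero>\<^bsub>?Q\<^esub> \<in> carrier ?Q" using ec[of "\<zero>\<^bsub>V\<^esub>"] zero by simp
  qed
  show "module F ?Q"
  proof (rule moduleI[OF V.R.is_cring ab])
    fix a X assume a: "a \<in> carrier F" and X: "X \<in> carrier ?Q"
    obtain v where v: "v \<in> carrier V" "X = B +>\<^bsub>V\<^esub> v" using ex[OF X] by blast
    show "a \<odot>\<^bsub>?Q\<^esub> X \<in> carrier ?Q" using a v by (simp add: smult ec)
    fix b assume b: "b \<in> carrier F"
    show "(a \<oplus>\<^bsub>F\<^esub> b) \<odot>\<^bsub>?Q\<^esub> X = a \<odot>\<^bsub>?Q\<^esub> X \<oplus>\<^bsub>?Q\<^esub> b \<odot>\<^bsub>?Q\<^esub> X"
      using a b v by (simp add: smult add V.smult_l_distr)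
    show "(a \<otimes>\<^bsub>F\<^esub> b) \<odot>\<^bsub>?Q\<^esub> X = a \<odot>\<^bsub>?Q\<^esub> (b \<odot>\<^bsub>?Q\<^esub> X)"
      using a b v by (simp add: smult V.smult_assoc1)
  next
    fix a X Y assume a: "a \<in> carrier F" and X: "X \<in> carrier ?Q" and Y: "Y \<in> carrier ?Q"
    obtain v w where v: "v \<in> carrier V" "X = B +>\<^bsub>V\<^esub> v" "w \<in> carrier V" "Y = B +>\<^bsub>V\<^esub> w"
      using ex[OF X] ex[OF Y] by blast
    show "a \<odot>\<^bsub>?Q\<^esub> (X \<oplus>\<^bsub>?Q\<^esub> Y) = a \<odot>\<^bsub>?Q\<^esub> X \<oplus>\<^bsub>?Q\<^esub> a \<odot>\<^bsub>?Q\<^esub> Y"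
      using a v by (simp add: smult add V.smult_r_distr)
  next
    fix X assume X: "X \<in> carrier ?Q"
    obtain v where v: "v \<in> carrier V" "X = B +>\<^bsub>V\<^esub> v" using ex[OF X] by blast
    show "\<one>\<^bsub>F\<^esub> \<odot>\<^bsub>?Q\<^esub> X = X" using v by (simp add: smult)
  qed
qed

lemma fun_module_module:
  assumes "cring F" and sub: "Z \<subseteq> X \<rightarrow>\<^sub>E carrier F" and zero: "(\<lambda>s\<in>X. \<zero>\<^bsub>F\<^esub>) \<in> Z"
    and add: "\<And>f g. f \<in> Z \<Longrightarrow> g \<in> Z \<Longrightarrow> (\<lambda>s\<in>X. f s \<oplus>\<^bsub>F\<^esub> g s) \<in> Z"
    and smult: "\<And>a f. a \<in> carrier F \<Longrightarrow> f \<in> Z \<Longrightarrow> (\<lambda>s\<in>X. a \<otimes>\<^bsub>F\<^esub> f s) \<in> Z"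
  shows "module F (fun_module F X Z)"
proof -
  interpret F: cring F by fact
  let ?V = "fun_module F X Z"
  have fc: "f s \<in> carrier F" if "f \<in> Z" "s \<in> X" for f s using that sub by auto
  have fe: "restrict f X = f" if "f \<in> Z" for f using that sub by (metis PiE_restrict subsetD)
  show ?thesis
  proof (rule moduleI)
    show "cring F" by fact
    show "abelian_group ?V"
    proof (rule abelian_groupI)
      fix f g h assume fgh: "f \<in> carrier ?V" "g \<in> carrier ?V" "h \<in> carrier ?V"
      then have Z: "f \<in> Z" "g \<in> Z" "h \<in> Z" by (simp_all add: fun_module_def)
      show "f \<oplus>\<^bsub>?V\<^esub> g \<oplus>\<^bsub>?V\<^esub> h = f \<oplus>\<^bsub>?V\<^esub> (g \<oplus>\<^bsub>?V\<^esub> h)"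
        unfolding fun_module_def using Z by (auto simp: fc F.a_assoc intro!: restrict_ext)
    next
      fix f g assume fg: "f \<in> carrier ?V" "g \<in> carrier ?V"
      then have Z: "f \<in> Z" "g \<in> Z" by (simp_all add: fun_module_def)
      show "f \<oplus>\<^bsub>?V\<^esub> g = g \<oplus>\<^bsub>?V\<^esub> f"
        unfolding fun_module_def using Z by (auto simp: fc F.a_comm intro!: restrict_ext)
      show "f \<oplus>\<^bsub>?V\<^esub> g \<in> carrier ?V" using Z add by (simp add: fun_module_def)
    next
      show "\<zero>\<^bsub>?V\<^esub> \<in> carrier ?V" using zero by (simp add: fun_module_def)
    next
      fix f assume "f \<in> carrier ?V"
      then have Z: "f \<in> Z" by (simp add: fun_module_def)
      have "(\<lambda>s\<in>X. (\<lambda>s\<in>X. \<zero>\<^bsub>F\<^esub>) s \<oplus>\<^bsub>F\<^esub> f s) = restrict f X"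
        by (rule restrict_ext) (simp add: fc Z)
      then show "\<zero>\<^bsub>?V\<^esub> \<oplus>\<^bsub>?V\<^esub> f = f" using fe[OF Z] by (simp add: fun_module_def)
      have "(\<lambda>s\<in>X. (\<lambda>s\<in>X. (\<ominus>\<^bsub>F\<^esub> \<one>\<^bsub>F\<^esub>) \<otimes>\<^bsub>F\<^esub> f s) s \<oplus>\<^bsub>F\<^esub> f s) = (\<lambda>s\<in>X. \<zero>\<^bsub>F\<^esub>)"
        by (rule restrict_ext) (simp add: fc Z F.l_minus F.l_neg)
      then show "\<exists>g\<in>carrier ?V. g \<oplus>\<^bsub>?V\<^esub> f = \<zero>\<^bsub>?V\<^esub>"
        using smult[OF _ Z, of "\<ominus>\<^bsub>F\<^esub> \<one>\<^bsub>F\<^esub>"] unfolding fun_module_def ring.simps partial_object.simps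
        by (intro bexI[of _ "\<lambda>s\<in>X. (\<ominus>\<^bsub>F\<^esub> \<one>\<^bsub>F\<^esub>) \<otimes>\<^bsub>F\<^esub> f s"]) simp_all
    qed
    fix a f assume a: "a \<in> carrier F" and f: "f \<in> carrier ?V"
    have Z: "f \<in> Z" using f by (simp add: fun_module_def)
    show "a \<odot>\<^bsub>?V\<^esub> f \<in> carrier ?V" using a Z smult by (simp add: fun_module_def)
    fix b assume b: "b \<in> carrier F"
    show "(a \<oplus>\<^bsub>F\<^esub> b) \<odot>\<^bsub>?V\<^esub> f = a \<odot>\<^bsub>?V\<^esub> f \<oplus>\<^bsub>?V\<^esub> b \<odot>\<^bsub>?V\<^esub> f"
      unfolding fun_module_def using Z a b by (auto simp: fc F.l_distr intro!: restrict_ext)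
    show "(a \<otimes>\<^bsub>F\<^esub> b) \<odot>\<^bsub>?V\<^esub> f = a \<odot>\<^bsub>?V\<^esub> (b \<odot>\<^bsub>?V\<^esub> f)"
      unfolding fun_module_def using Z a b by (auto simp: fc F.m_assoc intro!: restrict_ext)
  next
    fix a f g assume a: "a \<in> carrier F" and f: "f \<in> carrier ?V" "g \<in> carrier ?V"
    have Z: "f \<in> Z" "g \<in> Z" using f by (simp_all add: fun_module_def)
    show "a \<odot>\<^bsub>?V\<^esub> (f \<oplus>\<^bsub>?V\<^esub> g) = a \<odot>\<^bsub>?V\<^esub> f \<oplus>\<^bsub>?V\<^esub> a \<odot>\<^bsub>?V\<^esub> g"
      unfolding fun_module_def using Z a by (auto simp: fc F.r_distr intro!: restrict_ext)
  next
    fix f assume f: "f \<in> carrier ?V"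
    have Z: "f \<in> Z" using f by (simp add: fun_module_def)
    have "(\<lambda>s\<in>X. \<one>\<^bsub>F\<^esub> \<otimes>\<^bsub>F\<^esub> f s) = restrict f X"
      by (rule restrict_ext) (simp add: fc Z)
    then show "\<one>\<^bsub>F\<^esub> \<odot>\<^bsub>?V\<^esub> f = f" using fe[OF Z] by (simp add: fun_module_def)
  qed
qed

section \<open>Cocycles and coboundaries with coefficients in a character\<close>

lemma cochains_iff:
  "f \<in> cochains F T \<longleftrightarrow> f \<in> topspace T \<rightarrow>\<^sub>E carrier F \<and> near T (\<lambda>x y. f y = f x)"
  unfolding cochains_def continuous_map_discrete_near by auto

lemma cochainsI:
  assumes "\<And>s. s \<in> topspace T \<Longrightarrow> f s \<in> carrier F" "near T (\<lambda>x y. f y = f x)"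
  shows "restrict f (topspace T) \<in> cochains F T"
  unfolding cochains_iff using assms(1) by (auto intro: near_mono[OF assms(2)])

lemma near_trivial: "(\<And>x y. x \<in> topspace T \<Longrightarrow> y \<in> topspace T \<Longrightarrow> P x y) \<Longrightarrow> near T P"
  unfolding near_def by (meson openin_topspace)

locale char_cohomology = F?: field F + G?: group G for F :: "'k ring" (structure) and G :: "'g monoid" (structure) +
  fixes \<tau> :: "'g topology" and \<psi> :: "'g \<Rightarrow> 'k"
  assumes top: "topspace \<tau> = carrier G"
    and psi_closed [simp]: "g \<in> carrier G \<Longrightarrow> \<psi> g \<in> carrier F"
    and psi_mult: "g \<in> carrier G \<Longrightarrow> h \<in> carrier G \<Longrightarrow> \<psi> (g \<otimes>\<^bsub>G\<^esub> h) = \<psi> g \<otimes> \<psi> h"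
    and psi_near: "near \<tau> (\<lambda>g h. \<psi> h = \<psi> g)"
begin

lemma cocycles1_iff:
  "c \<in> cocycles1 G \<tau> F \<psi> \<longleftrightarrow> c \<in> carrier G \<rightarrow>\<^sub>E carrier F \<and> near \<tau> (\<lambda>x y. c y = c x) \<and>
    (\<forall>g\<in>carrier G. \<forall>h\<in>carrier G. c (g \<otimes>\<^bsub>G\<^esub> h) = \<psi> g \<otimes> c h \<oplus> c g)"
proof -
  have "\<psi> g \<otimes> c h \<ominus> c (g \<otimes>\<^bsub>G\<^esub> h) \<oplus> c g = \<zero> \<longleftrightarrow> c (g \<otimes>\<^bsub>G\<^esub> h) = \<psi> g \<otimes> c h \<oplus> c g"
    if "c \<in> carrier G \<rightarrow>\<^sub>E carrier F" and g: "g \<in> carrier G" "h \<in> carrier G" for g h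
  proof -
    have c: "c g \<in> carrier F" "c h \<in> carrier F" "c (g \<otimes>\<^bsub>G\<^esub> h) \<in> carrier F" using that by auto
    have "\<psi> g \<otimes> c h \<ominus> c (g \<otimes>\<^bsub>G\<^esub> h) \<oplus> c g = (\<psi> g \<otimes> c h \<oplus> c g) \<ominus> c (g \<otimes>\<^bsub>G\<^esub> h)"
      using c psi_closed[OF g(1)] by algebra
    then show ?thesis using c g by auto
  qed
  then show ?thesis
    unfolding cocycles1_def cochains_iff top cobound1_def by auto
qed

lemma coboundaries1_iff:
  "b \<in> coboundaries1 G F \<psi> \<longleftrightarrow> (\<exists>w\<in>carrier F. b = (\<lambda>g\<in>carrier G. \<psi> g \<otimes> w \<ominus> w))"
  unfolding coboundaries1_def cobound0_def by auto

lemma coboundary_cocycle: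
  assumes w: "w \<in> carrier F"
  shows "(\<lambda>g\<in>carrier G. \<psi> g \<otimes> w \<ominus> w) \<in> cocycles1 G \<tau> F \<psi>"
proof -
  have "near \<tau> (\<lambda>x y. (\<lambda>g\<in>carrier G. \<psi> g \<otimes> w \<ominus> w) y = (\<lambda>g\<in>carrier G. \<psi> g \<otimes> w \<ominus> w) x)"
    by (rule near_mono[OF psi_near]) (simp add: top)
  moreover have "\<psi> (g \<otimes>\<^bsub>G\<^esub> h) \<otimes> w \<ominus> w = \<psi> g \<otimes> (\<psi> h \<otimes> w \<ominus> w) \<oplus> (\<psi> g \<otimes> w \<ominus> w)"
    if "g \<in> carrier G" "h \<in> carrier G" for g h
    unfolding psi_mult[OF that] using psi_closed[OF that(1)] psi_closed[OF that(2)] w by algebra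
  ultimately show ?thesis unfolding cocycles1_iff using w by auto
qed

lemma cocycle_module: "module F (fun_module F (carrier G) (cocycles1 G \<tau> F \<psi>))"
proof (rule fun_module_module[OF is_cring])
  let ?Z = "cocycles1 G \<tau> F \<psi>"
  show "?Z \<subseteq> carrier G \<rightarrow>\<^sub>E carrier F" using cocycles1_iff by blast
  have "(\<lambda>g\<in>carrier G. \<psi> g \<otimes> \<zero> \<ominus> \<zero>) = (\<lambda>g\<in>carrier G. \<zero>)" by (rule restrict_ext) simp
  then show "(\<lambda>s\<in>carrier G. \<zero>) \<in> ?Z" using coboundary_cocycle[OF F.zero_closed] by simp
next
  let ?Z = "cocycles1 G \<tau> F \<psi>"
  fix f g assume fg: "f \<in> ?Z" "g \<in> ?Z"
  then have c: "\<And>s. s \<in> carrier G \<Longrightarrow> f s \<in> carrier F \<and> g s \<in> carrier F" by (auto simp: cocycles1_iff)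
  have "near \<tau> (\<lambda>x y. (\<lambda>s\<in>carrier G. f s \<oplus> g s) y = (\<lambda>s\<in>carrier G. f s \<oplus> g s) x)"
    by (rule near_mono2[of \<tau> "\<lambda>x y. f y = f x" "\<lambda>x y. g y = g x"]) (use fg in \<open>simp_all add: cocycles1_iff top\<close>)
  moreover have "f (s \<otimes>\<^bsub>G\<^esub> h) \<oplus> g (s \<otimes>\<^bsub>G\<^esub> h) = \<psi> s \<otimes> (f h \<oplus> g h) \<oplus> (f s \<oplus> g s)"
    if sh: "s \<in> carrier G" "h \<in> carrier G" for s h
  proof -
    have e: "f (s \<otimes>\<^bsub>G\<^esub> h) = \<psi> s \<otimes> f h \<oplus> f s" "g (s \<otimes>\<^bsub>G\<^esub> h) = \<psi> s \<otimes> g h \<oplus> g s"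
      using fg sh by (simp_all add: cocycles1_iff)
    show ?thesis unfolding e using c[OF sh(1)] c[OF sh(2)] psi_closed[OF sh(1)]
      by (elim conjE) algebra
  qed
  ultimately show "(\<lambda>s\<in>carrier G. f s \<oplus> g s) \<in> ?Z" using c by (auto simp: cocycles1_iff)
next
  let ?Z = "cocycles1 G \<tau> F \<psi>"
  fix a f assume a: "a \<in> carrier F" and f: "f \<in> ?Z"
  then have c: "\<And>s. s \<in> carrier G \<Longrightarrow> f s \<in> carrier F" by (auto simp: cocycles1_iff)
  have "near \<tau> (\<lambda>x y. (\<lambda>s\<in>carrier G. a \<otimes> f s) y = (\<lambda>s\<in>carrier G. a \<otimes> f s) x)"
    by (rule near_mono[of \<tau> "\<lambda>x y. f y = f x"]) (use f in \<open>simp_all add: cocycles1_iff top\<close>)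
  moreover have "a \<otimes> f (s \<otimes>\<^bsub>G\<^esub> h) = \<psi> s \<otimes> (a \<otimes> f h) \<oplus> a \<otimes> f s"
    if sh: "s \<in> carrier G" "h \<in> carrier G" for s h
  proof -
    have e: "f (s \<otimes>\<^bsub>G\<^esub> h) = \<psi> s \<otimes> f h \<oplus> f s" using f sh by (simp add: cocycles1_iff)
    show ?thesis unfolding e using c[OF sh(1)] c[OF sh(2)] psi_closed[OF sh(1)] a by algebra
  qed
  ultimately show "(\<lambda>s\<in>carrier G. a \<otimes> f s) \<in> ?Z" using a c by (auto simp: cocycles1_iff)
qed

lemma coboundaries_subgroup:
  "additive_subgroup (coboundaries1 G F \<psi>) (fun_module F (carrier G) (cocycles1 G \<tau> F \<psi>))"
  and coboundaries_smult: "a \<in> carrier F \<Longrightarrow> b \<in> coboundaries1 G F \<psi> \<Longrightarrow>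
    a \<odot>\<^bsub>fun_module F (carrier G) (cocycles1 G \<tau> F \<psi>)\<^esub> b \<in> coboundaries1 G F \<psi>"
proof -
  let ?V = "fun_module F (carrier G) (cocycles1 G \<tau> F \<psi>)" and ?B = "coboundaries1 G F \<psi>"
  interpret V: module F ?V by (rule cocycle_module)
  have sub: "?B \<subseteq> carrier ?V" using coboundary_cocycle by (auto simp: coboundaries1_iff fun_module_def)
  have sm: "a \<odot>\<^bsub>?V\<^esub> b \<in> ?B" if a: "a \<in> carrier F" and b: "b \<in> ?B" for a b
  proof -
    obtain w where w: "w \<in> carrier F" "b = (\<lambda>g\<in>carrier G. \<psi> g \<otimes> w \<ominus> w)" using b coboundaries1_iff by blast
    have "a \<odot>\<^bsub>?V\<^esub> b = (\<lambda>g\<in>carrier G. \<psi> g \<otimes> (a \<otimes> w) \<ominus> a \<otimes> w)"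
      unfolding fun_module_def module.simps
    proof (rule restrict_ext)
      fix g assume g: "g \<in> carrier G"
      have "a \<otimes> (\<psi> g \<otimes> w \<ominus> w) = \<psi> g \<otimes> (a \<otimes> w) \<ominus> a \<otimes> w" using psi_closed[OF g] a w(1) by algebra
      then show "a \<otimes> b g = \<psi> g \<otimes> (a \<otimes> w) \<ominus> a \<otimes> w" using w(2) g by simp
    qed
    then show ?thesis using a w(1) coboundaries1_iff by blast
  qed
  then show "a \<in> carrier F \<Longrightarrow> b \<in> ?B \<Longrightarrow> a \<odot>\<^bsub>?V\<^esub> b \<in> ?B" .
  have ad: "b \<oplus>\<^bsub>?V\<^esub> b' \<in> ?B" if bb: "b \<in> ?B" "b' \<in> ?B" for b b'
  proof -
    obtain w where w: "w \<in> carrier F" "b = (\<lambda>g\<in>carrier G. \<psi> g \<otimes> w \<ominus> w)" using bb coboundaries1_iff by blast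
    obtain w' where w': "w' \<in> carrier F" "b' = (\<lambda>g\<in>carrier G. \<psi> g \<otimes> w' \<ominus> w')" using bb coboundaries1_iff by blast
    have "b \<oplus>\<^bsub>?V\<^esub> b' = (\<lambda>g\<in>carrier G. \<psi> g \<otimes> (w \<oplus> w') \<ominus> (w \<oplus> w'))"
      unfolding fun_module_def ring.simps
    proof (rule restrict_ext)
      fix g assume g: "g \<in> carrier G"
      have "(\<psi> g \<otimes> w \<ominus> w) \<oplus> (\<psi> g \<otimes> w' \<ominus> w') = \<psi> g \<otimes> (w \<oplus> w') \<ominus> (w \<oplus> w')"
        using psi_closed[OF g] w'(1) w(1) by algebra
      then show "b g \<oplus> b' g = \<psi> g \<otimes> (w \<oplus> w') \<ominus> (w \<oplus> w')" using w(2) w'(2) g by simp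
    qed
    then show ?thesis using w(1) w'(1) coboundaries1_iff by blast
  qed
  have ze: "\<zero>\<^bsub>?V\<^esub> \<in> ?B"
  proof -
    have "\<zero>\<^bsub>?V\<^esub> = (\<lambda>g\<in>carrier G. \<psi> g \<otimes> \<zero> \<ominus> \<zero>)"
      unfolding fun_module_def ring.simps by (rule restrict_ext) (simp add: a_minus_def)
    then show ?thesis using coboundaries1_iff by blast
  qed
  show "additive_subgroup ?B ?V"
  proof (rule additive_subgroup.intro, rule group.subgroupI)
    show "Group.group (add_monoid ?V)" by (rule V.a_group)
    show "?B \<subseteq> carrier (add_monoid ?V)" using sub by simp
    show "?B \<noteq> {}" using ze by blast
    fix b assume b: "b \<in> ?B"
    then have "\<ominus>\<^bsub>?V\<^esub> b = (\<ominus> \<one>) \<odot>\<^bsub>?V\<^esub> b" using sub V.smult_l_minus[of \<one> b] by auto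
    then show "inv\<^bsub>add_monoid ?V\<^esub> b \<in> ?B" using sm[OF F.a_inv_closed[OF F.one_closed] b] unfolding a_inv_def by simp
    fix b' assume "b' \<in> ?B"
    then show "b \<otimes>\<^bsub>add_monoid ?V\<^esub> b' \<in> ?B" using ad b by simp
  qed
qed

text \<open>A basis of the space of classes has one element, so the non-zero class \<open>x\<close>
  spans it. Passing to representatives turns equality of classes into equality up to coboundaries,
  the form that can be compared with matrix entries.\<close>

lemma H1_one_dimensional:
  assumes fin: "vectorspace.fin_dim F (H1 G \<tau> F \<psi>)" and dim: "vectorspace.dim F (H1 G \<tau> F \<psi>) = 1"
    and x: "x \<in> carrier (H1 G \<tau> F \<psi>)" "x \<noteq> \<zero>\<^bsub>H1 G \<tau> F \<psi>\<^esub>" "c \<in> x"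
  shows "c \<in> cocycles1 G \<tau> F \<psi>" (is "c \<in> ?Z")
    and "w \<in> carrier F \<Longrightarrow> \<exists>g\<in>carrier G. c g \<noteq> \<psi> g \<otimes> w \<ominus> w"
    and "z \<in> cocycles1 G \<tau> F \<psi> \<Longrightarrow> \<exists>s\<in>carrier F. \<exists>w\<in>carrier F. \<forall>g\<in>carrier G. z g = s \<otimes> c g \<oplus> (\<psi> g \<otimes> w \<ominus> w)"
proof -
  let ?V = "fun_module F (carrier G) ?Z" and ?B = "coboundaries1 G F \<psi>" and ?H = "H1 G \<tau> F \<psi>"
  interpret V: module F ?V by (rule cocycle_module)
  interpret B: abelian_subgroup ?B ?V
    using coboundaries_subgroup V.M.abelian_group_axioms by (rule abelian_subgroupI3)
  have H: "?H = quot_module ?V ?B" by (simp add: H1_def)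
  interpret H: vectorspace F ?H
    unfolding H vectorspace_def
    using quot_module_module(1)[OF cocycle_module coboundaries_subgroup coboundaries_smult] field_axioms by simp
  have sm: "\<And>a v. a \<in> carrier F \<Longrightarrow> v \<in> carrier ?V \<Longrightarrow> a \<odot>\<^bsub>?H\<^esub> (?B +>\<^bsub>?V\<^esub> v) = ?B +>\<^bsub>?V\<^esub> (a \<odot>\<^bsub>?V\<^esub> v)"
    unfolding H by (rule quot_module_module(2)[OF cocycle_module coboundaries_subgroup coboundaries_smult])
  have car: "carrier ?H = a_rcosets\<^bsub>?V\<^esub> ?B" and zH: "\<zero>\<^bsub>?H\<^esub> = ?B" by (simp_all add: H quot_module_def)
  have carV: "carrier ?V = ?Z" by (simp add: fun_module_def)
  obtain v where v: "v \<in> carrier ?V" "x = ?B +>\<^bsub>?V\<^esub> v" using x(1) unfolding car A_RCOSETS_def' by blast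
  have cV: "c \<in> carrier ?V" using B.a_rcosets_carrier x(1,3) car by blast
  then show cZ: "c \<in> ?Z" using carV by simp
  have xc: "x = ?B +>\<^bsub>?V\<^esub> c" using B.a_repr_independence'[of c v] x(3) v by simp
  show "\<exists>g\<in>carrier G. c g \<noteq> \<psi> g \<otimes> w \<ominus> w" if w: "w \<in> carrier F"
  proof (rule ccontr)
    assume "\<not> ?thesis"
    then have "restrict c (carrier G) = (\<lambda>g\<in>carrier G. \<psi> g \<otimes> w \<ominus> w)" by (intro restrict_ext) simp
    moreover have "restrict c (carrier G) = c" using cZ cocycles1_iff by (metis PiE_restrict)
    ultimately have "c \<in> ?B" using w coboundaries1_iff by metis
    then show False using xc x(2) zH B.a_rcos_const by simp
  qed
  obtain \<beta> where \<beta>: "finite \<beta>" "H.basis \<beta>" using H.finite_basis_exists[OF fin] by blast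
  have "card \<beta> = 1" using H.dim_basis[OF \<beta>] dim by simp
  then obtain b where b: "\<beta> = {b}" using card_1_singletonE by blast
  have gen: "H.span {b} = carrier ?H" and bc: "b \<in> carrier ?H" using \<beta>(2) b by (auto simp: H.basis_def)
  have mult: "\<exists>s\<in>carrier F. y = s \<odot>\<^bsub>?H\<^esub> b" if y: "y \<in> carrier ?H" for y
  proof -
    have "y \<in> {H.lincomb a {b} | a. a \<in> {b} \<rightarrow> carrier F}"
      using y H.finite_span[of "{b}"] bc gen by auto
    then obtain a where a: "a b \<in> carrier F" "y = H.lincomb a {b}" by auto
    have "H.lincomb a {b} = a b \<odot>\<^bsub>?H\<^esub> b" using a(1) bc by (simp add: H.lincomb_def)
    then show ?thesis using a by blast
  qed
  \<comment> \<open>\<open>x\<close> is \<open>s0 b\<close> with \<open>s0\<close> invertible, so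
    the basis vector \<open>b\<close> can be traded for \<open>x\<close>; the coefficient of a class
    \<open>s1 b\<close> with respect to \<open>x\<close> is \<open>s1 / s0\<close>.\<close>
  obtain s0 where s0: "s0 \<in> carrier F" "x = s0 \<odot>\<^bsub>?H\<^esub> b" using mult[OF x(1)] by blast
  have "s0 \<noteq> \<zero>" using s0 x(2) bc H.smult_l_null by auto
  then have s0u: "s0 \<in> Units F" using s0(1) field_Units by simp
  assume z: "z \<in> ?Z"
  have "?B +>\<^bsub>?V\<^esub> z \<in> carrier ?H" unfolding car A_RCOSETS_def' carV using z by blast
  then obtain s1 where s1: "s1 \<in> carrier F" "?B +>\<^bsub>?V\<^esub> z = s1 \<odot>\<^bsub>?H\<^esub> b" using mult by blast
  define s where "s = s1 \<otimes> inv s0"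
  have sc: "s \<in> carrier F" using s1 s0u by (simp add: s_def)
  have "s \<otimes> s0 = s1" using s1 s0u s0(1) by (simp add: s_def F.m_assoc)
  then have "?B +>\<^bsub>?V\<^esub> z = s \<odot>\<^bsub>?H\<^esub> x" using s1 s0 sc bc H.smult_assoc1[of s s0 b] by simp
  also have "\<dots> = ?B +>\<^bsub>?V\<^esub> (s \<odot>\<^bsub>?V\<^esub> c)" unfolding xc by (rule sm[OF sc cV])
  finally have "z \<in> ?B +>\<^bsub>?V\<^esub> (s \<odot>\<^bsub>?V\<^esub> c)" using B.a_rcos_self[of z] z carV by simp
  then obtain b' where b': "b' \<in> ?B" "z = b' \<oplus>\<^bsub>?V\<^esub> (s \<odot>\<^bsub>?V\<^esub> c)" unfolding a_r_coset_def' by blast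
  obtain w where w: "w \<in> carrier F" "b' = (\<lambda>g\<in>carrier G. \<psi> g \<otimes> w \<ominus> w)" using b'(1) coboundaries1_iff by blast
  have "z g = s \<otimes> c g \<oplus> (\<psi> g \<otimes> w \<ominus> w)" if g: "g \<in> carrier G" for g
  proof -
    have "c g \<in> carrier F" using cZ g by (auto simp: cocycles1_iff)
    then show ?thesis using b'(2) w g sc by (simp add: fun_module_def F.a_comm)
  qed
  then show "\<exists>s\<in>carrier F. \<exists>w\<in>carrier F. \<forall>g\<in>carrier G. z g = s \<otimes> c g \<oplus> (\<psi> g \<otimes> w \<ominus> w)"
    using sc w(1) by blast
qed

lemma H2_trivial:
  assumes H2: "carrier (H2 G \<tau> F \<psi>) = {\<zero>\<^bsub>H2 G \<tau> F \<psi>\<^esub>}" and z: "z \<in> cocycles2 G \<tau> F \<psi>"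
  obtains f where "\<And>g. g \<in> carrier G \<Longrightarrow> f g \<in> carrier F" "near \<tau> (\<lambda>g h. f h = f g)"
    "\<And>g h. g \<in> carrier G \<Longrightarrow> h \<in> carrier G \<Longrightarrow> z (g, h) = \<psi> g \<otimes> f h \<ominus> f (g \<otimes>\<^bsub>G\<^esub> h) \<oplus> f g"
proof -
  let ?V = "fun_module F (carrier G \<times> carrier G) (cocycles2 G \<tau> F \<psi>)" and ?B = "coboundaries2 G \<tau> F \<psi>"
  have "?B +>\<^bsub>?V\<^esub> z \<in> carrier (H2 G \<tau> F \<psi>)"
    using z by (auto simp: H2_def quot_module_def A_RCOSETS_def' fun_module_def)
  then have eq: "?B +>\<^bsub>?V\<^esub> z = ?B" using H2 by (simp add: H2_def quot_module_def)
  \<comment> \<open>The zero cochain. Its coboundary is zero and belongs to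
    \<open>coboundaries2\<close>, which shows that \<open>z\<close> lies in its own coset.\<close>
  define o1 where "o1 = (\<lambda>g\<in>carrier G. \<zero>)"
  have o1: "o1 \<in> cochains F \<tau>"
    using cochainsI[of \<tau> "\<lambda>_. \<zero>" F] near_trivial[of \<tau> "\<lambda>_ _. True"] by (simp add: o1_def top)
  have zc: "z \<in> carrier G \<times> carrier G \<rightarrow>\<^sub>E carrier F"
    using z by (simp add: cocycles2_def cochains_iff top)
  have "cobound1 G F \<psi> o1 \<oplus>\<^bsub>?V\<^esub> z = restrict z (carrier G \<times> carrier G)"
    unfolding fun_module_def ring.simps
  proof (rule restrict_ext)
    fix s assume s: "s \<in> carrier G \<times> carrier G"
    then have "z s \<in> carrier F" using zc by auto
    then show "cobound1 G F \<psi> o1 s \<oplus> z s = z s"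
      using s by (auto simp: cobound1_def o1_def a_minus_def)
  qed
  also have "\<dots> = z" using zc by (rule PiE_restrict)
  finally have "z = cobound1 G F \<psi> o1 \<oplus>\<^bsub>?V\<^esub> z" by simp
  moreover have "cobound1 G F \<psi> o1 \<in> ?B" using o1 by (simp add: coboundaries2_def)
  ultimately have "z \<in> ?B +>\<^bsub>?V\<^esub> z" unfolding a_r_coset_def' by blast
  then have "z \<in> ?B" using eq by simp
  then obtain f where f: "f \<in> cochains F \<tau>" "z = cobound1 G F \<psi> f" by (auto simp: coboundaries2_def)
  show ?thesis
  proof (rule that[of f])
    show "\<And>g. g \<in> carrier G \<Longrightarrow> f g \<in> carrier F" "near \<tau> (\<lambda>g h. f h = f g)"
      using f(1) by (auto simp: cochains_iff top)
    show "\<And>g h. g \<in> carrier G \<Longrightarrow> h \<in> carrier G \<Longrightarrow> z (g, h) = \<psi> g \<otimes> f h \<ominus> f (g \<otimes>\<^bsub>G\<^esub> h) \<oplus> f g"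
      by (simp add: f(2) cobound1_def)
  qed
qed

end


section \<open>The residual extension\<close>

text \<open>The residual representation has entries \<open>\<psi>1\<close>, \<open>e\<close>, \<open>0\<close>, \<open>\<psi>2\<close>, where \<open>e = \<psi>2 c\<close> for a
  cocycle \<open>c\<close>.  The conditions on \<open>H\<^sup>1\<close> and \<open>H\<^sup>2\<close> are stated for cochains multiplied in the same way by \<open>\<psi>2\<close>,
  which is the form in which upper right entries of matrices satisfy them.\<close>

locale residual_extension = F?: field F + G?: group G for F :: "'k ring" (structure) and G :: "'g monoid" (structure) +
  fixes \<tau> :: "'g topology" and \<psi>1 \<psi>2 e :: "'g \<Rightarrow> 'k" and u :: 'g
  assumes finite_F: "finite (carrier F)"
    and compact: "compact_space \<tau>" and top: "topspace \<tau> = carrier G"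
    and mult_cont: "continuous_map (prod_topology \<tau> \<tau>) \<tau> (\<lambda>(g, h). g \<otimes>\<^bsub>G\<^esub> h)"
    and psi1_closed [simp]: "g \<in> carrier G \<Longrightarrow> \<psi>1 g \<in> carrier F"
    and psi2_closed [simp]: "g \<in> carrier G \<Longrightarrow> \<psi>2 g \<in> carrier F"
    and psi1_mult: "g \<in> carrier G \<Longrightarrow> h \<in> carrier G \<Longrightarrow> \<psi>1 (g \<otimes>\<^bsub>G\<^esub> h) = \<psi>1 g \<otimes> \<psi>1 h"
    and psi2_mult: "g \<in> carrier G \<Longrightarrow> h \<in> carrier G \<Longrightarrow> \<psi>2 (g \<otimes>\<^bsub>G\<^esub> h) = \<psi>2 g \<otimes> \<psi>2 h"
    and psi1_one: "\<psi>1 \<one>\<^bsub>G\<^esub> = \<one>" and psi2_one: "\<psi>2 \<one>\<^bsub>G\<^esub> = \<one>"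
    and psi1_near: "near \<tau> (\<lambda>g h. \<psi>1 h = \<psi>1 g)"
    and psi2_near: "near \<tau> (\<lambda>g h. \<psi>2 h = \<psi>2 g)"
    and u [simp]: "u \<in> carrier G" and psi_u: "\<psi>1 u \<noteq> \<psi>2 u"
    and e_closed [simp]: "g \<in> carrier G \<Longrightarrow> e g \<in> carrier F"
    and e_near: "near \<tau> (\<lambda>g h. e h = e g)"
    and e_mult: "g \<in> carrier G \<Longrightarrow> h \<in> carrier G \<Longrightarrow> e (g \<otimes>\<^bsub>G\<^esub> h) = \<psi>1 g \<otimes> e h \<oplus> \<psi>2 h \<otimes> e g"
    and e_nontrivial: "v \<in> carrier F \<Longrightarrow> \<exists>g\<in>carrier G. e g \<noteq> v \<otimes> (\<psi>1 g \<ominus> \<psi>2 g)"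
    and H1: "\<And>f. (\<And>g. g \<in> carrier G \<Longrightarrow> f g \<in> carrier F) \<Longrightarrow> near \<tau> (\<lambda>g h. f h = f g) \<Longrightarrow>
      (\<And>g h. g \<in> carrier G \<Longrightarrow> h \<in> carrier G \<Longrightarrow> f (g \<otimes>\<^bsub>G\<^esub> h) = \<psi>1 g \<otimes> f h \<oplus> \<psi>2 h \<otimes> f g) \<Longrightarrow>
      \<exists>s\<in>carrier F. \<exists>v\<in>carrier F. \<forall>g\<in>carrier G. f g = s \<otimes> e g \<oplus> v \<otimes> (\<psi>1 g \<ominus> \<psi>2 g)"
    and H2: "\<And>z. (\<And>g h. g \<in> carrier G \<Longrightarrow> h \<in> carrier G \<Longrightarrow> z g h \<in> carrier F) \<Longrightarrow>
      near (prod_topology \<tau> \<tau>) (\<lambda>s s'. z (fst s') (snd s') = z (fst s) (snd s)) \<Longrightarrow>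
      (\<And>g h k. g \<in> carrier G \<Longrightarrow> h \<in> carrier G \<Longrightarrow> k \<in> carrier G \<Longrightarrow>
        z g (h \<otimes>\<^bsub>G\<^esub> k) \<oplus> \<psi>1 g \<otimes> z h k = z (g \<otimes>\<^bsub>G\<^esub> h) k \<oplus> z g h \<otimes> \<psi>2 k) \<Longrightarrow>
      \<exists>f. (\<forall>g\<in>carrier G. f g \<in> carrier F) \<and> near \<tau> (\<lambda>g h. f h = f g) \<and>
        (\<forall>g\<in>carrier G. \<forall>h\<in>carrier G. z g h = \<psi>1 g \<otimes> f h \<oplus> \<psi>2 h \<otimes> f g \<ominus> f (g \<otimes>\<^bsub>G\<^esub> h))"
begin

text \<open>\<open>e\<close> is changed by the coboundary that makes it vanish at \<open>u\<close>:
  \<open>\<beta>\<close> is the upper right entry in a basis where the residual matrix of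
  \<open>u\<close> is diagonal. At \<open>r0\<close> it is non-zero, and \<open>r0\<close> is the
  element whose upper right entry generates all others.\<close>

definition "v0 = e u \<otimes> inv (\<psi>1 u \<ominus> \<psi>2 u)"
definition "\<beta> g = e g \<ominus> v0 \<otimes> (\<psi>1 g \<ominus> \<psi>2 g)"
definition "r0 = (SOME g. g \<in> carrier G \<and> \<beta> g \<noteq> \<zero>)"

lemma psi_diff_unit: "\<psi>1 u \<ominus> \<psi>2 u \<in> Units F"
  using psi_u field_Units by simp

lemma v0_closed [simp]: "v0 \<in> carrier F"
  using psi_diff_unit by (simp add: v0_def)

lemma beta_closed [simp]: "g \<in> carrier G \<Longrightarrow> \<beta> g \<in> carrier F"
  by (simp add: \<beta>_def)

lemma beta_u: "\<beta> u = \<zero>"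
  using psi_diff_unit by (simp add: \<beta>_def v0_def F.m_assoc a_minus_def F.r_neg)

lemma r0: "r0 \<in> carrier G" "\<beta> r0 \<noteq> \<zero>"
proof -
  obtain g where g: "g \<in> carrier G" "e g \<noteq> v0 \<otimes> (\<psi>1 g \<ominus> \<psi>2 g)" using e_nontrivial[OF v0_closed] by metis
  then have "\<beta> g \<noteq> \<zero>" by (simp add: \<beta>_def)
  then have "\<exists>g. g \<in> carrier G \<and> \<beta> g \<noteq> \<zero>" using g(1) by blast
  from someI_ex[OF this] show "r0 \<in> carrier G" "\<beta> r0 \<noteq> \<zero>" by (simp_all add: r0_def)
qed

text \<open>Vanishing at \<open>u\<close> removes the freedom of adding a multiple of
  \<open>\<psi>1 - \<psi>2\<close>, since this function is non-zero at \<open>u\<close>.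
  One-dimensional cohomology thus becomes a one-dimensional space of normalised cocycles.\<close>

lemma cocycle_multiple_beta:
  assumes f: "\<And>g. g \<in> carrier G \<Longrightarrow> f g \<in> carrier F" "near \<tau> (\<lambda>g h. f h = f g)"
    "\<And>g h. g \<in> carrier G \<Longrightarrow> h \<in> carrier G \<Longrightarrow> f (g \<otimes>\<^bsub>G\<^esub> h) = \<psi>1 g \<otimes> f h \<oplus> \<psi>2 h \<otimes> f g"
    and fu: "f u = \<zero>"
  obtains s where "s \<in> carrier F" "\<And>g. g \<in> carrier G \<Longrightarrow> f g = s \<otimes> \<beta> g"
proof -
  obtain s v where s: "s \<in> carrier F" "v \<in> carrier F"
    and fg: "\<And>g. g \<in> carrier G \<Longrightarrow> f g = s \<otimes> e g \<oplus> v \<otimes> (\<psi>1 g \<ominus> \<psi>2 g)"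
    using H1[of f] f by metis
  define w where "w = v \<oplus> s \<otimes> v0"
  have w: "w \<in> carrier F" using s by (simp add: w_def)
  have fb: "f g = s \<otimes> \<beta> g \<oplus> w \<otimes> (\<psi>1 g \<ominus> \<psi>2 g)" if g: "g \<in> carrier G" for g
    unfolding fg[OF g] \<beta>_def w_def
    using s v0_closed e_closed[OF g] psi1_closed[OF g] psi2_closed[OF g] by algebra
  have "w \<otimes> (\<psi>1 u \<ominus> \<psi>2 u) = \<zero>" using fb[OF u] fu s w by (simp add: beta_u)
  then have "w = \<zero>" using psi_diff_unit w F.integral[of w "\<psi>1 u \<ominus> \<psi>2 u"] psi_u by simp
  then show ?thesis using that[of s] s fb by simp
qed

lemma cocycle_zero:
  assumes f: "\<And>g. g \<in> carrier G \<Longrightarrow> f g \<in> carrier F" "near \<tau> (\<lambda>g h. f h = f g)"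
    "\<And>g h. g \<in> carrier G \<Longrightarrow> h \<in> carrier G \<Longrightarrow> f (g \<otimes>\<^bsub>G\<^esub> h) = \<psi>1 g \<otimes> f h \<oplus> \<psi>2 h \<otimes> f g"
    and fu: "f u = \<zero>" "f r0 = \<zero>" and g: "g \<in> carrier G"
  shows "f g = \<zero>"
proof -
  obtain s where s: "s \<in> carrier F" "\<And>g. g \<in> carrier G \<Longrightarrow> f g = s \<otimes> \<beta> g"
    using cocycle_multiple_beta[OF f fu(1)] by metis
  have "s \<otimes> \<beta> r0 = \<zero>" using s(2)[OF r0(1)] fu(2) by simp
  then have "s = \<zero>" using F.integral[of s "\<beta> r0"] s(1) r0 by simp
  then show ?thesis using s(2)[OF g] g by simp
qed

end

text \<open>Since \<open>H\<^sup>1\<close> is one-dimensional, the module spanned by a family of upper right entries is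
  generated by the entry at a single group element.  A functional on the span that kills this entry is
  obtained from a maximal submodule, and gives a cocycle that vanishes by \<open>cocycle_zero\<close>.\<close>

locale entry_family = residual_extension F G \<tau> \<psi>1 \<psi>2 e u + R?: local_map R F \<pi> + H: ring_hom_cring R S \<Psi>
  for F :: "'k ring" (structure) and G :: "'g monoid" (structure) and \<tau> \<psi>1 \<psi>2 e u
    and R :: "('r, 'm) ring_scheme" (structure) and \<pi> and S :: "('s, 'n) ring_scheme" (structure) and \<Psi> +
  fixes a d :: "'g \<Rightarrow> 'r" and b :: "'g \<Rightarrow> 'x \<Rightarrow> 's"
  assumes a_res: "g \<in> carrier G \<Longrightarrow> a g \<in> carrier R \<and> \<pi> (a g) = \<psi>1 g"
    and d_res: "g \<in> carrier G \<Longrightarrow> d g \<in> carrier R \<and> \<pi> (d g) = \<psi>2 g"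
    and b_closed: "g \<in> carrier G \<Longrightarrow> b g k \<in> carrier S"
    and b_mult: "g \<in> carrier G \<Longrightarrow> h \<in> carrier G \<Longrightarrow>
      b (g \<otimes>\<^bsub>G\<^esub> h) k = \<Psi> (a g) \<otimes>\<^bsub>S\<^esub> b h k \<oplus>\<^bsub>S\<^esub> \<Psi> (d h) \<otimes>\<^bsub>S\<^esub> b g k"
    and b_u: "b u k = \<zero>\<^bsub>S\<^esub>"
    and b_near: "near \<tau> (\<lambda>g h. b h = b g)"
begin

text \<open>The ambient module consists of all functions from the index type to \<open>S\<close>,
  with \<open>R\<close> acting through \<open>\<Psi>\<close>. Treating \<open>b g\<close> as a
  single vector yields coefficients that are valid for all indices at once.\<close>

definition submod :: "('x \<Rightarrow> 's) set \<Rightarrow> bool" where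
  "submod N \<longleftrightarrow> (\<forall>f\<in>N. \<forall>k. f k \<in> carrier S) \<and> (\<lambda>k. \<zero>\<^bsub>S\<^esub>) \<in> N \<and>
     (\<forall>f\<in>N. \<forall>f'\<in>N. (\<lambda>k. f k \<oplus>\<^bsub>S\<^esub> f' k) \<in> N) \<and>
     (\<forall>r\<in>carrier R. \<forall>f\<in>N. (\<lambda>k. \<Psi> r \<otimes>\<^bsub>S\<^esub> f k) \<in> N)"

lemma submodD:
  assumes "submod N"
  shows "f \<in> N \<Longrightarrow> f k \<in> carrier S" "(\<lambda>k. \<zero>\<^bsub>S\<^esub>) \<in> N"
    "f \<in> N \<Longrightarrow> f' \<in> N \<Longrightarrow> (\<lambda>k. f k \<oplus>\<^bsub>S\<^esub> f' k) \<in> N"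
    "r \<in> carrier R \<Longrightarrow> f \<in> N \<Longrightarrow> (\<lambda>k. \<Psi> r \<otimes>\<^bsub>S\<^esub> f k) \<in> N"
  using assms unfolding submod_def by simp_all

lemma submod_comb:
  assumes N: "submod N" "f \<in> N" "f' \<in> N" "r \<in> carrier R" "r' \<in> carrier R"
    and eq: "\<And>k. h k = \<Psi> r \<otimes>\<^bsub>S\<^esub> f k \<oplus>\<^bsub>S\<^esub> \<Psi> r' \<otimes>\<^bsub>S\<^esub> f' k"
  shows "h \<in> N"
proof -
  have "h = (\<lambda>k. \<Psi> r \<otimes>\<^bsub>S\<^esub> f k \<oplus>\<^bsub>S\<^esub> \<Psi> r' \<otimes>\<^bsub>S\<^esub> f' k)" using eq by (rule ext)
  then show ?thesis
    using submodD(3)[OF N(1) submodD(4)[OF N(1,4,2)] submodD(4)[OF N(1,5,3)]] by simp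
qed

lemma submod_Union:
  assumes "C \<noteq> {}" "\<And>N. N \<in> C \<Longrightarrow> submod N" "\<And>N N'. N \<in> C \<Longrightarrow> N' \<in> C \<Longrightarrow> N \<subseteq> N' \<or> N' \<subseteq> N"
  shows "submod (\<Union>C)"
proof -
  have "(\<lambda>k. f k \<oplus>\<^bsub>S\<^esub> f' k) \<in> \<Union>C" if ff: "f \<in> \<Union>C" "f' \<in> \<Union>C" for f f'
  proof -
    obtain N N' where N: "N \<in> C" "f \<in> N" "N' \<in> C" "f' \<in> N'" using ff by (elim UnionE)
    then obtain M where "M \<in> C" "f \<in> M" "f' \<in> M" using assms(3)[of N N'] by (metis subsetD)
    then show ?thesis using submodD(3)[OF assms(2)] by (metis UnionI)
  qed
  moreover have "(\<lambda>k. \<zero>\<^bsub>S\<^esub>) \<in> \<Union>C" using assms(1) submodD(2)[OF assms(2)] by (metis UnionI ex_in_conv)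
  moreover have "f k \<in> carrier S" if "f \<in> \<Union>C" for f k
    using that submodD(1)[OF assms(2)] by (metis UnionE)
  moreover have "(\<lambda>k. \<Psi> r \<otimes>\<^bsub>S\<^esub> f k) \<in> \<Union>C" if "r \<in> carrier R" "f \<in> \<Union>C" for f r
    using that submodD(4)[OF assms(2)] by (metis UnionE UnionI)
  ultimately show ?thesis unfolding submod_def by (intro conjI ballI allI)
qed

lemma generation_mod_mm:
  assumes N: "submod N" "b r0 \<in> N" and mN: "\<And>s g. s \<in> mm \<Longrightarrow> g \<in> carrier G \<Longrightarrow> (\<lambda>k. \<Psi> s \<otimes>\<^bsub>S\<^esub> b g k) \<in> N"
    and g1: "g1 \<in> carrier G"
  shows "b g1 \<in> N"
proof (rule ccontr)
  assume nin: "b g1 \<notin> N"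
  \<comment> \<open>A submodule that is maximal among those missing \<open>b g1\<close> plays the
    part of a hyperplane: modulo it the entries span a line over the residue field.\<close>
  define \<A> where "\<A> = {M. submod M \<and> N \<subseteq> M \<and> b g1 \<notin> M}"
  have "\<exists>M\<in>\<A>. \<forall>X\<in>\<A>. M \<subseteq> X \<longrightarrow> X = M"
  proof (rule subset_Zorn_nonempty)
    have "N \<in> \<A>" using nin N(1) by (simp add: \<A>_def)
    then show "\<A> \<noteq> {}" by (metis empty_iff)
    fix C assume C: "C \<noteq> {}" "subset.chain \<A> C"
    then have CA: "M \<in> \<A>" and ch: "M' \<in> C \<Longrightarrow> M \<subseteq> M' \<or> M' \<subseteq> M" if "M \<in> C" for M M'
      using that unfolding subset_chain_def by (metis subsetD, metis)
    have "submod (\<Union>C)" using submod_Union[OF C(1) _ ch] CA by (simp add: \<A>_def)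
    moreover have "N \<subseteq> \<Union>C" using C(1) CA by (metis (mono_tags, lifting) Sup_upper2 \<A>_def ex_in_conv mem_Collect_eq)
    moreover have "b g1 \<notin> \<Union>C" using CA by (metis (mono_tags, lifting) UnionE \<A>_def mem_Collect_eq)
    ultimately show "\<Union>C \<in> \<A>" by (simp add: \<A>_def)
  qed
  then obtain M where MA: "M \<in> \<A>" and max: "\<And>X. X \<in> \<A> \<Longrightarrow> M \<subseteq> X \<Longrightarrow> X = M" by metis
  have M: "submod M" and NM: "N \<subseteq> M" and yM: "b g1 \<notin> M" using MA by (simp_all add: \<A>_def)
  let ?y = "b g1"
  have yc: "?y k \<in> carrier S" for k using b_closed[OF g1] .
  have coeff: "\<exists>t\<in>carrier R. (\<lambda>k. b g k \<ominus>\<^bsub>S\<^esub> \<Psi> t \<otimes>\<^bsub>S\<^esub> ?y k) \<in> M" if g: "g \<in> carrier G" for g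
  proof -
    have zc: "b g k \<in> carrier S" for k using b_closed[OF g] .
    \<comment> \<open>This is \<open>M + R b(g)\<close>. By maximality it equals \<open>M\<close> or
      contains \<open>b g1\<close>. In the second case the coefficient of \<open>b g\<close> is a
      unit, because multiples of \<open>b g\<close> by \<open>mm\<close> lie in \<open>N\<close>,
      and one can solve for \<open>b g\<close>.\<close>
    define M' where "M' = {f. \<exists>n\<in>M. \<exists>t\<in>carrier R. f = (\<lambda>k. n k \<oplus>\<^bsub>S\<^esub> \<Psi> t \<otimes>\<^bsub>S\<^esub> b g k)}"
    have inM': "f \<in> M'" if "n \<in> M" "t \<in> carrier R" "\<And>k. f k = n k \<oplus>\<^bsub>S\<^esub> \<Psi> t \<otimes>\<^bsub>S\<^esub> b g k" for f n t
      using that(1,2) ext[of f "\<lambda>k. n k \<oplus>\<^bsub>S\<^esub> \<Psi> t \<otimes>\<^bsub>S\<^esub> b g k", OF that(3)]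
      unfolding M'_def by (intro CollectI bexI[of _ n] bexI[of _ t])
    have MM': "M \<subseteq> M'"
    proof
      fix f assume f: "f \<in> M"
      show "f \<in> M'" by (rule inM'[OF f R.zero_closed]) (simp add: submodD(1)[OF M f] zc)
    qed
    have zM': "b g \<in> M'" by (rule inM'[OF submodD(2)[OF M] R.one_closed]) (simp add: zc)
    have "submod M'"
      unfolding submod_def
    proof (intro conjI ballI allI)
      show "(\<lambda>k. \<zero>\<^bsub>S\<^esub>) \<in> M'" using MM' submodD(2)[OF M] by (rule subsetD)
      fix f assume "f \<in> M'"
      then obtain n t where n: "n \<in> M" "t \<in> carrier R" "f = (\<lambda>k. n k \<oplus>\<^bsub>S\<^esub> \<Psi> t \<otimes>\<^bsub>S\<^esub> b g k)"
        unfolding M'_def by (elim CollectE bexE)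
      have nc: "n k \<in> carrier S" for k using submodD(1)[OF M n(1)] .
      show "f k \<in> carrier S" for k using n(2) nc zc by (simp add: n(3))
      {
        fix f' assume "f' \<in> M'"
        then obtain n' t' where n': "n' \<in> M" "t' \<in> carrier R" "f' = (\<lambda>k. n' k \<oplus>\<^bsub>S\<^esub> \<Psi> t' \<otimes>\<^bsub>S\<^esub> b g k)"
          unfolding M'_def by (elim CollectE bexE)
        have nc': "n' k \<in> carrier S" for k using submodD(1)[OF M n'(1)] .
        show "(\<lambda>k. f k \<oplus>\<^bsub>S\<^esub> f' k) \<in> M'"
        proof (rule inM'[OF submodD(3)[OF M n(1) n'(1)] R.a_closed[OF n(2) n'(2)]])
          fix k
          have t: "\<Psi> t \<in> carrier S" "\<Psi> t' \<in> carrier S" using n(2) n'(2) by simp_all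
          have "n k \<oplus>\<^bsub>S\<^esub> \<Psi> t \<otimes>\<^bsub>S\<^esub> b g k \<oplus>\<^bsub>S\<^esub> (n' k \<oplus>\<^bsub>S\<^esub> \<Psi> t' \<otimes>\<^bsub>S\<^esub> b g k) =
             n k \<oplus>\<^bsub>S\<^esub> n' k \<oplus>\<^bsub>S\<^esub> (\<Psi> t \<oplus>\<^bsub>S\<^esub> \<Psi> t') \<otimes>\<^bsub>S\<^esub> b g k" using t nc nc' zc by algebra
          then show "f k \<oplus>\<^bsub>S\<^esub> f' k = n k \<oplus>\<^bsub>S\<^esub> n' k \<oplus>\<^bsub>S\<^esub> \<Psi> (t \<oplus>\<^bsub>R\<^esub> t') \<otimes>\<^bsub>S\<^esub> b g k"
            using n(2) n'(2) by (simp add: n(3) n'(3))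
        qed
      }
      fix r assume r: "r \<in> carrier R"
      show "(\<lambda>k. \<Psi> r \<otimes>\<^bsub>S\<^esub> f k) \<in> M'"
        by (rule inM'[OF submodD(4)[OF M r n(1)] R.m_closed[OF r n(2)]])
          (use r n(2) nc zc in \<open>simp add: n(3) H.S.r_distr H.S.m_assoc\<close>)
    qed
    show ?thesis
    proof (cases "?y \<in> M'")
      case False
      then have "M' = M" using max[OF _ MM'] \<open>submod M'\<close> NM MM' by (simp add: \<A>_def)
      then have "b g \<in> M" using zM' by simp
      moreover have "(\<lambda>k. b g k \<ominus>\<^bsub>S\<^esub> \<Psi> \<zero>\<^bsub>R\<^esub> \<otimes>\<^bsub>S\<^esub> ?y k) = b g"
        using zc yc by (intro ext) (simp add: a_minus_def)
      ultimately show ?thesis by (intro bexI[of _ "\<zero>\<^bsub>R\<^esub>"]) simp_all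
    next
      case True
      then obtain n t where n: "n \<in> M" "t \<in> carrier R" "?y = (\<lambda>k. n k \<oplus>\<^bsub>S\<^esub> \<Psi> t \<otimes>\<^bsub>S\<^esub> b g k)"
        unfolding M'_def by (elim CollectE bexE)
      have nc: "n k \<in> carrier S" for k using submodD(1)[OF M n(1)] .
      have "t \<notin> mm"
      proof
        assume "t \<in> mm"
        then have "(\<lambda>k. \<Psi> t \<otimes>\<^bsub>S\<^esub> b g k) \<in> M" using mN[OF _ g] NM by (metis subsetD)
        from submodD(3)[OF M n(1) this] show False using yM n(3) by simp
      qed
      then have tu: "t \<in> Units R" using n(2) mm_iff residue_unit by simp
      let ?i = "inv\<^bsub>R\<^esub> t"
      have ic: "?i \<in> carrier R" using tu by simp
      have "\<Psi> ?i \<otimes>\<^bsub>S\<^esub> \<Psi> t = \<one>\<^bsub>S\<^esub>" using tu n(2) ic H.hom_mult[OF ic n(2)] by simp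
      have "(\<lambda>k. b g k \<ominus>\<^bsub>S\<^esub> \<Psi> ?i \<otimes>\<^bsub>S\<^esub> ?y k) \<in> M"
      proof (rule submod_comb[OF M n(1) n(1) R.a_inv_closed[OF ic] R.zero_closed])
        fix k
        have "b g k = (\<Psi> ?i \<otimes>\<^bsub>S\<^esub> \<Psi> t) \<otimes>\<^bsub>S\<^esub> b g k" using \<open>\<Psi> ?i \<otimes>\<^bsub>S\<^esub> \<Psi> t = \<one>\<^bsub>S\<^esub>\<close> zc by simp
        moreover have "?y k = n k \<oplus>\<^bsub>S\<^esub> \<Psi> t \<otimes>\<^bsub>S\<^esub> b g k" using fun_cong[OF n(3)] .
        moreover have "(\<Psi> ?i \<otimes>\<^bsub>S\<^esub> \<Psi> t) \<otimes>\<^bsub>S\<^esub> b g k \<ominus>\<^bsub>S\<^esub> \<Psi> ?i \<otimes>\<^bsub>S\<^esub> (n k \<oplus>\<^bsub>S\<^esub> \<Psi> t \<otimes>\<^bsub>S\<^esub> b g k) = \<ominus>\<^bsub>S\<^esub> \<Psi> ?i \<otimes>\<^bsub>S\<^esub> n k"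
          using H.hom_closed[OF ic] H.hom_closed[OF n(2)] zc nc by algebra
        ultimately show "b g k \<ominus>\<^bsub>S\<^esub> \<Psi> ?i \<otimes>\<^bsub>S\<^esub> ?y k = \<Psi> (\<ominus>\<^bsub>R\<^esub> ?i) \<otimes>\<^bsub>S\<^esub> n k \<oplus>\<^bsub>S\<^esub> \<Psi> \<zero>\<^bsub>R\<^esub> \<otimes>\<^bsub>S\<^esub> n k"
          using nc ic by simp
      qed
      then show ?thesis using ic by (intro bexI[of _ ?i])
    qed
  qed
  then obtain t where t: "\<And>g. g \<in> carrier G \<Longrightarrow> t g \<in> carrier R \<and> (\<lambda>k. b g k \<ominus>\<^bsub>S\<^esub> \<Psi> (t g) \<otimes>\<^bsub>S\<^esub> ?y k) \<in> M"
    by metis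
  \<comment> \<open>Two coefficients with different residues differ by a unit, and then
    \<open>b g1\<close> itself would lie in \<open>M\<close>.\<close>
  have uniq: "\<pi> s = \<pi> s'" if s: "s \<in> carrier R" "s' \<in> carrier R" and z: "\<And>k. z k \<in> carrier S"
      and m: "(\<lambda>k. z k \<ominus>\<^bsub>S\<^esub> \<Psi> s \<otimes>\<^bsub>S\<^esub> ?y k) \<in> M" "(\<lambda>k. z k \<ominus>\<^bsub>S\<^esub> \<Psi> s' \<otimes>\<^bsub>S\<^esub> ?y k) \<in> M" for s s' z
  proof (rule ccontr)
    assume "\<pi> s \<noteq> \<pi> s'"
    then have "\<pi> (s' \<ominus>\<^bsub>R\<^esub> s) \<noteq> \<zero>" using s by simp
    then have un: "s' \<ominus>\<^bsub>R\<^esub> s \<in> Units R" using s by (intro residue_unit) simp_all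
    let ?i = "inv\<^bsub>R\<^esub> (s' \<ominus>\<^bsub>R\<^esub> s)"
    have ic: "?i \<in> carrier R" using un by simp
    have "?i \<otimes>\<^bsub>R\<^esub> (s' \<ominus>\<^bsub>R\<^esub> s) = \<one>\<^bsub>R\<^esub>" using un by simp
    then have one: "\<Psi> ?i \<otimes>\<^bsub>S\<^esub> (\<Psi> s' \<ominus>\<^bsub>S\<^esub> \<Psi> s) = \<one>\<^bsub>S\<^esub>" using H.hom_mult[OF ic, of "s' \<ominus>\<^bsub>R\<^esub> s"] s by simp
    have "?y \<in> M"
    proof (rule submod_comb[OF M m ic R.a_inv_closed[OF ic]])
      fix k
      have "?y k = (\<Psi> ?i \<otimes>\<^bsub>S\<^esub> (\<Psi> s' \<ominus>\<^bsub>S\<^esub> \<Psi> s)) \<otimes>\<^bsub>S\<^esub> ?y k" using one yc by simp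
      also have "\<dots> = \<Psi> ?i \<otimes>\<^bsub>S\<^esub> (z k \<ominus>\<^bsub>S\<^esub> \<Psi> s \<otimes>\<^bsub>S\<^esub> ?y k) \<oplus>\<^bsub>S\<^esub> (\<ominus>\<^bsub>S\<^esub> \<Psi> ?i) \<otimes>\<^bsub>S\<^esub> (z k \<ominus>\<^bsub>S\<^esub> \<Psi> s' \<otimes>\<^bsub>S\<^esub> ?y k)"
        using H.hom_closed[OF ic] H.hom_closed[OF s(1)] H.hom_closed[OF s(2)] z yc by algebra
      finally show "?y k = \<Psi> ?i \<otimes>\<^bsub>S\<^esub> (z k \<ominus>\<^bsub>S\<^esub> \<Psi> s \<otimes>\<^bsub>S\<^esub> ?y k) \<oplus>\<^bsub>S\<^esub> \<Psi> (\<ominus>\<^bsub>R\<^esub> ?i) \<otimes>\<^bsub>S\<^esub> (z k \<ominus>\<^bsub>S\<^esub> \<Psi> s' \<otimes>\<^bsub>S\<^esub> ?y k)"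
        using ic by simp
    qed
    then show False using yM by simp
  qed
  \<comment> \<open>The coordinate on the line, evaluated at the entries. It inherits the cocycle
    rule from \<open>b_mult\<close> and vanishes at \<open>u\<close> and \<open>r0\<close>, yet it
    takes the value one at \<open>g1\<close>.\<close>
  define \<phi> where "\<phi> g = \<pi> (t g)" for g
  have phi: "\<phi> g = \<pi> s" if g: "g \<in> carrier G" and s: "s \<in> carrier R" and m: "(\<lambda>k. b g k \<ominus>\<^bsub>S\<^esub> \<Psi> s \<otimes>\<^bsub>S\<^esub> ?y k) \<in> M" for g s
    unfolding \<phi>_def using t[OF g] by (intro uniq[OF _ s b_closed[OF g] _ m]) simp_all
  have "\<phi> g1 = \<zero>"
  proof (rule cocycle_zero[where f = \<phi>])
    show "\<phi> g \<in> carrier F" if "g \<in> carrier G" for g using t[OF that] by (simp add: \<phi>_def)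
    show "near \<tau> (\<lambda>g h. \<phi> h = \<phi> g)"
    proof (rule near_mono[OF b_near])
      fix g h assume gh: "g \<in> topspace \<tau>" "h \<in> topspace \<tau>" "b h = b g"
      have "\<phi> h = \<pi> (t g)" using t[of g] gh top by (intro phi) simp_all
      then show "\<phi> h = \<phi> g" by (simp add: \<phi>_def)
    qed
    show "\<phi> (g \<otimes>\<^bsub>G\<^esub> h) = \<psi>1 g \<otimes> \<phi> h \<oplus> \<psi>2 h \<otimes> \<phi> g" if g: "g \<in> carrier G" "h \<in> carrier G" for g h
    proof -
      note tg = t[OF g(1)] and th = t[OF g(2)] and ag = a_res[OF g(1)] and dh = d_res[OF g(2)]
      let ?s = "a g \<otimes>\<^bsub>R\<^esub> t h \<oplus>\<^bsub>R\<^esub> d h \<otimes>\<^bsub>R\<^esub> t g"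
      have sc: "?s \<in> carrier R" using tg th ag dh by simp
      have "\<phi> (g \<otimes>\<^bsub>G\<^esub> h) = \<pi> ?s"
      proof (rule phi[OF G.m_closed[OF g] sc])
        show "(\<lambda>k. b (g \<otimes>\<^bsub>G\<^esub> h) k \<ominus>\<^bsub>S\<^esub> \<Psi> ?s \<otimes>\<^bsub>S\<^esub> ?y k) \<in> M"
        proof (rule submod_comb[OF M conjunct2[OF th] conjunct2[OF tg] conjunct1[OF ag] conjunct1[OF dh]])
          fix k
          have "\<Psi> (a g) \<otimes>\<^bsub>S\<^esub> b h k \<oplus>\<^bsub>S\<^esub> \<Psi> (d h) \<otimes>\<^bsub>S\<^esub> b g k \<ominus>\<^bsub>S\<^esub> (\<Psi> (a g) \<otimes>\<^bsub>S\<^esub> \<Psi> (t h) \<oplus>\<^bsub>S\<^esub> \<Psi> (d h) \<otimes>\<^bsub>S\<^esub> \<Psi> (t g)) \<otimes>\<^bsub>S\<^esub> ?y k =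
            \<Psi> (a g) \<otimes>\<^bsub>S\<^esub> (b h k \<ominus>\<^bsub>S\<^esub> \<Psi> (t h) \<otimes>\<^bsub>S\<^esub> ?y k) \<oplus>\<^bsub>S\<^esub> \<Psi> (d h) \<otimes>\<^bsub>S\<^esub> (b g k \<ominus>\<^bsub>S\<^esub> \<Psi> (t g) \<otimes>\<^bsub>S\<^esub> ?y k)"
            using H.hom_closed[OF conjunct1[OF ag]] H.hom_closed[OF conjunct1[OF dh]] H.hom_closed[OF conjunct1[OF tg]]
              H.hom_closed[OF conjunct1[OF th]] yc b_closed[OF g(1)] b_closed[OF g(2)] by algebra
          then show "b (g \<otimes>\<^bsub>G\<^esub> h) k \<ominus>\<^bsub>S\<^esub> \<Psi> ?s \<otimes>\<^bsub>S\<^esub> ?y k =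
            \<Psi> (a g) \<otimes>\<^bsub>S\<^esub> (b h k \<ominus>\<^bsub>S\<^esub> \<Psi> (t h) \<otimes>\<^bsub>S\<^esub> ?y k) \<oplus>\<^bsub>S\<^esub> \<Psi> (d h) \<otimes>\<^bsub>S\<^esub> (b g k \<ominus>\<^bsub>S\<^esub> \<Psi> (t g) \<otimes>\<^bsub>S\<^esub> ?y k)"
            using tg th ag dh by (simp add: b_mult[OF g])
        qed
      qed
      then show ?thesis using tg th ag dh by (simp add: \<phi>_def)
    qed
    have z0: "(\<lambda>k. \<zero>\<^bsub>S\<^esub> \<ominus>\<^bsub>S\<^esub> \<Psi> \<zero>\<^bsub>R\<^esub> \<otimes>\<^bsub>S\<^esub> ?y k) = (\<lambda>k. \<zero>\<^bsub>S\<^esub>)" using yc by (simp add: a_minus_def)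
    have "\<phi> u = \<pi> \<zero>\<^bsub>R\<^esub>" using z0 submodD(2)[OF M] by (intro phi) (simp_all add: b_u)
    then show "\<phi> u = \<zero>" by simp
    have "(\<lambda>k. b r0 k \<ominus>\<^bsub>S\<^esub> \<Psi> \<zero>\<^bsub>R\<^esub> \<otimes>\<^bsub>S\<^esub> ?y k) = b r0" using yc b_closed[OF r0(1)] by (simp add: a_minus_def)
    then have "\<phi> r0 = \<pi> \<zero>\<^bsub>R\<^esub>" using N(2) NM r0(1) by (intro phi) (simp_all add: subsetD)
    then show "\<phi> r0 = \<zero>" by simp
  qed (rule g1)
  moreover have "\<phi> g1 = \<pi> \<one>\<^bsub>R\<^esub>"
  proof (rule phi[OF g1 R.one_closed])
    have "(\<lambda>k. ?y k \<ominus>\<^bsub>S\<^esub> \<Psi> \<one>\<^bsub>R\<^esub> \<otimes>\<^bsub>S\<^esub> ?y k) = (\<lambda>k. \<zero>\<^bsub>S\<^esub>)" using yc by (simp add: a_minus_def H.S.r_neg)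
    then show "(\<lambda>k. ?y k \<ominus>\<^bsub>S\<^esub> \<Psi> \<one>\<^bsub>R\<^esub> \<otimes>\<^bsub>S\<^esub> ?y k) \<in> M" using submodD(2)[OF M] by simp
  qed
  ultimately show False by simp
qed

text \<open>Induction through colon submodules: \<open>N'\<close> consists of the functions that
  \<open>mpow n\<close> carries into \<open>N\<close>. It contains all multiples of entries by
  \<open>mm\<close>, so the preceding lemma puts every entry into \<open>N'\<close>, which lowers
  the exponent by one.\<close>

lemma generation_mod_mpow:
  assumes N: "submod N" "b r0 \<in> N"
    and mN: "\<And>s g. s \<in> mpow n \<Longrightarrow> g \<in> carrier G \<Longrightarrow> (\<lambda>k. \<Psi> s \<otimes>\<^bsub>S\<^esub> b g k) \<in> N"
    and g1: "g1 \<in> carrier G"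
  shows "b g1 \<in> N"
  using mN
proof (induction n)
  case 0
  have "(\<lambda>k. \<Psi> \<one>\<^bsub>R\<^esub> \<otimes>\<^bsub>S\<^esub> b g1 k) = b g1" using b_closed[OF g1] by simp
  then show ?case using "0"[OF _ g1, of "\<one>\<^bsub>R\<^esub>"] by simp
next
  case (Suc n)
  have mc: "s \<in> carrier R" if "s \<in> mpow n" for s using that ideal.Icarr[OF mpow_ideal] by metis
  define N' where "N' = {f. (\<forall>k. f k \<in> carrier S) \<and> (\<forall>s\<in>mpow n. (\<lambda>k. \<Psi> s \<otimes>\<^bsub>S\<^esub> f k) \<in> N)}"
  have "submod N'"
    unfolding submod_def
  proof (intro conjI ballI allI)
    show "f k \<in> carrier S" if "f \<in> N'" for f k using that by (simp add: N'_def)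
    have "(\<lambda>k. \<Psi> s \<otimes>\<^bsub>S\<^esub> \<zero>\<^bsub>S\<^esub>) \<in> N" if "s \<in> mpow n" for s using submodD(2)[OF N(1)] mc[OF that] by simp
    then show "(\<lambda>k. \<zero>\<^bsub>S\<^esub>) \<in> N'" by (simp add: N'_def)
    fix f assume f: "f \<in> N'"
    then have fc: "\<And>k. f k \<in> carrier S" by (simp add: N'_def)
    {
      fix f' assume f': "f' \<in> N'"
      then have fc': "\<And>k. f' k \<in> carrier S" by (simp add: N'_def)
      have "(\<lambda>k. \<Psi> s \<otimes>\<^bsub>S\<^esub> (f k \<oplus>\<^bsub>S\<^esub> f' k)) \<in> N" if s: "s \<in> mpow n" for s
      proof -
        have "(\<lambda>k. \<Psi> s \<otimes>\<^bsub>S\<^esub> f k) \<in> N" "(\<lambda>k. \<Psi> s \<otimes>\<^bsub>S\<^esub> f' k) \<in> N" using f f' s by (simp_all add: N'_def)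
        from submodD(3)[OF N(1) this] show ?thesis using fc fc' mc[OF s] by (simp add: H.S.r_distr)
      qed
      then show "(\<lambda>k. f k \<oplus>\<^bsub>S\<^esub> f' k) \<in> N'" using fc fc' by (simp add: N'_def)
    }
    fix r assume r: "r \<in> carrier R"
    have "(\<lambda>k. \<Psi> s \<otimes>\<^bsub>S\<^esub> (\<Psi> r \<otimes>\<^bsub>S\<^esub> f k)) \<in> N" if s: "s \<in> mpow n" for s
    proof -
      have "s \<otimes>\<^bsub>R\<^esub> r \<in> mpow n" using ideal.I_r_closed[OF mpow_ideal s r] .
      then have "(\<lambda>k. \<Psi> (s \<otimes>\<^bsub>R\<^esub> r) \<otimes>\<^bsub>S\<^esub> f k) \<in> N" using f by (simp add: N'_def)
      then show ?thesis using fc mc[OF s] r by (simp add: H.S.m_assoc)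
    qed
    then show "(\<lambda>k. \<Psi> r \<otimes>\<^bsub>S\<^esub> f k) \<in> N'" using fc r by (simp add: N'_def)
  qed
  moreover have "b r0 \<in> N'"
    using submodD(4)[OF N(1) mc N(2)] b_closed[OF r0(1)] by (simp add: N'_def)
  moreover have "(\<lambda>k. \<Psi> s \<otimes>\<^bsub>S\<^esub> b g k) \<in> N'" if s: "s \<in> mm" and g: "g \<in> carrier G" for s g
  proof -
    have sc: "s \<in> carrier R" using s by (simp add: mm_iff)
    have "(\<lambda>k. \<Psi> s' \<otimes>\<^bsub>S\<^esub> (\<Psi> s \<otimes>\<^bsub>S\<^esub> b g k)) \<in> N" if s': "s' \<in> mpow n" for s'
    proof -
      have "(\<lambda>k. \<Psi> (s' \<otimes>\<^bsub>R\<^esub> s) \<otimes>\<^bsub>S\<^esub> b g k) \<in> N"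
        using Suc.prems[OF R.ideal_power_Suc_mem[OF s' s] g] .
      then show ?thesis using mc[OF s'] sc b_closed[OF g] by (simp add: H.S.m_assoc)
    qed
    then show ?thesis using sc b_closed[OF g] by (simp add: N'_def)
  qed
  ultimately have "b g \<in> N'" if "g \<in> carrier G" for g using generation_mod_mm[of N' g] that by simp
  then show ?case by (intro Suc.IH) (simp add: N'_def)
qed

text \<open>The case \<open>N = R b(r0)\<close>. Since \<open>\<Psi>\<close> kills
  \<open>mpow n\<close>, the module is annihilated by a power of \<open>mm\<close>; nilpotence
  stands in for the finiteness condition of Nakayama's lemma.\<close>

theorem generation:
  assumes nil: "\<And>s. s \<in> mpow n \<Longrightarrow> \<Psi> s = \<zero>\<^bsub>S\<^esub>" and g: "g \<in> carrier G"
  obtains r where "r \<in> carrier R" "\<And>k. b g k = \<Psi> r \<otimes>\<^bsub>S\<^esub> b r0 k"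
proof -
  let ?N = "{f. \<exists>r\<in>carrier R. f = (\<lambda>k. \<Psi> r \<otimes>\<^bsub>S\<^esub> b r0 k)}"
  have bc: "b r0 k \<in> carrier S" for k using b_closed[OF r0(1)] .
  have inN: "f \<in> ?N" if "r \<in> carrier R" "\<And>k. f k = \<Psi> r \<otimes>\<^bsub>S\<^esub> b r0 k" for f r
    using that(1) ext[of f "\<lambda>k. \<Psi> r \<otimes>\<^bsub>S\<^esub> b r0 k", OF that(2)] by (intro CollectI bexI[of _ r])
  have "submod ?N"
    unfolding submod_def
  proof (intro conjI ballI allI)
    show "(\<lambda>k. \<zero>\<^bsub>S\<^esub>) \<in> ?N" by (rule inN[OF R.zero_closed]) (simp add: bc)
    fix f assume "f \<in> ?N"
    then obtain r where r: "r \<in> carrier R" "f = (\<lambda>k. \<Psi> r \<otimes>\<^bsub>S\<^esub> b r0 k)" by (elim CollectE bexE)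
    show "f k \<in> carrier S" for k using r bc by simp
    show "(\<lambda>k. \<Psi> s \<otimes>\<^bsub>S\<^esub> f k) \<in> ?N" if s: "s \<in> carrier R" for s
      by (rule inN[OF R.m_closed[OF s r(1)]]) (use r s bc in \<open>simp add: H.S.m_assoc\<close>)
    fix f' assume "f' \<in> ?N"
    then obtain r' where r': "r' \<in> carrier R" "f' = (\<lambda>k. \<Psi> r' \<otimes>\<^bsub>S\<^esub> b r0 k)" by (elim CollectE bexE)
    show "(\<lambda>k. f k \<oplus>\<^bsub>S\<^esub> f' k) \<in> ?N"
      by (rule inN[OF R.a_closed[OF r(1) r'(1)]]) (use r r' bc in \<open>simp add: H.S.l_distr\<close>)
  qed
  moreover have "b r0 \<in> ?N" by (rule inN[OF R.one_closed]) (simp add: bc)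
  moreover have "(\<lambda>k. \<Psi> s \<otimes>\<^bsub>S\<^esub> b h k) \<in> ?N" if "s \<in> mpow n" "h \<in> carrier G" for s h
    by (rule inN[OF R.zero_closed]) (simp add: nil[OF that(1)] bc b_closed[OF that(2)])
  ultimately have "b g \<in> ?N" by (rule generation_mod_mpow[OF _ _ _ g])
  then obtain r where "r \<in> carrier R" "b g = (\<lambda>k. \<Psi> r \<otimes>\<^bsub>S\<^esub> b r0 k)" by (elim CollectE bexE)
  then show ?thesis using that[of r] by simp
qed

end


section \<open>The group of invertible matrices\<close>

lemma mat2_cases: obtains a b c d where "A = Mat2 a b c d"
  by (cases A) simp

context cring
begin

lemma GL2_iff: "Mat2 a b c d \<in> carrier (GL2 R) \<longleftrightarrow>
  a \<in> carrier R \<and> b \<in> carrier R \<and> c \<in> carrier R \<and> d \<in> carrier R \<and> a \<otimes> d \<ominus> b \<otimes> c \<in> Units R"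
  by (simp add: GL2_def mat2_det_def)

lemma GL2_mult: "Mat2 a b c d \<otimes>\<^bsub>GL2 R\<^esub> Mat2 a' b' c' d' =
  Mat2 (a \<otimes> a' \<oplus> b \<otimes> c') (a \<otimes> b' \<oplus> b \<otimes> d') (c \<otimes> a' \<oplus> d \<otimes> c') (c \<otimes> b' \<oplus> d \<otimes> d')"
  by (simp add: GL2_def mat2_mult_def)

lemma GL2_one: "\<one>\<^bsub>GL2 R\<^esub> = Mat2 \<one> \<zero> \<zero> \<one>"
  by (simp add: GL2_def)

lemma GL2_group: "group (GL2 R)"
proof (rule groupI)
  fix X Y assume X: "X \<in> carrier (GL2 R)" and Y: "Y \<in> carrier (GL2 R)"
  obtain a b c d where Xe: "X = Mat2 a b c d" by (rule mat2_cases)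
  obtain a' b' c' d' where Ye: "Y = Mat2 a' b' c' d'" by (rule mat2_cases)
  have x: "a \<in> carrier R" "b \<in> carrier R" "c \<in> carrier R" "d \<in> carrier R" "a \<otimes> d \<ominus> b \<otimes> c \<in> Units R"
    using X unfolding Xe GL2_iff by simp_all
  have y: "a' \<in> carrier R" "b' \<in> carrier R" "c' \<in> carrier R" "d' \<in> carrier R" "a' \<otimes> d' \<ominus> b' \<otimes> c' \<in> Units R"
    using Y unfolding Ye GL2_iff by simp_all
  have "(a \<otimes> a' \<oplus> b \<otimes> c') \<otimes> (c \<otimes> b' \<oplus> d \<otimes> d') \<ominus> (a \<otimes> b' \<oplus> b \<otimes> d') \<otimes> (c \<otimes> a' \<oplus> d \<otimes> c') =
    (a \<otimes> d \<ominus> b \<otimes> c) \<otimes> (a' \<otimes> d' \<ominus> b' \<otimes> c')"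
    using x(1-4) y(1-4) by algebra
  then show "X \<otimes>\<^bsub>GL2 R\<^esub> Y \<in> carrier (GL2 R)"
    using x y unfolding Xe Ye GL2_mult GL2_iff by simp
  fix Z assume Z: "Z \<in> carrier (GL2 R)"
  obtain a'' b'' c'' d'' where Ze: "Z = Mat2 a'' b'' c'' d''" by (rule mat2_cases)
  have z: "a'' \<in> carrier R" "b'' \<in> carrier R" "c'' \<in> carrier R" "d'' \<in> carrier R"
    using Z unfolding Ze GL2_iff by simp_all
  have assoc: "(s \<otimes> s' \<oplus> t \<otimes> v) \<otimes> w \<oplus> (s \<otimes> t' \<oplus> t \<otimes> v') \<otimes> w' = s \<otimes> (s' \<otimes> w \<oplus> t' \<otimes> w') \<oplus> t \<otimes> (v \<otimes> w \<oplus> v' \<otimes> w')"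
    if "s \<in> carrier R" "s' \<in> carrier R" "t \<in> carrier R" "t' \<in> carrier R" "v \<in> carrier R" "v' \<in> carrier R" "w \<in> carrier R" "w' \<in> carrier R"
    for s s' t t' v v' w w' using that by algebra
  show "X \<otimes>\<^bsub>GL2 R\<^esub> Y \<otimes>\<^bsub>GL2 R\<^esub> Z = X \<otimes>\<^bsub>GL2 R\<^esub> (Y \<otimes>\<^bsub>GL2 R\<^esub> Z)"
    unfolding Xe Ye Ze GL2_mult using x y z by (simp only: assoc)
next
  show "\<one>\<^bsub>GL2 R\<^esub> \<in> carrier (GL2 R)" unfolding GL2_one GL2_iff by (simp add: a_minus_def)
next
  fix X assume X: "X \<in> carrier (GL2 R)"
  obtain a b c d where Xe: "X = Mat2 a b c d" by (rule mat2_cases)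
  have x: "a \<in> carrier R" "b \<in> carrier R" "c \<in> carrier R" "d \<in> carrier R" and un: "a \<otimes> d \<ominus> b \<otimes> c \<in> Units R"
    using X unfolding Xe GL2_iff by simp_all
  show "\<one>\<^bsub>GL2 R\<^esub> \<otimes>\<^bsub>GL2 R\<^esub> X = X" unfolding Xe GL2_one GL2_mult using x by simp
  define i where "i = inv (a \<otimes> d \<ominus> b \<otimes> c)"
  have i: "i \<in> carrier R" "i \<otimes> (a \<otimes> d \<ominus> b \<otimes> c) = \<one>" using un by (simp_all add: i_def)
  let ?Y = "Mat2 (i \<otimes> d) (\<ominus> (i \<otimes> b)) (\<ominus> (i \<otimes> c)) (i \<otimes> a)"
  have "i \<otimes> d \<otimes> (i \<otimes> a) \<ominus> (\<ominus> (i \<otimes> b)) \<otimes> (\<ominus> (i \<otimes> c)) = i \<otimes> (i \<otimes> (a \<otimes> d \<ominus> b \<otimes> c))"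
    using x i(1) by algebra
  also have "\<dots> = i" using i by simp
  finally have "?Y \<in> carrier (GL2 R)" unfolding GL2_iff using x i un by (simp add: i_def)
  moreover have "?Y \<otimes>\<^bsub>GL2 R\<^esub> X = \<one>\<^bsub>GL2 R\<^esub>"
  proof -
    have "i \<otimes> d \<otimes> a \<oplus> (\<ominus> (i \<otimes> b)) \<otimes> c = i \<otimes> (a \<otimes> d \<ominus> b \<otimes> c)" "i \<otimes> d \<otimes> b \<oplus> (\<ominus> (i \<otimes> b)) \<otimes> d = \<zero>"
      "(\<ominus> (i \<otimes> c)) \<otimes> a \<oplus> i \<otimes> a \<otimes> c = \<zero>" "(\<ominus> (i \<otimes> c)) \<otimes> b \<oplus> i \<otimes> a \<otimes> d = i \<otimes> (a \<otimes> d \<ominus> b \<otimes> c)"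
      using x i(1) by algebra+
    then show ?thesis unfolding Xe GL2_mult GL2_one i(2) by simp
  qed
  ultimately show "\<exists>Y\<in>carrier (GL2 R). Y \<otimes>\<^bsub>GL2 R\<^esub> X = \<one>\<^bsub>GL2 R\<^esub>" by blast
qed

lemma GL2_tr_comm:
  assumes "X \<in> carrier (GL2 R)" "Y \<in> carrier (GL2 R)"
  shows "mat2_tr R (X \<otimes>\<^bsub>GL2 R\<^esub> Y) = mat2_tr R (Y \<otimes>\<^bsub>GL2 R\<^esub> X)"
proof -
  obtain a b c d where Xe: "X = Mat2 a b c d" by (rule mat2_cases)
  obtain a' b' c' d' where Ye: "Y = Mat2 a' b' c' d'" by (rule mat2_cases)
  have x: "a \<in> carrier R" "b \<in> carrier R" "c \<in> carrier R" "d \<in> carrier R"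
    using assms(1) unfolding Xe GL2_iff by simp_all
  have y: "a' \<in> carrier R" "b' \<in> carrier R" "c' \<in> carrier R" "d' \<in> carrier R"
    using assms(2) unfolding Ye GL2_iff by simp_all
  show ?thesis unfolding Xe Ye GL2_mult mat2_tr_def mat2.sel using x y by algebra
qed

lemma GL2_tr_conj:
  assumes Q: "Q \<in> carrier (GL2 R)" and X: "X \<in> carrier (GL2 R)"
  shows "mat2_tr R (inv\<^bsub>GL2 R\<^esub> Q \<otimes>\<^bsub>GL2 R\<^esub> X \<otimes>\<^bsub>GL2 R\<^esub> Q) = mat2_tr R X"
proof -
  interpret GL: group "GL2 R" by (rule GL2_group)
  show ?thesis
    using GL2_tr_comm[of "inv\<^bsub>GL2 R\<^esub> Q \<otimes>\<^bsub>GL2 R\<^esub> X" Q] Q X by (simp add: GL.m_assoc[symmetric])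
qed

end

text \<open>The adic topology is discrete once a power of \<open>mm\<close> is zero.\<close>

lemma (in local_map) nilpotent_continuous_iff:
  assumes "mpow N = {\<zero>}"
  shows "continuous_map T (adic_topology R) f \<longleftrightarrow> f \<in> topspace T \<rightarrow> carrier R \<and> near T (\<lambda>x y. f y = f x)"
  unfolding continuous_adic_near
proof (intro conj_cong refl iffI allI)
  assume f: "f \<in> topspace T \<rightarrow> carrier R"
  {
    assume "\<forall>n. near T (\<lambda>x y. f y \<ominus> f x \<in> mpow n)"
    then have "near T (\<lambda>x y. f y \<ominus> f x \<in> mpow N)" by simp
    then show "near T (\<lambda>x y. f y = f x)"
      by (rule near_mono) (use f in \<open>simp add: assms Pi_def\<close>)
  next
    fix n
    assume "near T (\<lambda>x y. f y = f x)"
    then show "near T (\<lambda>x y. f y \<ominus> f x \<in> mpow n)"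
      by (rule near_mono)
        (use f additive_subgroup.zero_closed[OF ideal.axioms(1)[OF mpow_ideal[of n]]] in \<open>simp add: a_minus_def R.r_neg Pi_def\<close>)
  }
qed

context residual_extension
begin

definition "\<rho>bar g = Mat2 (\<psi>1 g) (e g) \<zero> (\<psi>2 g)"

text \<open>Once \<open>u\<close> is diagonalised, the diagonal entries are constant, the lower left entry vanishes and
  the upper right entry is a constant cocycle up to a scalar.\<close>

lemma constant_pseudo_rep_lift:
  assumes "local_map A F \<pi>" and \<theta>: "\<theta> \<in> ring_hom F A" and \<pi>\<theta>: "\<And>z. z \<in> carrier F \<Longrightarrow> \<pi> (\<theta> z) = z"
    and \<rho>: "\<rho> \<in> hom G (GL2 A)" and near: "near \<tau> (\<lambda>g h. \<rho> h = \<rho> g)"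
    and res: "\<And>g. g \<in> carrier G \<Longrightarrow> map_mat2 \<pi> (\<rho> g) = \<rho>bar g"
    and tr: "\<And>g. g \<in> carrier G \<Longrightarrow> mat2_tr A (\<rho> g) = \<theta> (\<psi>1 g \<oplus> \<psi>2 g)"
    and det: "mat2_det A (\<rho> u) = \<theta> (\<psi>1 u \<otimes> \<psi>2 u)"
  shows "\<exists>P\<in>carrier (GL2 A). map_mat2 \<pi> P = \<one>\<^bsub>GL2 F\<^esub> \<and>
    (\<forall>g\<in>carrier G. map_mat2 \<theta> (\<rho>bar g) = P \<otimes>\<^bsub>GL2 A\<^esub> \<rho> g \<otimes>\<^bsub>GL2 A\<^esub> inv\<^bsub>GL2 A\<^esub> P)"
proof -
  interpret A: local_map A F \<pi> by fact
  interpret T: ring_hom_cring F A \<theta>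
    using \<theta> A.R.is_cring F.is_cring by (simp add: ring_hom_cring_def ring_hom_cring_axioms_def)
  interpret GL: group "GL2 A" by (rule A.R.GL2_group)
  have \<rho>c: "\<rho> g \<in> carrier (GL2 A)" if "g \<in> carrier G" for g using \<rho> that by (rule hom_in_carrier)

  \<comment> \<open>An eigenbasis for the image of \<open>u\<close>\<close>
  obtain \<alpha> \<beta>' \<gamma> \<delta> where ru: "\<rho> u = Mat2 \<alpha> \<beta>' \<gamma> \<delta>" by (rule mat2_cases)
  have c: "\<alpha> \<in> carrier A" "\<beta>' \<in> carrier A" "\<gamma> \<in> carrier A" "\<delta> \<in> carrier A"
    using \<rho>c[OF u] unfolding ru A.R.GL2_iff by simp_all
  have pu: "\<pi> \<alpha> = \<psi>1 u" "\<pi> \<beta>' = e u" "\<pi> \<gamma> = \<zero>" "\<pi> \<delta> = \<psi>2 u"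
    using res[OF u] by (simp_all add: ru \<rho>bar_def)
  define L1 L2 where "L1 = \<theta> (\<psi>1 u)" and "L2 = \<theta> (\<psi>2 u)"
  have L: "L1 \<in> carrier A" "L2 \<in> carrier A" "\<pi> L1 = \<psi>1 u" "\<pi> L2 = \<psi>2 u"
    by (simp_all add: L1_def L2_def \<pi>\<theta>)
  have tru: "\<alpha> \<oplus>\<^bsub>A\<^esub> \<delta> = L1 \<oplus>\<^bsub>A\<^esub> L2" using tr[OF u] by (simp add: ru mat2_tr_def L1_def L2_def)
  have detu: "\<alpha> \<otimes>\<^bsub>A\<^esub> \<delta> \<ominus>\<^bsub>A\<^esub> \<beta>' \<otimes>\<^bsub>A\<^esub> \<gamma> = L1 \<otimes>\<^bsub>A\<^esub> L2" using det by (simp add: ru mat2_det_def L1_def L2_def)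
  have u1: "\<alpha> \<ominus>\<^bsub>A\<^esub> L2 \<in> Units A" using c L pu psi_u by (intro A.residue_unit) simp_all
  have u2: "L1 \<ominus>\<^bsub>A\<^esub> \<delta> \<in> Units A" using c L pu psi_u by (intro A.residue_unit) simp_all
  have ueq: "L1 \<ominus>\<^bsub>A\<^esub> \<delta> = \<alpha> \<ominus>\<^bsub>A\<^esub> L2"
  proof -
    have "L1 \<ominus>\<^bsub>A\<^esub> \<delta> = (L1 \<oplus>\<^bsub>A\<^esub> L2) \<ominus>\<^bsub>A\<^esub> L2 \<ominus>\<^bsub>A\<^esub> \<delta>" using c L(1,2) by algebra
    also have "\<dots> = \<alpha> \<ominus>\<^bsub>A\<^esub> L2" unfolding tru[symmetric] using c L(1,2) by algebra
    finally show ?thesis .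
  qed
  define i where "i = inv\<^bsub>A\<^esub> (\<alpha> \<ominus>\<^bsub>A\<^esub> L2)"
  have i: "i \<in> carrier A" "i \<otimes>\<^bsub>A\<^esub> (\<alpha> \<ominus>\<^bsub>A\<^esub> L2) = \<one>\<^bsub>A\<^esub>" using u1 by (simp_all add: i_def)
  \<comment> \<open>The columns are eigenvectors of \<open>\<rho> u\<close> for \<open>L1\<close>
    and \<open>L2\<close>, normalised to diagonal entries one. The denominator
    \<open>\<alpha> - L2\<close> is a unit because its residue is
    \<open>\<psi>1 u - \<psi>2 u\<close>.\<close>
  define Q where "Q = Mat2 \<one>\<^bsub>A\<^esub> (\<ominus>\<^bsub>A\<^esub> (i \<otimes>\<^bsub>A\<^esub> \<beta>')) (i \<otimes>\<^bsub>A\<^esub> \<gamma>) \<one>\<^bsub>A\<^esub>"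
  have pi_i: "\<pi> i = inv (\<psi>1 u \<ominus> \<psi>2 u)"
  proof -
    have "\<pi> (i \<otimes>\<^bsub>A\<^esub> (\<alpha> \<ominus>\<^bsub>A\<^esub> L2)) = \<one>" unfolding i(2) by simp
    then have "\<pi> i \<otimes> (\<psi>1 u \<ominus> \<psi>2 u) = \<one>" using i(1) c L pu by simp
    then show ?thesis using F.comm_inv_char[of "\<psi>1 u \<ominus> \<psi>2 u" "\<pi> i"] i(1) F.m_comm[of "\<pi> i"] by simp
  qed
  have Qc: "Q \<in> carrier (GL2 A)"
    unfolding Q_def A.R.GL2_iff using c i by (intro conjI A.residue_unit) (simp_all add: pu a_minus_def F.r_neg)
  have QD: "\<rho> u \<otimes>\<^bsub>GL2 A\<^esub> Q = Q \<otimes>\<^bsub>GL2 A\<^esub> Mat2 L1 \<zero>\<^bsub>A\<^esub> \<zero>\<^bsub>A\<^esub> L2"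
  proof -
    have ch: "\<beta>' \<otimes>\<^bsub>A\<^esub> \<gamma> = (L1 \<ominus>\<^bsub>A\<^esub> \<alpha>) \<otimes>\<^bsub>A\<^esub> (\<alpha> \<ominus>\<^bsub>A\<^esub> L2)"
    proof -
      have "\<beta>' \<otimes>\<^bsub>A\<^esub> \<gamma> = \<alpha> \<otimes>\<^bsub>A\<^esub> \<delta> \<ominus>\<^bsub>A\<^esub> (\<alpha> \<otimes>\<^bsub>A\<^esub> \<delta> \<ominus>\<^bsub>A\<^esub> \<beta>' \<otimes>\<^bsub>A\<^esub> \<gamma>)" using c by algebra
      also have "\<dots> = \<alpha> \<otimes>\<^bsub>A\<^esub> (\<alpha> \<oplus>\<^bsub>A\<^esub> \<delta>) \<ominus>\<^bsub>A\<^esub> \<alpha> \<otimes>\<^bsub>A\<^esub> \<alpha> \<ominus>\<^bsub>A\<^esub> L1 \<otimes>\<^bsub>A\<^esub> L2" unfolding detu using c L(1,2) by algebra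
      also have "\<dots> = (L1 \<ominus>\<^bsub>A\<^esub> \<alpha>) \<otimes>\<^bsub>A\<^esub> (\<alpha> \<ominus>\<^bsub>A\<^esub> L2)" unfolding tru using c L(1,2) by algebra
      finally show ?thesis .
    qed
    have del: "\<delta> = L1 \<ominus>\<^bsub>A\<^esub> (\<alpha> \<ominus>\<^bsub>A\<^esub> L2)" unfolding ueq[symmetric] using c L(1,2) by algebra
    have e11: "\<alpha> \<oplus>\<^bsub>A\<^esub> \<beta>' \<otimes>\<^bsub>A\<^esub> (i \<otimes>\<^bsub>A\<^esub> \<gamma>) = L1"
    proof -
      have "\<alpha> \<oplus>\<^bsub>A\<^esub> \<beta>' \<otimes>\<^bsub>A\<^esub> (i \<otimes>\<^bsub>A\<^esub> \<gamma>) = \<alpha> \<oplus>\<^bsub>A\<^esub> i \<otimes>\<^bsub>A\<^esub> (\<beta>' \<otimes>\<^bsub>A\<^esub> \<gamma>)" using c i(1) by algebra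
      also have "\<dots> = \<alpha> \<oplus>\<^bsub>A\<^esub> (i \<otimes>\<^bsub>A\<^esub> (\<alpha> \<ominus>\<^bsub>A\<^esub> L2)) \<otimes>\<^bsub>A\<^esub> (L1 \<ominus>\<^bsub>A\<^esub> \<alpha>)" unfolding ch using c i(1) L(1,2) by algebra
      also have "\<dots> = L1" unfolding i(2) using c L(1,2) by algebra
      finally show ?thesis .
    qed
    have e12: "\<ominus>\<^bsub>A\<^esub> (\<alpha> \<otimes>\<^bsub>A\<^esub> (i \<otimes>\<^bsub>A\<^esub> \<beta>')) \<oplus>\<^bsub>A\<^esub> \<beta>' = \<ominus>\<^bsub>A\<^esub> (i \<otimes>\<^bsub>A\<^esub> \<beta>' \<otimes>\<^bsub>A\<^esub> L2)"
    proof -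
      have "\<ominus>\<^bsub>A\<^esub> (\<alpha> \<otimes>\<^bsub>A\<^esub> (i \<otimes>\<^bsub>A\<^esub> \<beta>')) \<oplus>\<^bsub>A\<^esub> \<beta>' = \<ominus>\<^bsub>A\<^esub> (i \<otimes>\<^bsub>A\<^esub> (\<alpha> \<ominus>\<^bsub>A\<^esub> L2)) \<otimes>\<^bsub>A\<^esub> \<beta>' \<ominus>\<^bsub>A\<^esub> i \<otimes>\<^bsub>A\<^esub> \<beta>' \<otimes>\<^bsub>A\<^esub> L2 \<oplus>\<^bsub>A\<^esub> \<beta>'"
        using c i(1) L(1,2) by algebra
      also have "\<dots> = \<ominus>\<^bsub>A\<^esub> (i \<otimes>\<^bsub>A\<^esub> \<beta>' \<otimes>\<^bsub>A\<^esub> L2)" unfolding i(2) using c i(1) L(1,2) by algebra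
      finally show ?thesis .
    qed
    have e21: "\<gamma> \<oplus>\<^bsub>A\<^esub> \<delta> \<otimes>\<^bsub>A\<^esub> (i \<otimes>\<^bsub>A\<^esub> \<gamma>) = i \<otimes>\<^bsub>A\<^esub> \<gamma> \<otimes>\<^bsub>A\<^esub> L1"
    proof -
      have "\<gamma> \<oplus>\<^bsub>A\<^esub> \<delta> \<otimes>\<^bsub>A\<^esub> (i \<otimes>\<^bsub>A\<^esub> \<gamma>) = \<gamma> \<oplus>\<^bsub>A\<^esub> i \<otimes>\<^bsub>A\<^esub> \<gamma> \<otimes>\<^bsub>A\<^esub> L1 \<ominus>\<^bsub>A\<^esub> (i \<otimes>\<^bsub>A\<^esub> (\<alpha> \<ominus>\<^bsub>A\<^esub> L2)) \<otimes>\<^bsub>A\<^esub> \<gamma>"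
        unfolding del using c i(1) L(1,2) by algebra
      also have "\<dots> = i \<otimes>\<^bsub>A\<^esub> \<gamma> \<otimes>\<^bsub>A\<^esub> L1" unfolding i(2) using c i(1) L(1,2) by algebra
      finally show ?thesis .
    qed
    have e22: "\<ominus>\<^bsub>A\<^esub> (\<gamma> \<otimes>\<^bsub>A\<^esub> (i \<otimes>\<^bsub>A\<^esub> \<beta>')) \<oplus>\<^bsub>A\<^esub> \<delta> = L2"
    proof -
      have "\<ominus>\<^bsub>A\<^esub> (\<gamma> \<otimes>\<^bsub>A\<^esub> (i \<otimes>\<^bsub>A\<^esub> \<beta>')) \<oplus>\<^bsub>A\<^esub> \<delta> = \<alpha> \<oplus>\<^bsub>A\<^esub> \<delta> \<ominus>\<^bsub>A\<^esub> (\<alpha> \<oplus>\<^bsub>A\<^esub> \<beta>' \<otimes>\<^bsub>A\<^esub> (i \<otimes>\<^bsub>A\<^esub> \<gamma>))"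
        using c i(1) by algebra
      also have "\<dots> = L2" unfolding e11 tru using L(1,2) by algebra
      finally show ?thesis .
    qed
    show ?thesis
      unfolding ru Q_def A.R.GL2_mult using c i(1) L(1,2) e11 e12 e21 e22
      by (simp add: A.R.r_minus A.R.l_minus)
  qed
  define \<sigma> where "\<sigma> g = inv\<^bsub>GL2 A\<^esub> Q \<otimes>\<^bsub>GL2 A\<^esub> \<rho> g \<otimes>\<^bsub>GL2 A\<^esub> Q" for g
  have \<sigma>c: "\<sigma> g \<in> carrier (GL2 A)" if "g \<in> carrier G" for g using Qc \<rho>c[OF that] by (simp add: \<sigma>_def)
  have Q\<sigma>: "Q \<otimes>\<^bsub>GL2 A\<^esub> \<sigma> g = \<rho> g \<otimes>\<^bsub>GL2 A\<^esub> Q" if "g \<in> carrier G" for g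
    using Qc \<rho>c[OF that] by (simp add: \<sigma>_def GL.m_assoc[symmetric])
  have \<sigma>_mult: "\<sigma> (g \<otimes>\<^bsub>G\<^esub> h) = \<sigma> g \<otimes>\<^bsub>GL2 A\<^esub> \<sigma> h" if gh: "g \<in> carrier G" "h \<in> carrier G" for g h
  proof -
    have "\<sigma> g \<otimes>\<^bsub>GL2 A\<^esub> \<sigma> h = inv\<^bsub>GL2 A\<^esub> Q \<otimes>\<^bsub>GL2 A\<^esub> \<rho> g \<otimes>\<^bsub>GL2 A\<^esub> (Q \<otimes>\<^bsub>GL2 A\<^esub> \<sigma> h)"
      using Qc \<rho>c[OF gh(1)] \<sigma>c[OF gh(2)] unfolding \<sigma>_def[of g] by (simp add: GL.m_assoc)
    also have "\<dots> = \<sigma> (g \<otimes>\<^bsub>G\<^esub> h)"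
      using Qc \<rho>c[OF gh(1)] \<rho>c[OF gh(2)] unfolding Q\<sigma>[OF gh(2)] \<sigma>_def[of "g \<otimes>\<^bsub>G\<^esub> h"] hom_mult[OF \<rho> gh]
      by (simp add: GL.m_assoc)
    finally show ?thesis by simp
  qed
  define D where "D = Mat2 L1 \<zero>\<^bsub>A\<^esub> \<zero>\<^bsub>A\<^esub> L2"
  have Dc: "D \<in> carrier (GL2 A)"
    unfolding D_def A.R.GL2_iff
  proof (intro conjI L A.R.zero_closed)
    have "L1 \<otimes>\<^bsub>A\<^esub> L2 \<in> Units A"
      using \<rho>c[OF u] unfolding ru A.R.GL2_iff detu by simp
    then show "L1 \<otimes>\<^bsub>A\<^esub> L2 \<ominus>\<^bsub>A\<^esub> \<zero>\<^bsub>A\<^esub> \<otimes>\<^bsub>A\<^esub> \<zero>\<^bsub>A\<^esub> \<in> Units A" using L by (simp add: a_minus_def)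
  qed
  have \<sigma>u: "\<sigma> u = D"
    using QD Qc Dc \<rho>c[OF u] unfolding D_def[symmetric] \<sigma>_def
    by (simp add: GL.m_assoc GL.inv_solve_left')

  \<comment> \<open>The matrix entries in the eigenbasis\<close>
  define p q r s where "p g = m11 (\<sigma> g)" and "q g = m12 (\<sigma> g)" and "r g = m21 (\<sigma> g)" and "s g = m22 (\<sigma> g)" for g
  have \<sigma>e: "\<sigma> g = Mat2 (p g) (q g) (r g) (s g)" for g by (simp add: p_def q_def r_def s_def)
  have ec: "p g \<in> carrier A" "q g \<in> carrier A" "r g \<in> carrier A" "s g \<in> carrier A" if "g \<in> carrier G" for g
    using \<sigma>c[OF that] unfolding \<sigma>e A.R.GL2_iff by simp_all
  have em: "p (g \<otimes>\<^bsub>G\<^esub> h) = p g \<otimes>\<^bsub>A\<^esub> p h \<oplus>\<^bsub>A\<^esub> q g \<otimes>\<^bsub>A\<^esub> r h" "q (g \<otimes>\<^bsub>G\<^esub> h) = p g \<otimes>\<^bsub>A\<^esub> q h \<oplus>\<^bsub>A\<^esub> q g \<otimes>\<^bsub>A\<^esub> s h"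
    "s (g \<otimes>\<^bsub>G\<^esub> h) = r g \<otimes>\<^bsub>A\<^esub> q h \<oplus>\<^bsub>A\<^esub> s g \<otimes>\<^bsub>A\<^esub> s h"
    if "g \<in> carrier G" "h \<in> carrier G" for g h
    using \<sigma>_mult[OF that] unfolding \<sigma>e A.R.GL2_mult by simp_all
  have eu: "p u = L1" "q u = \<zero>\<^bsub>A\<^esub>" "r u = \<zero>\<^bsub>A\<^esub>" "s u = L2" using \<sigma>u unfolding \<sigma>e D_def by simp_all
  have trs: "p g \<oplus>\<^bsub>A\<^esub> s g = \<theta> (\<psi>1 g) \<oplus>\<^bsub>A\<^esub> \<theta> (\<psi>2 g)" if g: "g \<in> carrier G" for g
    using A.R.GL2_tr_conj[OF Qc \<rho>c[OF g]] tr[OF g] g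
    by (simp add: \<sigma>_def[symmetric] \<sigma>e mat2_tr_def)
  \<comment> \<open>The traces at \<open>g\<close> and at \<open>u g\<close> form a linear system
    for \<open>p g\<close> and \<open>s g\<close> with determinant \<open>L1 - L2\<close> up to
    sign, and the constant characters solve it.\<close>
  have ps: "p g = \<theta> (\<psi>1 g)" "s g = \<theta> (\<psi>2 g)" if g: "g \<in> carrier G" for g
  proof -
    define x y where "x = \<theta> (\<psi>1 g)" and "y = \<theta> (\<psi>2 g)"
    have xy: "x \<in> carrier A" "y \<in> carrier A" using g by (simp_all add: x_def y_def)
    note pc = ec[OF g]
    have "p (u \<otimes>\<^bsub>G\<^esub> g) \<oplus>\<^bsub>A\<^esub> s (u \<otimes>\<^bsub>G\<^esub> g) = L1 \<otimes>\<^bsub>A\<^esub> x \<oplus>\<^bsub>A\<^esub> L2 \<otimes>\<^bsub>A\<^esub> y"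
      using trs[of "u \<otimes>\<^bsub>G\<^esub> g"] g by (simp add: psi1_mult psi2_mult L1_def L2_def x_def y_def)
    then have e1: "L1 \<otimes>\<^bsub>A\<^esub> p g \<oplus>\<^bsub>A\<^esub> L2 \<otimes>\<^bsub>A\<^esub> s g = L1 \<otimes>\<^bsub>A\<^esub> x \<oplus>\<^bsub>A\<^esub> L2 \<otimes>\<^bsub>A\<^esub> y"
      using pc L by (simp add: em[OF u g] eu)
    have e2: "p g \<oplus>\<^bsub>A\<^esub> s g = x \<oplus>\<^bsub>A\<^esub> y" using trs[OF g] by (simp add: x_def y_def)
    have un: "L1 \<ominus>\<^bsub>A\<^esub> L2 \<in> Units A" using L psi_u by (intro A.residue_unit) simp_all
    have e3: "L1 \<otimes>\<^bsub>A\<^esub> p g \<oplus>\<^bsub>A\<^esub> L2 \<otimes>\<^bsub>A\<^esub> s g \<ominus>\<^bsub>A\<^esub> L2 \<otimes>\<^bsub>A\<^esub> (p g \<oplus>\<^bsub>A\<^esub> s g) = L1 \<otimes>\<^bsub>A\<^esub> x \<oplus>\<^bsub>A\<^esub> L2 \<otimes>\<^bsub>A\<^esub> y \<ominus>\<^bsub>A\<^esub> L2 \<otimes>\<^bsub>A\<^esub> (x \<oplus>\<^bsub>A\<^esub> y)"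
      unfolding e1 e2 ..
    have "p g = x"
    proof (rule A.R.unit_cancel_diff[OF un _ _ _ e3])
      show "(L1 \<ominus>\<^bsub>A\<^esub> L2) \<otimes>\<^bsub>A\<^esub> (p g \<ominus>\<^bsub>A\<^esub> x) = L1 \<otimes>\<^bsub>A\<^esub> p g \<oplus>\<^bsub>A\<^esub> L2 \<otimes>\<^bsub>A\<^esub> s g \<ominus>\<^bsub>A\<^esub> L2 \<otimes>\<^bsub>A\<^esub> (p g \<oplus>\<^bsub>A\<^esub> s g) \<ominus>\<^bsub>A\<^esub>
        (L1 \<otimes>\<^bsub>A\<^esub> x \<oplus>\<^bsub>A\<^esub> L2 \<otimes>\<^bsub>A\<^esub> y \<ominus>\<^bsub>A\<^esub> L2 \<otimes>\<^bsub>A\<^esub> (x \<oplus>\<^bsub>A\<^esub> y))" using pc xy L(1,2) by algebra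
    qed (use pc xy L in simp_all)
    then show "p g = \<theta> (\<psi>1 g)" "s g = \<theta> (\<psi>2 g)" using e2 pc xy by (simp_all add: x_def y_def)
  qed
  \<comment> \<open>\<open>p\<close> is already multiplicative, so the off-diagonal contribution to
    \<open>p\<close> of a product vanishes.\<close>
  have qr: "q g \<otimes>\<^bsub>A\<^esub> r h = \<zero>\<^bsub>A\<^esub>" if gh: "g \<in> carrier G" "h \<in> carrier G" for g h
  proof -
    have "p (g \<otimes>\<^bsub>G\<^esub> h) = p g \<otimes>\<^bsub>A\<^esub> p h" using gh by (simp add: ps psi1_mult)
    then have "p g \<otimes>\<^bsub>A\<^esub> p h \<oplus>\<^bsub>A\<^esub> q g \<otimes>\<^bsub>A\<^esub> r h = p g \<otimes>\<^bsub>A\<^esub> p h \<oplus>\<^bsub>A\<^esub> \<zero>\<^bsub>A\<^esub>"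
      using em(1)[OF gh] ec[OF gh(1)] ec[OF gh(2)] by simp
    then show ?thesis using ec[OF gh(1)] ec[OF gh(2)] by (simp del: A.R.r_zero)
  qed
  have pq: "\<pi> (q g) = \<beta> g" if g: "g \<in> carrier G" for g
  proof -
    obtain a b c' d where rg: "\<rho> g = Mat2 a b c' d" by (rule mat2_cases)
    have rc: "a \<in> carrier A" "b \<in> carrier A" "c' \<in> carrier A" "d \<in> carrier A"
      using \<rho>c[OF g] unfolding rg A.R.GL2_iff by simp_all
    have rr: "\<pi> a = \<psi>1 g" "\<pi> b = e g" "\<pi> d = \<psi>2 g" using res[OF g] by (simp_all add: rg \<rho>bar_def)
    have "m12 (Q \<otimes>\<^bsub>GL2 A\<^esub> \<sigma> g) = m12 (\<rho> g \<otimes>\<^bsub>GL2 A\<^esub> Q)" using Q\<sigma>[OF g] by simp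
    then have "\<one>\<^bsub>A\<^esub> \<otimes>\<^bsub>A\<^esub> q g \<oplus>\<^bsub>A\<^esub> \<ominus>\<^bsub>A\<^esub> (i \<otimes>\<^bsub>A\<^esub> \<beta>') \<otimes>\<^bsub>A\<^esub> s g = a \<otimes>\<^bsub>A\<^esub> \<ominus>\<^bsub>A\<^esub> (i \<otimes>\<^bsub>A\<^esub> \<beta>') \<oplus>\<^bsub>A\<^esub> b \<otimes>\<^bsub>A\<^esub> \<one>\<^bsub>A\<^esub>"
      unfolding Q_def \<sigma>e rg A.R.GL2_mult by simp
    then have "\<pi> (\<one>\<^bsub>A\<^esub> \<otimes>\<^bsub>A\<^esub> q g \<oplus>\<^bsub>A\<^esub> \<ominus>\<^bsub>A\<^esub> (i \<otimes>\<^bsub>A\<^esub> \<beta>') \<otimes>\<^bsub>A\<^esub> s g) = \<pi> (a \<otimes>\<^bsub>A\<^esub> \<ominus>\<^bsub>A\<^esub> (i \<otimes>\<^bsub>A\<^esub> \<beta>') \<oplus>\<^bsub>A\<^esub> b \<otimes>\<^bsub>A\<^esub> \<one>\<^bsub>A\<^esub>)" by simp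
    then have eq: "\<pi> (q g) \<oplus> \<ominus> v0 \<otimes> \<psi>2 g = \<psi>1 g \<otimes> \<ominus> v0 \<oplus> e g"
      using ec[OF g] rc rr i(1) c g by (simp add: pu pi_i ps \<pi>\<theta> v0_def F.m_comm[of "e u"] psi_diff_unit)
    have qc: "\<pi> (q g) \<in> carrier F" using ec[OF g] by simp
    have "\<pi> (q g) = (\<pi> (q g) \<oplus> \<ominus> v0 \<otimes> \<psi>2 g) \<oplus> v0 \<otimes> \<psi>2 g"
      using qc v0_closed psi2_closed[OF g] by algebra
    also have "\<dots> = \<beta> g" unfolding eq \<beta>_def using e_closed[OF g] v0_closed psi2_closed[OF g] psi1_closed[OF g] by algebra
    finally show ?thesis .
  qed
  \<comment> \<open>The coefficients are taken from the field \<open>F\<close>, acting on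
    \<open>A\<close> through \<open>\<theta>\<close>, and the index type has one point. The maximal
    ideal of \<open>F\<close> is zero, so generation applies with exponent one.\<close>
  interpret E: entry_family F G \<tau> \<psi>1 \<psi>2 e u F id A \<theta> \<psi>1 \<psi>2 "\<lambda>g (_::unit). q g"
  proof (intro entry_family.intro entry_family_axioms.intro)
    show "residual_extension F G \<tau> \<psi>1 \<psi>2 e u" by (rule residual_extension_axioms)
    show "local_map F F id"
      using F.field_axioms F.is_cring by (intro local_mapI) (simp_all add: F.field_Units)
    show "ring_hom_cring F A \<theta>" by (rule T.ring_hom_cring_axioms)
    show "near \<tau> (\<lambda>g h. (\<lambda>_::unit. q h) = (\<lambda>_. q g))"
      by (rule near_mono[OF near]) (simp add: q_def \<sigma>_def)
    fix g k assume g: "g \<in> carrier G"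
    show "q g \<in> carrier A" using ec[OF g] by simp
    fix h assume h: "h \<in> carrier G"
    show "q (g \<otimes>\<^bsub>G\<^esub> h) = \<theta> (\<psi>1 g) \<otimes>\<^bsub>A\<^esub> q h \<oplus>\<^bsub>A\<^esub> \<theta> (\<psi>2 h) \<otimes>\<^bsub>A\<^esub> q g"
      using em(2)[OF g h] ec[OF g] ec[OF h] by (simp add: ps g h A.R.m_comm)
  qed (simp_all add: eu)
  have F1: "z = \<zero>" if "z \<in> E.R.mpow (Suc 0)" for z using that unfolding E.R.mpow_1 E.R.mm_iff by simp
  have qgen: "\<exists>t\<in>carrier F. q g = \<theta> t \<otimes>\<^bsub>A\<^esub> q r0" if g: "g \<in> carrier G" for g
    using E.generation[OF _ g, of "Suc 0"] F1 T.hom_zero by metis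
  \<comment> \<open>As \<open>q r0\<close> is a unit, its vanishing products with the lower left
    entries force the latter to be zero.\<close>
  have qr0: "q r0 \<in> Units A" using ec[OF r0(1)] r0(2) pq[OF r0(1)] by (intro A.residue_unit) simp_all
  have rz: "r h = \<zero>\<^bsub>A\<^esub>" if h: "h \<in> carrier G" for h
    using qr[OF r0(1) h] A.R.Units_l_cancel[OF qr0, of "r h" "\<zero>\<^bsub>A\<^esub>"] ec[OF h] ec[OF r0(1)] by simp
  have bu: "\<beta> r0 \<in> Units F" using r0 F.field_Units by simp
  \<comment> \<open>\<open>q\<close> is the constant lift of \<open>\<beta>\<close> times a single
    scalar. Normalising at \<open>r0\<close> gives this scalar residue one, as strict equivalence
    demands.\<close>
  define \<kappa> where "\<kappa> = \<theta> (inv (\<beta> r0)) \<otimes>\<^bsub>A\<^esub> q r0"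
  have \<kappa>: "\<kappa> \<in> carrier A" "\<pi> \<kappa> = \<one>"
    using bu ec[OF r0(1)] r0(1) by (simp_all add: \<kappa>_def \<pi>\<theta> pq)
  have q\<kappa>: "q g = \<kappa> \<otimes>\<^bsub>A\<^esub> \<theta> (\<beta> g)" if g: "g \<in> carrier G" for g
  proof -
    obtain t where t: "t \<in> carrier F" "q g = \<theta> t \<otimes>\<^bsub>A\<^esub> q r0" using qgen[OF g] by blast
    have "\<beta> g = t \<otimes> \<beta> r0" using pq[OF g] pq[OF r0(1)] t ec[OF r0(1)] by (simp add: \<pi>\<theta>)
    then have "t = inv (\<beta> r0) \<otimes> \<beta> g"
      using bu t(1) r0(1) F.m_assoc[of t "\<beta> r0" "inv (\<beta> r0)"] g by (simp add: F.m_comm)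
    then show ?thesis using t(2) bu ec[OF r0(1)] g by (simp add: \<kappa>_def A.R.m_ac)
  qed
  define v where "v = \<theta> v0"
  have v: "v \<in> carrier A" "\<pi> v = v0" by (simp_all add: v_def \<pi>\<theta>)
  \<comment> \<open>\<open>K\<close> absorbs the scalar \<open>\<kappa>\<close> and undoes the
    passage from \<open>e\<close> to \<open>\<beta>\<close>. The residues of \<open>Q\<close> and
    \<open>K\<close> are unipotent with upper right entries \<open>- v0\<close> and
    \<open>v0\<close>, so their product is residually the identity.\<close>
  define K where "K = Mat2 \<kappa> (\<kappa> \<otimes>\<^bsub>A\<^esub> v) \<zero>\<^bsub>A\<^esub> \<one>\<^bsub>A\<^esub>"
  have Kc: "K \<in> carrier (GL2 A)"
    unfolding K_def A.R.GL2_iff using \<kappa> v A.F_one_not_zero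
    by (intro conjI A.residue_unit) (simp_all add: a_minus_def)
  define X where "X g = map_mat2 \<theta> (\<rho>bar g)" for g
  have KX: "\<sigma> g \<otimes>\<^bsub>GL2 A\<^esub> K = K \<otimes>\<^bsub>GL2 A\<^esub> X g" if g: "g \<in> carrier G" for g
  proof -
    define x y ee bb where "x = \<theta> (\<psi>1 g)" and "y = \<theta> (\<psi>2 g)" and "ee = \<theta> (e g)" and "bb = \<theta> (\<beta> g)"
    note d = this
    have dc: "x \<in> carrier A" "y \<in> carrier A" "ee \<in> carrier A" "bb \<in> carrier A" using g by (simp_all add: d)
    have bb: "bb = ee \<ominus>\<^bsub>A\<^esub> v \<otimes>\<^bsub>A\<^esub> (x \<ominus>\<^bsub>A\<^esub> y)" using g by (simp add: d \<beta>_def v_def)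
    have 1: "x \<otimes>\<^bsub>A\<^esub> (\<kappa> \<otimes>\<^bsub>A\<^esub> v) \<oplus>\<^bsub>A\<^esub> \<kappa> \<otimes>\<^bsub>A\<^esub> bb = \<kappa> \<otimes>\<^bsub>A\<^esub> ee \<oplus>\<^bsub>A\<^esub> \<kappa> \<otimes>\<^bsub>A\<^esub> v \<otimes>\<^bsub>A\<^esub> y"
      unfolding bb using dc(1-3) \<kappa>(1) v(1) by algebra
    show ?thesis
      unfolding X_def \<rho>bar_def \<sigma>e K_def mat2.map A.R.GL2_mult ps[OF g] rz[OF g] q\<kappa>[OF g]
      using 1 dc \<kappa>(1) v(1) by (simp add: d[symmetric] A.R.m_comm)
  qed
  have Xc: "X g \<in> carrier (GL2 A)" if g: "g \<in> carrier G" for g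
  proof -
    have "\<pi> (\<theta> (\<psi>1 g) \<otimes>\<^bsub>A\<^esub> \<theta> (\<psi>2 g)) = \<psi>1 g \<otimes> \<psi>2 g" using g by (simp add: \<pi>\<theta>)
    moreover have "\<psi>1 g \<noteq> \<zero>" "\<psi>2 g \<noteq> \<zero>"
    proof -
      have "\<psi>1 g \<otimes> \<psi>1 (inv\<^bsub>G\<^esub> g) = \<one>" "\<psi>2 g \<otimes> \<psi>2 (inv\<^bsub>G\<^esub> g) = \<one>"
        using g by (simp_all add: psi1_mult[symmetric] psi2_mult[symmetric] psi1_one psi2_one)
      then show "\<psi>1 g \<noteq> \<zero>" "\<psi>2 g \<noteq> \<zero>" using g A.F_one_not_zero by auto
    qed
    ultimately show ?thesis unfolding X_def \<rho>bar_def mat2.map A.R.GL2_iff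
      using g F.integral[of "\<psi>1 g" "\<psi>2 g"]
      by (intro conjI A.residue_unit) (auto simp: \<pi>\<theta> a_minus_def)
  qed
  define M where "M = Q \<otimes>\<^bsub>GL2 A\<^esub> K"
  have Mc: "M \<in> carrier (GL2 A)" using Qc Kc by (simp add: M_def)
  have MX: "\<rho> g \<otimes>\<^bsub>GL2 A\<^esub> M = M \<otimes>\<^bsub>GL2 A\<^esub> X g" if g: "g \<in> carrier G" for g
  proof -
    have "\<rho> g \<otimes>\<^bsub>GL2 A\<^esub> M = (\<rho> g \<otimes>\<^bsub>GL2 A\<^esub> Q) \<otimes>\<^bsub>GL2 A\<^esub> K"
      using \<rho>c[OF g] Qc Kc by (simp add: M_def GL.m_assoc)
    also have "\<dots> = Q \<otimes>\<^bsub>GL2 A\<^esub> (\<sigma> g \<otimes>\<^bsub>GL2 A\<^esub> K)"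
      using \<sigma>c[OF g] Qc Kc by (simp add: Q\<sigma>[OF g, symmetric] GL.m_assoc)
    also have "\<dots> = M \<otimes>\<^bsub>GL2 A\<^esub> X g" using Xc[OF g] Qc Kc by (simp add: KX[OF g] M_def GL.m_assoc)
    finally show ?thesis .
  qed
  have resM: "map_mat2 \<pi> M = \<one>\<^bsub>GL2 F\<^esub>"
  proof -
    have "\<pi> (i \<otimes>\<^bsub>A\<^esub> \<beta>') = v0" using i(1) c by (simp add: pu pi_i v0_def F.m_comm psi_diff_unit)
    then show ?thesis
      unfolding M_def Q_def K_def A.R.GL2_mult F.GL2_one mat2.map
      using i(1) c \<kappa> v by (simp add: pu F.r_neg)
  qed
  let ?P = "inv\<^bsub>GL2 A\<^esub> M"
  have resP: "map_mat2 \<pi> ?P = \<one>\<^bsub>GL2 F\<^esub>"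
  proof -
    obtain a b c' d where Pe: "?P = Mat2 a b c' d" by (rule mat2_cases)
    obtain a' b' c'' d' where Me: "M = Mat2 a' b' c'' d'" by (rule mat2_cases)
    have Pc: "?P \<in> carrier (GL2 A)" using Mc by simp
    have pc: "a \<in> carrier A" "b \<in> carrier A" "c' \<in> carrier A" "d \<in> carrier A" using Pc unfolding Pe A.R.GL2_iff by simp_all
    have mc: "a' \<in> carrier A" "b' \<in> carrier A" "c'' \<in> carrier A" "d' \<in> carrier A" using Mc unfolding Me A.R.GL2_iff by simp_all
    have mr: "\<pi> a' = \<one>" "\<pi> b' = \<zero>" "\<pi> c'' = \<zero>" "\<pi> d' = \<one>" using resM unfolding Me F.GL2_one by simp_all
    have "Mat2 a b c' d \<otimes>\<^bsub>GL2 A\<^esub> Mat2 a' b' c'' d' = \<one>\<^bsub>GL2 A\<^esub>"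
      unfolding Pe[symmetric] Me[symmetric] using Mc by simp
    then have m: "a \<otimes>\<^bsub>A\<^esub> a' \<oplus>\<^bsub>A\<^esub> b \<otimes>\<^bsub>A\<^esub> c'' = \<one>\<^bsub>A\<^esub>" "a \<otimes>\<^bsub>A\<^esub> b' \<oplus>\<^bsub>A\<^esub> b \<otimes>\<^bsub>A\<^esub> d' = \<zero>\<^bsub>A\<^esub>"
      "c' \<otimes>\<^bsub>A\<^esub> a' \<oplus>\<^bsub>A\<^esub> d \<otimes>\<^bsub>A\<^esub> c'' = \<zero>\<^bsub>A\<^esub>" "c' \<otimes>\<^bsub>A\<^esub> b' \<oplus>\<^bsub>A\<^esub> d \<otimes>\<^bsub>A\<^esub> d' = \<one>\<^bsub>A\<^esub>"
      unfolding A.R.GL2_mult A.R.GL2_one by simp_all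
    have "\<pi> a = \<one>" "\<pi> b = \<zero>" "\<pi> c' = \<zero>" "\<pi> d = \<one>"
      using arg_cong[OF m(1), of \<pi>] arg_cong[OF m(2), of \<pi>] arg_cong[OF m(3), of \<pi>] arg_cong[OF m(4), of \<pi>] pc mc mr
      by simp_all
    then show ?thesis unfolding Pe F.GL2_one by simp
  qed
  have "X g = ?P \<otimes>\<^bsub>GL2 A\<^esub> \<rho> g \<otimes>\<^bsub>GL2 A\<^esub> inv\<^bsub>GL2 A\<^esub> ?P" if g: "g \<in> carrier G" for g
  proof -
    have "?P \<otimes>\<^bsub>GL2 A\<^esub> \<rho> g \<otimes>\<^bsub>GL2 A\<^esub> M = ?P \<otimes>\<^bsub>GL2 A\<^esub> (M \<otimes>\<^bsub>GL2 A\<^esub> X g)"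
      using \<rho>c[OF g] Mc by (simp add: GL.m_assoc MX[OF g])
    also have "\<dots> = X g" using Xc[OF g] Mc by (simp add: GL.m_assoc[symmetric])
    finally show ?thesis using Mc by simp
  qed
  then show ?thesis using resP Mc unfolding X_def by (intro bexI[of _ ?P]) simp_all
qed

end


section \<open>Constructing lifts\<close>

context residual_extension
begin

lemma psi_nonzero: assumes "g \<in> carrier G" shows "\<psi>1 g \<otimes> \<psi>2 g \<noteq> \<zero>"
proof -
  have "\<psi>1 g \<otimes> \<psi>1 (inv\<^bsub>G\<^esub> g) = \<one>" "\<psi>2 g \<otimes> \<psi>2 (inv\<^bsub>G\<^esub> g) = \<one>"
    using assms by (simp_all add: psi1_mult[symmetric] psi2_mult[symmetric] psi1_one psi2_one)
  then have "\<psi>1 g \<noteq> \<zero>" "\<psi>2 g \<noteq> \<zero>" using assms by auto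
  then show ?thesis using F.integral[of "\<psi>1 g" "\<psi>2 g"] assms by auto
qed

text \<open>Invertibility is seen on residues: the determinant reduces to \<open>\<psi>1 g\<close>
  times \<open>\<psi>2 g\<close>, which is non-zero.\<close>

lemma lift_from_entries:
  assumes "local_map A F \<pi>"
    and c: "\<And>g. g \<in> carrier G \<Longrightarrow> p g \<in> carrier A \<and> q g \<in> carrier A \<and> r g \<in> carrier A \<and> s g \<in> carrier A"
    and m: "\<And>g h. g \<in> carrier G \<Longrightarrow> h \<in> carrier G \<Longrightarrow>
      p (g \<otimes>\<^bsub>G\<^esub> h) = p g \<otimes>\<^bsub>A\<^esub> p h \<oplus>\<^bsub>A\<^esub> q g \<otimes>\<^bsub>A\<^esub> r h \<and> q (g \<otimes>\<^bsub>G\<^esub> h) = p g \<otimes>\<^bsub>A\<^esub> q h \<oplus>\<^bsub>A\<^esub> q g \<otimes>\<^bsub>A\<^esub> s h \<and>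
      r (g \<otimes>\<^bsub>G\<^esub> h) = r g \<otimes>\<^bsub>A\<^esub> p h \<oplus>\<^bsub>A\<^esub> s g \<otimes>\<^bsub>A\<^esub> r h \<and> s (g \<otimes>\<^bsub>G\<^esub> h) = r g \<otimes>\<^bsub>A\<^esub> q h \<oplus>\<^bsub>A\<^esub> s g \<otimes>\<^bsub>A\<^esub> s h"
    and res: "\<And>g. g \<in> carrier G \<Longrightarrow> \<pi> (p g) = \<psi>1 g \<and> \<pi> (q g) = e g \<and> \<pi> (r g) = \<zero> \<and> \<pi> (s g) = \<psi>2 g"
  shows "(\<lambda>g. Mat2 (p g) (q g) (r g) (s g)) \<in> hom G (GL2 A)"
    and "g \<in> carrier G \<Longrightarrow> map_mat2 \<pi> (Mat2 (p g) (q g) (r g) (s g)) = \<rho>bar g"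
proof -
  interpret A: local_map A F \<pi> by fact
  show "(\<lambda>g. Mat2 (p g) (q g) (r g) (s g)) \<in> hom G (GL2 A)"
  proof (rule homI)
    fix g assume g: "g \<in> carrier G"
    have "\<pi> (p g \<otimes>\<^bsub>A\<^esub> s g \<ominus>\<^bsub>A\<^esub> q g \<otimes>\<^bsub>A\<^esub> r g) \<noteq> \<zero>"
      using c[OF g] res[OF g] psi_nonzero[OF g] g by (simp add: a_minus_def)
    then show "Mat2 (p g) (q g) (r g) (s g) \<in> carrier (GL2 A)"
      unfolding A.R.GL2_iff using c[OF g] by (intro conjI A.residue_unit) simp_all
    fix h assume h: "h \<in> carrier G"
    show "Mat2 (p (g \<otimes>\<^bsub>G\<^esub> h)) (q (g \<otimes>\<^bsub>G\<^esub> h)) (r (g \<otimes>\<^bsub>G\<^esub> h)) (s (g \<otimes>\<^bsub>G\<^esub> h)) =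
      Mat2 (p g) (q g) (r g) (s g) \<otimes>\<^bsub>GL2 A\<^esub> Mat2 (p h) (q h) (r h) (s h)"
      unfolding A.R.GL2_mult using m[OF g h] by simp
  qed
  show "map_mat2 \<pi> (Mat2 (p g) (q g) (r g) (s g)) = \<rho>bar g" if "g \<in> carrier G"
    using res[OF that] by (simp add: \<rho>bar_def)
qed

text \<open>Conjugation by an upper unipotent matrix moves the residual entry \<open>\<beta>\<close> back to \<open>e\<close>.\<close>

lemma lift_from_beta_entries:
  assumes loc: "local_map A F \<pi>"
    and c: "\<And>g. g \<in> carrier G \<Longrightarrow> p g \<in> carrier A \<and> q g \<in> carrier A \<and> r g \<in> carrier A \<and> s g \<in> carrier A"
    and m: "\<And>g h. g \<in> carrier G \<Longrightarrow> h \<in> carrier G \<Longrightarrow>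
      p (g \<otimes>\<^bsub>G\<^esub> h) = p g \<otimes>\<^bsub>A\<^esub> p h \<oplus>\<^bsub>A\<^esub> q g \<otimes>\<^bsub>A\<^esub> r h \<and> q (g \<otimes>\<^bsub>G\<^esub> h) = p g \<otimes>\<^bsub>A\<^esub> q h \<oplus>\<^bsub>A\<^esub> q g \<otimes>\<^bsub>A\<^esub> s h \<and>
      r (g \<otimes>\<^bsub>G\<^esub> h) = r g \<otimes>\<^bsub>A\<^esub> p h \<oplus>\<^bsub>A\<^esub> s g \<otimes>\<^bsub>A\<^esub> r h \<and> s (g \<otimes>\<^bsub>G\<^esub> h) = r g \<otimes>\<^bsub>A\<^esub> q h \<oplus>\<^bsub>A\<^esub> s g \<otimes>\<^bsub>A\<^esub> s h"
    and res: "\<And>g. g \<in> carrier G \<Longrightarrow> \<pi> (p g) = \<psi>1 g \<and> \<pi> (q g) = \<beta> g \<and> \<pi> (r g) = \<zero> \<and> \<pi> (s g) = \<psi>2 g"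
    and near: "near \<tau> (\<lambda>g h. p h = p g \<and> q h = q g \<and> r h = r g \<and> s h = s g)"
  obtains \<sigma> where "\<sigma> \<in> hom G (GL2 A)" "near \<tau> (\<lambda>g h. \<sigma> h = \<sigma> g)"
    "\<And>g. g \<in> carrier G \<Longrightarrow> map_mat2 \<pi> (\<sigma> g) = \<rho>bar g"
    "\<And>g. g \<in> carrier G \<Longrightarrow> mat2_tr A (\<sigma> g) = p g \<oplus>\<^bsub>A\<^esub> s g"
    "\<And>g. g \<in> carrier G \<Longrightarrow> mat2_det A (\<sigma> g) = p g \<otimes>\<^bsub>A\<^esub> s g \<ominus>\<^bsub>A\<^esub> q g \<otimes>\<^bsub>A\<^esub> r g"
proof -
  interpret A: local_map A F \<pi> by fact
  obtain v where v: "v \<in> carrier A" "\<pi> v = \<ominus> v0" using A.lift_exists[of "\<ominus> v0"] by auto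
  \<comment> \<open>The entries after conjugation by the upper unipotent matrix with entry
    \<open>v\<close>, a lift of \<open>- v0\<close>.\<close>
  define p' q' r' s' where "p' g = p g \<oplus>\<^bsub>A\<^esub> v \<otimes>\<^bsub>A\<^esub> r g" and
    "q' g = q g \<oplus>\<^bsub>A\<^esub> v \<otimes>\<^bsub>A\<^esub> s g \<ominus>\<^bsub>A\<^esub> (p g \<oplus>\<^bsub>A\<^esub> v \<otimes>\<^bsub>A\<^esub> r g) \<otimes>\<^bsub>A\<^esub> v" and "r' g = r g" and "s' g = s g \<ominus>\<^bsub>A\<^esub> r g \<otimes>\<^bsub>A\<^esub> v" for g
  note defs = this
  let ?\<sigma> = "\<lambda>g. Mat2 (p' g) (q' g) (r' g) (s' g)"
  have c': "p' g \<in> carrier A \<and> q' g \<in> carrier A \<and> r' g \<in> carrier A \<and> s' g \<in> carrier A" if "g \<in> carrier G" for g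
    using c[OF that] v by (simp add: defs)
  have m': "p' (g \<otimes>\<^bsub>G\<^esub> h) = p' g \<otimes>\<^bsub>A\<^esub> p' h \<oplus>\<^bsub>A\<^esub> q' g \<otimes>\<^bsub>A\<^esub> r' h \<and> q' (g \<otimes>\<^bsub>G\<^esub> h) = p' g \<otimes>\<^bsub>A\<^esub> q' h \<oplus>\<^bsub>A\<^esub> q' g \<otimes>\<^bsub>A\<^esub> s' h \<and>
      r' (g \<otimes>\<^bsub>G\<^esub> h) = r' g \<otimes>\<^bsub>A\<^esub> p' h \<oplus>\<^bsub>A\<^esub> s' g \<otimes>\<^bsub>A\<^esub> r' h \<and> s' (g \<otimes>\<^bsub>G\<^esub> h) = r' g \<otimes>\<^bsub>A\<^esub> q' h \<oplus>\<^bsub>A\<^esub> s' g \<otimes>\<^bsub>A\<^esub> s' h"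
    if gh: "g \<in> carrier G" "h \<in> carrier G" for g h
  proof -
    define a b cc d a' b' cc' d' where "a = p g" and "b = q g" and "cc = r g" and "d = s g"
      and "a' = p h" and "b' = q h" and "cc' = r h" and "d' = s h"
    note e = this
    have x: "a \<in> carrier A" "b \<in> carrier A" "cc \<in> carrier A" "d \<in> carrier A"
      "a' \<in> carrier A" "b' \<in> carrier A" "cc' \<in> carrier A" "d' \<in> carrier A"
      using c[OF gh(1)] c[OF gh(2)] by (simp_all add: e)
    have 1: "a \<otimes>\<^bsub>A\<^esub> a' \<oplus>\<^bsub>A\<^esub> b \<otimes>\<^bsub>A\<^esub> cc' \<oplus>\<^bsub>A\<^esub> v \<otimes>\<^bsub>A\<^esub> (cc \<otimes>\<^bsub>A\<^esub> a' \<oplus>\<^bsub>A\<^esub> d \<otimes>\<^bsub>A\<^esub> cc') =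
      (a \<oplus>\<^bsub>A\<^esub> v \<otimes>\<^bsub>A\<^esub> cc) \<otimes>\<^bsub>A\<^esub> (a' \<oplus>\<^bsub>A\<^esub> v \<otimes>\<^bsub>A\<^esub> cc') \<oplus>\<^bsub>A\<^esub> (b \<oplus>\<^bsub>A\<^esub> v \<otimes>\<^bsub>A\<^esub> d \<ominus>\<^bsub>A\<^esub> (a \<oplus>\<^bsub>A\<^esub> v \<otimes>\<^bsub>A\<^esub> cc) \<otimes>\<^bsub>A\<^esub> v) \<otimes>\<^bsub>A\<^esub> cc'"
      using x v(1) by algebra
    have 3: "cc \<otimes>\<^bsub>A\<^esub> a' \<oplus>\<^bsub>A\<^esub> d \<otimes>\<^bsub>A\<^esub> cc' = cc \<otimes>\<^bsub>A\<^esub> (a' \<oplus>\<^bsub>A\<^esub> v \<otimes>\<^bsub>A\<^esub> cc') \<oplus>\<^bsub>A\<^esub> (d \<ominus>\<^bsub>A\<^esub> cc \<otimes>\<^bsub>A\<^esub> v) \<otimes>\<^bsub>A\<^esub> cc'"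
      using x v(1) by algebra
    have 4: "cc \<otimes>\<^bsub>A\<^esub> b' \<oplus>\<^bsub>A\<^esub> d \<otimes>\<^bsub>A\<^esub> d' \<ominus>\<^bsub>A\<^esub> (cc \<otimes>\<^bsub>A\<^esub> a' \<oplus>\<^bsub>A\<^esub> d \<otimes>\<^bsub>A\<^esub> cc') \<otimes>\<^bsub>A\<^esub> v =
      cc \<otimes>\<^bsub>A\<^esub> (b' \<oplus>\<^bsub>A\<^esub> v \<otimes>\<^bsub>A\<^esub> d' \<ominus>\<^bsub>A\<^esub> (a' \<oplus>\<^bsub>A\<^esub> v \<otimes>\<^bsub>A\<^esub> cc') \<otimes>\<^bsub>A\<^esub> v) \<oplus>\<^bsub>A\<^esub> (d \<ominus>\<^bsub>A\<^esub> cc \<otimes>\<^bsub>A\<^esub> v) \<otimes>\<^bsub>A\<^esub> (d' \<ominus>\<^bsub>A\<^esub> cc' \<otimes>\<^bsub>A\<^esub> v)"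
      using x v(1) by algebra
    define P where "P = a \<oplus>\<^bsub>A\<^esub> v \<otimes>\<^bsub>A\<^esub> cc"
    define W where "W = b \<oplus>\<^bsub>A\<^esub> v \<otimes>\<^bsub>A\<^esub> d"
    have PW: "P \<in> carrier A" "W \<in> carrier A" using x v by (simp_all add: P_def W_def)
    have s1: "a \<otimes>\<^bsub>A\<^esub> b' \<oplus>\<^bsub>A\<^esub> b \<otimes>\<^bsub>A\<^esub> d' \<oplus>\<^bsub>A\<^esub> v \<otimes>\<^bsub>A\<^esub> (cc \<otimes>\<^bsub>A\<^esub> b' \<oplus>\<^bsub>A\<^esub> d \<otimes>\<^bsub>A\<^esub> d') = P \<otimes>\<^bsub>A\<^esub> b' \<oplus>\<^bsub>A\<^esub> W \<otimes>\<^bsub>A\<^esub> d'"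
      unfolding P_def W_def using x v(1) by algebra
    have s2: "a \<otimes>\<^bsub>A\<^esub> a' \<oplus>\<^bsub>A\<^esub> b \<otimes>\<^bsub>A\<^esub> cc' \<oplus>\<^bsub>A\<^esub> v \<otimes>\<^bsub>A\<^esub> (cc \<otimes>\<^bsub>A\<^esub> a' \<oplus>\<^bsub>A\<^esub> d \<otimes>\<^bsub>A\<^esub> cc') = P \<otimes>\<^bsub>A\<^esub> a' \<oplus>\<^bsub>A\<^esub> W \<otimes>\<^bsub>A\<^esub> cc'"
      unfolding P_def W_def using x v(1) by algebra
    have 2: "P \<otimes>\<^bsub>A\<^esub> b' \<oplus>\<^bsub>A\<^esub> W \<otimes>\<^bsub>A\<^esub> d' \<ominus>\<^bsub>A\<^esub> (P \<otimes>\<^bsub>A\<^esub> a' \<oplus>\<^bsub>A\<^esub> W \<otimes>\<^bsub>A\<^esub> cc') \<otimes>\<^bsub>A\<^esub> v =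
       P \<otimes>\<^bsub>A\<^esub> (b' \<oplus>\<^bsub>A\<^esub> v \<otimes>\<^bsub>A\<^esub> d' \<ominus>\<^bsub>A\<^esub> (a' \<oplus>\<^bsub>A\<^esub> v \<otimes>\<^bsub>A\<^esub> cc') \<otimes>\<^bsub>A\<^esub> v) \<oplus>\<^bsub>A\<^esub> (W \<ominus>\<^bsub>A\<^esub> P \<otimes>\<^bsub>A\<^esub> v) \<otimes>\<^bsub>A\<^esub> (d' \<ominus>\<^bsub>A\<^esub> cc' \<otimes>\<^bsub>A\<^esub> v)"
      using x v(1) PW by algebra
    show ?thesis
      using 1 3 4 2[folded s1 s2, unfolded P_def W_def] m[OF gh]
      unfolding defs e by simp
  qed
  have res': "\<pi> (p' g) = \<psi>1 g \<and> \<pi> (q' g) = e g \<and> \<pi> (r' g) = \<zero> \<and> \<pi> (s' g) = \<psi>2 g" if g: "g \<in> carrier G" for g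
  proof -
    have "\<beta> g \<oplus> \<ominus> v0 \<otimes> \<psi>2 g \<ominus> \<psi>1 g \<otimes> \<ominus> v0 = e g"
      unfolding \<beta>_def using v0_closed e_closed[OF g] psi1_closed[OF g] psi2_closed[OF g] by algebra
    then show ?thesis using c[OF g] res[OF g] v g by (simp add: defs a_minus_def)
  qed
  show ?thesis
  proof (rule that[of ?\<sigma>])
    show "?\<sigma> \<in> hom G (GL2 A)" by (rule lift_from_entries(1)[OF loc c' m' res'])
    show "\<And>g. g \<in> carrier G \<Longrightarrow> map_mat2 \<pi> (?\<sigma> g) = \<rho>bar g" by (rule lift_from_entries(2)[OF loc c' m' res'])
    show "near \<tau> (\<lambda>g h. ?\<sigma> h = ?\<sigma> g)" by (rule near_mono[OF near]) (simp add: defs)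
    fix g assume g: "g \<in> carrier G"
    define a b cc d where "a = p g" and "b = q g" and "cc = r g" and "d = s g"
    note e = this
    have x: "a \<in> carrier A" "b \<in> carrier A" "cc \<in> carrier A" "d \<in> carrier A" using c[OF g] by (simp_all add: e)
    show "mat2_tr A (?\<sigma> g) = p g \<oplus>\<^bsub>A\<^esub> s g"
      unfolding mat2_tr_def mat2.sel defs e[symmetric] using x v(1) by algebra
    show "mat2_det A (?\<sigma> g) = p g \<otimes>\<^bsub>A\<^esub> s g \<ominus>\<^bsub>A\<^esub> q g \<otimes>\<^bsub>A\<^esub> r g"
      unfolding mat2_det_def mat2.sel defs e[symmetric] using x v(1) by algebra
  qed
qed

text \<open>Obstruction theory: \<open>H\<^sup>2 = 0\<close> allows the upper right entry to be corrected one copy of the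
  residue field at a time.\<close>

lemma reducible_lift_entry:
  assumes loc: "local_map A F \<pi>" and noeth: "noetherian_ring A"
    and nil: "ideal_power A (a_kernel A F \<pi>) N = {\<zero>\<^bsub>A\<^esub>}"
    and ad: "\<And>g. g \<in> carrier G \<Longrightarrow> a g \<in> carrier A \<and> d g \<in> carrier A \<and> \<pi> (a g) = \<psi>1 g \<and> \<pi> (d g) = \<psi>2 g"
    and mult: "\<And>g h. g \<in> carrier G \<Longrightarrow> h \<in> carrier G \<Longrightarrow>
      a (g \<otimes>\<^bsub>G\<^esub> h) = a g \<otimes>\<^bsub>A\<^esub> a h \<and> d (g \<otimes>\<^bsub>G\<^esub> h) = d g \<otimes>\<^bsub>A\<^esub> d h"
    and near: "near \<tau> (\<lambda>g h. a h = a g \<and> d h = d g)"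
  obtains b where "\<And>g. g \<in> carrier G \<Longrightarrow> b g \<in> carrier A \<and> \<pi> (b g) = e g" "near \<tau> (\<lambda>g h. b h = b g)"
    "\<And>g h. g \<in> carrier G \<Longrightarrow> h \<in> carrier G \<Longrightarrow> b (g \<otimes>\<^bsub>G\<^esub> h) = a g \<otimes>\<^bsub>A\<^esub> b h \<oplus>\<^bsub>A\<^esub> b g \<otimes>\<^bsub>A\<^esub> d h"
proof -
  interpret A: local_map A F \<pi> by fact
  \<comment> \<open>\<open>E b\<close> is the defect of \<open>b\<close> in the multiplication rule
    for an upper right entry. The induction runs over ideals \<open>K\<close> modulo which some
    \<open>b\<close> has no defect.\<close>
  define E where "E b g h = b (g \<otimes>\<^bsub>G\<^esub> h) \<ominus>\<^bsub>A\<^esub> (a g \<otimes>\<^bsub>A\<^esub> b h \<oplus>\<^bsub>A\<^esub> b g \<otimes>\<^bsub>A\<^esub> d h)" for b g h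
  define P where "P K \<longleftrightarrow> (\<exists>b. (\<forall>g\<in>carrier G. b g \<in> carrier A \<and> \<pi> (b g) = e g) \<and> near \<tau> (\<lambda>g h. b h = b g) \<and>
    (\<forall>g\<in>carrier G. \<forall>h\<in>carrier G. E b g h \<in> K))" for K
  define l where "l = inv_into (carrier A) \<pi>"
  have l: "l z \<in> carrier A" "\<pi> (l z) = z" if "z \<in> carrier F" for z
    using that A.residue_surj unfolding l_def by (metis inv_into_into, metis f_inv_into_f)
  have Ec: "E b g h \<in> carrier A" if "\<And>g. g \<in> carrier G \<Longrightarrow> b g \<in> carrier A" "g \<in> carrier G" "h \<in> carrier G" for b g h
    using that ad by (simp add: E_def)
  have "P {\<zero>\<^bsub>A\<^esub>}"
  proof (rule A.open_ideal_induct[where P = P and N = N, OF noeth _ _ A.R.zeroideal])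
    show "A.mpow N \<subseteq> {\<zero>\<^bsub>A\<^esub>}" using nil by simp
  next
    fix K assume K: "ideal K A" "A.mm \<subseteq> K"
    have "E (\<lambda>g. l (e g)) g h \<in> K" if g: "g \<in> carrier G" "h \<in> carrier G" for g h
    proof -
      have cE: "E (\<lambda>g. l (e g)) g h \<in> carrier A" using g l by (intro Ec) simp_all
      have "\<pi> (E (\<lambda>g. l (e g)) g h) = \<zero>"
        unfolding E_def using ad[OF g(1)] ad[OF g(2)] l g e_mult[OF g]
        by (simp add: F.m_comm[of "e g"] F.r_neg a_minus_def)
      then show ?thesis using K(2) cE A.mm_iff by (metis subsetD)
    qed
    moreover have "near \<tau> (\<lambda>g h. l (e h) = l (e g))" by (rule near_mono[OF e_near]) simp
    ultimately show "P K" unfolding P_def using l by (intro exI[of _ "\<lambda>g. l (e g)"]) simp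
  next
    fix K \<epsilon> assume K: "ideal K A" and \<epsilon>: "\<epsilon> \<in> A.mm" "\<epsilon> \<notin> K" and m\<epsilon>: "\<And>s. s \<in> A.mm \<Longrightarrow> s \<otimes>\<^bsub>A\<^esub> \<epsilon> \<in> K"
      and PK: "P (set_add A K (PIdl\<^bsub>A\<^esub> \<epsilon>))"
    interpret K: ideal K A by fact
    have \<epsilon>c: "\<epsilon> \<in> carrier A" using \<epsilon>(1) A.mm_iff by simp
    obtain b where B: "\<forall>g\<in>carrier G. b g \<in> carrier A \<and> \<pi> (b g) = e g" and bn: "near \<tau> (\<lambda>g h. b h = b g)"
      and BE: "\<forall>g\<in>carrier G. \<forall>h\<in>carrier G. E b g h \<in> set_add A K (PIdl\<^bsub>A\<^esub> \<epsilon>)"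
      using PK unfolding P_def by (elim exE conjE)
    have b: "\<And>g. g \<in> carrier G \<Longrightarrow> b g \<in> carrier A" "\<And>g. g \<in> carrier G \<Longrightarrow> \<pi> (b g) = e g"
      and bE: "\<And>g h. g \<in> carrier G \<Longrightarrow> h \<in> carrier G \<Longrightarrow> E b g h \<in> set_add A K (PIdl\<^bsub>A\<^esub> \<epsilon>)"
      using B BE by simp_all
    \<comment> \<open>The coordinate on \<open>K + (\<epsilon>)\<close> modulo \<open>K\<close>, a
      line over the residue field. It depends on the element alone, so local constancy of the defect
      passes to the cochain \<open>z\<close> below.\<close>
    define co where "co y = (SOME z. z \<in> carrier F \<and> y \<ominus>\<^bsub>A\<^esub> l z \<otimes>\<^bsub>A\<^esub> \<epsilon> \<in> K)" for y
    have co: "co y \<in> carrier F \<and> y \<ominus>\<^bsub>A\<^esub> l (co y) \<otimes>\<^bsub>A\<^esub> \<epsilon> \<in> K" if y: "y \<in> set_add A K (PIdl\<^bsub>A\<^esub> \<epsilon>)" for y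
    proof -
      obtain k s where k: "k \<in> K" "s \<in> carrier A" "y = k \<oplus>\<^bsub>A\<^esub> s \<otimes>\<^bsub>A\<^esub> \<epsilon>"
        using y unfolding A.mem_add_PIdl by (elim bexE)
      have lc: "l (\<pi> s) \<in> carrier A" "\<pi> (l (\<pi> s)) = \<pi> s" using l k(2) by simp_all
      have "(s \<ominus>\<^bsub>A\<^esub> l (\<pi> s)) \<otimes>\<^bsub>A\<^esub> \<epsilon> \<in> K" using A.residue_eq_iff[of s "l (\<pi> s)"] lc k(2) by (intro m\<epsilon>) simp
      then have "k \<oplus>\<^bsub>A\<^esub> (s \<ominus>\<^bsub>A\<^esub> l (\<pi> s)) \<otimes>\<^bsub>A\<^esub> \<epsilon> \<in> K" using k(1) by simp
      moreover have "k \<oplus>\<^bsub>A\<^esub> (s \<ominus>\<^bsub>A\<^esub> l (\<pi> s)) \<otimes>\<^bsub>A\<^esub> \<epsilon> = y \<ominus>\<^bsub>A\<^esub> l (\<pi> s) \<otimes>\<^bsub>A\<^esub> \<epsilon>"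
        unfolding k(3) using K.Icarr[OF k(1)] k(2) lc(1) \<epsilon>c by algebra
      ultimately have "\<pi> s \<in> carrier F \<and> y \<ominus>\<^bsub>A\<^esub> l (\<pi> s) \<otimes>\<^bsub>A\<^esub> \<epsilon> \<in> K" using k(2) by simp
      then show ?thesis unfolding co_def by (rule someI)
    qed
    \<comment> \<open>Coordinates are unique: a unit multiple of \<open>\<epsilon>\<close> in
      \<open>K\<close> would put \<open>\<epsilon>\<close> into \<open>K\<close>.\<close>
    have zero: "\<pi> y = \<zero>" if "y \<in> carrier A" "y \<otimes>\<^bsub>A\<^esub> \<epsilon> \<in> K" for y
    proof (rule ccontr)
      assume "\<pi> y \<noteq> \<zero>"
      then have yu: "y \<in> Units A" using that(1) A.residue_unit by simp
      then have "inv\<^bsub>A\<^esub> y \<otimes>\<^bsub>A\<^esub> (y \<otimes>\<^bsub>A\<^esub> \<epsilon>) \<in> K" using yu by (intro K.I_l_closed[OF that(2)]) simp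
      moreover have "inv\<^bsub>A\<^esub> y \<otimes>\<^bsub>A\<^esub> (y \<otimes>\<^bsub>A\<^esub> \<epsilon>) = \<epsilon>"
        using A.R.m_assoc[of "inv\<^bsub>A\<^esub> y" y \<epsilon>] yu \<epsilon>c that(1) by simp
      ultimately show False using \<epsilon>(2) by simp
    qed
    define z where "z g h = co (E b g h)" for g h
    have zc: "z g h \<in> carrier F" "E b g h \<ominus>\<^bsub>A\<^esub> l (z g h) \<otimes>\<^bsub>A\<^esub> \<epsilon> \<in> K" if "g \<in> carrier G" "h \<in> carrier G" for g h
      using co[OF bE[OF that]] by (simp_all add: z_def)
    obtain f where f: "\<And>g. g \<in> carrier G \<Longrightarrow> f g \<in> carrier F" "near \<tau> (\<lambda>g h. f h = f g)"
      and zf: "\<And>g h. g \<in> carrier G \<Longrightarrow> h \<in> carrier G \<Longrightarrow> z g h = \<psi>1 g \<otimes> f h \<oplus> \<psi>2 h \<otimes> f g \<ominus> f (g \<otimes>\<^bsub>G\<^esub> h)"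
    proof -
      have "\<exists>f. (\<forall>g\<in>carrier G. f g \<in> carrier F) \<and> near \<tau> (\<lambda>g h. f h = f g) \<and>
        (\<forall>g\<in>carrier G. \<forall>h\<in>carrier G. z g h = \<psi>1 g \<otimes> f h \<oplus> \<psi>2 h \<otimes> f g \<ominus> f (g \<otimes>\<^bsub>G\<^esub> h))"
      proof (rule H2)
        show "z g h \<in> carrier F" if "g \<in> carrier G" "h \<in> carrier G" for g h using zc[OF that] by simp
        have n: "near \<tau> (\<lambda>g h. (a h = a g \<and> d h = d g) \<and> b h = b g)" by (rule near_conj[OF near bn])
        have n1: "near (prod_topology \<tau> \<tau>) (\<lambda>s s'. (a (fst s') = a (fst s) \<and> d (fst s') = d (fst s)) \<and> b (fst s') = b (fst s))"
          by (rule near_pull[OF n continuous_map_fst])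
        have n2: "near (prod_topology \<tau> \<tau>) (\<lambda>s s'. (a (snd s') = a (snd s) \<and> d (snd s') = d (snd s)) \<and> b (snd s') = b (snd s))"
          by (rule near_pull[OF n continuous_map_snd])
        have n3: "near (prod_topology \<tau> \<tau>) (\<lambda>s s'. b (fst s' \<otimes>\<^bsub>G\<^esub> snd s') = b (fst s \<otimes>\<^bsub>G\<^esub> snd s))"
          using near_pull[OF bn mult_cont] by (simp add: case_prod_unfold)
        show "near (prod_topology \<tau> \<tau>) (\<lambda>s s'. z (fst s') (snd s') = z (fst s) (snd s))"
          by (rule near_mono2[OF near_conj[OF n1 n2] n3]) (simp add: z_def E_def)
        fix g h k assume g: "g \<in> carrier G" and h: "h \<in> carrier G" and k: "k \<in> carrier G"
        let ?y = "l (z g (h \<otimes>\<^bsub>G\<^esub> k)) \<oplus>\<^bsub>A\<^esub> a g \<otimes>\<^bsub>A\<^esub> l (z h k) \<ominus>\<^bsub>A\<^esub> l (z (g \<otimes>\<^bsub>G\<^esub> h) k) \<ominus>\<^bsub>A\<^esub> l (z g h) \<otimes>\<^bsub>A\<^esub> d k"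
        define e1 e2 e3 e4 where "e1 = E b g (h \<otimes>\<^bsub>G\<^esub> k)" and "e2 = E b h k" and "e3 = E b (g \<otimes>\<^bsub>G\<^esub> h) k" and "e4 = E b g h"
        define z1 z2 z3 z4 where "z1 = l (z g (h \<otimes>\<^bsub>G\<^esub> k))" and "z2 = l (z h k)" and "z3 = l (z (g \<otimes>\<^bsub>G\<^esub> h) k)" and "z4 = l (z g h)"
        have ec: "e1 \<in> carrier A" "e2 \<in> carrier A" "e3 \<in> carrier A" "e4 \<in> carrier A"
          using g h k b(1) by (simp_all add: e1_def e2_def e3_def e4_def Ec)
        have zzc: "z1 \<in> carrier A" "z2 \<in> carrier A" "z3 \<in> carrier A" "z4 \<in> carrier A"
          using g h k zc(1) l by (simp_all add: z1_def z2_def z3_def z4_def)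
        have diffs: "e1 \<ominus>\<^bsub>A\<^esub> z1 \<otimes>\<^bsub>A\<^esub> \<epsilon> \<in> K" "e2 \<ominus>\<^bsub>A\<^esub> z2 \<otimes>\<^bsub>A\<^esub> \<epsilon> \<in> K" "e3 \<ominus>\<^bsub>A\<^esub> z3 \<otimes>\<^bsub>A\<^esub> \<epsilon> \<in> K" "e4 \<ominus>\<^bsub>A\<^esub> z4 \<otimes>\<^bsub>A\<^esub> \<epsilon> \<in> K"
          using g h k zc(2) by (simp_all add: e1_def e2_def e3_def e4_def z1_def z2_def z3_def z4_def)
        have agc: "a g \<in> carrier A" "a h \<in> carrier A" "d h \<in> carrier A" "d k \<in> carrier A" using ad g h k by simp_all
        \<comment> \<open>The defect satisfies the twisted 2-cocycle identity over \<open>A\<close>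
          because \<open>a\<close> and \<open>d\<close> are multiplicative; the coordinates then
          satisfy it over \<open>F\<close>.\<close>
        have coc: "e1 \<oplus>\<^bsub>A\<^esub> a g \<otimes>\<^bsub>A\<^esub> e2 \<ominus>\<^bsub>A\<^esub> e3 \<ominus>\<^bsub>A\<^esub> e4 \<otimes>\<^bsub>A\<^esub> d k = \<zero>\<^bsub>A\<^esub>"
        proof -
          have bc: "b (g \<otimes>\<^bsub>G\<^esub> h \<otimes>\<^bsub>G\<^esub> k) \<in> carrier A" "b (h \<otimes>\<^bsub>G\<^esub> k) \<in> carrier A" "b (g \<otimes>\<^bsub>G\<^esub> h) \<in> carrier A"
            "b g \<in> carrier A" "b h \<in> carrier A" "b k \<in> carrier A" using b(1) g h k by simp_all
          have ee: "e1 = b (g \<otimes>\<^bsub>G\<^esub> h \<otimes>\<^bsub>G\<^esub> k) \<ominus>\<^bsub>A\<^esub> (a g \<otimes>\<^bsub>A\<^esub> b (h \<otimes>\<^bsub>G\<^esub> k) \<oplus>\<^bsub>A\<^esub> b g \<otimes>\<^bsub>A\<^esub> (d h \<otimes>\<^bsub>A\<^esub> d k))"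
            "e3 = b (g \<otimes>\<^bsub>G\<^esub> h \<otimes>\<^bsub>G\<^esub> k) \<ominus>\<^bsub>A\<^esub> (a g \<otimes>\<^bsub>A\<^esub> a h \<otimes>\<^bsub>A\<^esub> b k \<oplus>\<^bsub>A\<^esub> b (g \<otimes>\<^bsub>G\<^esub> h) \<otimes>\<^bsub>A\<^esub> d k)"
            using mult g h k by (simp_all add: e1_def e3_def E_def G.m_assoc)
          show ?thesis unfolding ee unfolding e2_def e4_def E_def using bc agc by algebra
        qed
        have "(e1 \<ominus>\<^bsub>A\<^esub> z1 \<otimes>\<^bsub>A\<^esub> \<epsilon>) \<oplus>\<^bsub>A\<^esub> a g \<otimes>\<^bsub>A\<^esub> (e2 \<ominus>\<^bsub>A\<^esub> z2 \<otimes>\<^bsub>A\<^esub> \<epsilon>) \<ominus>\<^bsub>A\<^esub> (e3 \<ominus>\<^bsub>A\<^esub> z3 \<otimes>\<^bsub>A\<^esub> \<epsilon>) \<ominus>\<^bsub>A\<^esub> (e4 \<ominus>\<^bsub>A\<^esub> z4 \<otimes>\<^bsub>A\<^esub> \<epsilon>) \<otimes>\<^bsub>A\<^esub> d k \<in> K"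
          using diffs agc by (simp add: K.diff_closed K.I_l_closed K.I_r_closed)
        moreover have "(e1 \<ominus>\<^bsub>A\<^esub> z1 \<otimes>\<^bsub>A\<^esub> \<epsilon>) \<oplus>\<^bsub>A\<^esub> a g \<otimes>\<^bsub>A\<^esub> (e2 \<ominus>\<^bsub>A\<^esub> z2 \<otimes>\<^bsub>A\<^esub> \<epsilon>) \<ominus>\<^bsub>A\<^esub> (e3 \<ominus>\<^bsub>A\<^esub> z3 \<otimes>\<^bsub>A\<^esub> \<epsilon>) \<ominus>\<^bsub>A\<^esub> (e4 \<ominus>\<^bsub>A\<^esub> z4 \<otimes>\<^bsub>A\<^esub> \<epsilon>) \<otimes>\<^bsub>A\<^esub> d k =
           (e1 \<oplus>\<^bsub>A\<^esub> a g \<otimes>\<^bsub>A\<^esub> e2 \<ominus>\<^bsub>A\<^esub> e3 \<ominus>\<^bsub>A\<^esub> e4 \<otimes>\<^bsub>A\<^esub> d k) \<ominus>\<^bsub>A\<^esub> (z1 \<oplus>\<^bsub>A\<^esub> a g \<otimes>\<^bsub>A\<^esub> z2 \<ominus>\<^bsub>A\<^esub> z3 \<ominus>\<^bsub>A\<^esub> z4 \<otimes>\<^bsub>A\<^esub> d k) \<otimes>\<^bsub>A\<^esub> \<epsilon>"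
          using ec zzc agc \<epsilon>c by algebra
        ultimately have "\<ominus>\<^bsub>A\<^esub> ((z1 \<oplus>\<^bsub>A\<^esub> a g \<otimes>\<^bsub>A\<^esub> z2 \<ominus>\<^bsub>A\<^esub> z3 \<ominus>\<^bsub>A\<^esub> z4 \<otimes>\<^bsub>A\<^esub> d k) \<otimes>\<^bsub>A\<^esub> \<epsilon>) \<in> K"
          unfolding coc using zzc agc \<epsilon>c by (simp add: a_minus_def)
        then have "(z1 \<oplus>\<^bsub>A\<^esub> a g \<otimes>\<^bsub>A\<^esub> z2 \<ominus>\<^bsub>A\<^esub> z3 \<ominus>\<^bsub>A\<^esub> z4 \<otimes>\<^bsub>A\<^esub> d k) \<otimes>\<^bsub>A\<^esub> \<epsilon> \<in> K"
          using K.a_inv_closed zzc agc \<epsilon>c by fastforce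
        then have "\<pi> (z1 \<oplus>\<^bsub>A\<^esub> a g \<otimes>\<^bsub>A\<^esub> z2 \<ominus>\<^bsub>A\<^esub> z3 \<ominus>\<^bsub>A\<^esub> z4 \<otimes>\<^bsub>A\<^esub> d k) = \<zero>"
          using zzc agc by (intro zero) simp_all
        then have "z g (h \<otimes>\<^bsub>G\<^esub> k) \<oplus> \<psi>1 g \<otimes> z h k \<ominus> z (g \<otimes>\<^bsub>G\<^esub> h) k \<ominus> z g h \<otimes> \<psi>2 k = \<zero>"
          using zzc agc g h k ad zc(1) l by (simp add: z1_def z2_def z3_def z4_def)
        moreover have "z g (h \<otimes>\<^bsub>G\<^esub> k) \<oplus> \<psi>1 g \<otimes> z h k \<ominus> z (g \<otimes>\<^bsub>G\<^esub> h) k \<ominus> z g h \<otimes> \<psi>2 k =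
           (z g (h \<otimes>\<^bsub>G\<^esub> k) \<oplus> \<psi>1 g \<otimes> z h k) \<ominus> (z (g \<otimes>\<^bsub>G\<^esub> h) k \<oplus> z g h \<otimes> \<psi>2 k)"
        proof -
          have "z g (h \<otimes>\<^bsub>G\<^esub> k) \<in> carrier F" "z h k \<in> carrier F" "z (g \<otimes>\<^bsub>G\<^esub> h) k \<in> carrier F" "z g h \<in> carrier F"
            using g h k zc(1) by simp_all
          then show ?thesis using psi1_closed[OF g] psi2_closed[OF k] by algebra
        qed
        ultimately show "z g (h \<otimes>\<^bsub>G\<^esub> k) \<oplus> \<psi>1 g \<otimes> z h k = z (g \<otimes>\<^bsub>G\<^esub> h) k \<oplus> z g h \<otimes> \<psi>2 k"
          using g h k zc(1) by simp
      qed
      then show ?thesis using that by metis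
    qed
    \<comment> \<open>The coordinate \<open>z\<close> of the defect is the twisted coboundary of
      \<open>f\<close>, so adding lifts of \<open>f\<close> times \<open>\<epsilon>\<close> cancels
      the defect modulo \<open>K\<close>. The residue remains \<open>e\<close> because
      \<open>\<epsilon>\<close> lies in the maximal ideal.\<close>
    define b' where "b' g = b g \<oplus>\<^bsub>A\<^esub> l (f g) \<otimes>\<^bsub>A\<^esub> \<epsilon>" for g
    have b': "b' g \<in> carrier A \<and> \<pi> (b' g) = e g" if g: "g \<in> carrier G" for g
      using b[OF g] l f(1)[OF g] \<epsilon>c \<epsilon>(1) g by (simp add: b'_def A.mm_iff)
    have "near \<tau> (\<lambda>g h. b' h = b' g)"
      by (rule near_mono2[OF bn f(2)]) (simp add: b'_def)
    moreover have "E b' g h \<in> K" if g: "g \<in> carrier G" and h: "h \<in> carrier G" for g h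
    proof -
      define w x y where "w = l (f (g \<otimes>\<^bsub>G\<^esub> h))" and "x = l (f h)" and "y = l (f g)"
      have wc: "w \<in> carrier A" "x \<in> carrier A" "y \<in> carrier A" using f(1) l g h by (simp_all add: w_def x_def y_def)
      have c: "a g \<in> carrier A" "d h \<in> carrier A" "b (g \<otimes>\<^bsub>G\<^esub> h) \<in> carrier A" "b g \<in> carrier A" "b h \<in> carrier A"
        using ad b(1) g h by simp_all
      define z' where "z' = l (z g h)"
      have z': "z' \<in> carrier A" "\<pi> z' = z g h" using zc(1)[OF g h] l by (simp_all add: z'_def)
      have "E b' g h = (E b g h \<ominus>\<^bsub>A\<^esub> z' \<otimes>\<^bsub>A\<^esub> \<epsilon>) \<oplus>\<^bsub>A\<^esub> (z' \<oplus>\<^bsub>A\<^esub> w \<ominus>\<^bsub>A\<^esub> a g \<otimes>\<^bsub>A\<^esub> x \<ominus>\<^bsub>A\<^esub> y \<otimes>\<^bsub>A\<^esub> d h) \<otimes>\<^bsub>A\<^esub> \<epsilon>"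
        unfolding E_def b'_def w_def[symmetric] x_def[symmetric] y_def[symmetric]
        using c wc z'(1) \<epsilon>c by algebra
      moreover have "z' \<oplus>\<^bsub>A\<^esub> w \<ominus>\<^bsub>A\<^esub> a g \<otimes>\<^bsub>A\<^esub> x \<ominus>\<^bsub>A\<^esub> y \<otimes>\<^bsub>A\<^esub> d h \<in> A.mm"
      proof -
        have fc: "f g \<in> carrier F" "f h \<in> carrier F" "f (g \<otimes>\<^bsub>G\<^esub> h) \<in> carrier F" using f(1) g h by simp_all
        have "\<psi>1 g \<otimes> f h \<oplus> \<psi>2 h \<otimes> f g \<ominus> f (g \<otimes>\<^bsub>G\<^esub> h) \<oplus> f (g \<otimes>\<^bsub>G\<^esub> h) \<ominus> \<psi>1 g \<otimes> f h \<ominus> f g \<otimes> \<psi>2 h = \<zero>"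
          using fc psi1_closed[OF g] psi2_closed[OF h] by algebra
        then have "\<pi> (z' \<oplus>\<^bsub>A\<^esub> w \<ominus>\<^bsub>A\<^esub> a g \<otimes>\<^bsub>A\<^esub> x \<ominus>\<^bsub>A\<^esub> y \<otimes>\<^bsub>A\<^esub> d h) = \<zero>"
          using wc c z' ad g h fc l by (simp add: zf[OF g h] w_def x_def y_def)
        then show ?thesis unfolding A.mm_iff using wc c z' by simp
      qed
      ultimately show ?thesis
        using zc(2)[OF g h] m\<epsilon> unfolding z'_def by (simp add: K.a_closed)
    qed
    ultimately show "P K" unfolding P_def using b' by (intro exI[of _ b']) simp
  qed
  then obtain b where B: "\<forall>g\<in>carrier G. b g \<in> carrier A \<and> \<pi> (b g) = e g" "near \<tau> (\<lambda>g h. b h = b g)"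
    "\<forall>g\<in>carrier G. \<forall>h\<in>carrier G. E b g h \<in> {\<zero>\<^bsub>A\<^esub>}"
    unfolding P_def by (elim exE conjE)
  then have b: "\<And>g. g \<in> carrier G \<Longrightarrow> b g \<in> carrier A \<and> \<pi> (b g) = e g" "near \<tau> (\<lambda>g h. b h = b g)"
    "\<And>g h. g \<in> carrier G \<Longrightarrow> h \<in> carrier G \<Longrightarrow> E b g h = \<zero>\<^bsub>A\<^esub>" by simp_all
  have "b (g \<otimes>\<^bsub>G\<^esub> h) = a g \<otimes>\<^bsub>A\<^esub> b h \<oplus>\<^bsub>A\<^esub> b g \<otimes>\<^bsub>A\<^esub> d h" if g: "g \<in> carrier G" "h \<in> carrier G" for g h
    using b(3)[OF g] b(1) ad g by (simp add: E_def)
  then show ?thesis using that[of b] b by simp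
qed

end


section \<open>Lifts over quotients of the pseudo-deformation ring\<close>

locale universal_split = residual_extension F G \<tau> \<psi>1 \<psi>2 e u + L: complete_local_map R F \<pi> +
  P: split_pseudo_rep R G T D u l1 l2
  for F :: "'k ring" (structure) and G :: "'g monoid" (structure) and \<tau> \<psi>1 \<psi>2 e u
    and R :: "('r, 'm) ring_scheme" (structure) and \<pi> and T D :: "'g \<Rightarrow> 'r" and l1 l2 +
  assumes T_res: "g \<in> carrier G \<Longrightarrow> \<pi> (T g) = \<psi>1 g \<oplus> \<psi>2 g"
    and l_res: "\<pi> l1 = \<psi>1 u" "\<pi> l2 = \<psi>2 u"
    and T_near: "near \<tau> (\<lambda>g h. T h \<ominus>\<^bsub>R\<^esub> T g \<in> L.mpow n)"
begin

section \<open>Residues and continuity of the matrix coefficients\<close>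

lemma ad_res:
  assumes g: "g \<in> carrier G" shows "\<pi> (P.a g) = \<psi>1 g" "\<pi> (P.d g) = \<psi>2 g"
proof -
  define A where "A = \<pi> (P.a g)"
  have A: "A \<in> carrier F" using g by (simp add: A_def)
  have "\<pi> (T (u \<otimes>\<^bsub>G\<^esub> g)) = (\<psi>1 u \<ominus> \<psi>2 u) \<otimes> A \<oplus> \<psi>2 u \<otimes> (\<psi>1 g \<oplus> \<psi>2 g)"
    using P.T_u_mult[OF g] g by (simp add: l_res T_res A_def)
  then have eq: "(\<psi>1 u \<ominus> \<psi>2 u) \<otimes> A \<oplus> \<psi>2 u \<otimes> (\<psi>1 g \<oplus> \<psi>2 g) = \<psi>1 u \<otimes> \<psi>1 g \<oplus> \<psi>2 u \<otimes> \<psi>2 g"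
    using T_res[of "u \<otimes>\<^bsub>G\<^esub> g"] g by (simp add: psi1_mult psi2_mult)
  have "A = \<psi>1 g"
  proof (rule F.unit_cancel_diff[OF psi_diff_unit _ _ _ eq])
    show "(\<psi>1 u \<ominus> \<psi>2 u) \<otimes> (A \<ominus> \<psi>1 g) =
      (\<psi>1 u \<ominus> \<psi>2 u) \<otimes> A \<oplus> \<psi>2 u \<otimes> (\<psi>1 g \<oplus> \<psi>2 g) \<ominus> (\<psi>1 u \<otimes> \<psi>1 g \<oplus> \<psi>2 u \<otimes> \<psi>2 g)"
      using A psi1_closed[OF g] psi2_closed[OF g] psi1_closed[OF u] psi2_closed[OF u] by algebra
  qed (use A g in simp_all)
  then show "\<pi> (P.a g) = \<psi>1 g" by (simp add: A_def)
  have "\<psi>1 g \<oplus> \<psi>2 g \<ominus> \<psi>1 g = \<psi>2 g" using psi1_closed[OF g] psi2_closed[OF g] by algebra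
  then show "\<pi> (P.d g) = \<psi>2 g"
    using g \<open>A = \<psi>1 g\<close> by (simp add: P.d_def T_res A_def)
qed

lemma x_mm: assumes "g \<in> carrier G" "h \<in> carrier G" shows "P.x g h \<in> L.mm"
  using assms unfolding L.mm_iff by (simp add: P.x_def ad_res psi1_mult)

lemma left_mult_cont: "g \<in> carrier G \<Longrightarrow> continuous_map \<tau> \<tau> (\<lambda>h. g \<otimes>\<^bsub>G\<^esub> h)"
proof -
  assume g: "g \<in> carrier G"
  have "continuous_map \<tau> (prod_topology \<tau> \<tau>) (\<lambda>h. (g, h))"
    using g top by (simp add: continuous_map_pairedI)
  from continuous_map_compose[OF this mult_cont] show ?thesis by (simp add: o_def)
qed

lemma a_near: "near \<tau> (\<lambda>g h. P.a h \<ominus>\<^bsub>R\<^esub> P.a g \<in> L.mpow n)"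
proof (rule near_mono2[OF near_pull[OF T_near left_mult_cont[OF u]] T_near])
  fix g h assume gh: "g \<in> topspace \<tau>" "h \<in> topspace \<tau>" "T (u \<otimes>\<^bsub>G\<^esub> h) \<ominus>\<^bsub>R\<^esub> T (u \<otimes>\<^bsub>G\<^esub> g) \<in> L.mpow n"
    "T h \<ominus>\<^bsub>R\<^esub> T g \<in> L.mpow n"
  interpret K: ideal "L.mpow n" R by (rule L.mpow_ideal)
  have g: "g \<in> carrier G" "h \<in> carrier G" using gh top by simp_all
  let ?i = "inv\<^bsub>R\<^esub> (l1 \<ominus>\<^bsub>R\<^esub> l2)"
  have i: "?i \<in> carrier R" using P.l_unit by simp
  have c: "T (u \<otimes>\<^bsub>G\<^esub> h) \<in> carrier R" "T (u \<otimes>\<^bsub>G\<^esub> g) \<in> carrier R" "T h \<in> carrier R" "T g \<in> carrier R"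
    using g by simp_all
  have "P.a h \<ominus>\<^bsub>R\<^esub> P.a g = ?i \<otimes>\<^bsub>R\<^esub> ((T (u \<otimes>\<^bsub>G\<^esub> h) \<ominus>\<^bsub>R\<^esub> T (u \<otimes>\<^bsub>G\<^esub> g)) \<ominus>\<^bsub>R\<^esub> l2 \<otimes>\<^bsub>R\<^esub> (T h \<ominus>\<^bsub>R\<^esub> T g))"
    unfolding P.a_def using i c P.l_closed by algebra
  also have "\<dots> \<in> L.mpow n" using gh i by (simp add: K.I_l_closed K.diff_closed)
  finally show "P.a h \<ominus>\<^bsub>R\<^esub> P.a g \<in> L.mpow n" .
qed

lemma d_near: "near \<tau> (\<lambda>g h. P.d h \<ominus>\<^bsub>R\<^esub> P.d g \<in> L.mpow n)"
  by (rule near_mono2[OF T_near[of n] a_near[of n]], unfold P.d_def, rule L.R.ideal_diff_minus[OF L.mpow_ideal])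
    (simp_all add: top)

text \<open>Neighbourhoods that are uniform in the second argument come from compactness of the
  group. Uniformity matters because \<open>P.x g\<close> is next regarded as a single function of
  \<open>k\<close>, which must be locally constant in \<open>g\<close> modulo
  \<open>mpow n\<close>.\<close>

lemma x_near: "near \<tau> (\<lambda>g h. \<forall>k\<in>carrier G. P.x h k \<ominus>\<^bsub>R\<^esub> P.x g k \<in> L.mpow n)"
proof -
  define X where "X s = P.x (fst s) (snd s)" for s
  define C where "C s s' \<longleftrightarrow> X s \<in> carrier R \<and> X s' \<in> carrier R \<and> X s' \<ominus>\<^bsub>R\<^esub> X s \<in> L.mpow n" for s s'
  have n1: "near (prod_topology \<tau> \<tau>) (\<lambda>s s'. P.a (fst s') \<ominus>\<^bsub>R\<^esub> P.a (fst s) \<in> L.mpow n)"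
    by (rule near_pull[OF a_near continuous_map_fst])
  have n2: "near (prod_topology \<tau> \<tau>) (\<lambda>s s'. P.a (snd s') \<ominus>\<^bsub>R\<^esub> P.a (snd s) \<in> L.mpow n)"
    by (rule near_pull[OF a_near continuous_map_snd])
  have n3: "near (prod_topology \<tau> \<tau>) (\<lambda>s s'. P.a (fst s' \<otimes>\<^bsub>G\<^esub> snd s') \<ominus>\<^bsub>R\<^esub> P.a (fst s \<otimes>\<^bsub>G\<^esub> snd s) \<in> L.mpow n)"
    using near_pull[OF a_near[of n] mult_cont] by (simp add: case_prod_unfold)
  have "near (prod_topology \<tau> \<tau>) C"
  proof (rule near_mono2[OF near_conj[OF n1 n2] n3])
    fix s s' assume s: "s \<in> topspace (prod_topology \<tau> \<tau>)" "s' \<in> topspace (prod_topology \<tau> \<tau>)"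
      and 1: "P.a (fst s') \<ominus>\<^bsub>R\<^esub> P.a (fst s) \<in> L.mpow n \<and> P.a (snd s') \<ominus>\<^bsub>R\<^esub> P.a (snd s) \<in> L.mpow n"
      and 2: "P.a (fst s' \<otimes>\<^bsub>G\<^esub> snd s') \<ominus>\<^bsub>R\<^esub> P.a (fst s \<otimes>\<^bsub>G\<^esub> snd s) \<in> L.mpow n"
    have g: "fst s \<in> carrier G" "snd s \<in> carrier G" "fst s' \<in> carrier G" "snd s' \<in> carrier G"
      using s by (auto simp: top)
    have "X s' \<ominus>\<^bsub>R\<^esub> X s \<in> L.mpow n"
      unfolding X_def P.x_def
      using 1 2 g by (intro L.R.ideal_diff_minus[OF L.mpow_ideal] L.R.ideal_diff_mult[OF L.mpow_ideal]) simp_all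
    then show "C s s'" using g by (simp add: C_def X_def)
  qed
  then have "near \<tau> (\<lambda>g h. \<forall>k\<in>topspace \<tau>. P.x h k \<ominus>\<^bsub>R\<^esub> P.x g k \<in> L.mpow n)"
  proof (rule near_prod_compact[OF _ compact])
    fix g h k k' assume "C (g, k') (h, k)" "C (g, k') (g, k)"
    then show "P.x h k \<ominus>\<^bsub>R\<^esub> P.x g k \<in> L.mpow n"
      using L.R.ideal_diff_trans[OF L.mpow_ideal, of "P.x h k" "P.x g k'" "P.x g k"]
        L.R.ideal_diff_sym[OF L.mpow_ideal, of "P.x g k" "P.x g k'"]
      by (simp add: C_def X_def)
  qed
  then show ?thesis by (simp add: top)
qed

text \<open>The values at all \<open>k\<close> form one family with target \<open>R\<close> modulo
  \<open>mpow n\<close>, continued by zero outside \<open>carrier G\<close>. This is how a single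
  multiplier \<open>r\<close> comes to serve for every \<open>k\<close>.\<close>

lemma coefficient_mod:
  assumes g: "g \<in> carrier G"
  shows "\<exists>r\<in>carrier R. \<forall>k\<in>carrier G. P.x g k \<ominus>\<^bsub>R\<^esub> r \<otimes>\<^bsub>R\<^esub> P.x r0 k \<in> L.mpow n"
proof -
  interpret K: ideal "L.mpow n" R by (rule L.mpow_ideal)
  let ?S = "R Quot L.mpow n" and ?\<Psi> = "(+>\<^bsub>R\<^esub>) (L.mpow n)"
  have kern: "?\<Psi> r = ?\<Psi> s \<longleftrightarrow> r \<ominus>\<^bsub>R\<^esub> s \<in> L.mpow n" if "r \<in> carrier R" "s \<in> carrier R" for r s
    using L.R.quotient_eq_iff_same_a_r_cos[OF L.mpow_ideal that] by simp
  interpret S: ring_hom_cring R ?S ?\<Psi>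
    using K.rcos_ring_hom K.quotient_is_cring[OF L.R.is_cring] L.R.is_cring
    by (simp add: ring_hom_cring_def ring_hom_cring_axioms_def)
  interpret E: entry_family F G \<tau> \<psi>1 \<psi>2 e u R \<pi> ?S ?\<Psi> P.a P.d
    "\<lambda>g k. if k \<in> carrier G then ?\<Psi> (P.x g k) else \<zero>\<^bsub>?S\<^esub>"
  proof (intro entry_family.intro entry_family_axioms.intro)
    show "residual_extension F G \<tau> \<psi>1 \<psi>2 e u" by (rule residual_extension_axioms)
    show "local_map R F \<pi>" by (rule L.local_map_axioms)
    show "ring_hom_cring R ?S ?\<Psi>" by (rule S.ring_hom_cring_axioms)
    show "near \<tau> (\<lambda>g h. (\<lambda>k. if k \<in> carrier G then ?\<Psi> (P.x h k) else \<zero>\<^bsub>?S\<^esub>) =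
      (\<lambda>k. if k \<in> carrier G then ?\<Psi> (P.x g k) else \<zero>\<^bsub>?S\<^esub>))"
      by (rule near_mono[OF x_near[of n]]) (rule ext, simp add: kern top)
    fix g k assume g: "g \<in> carrier G"
    show "P.a g \<in> carrier R \<and> \<pi> (P.a g) = \<psi>1 g" "P.d g \<in> carrier R \<and> \<pi> (P.d g) = \<psi>2 g"
      using g by (simp_all add: ad_res)
    show "(if k \<in> carrier G then ?\<Psi> (P.x g k) else \<zero>\<^bsub>?S\<^esub>) \<in> carrier ?S" using g by simp
    fix h assume h: "h \<in> carrier G"
    show "(if k \<in> carrier G then ?\<Psi> (P.x (g \<otimes>\<^bsub>G\<^esub> h) k) else \<zero>\<^bsub>?S\<^esub>) =
      ?\<Psi> (P.a g) \<otimes>\<^bsub>?S\<^esub> (if k \<in> carrier G then ?\<Psi> (P.x h k) else \<zero>\<^bsub>?S\<^esub>) \<oplus>\<^bsub>?S\<^esub>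
      ?\<Psi> (P.d h) \<otimes>\<^bsub>?S\<^esub> (if k \<in> carrier G then ?\<Psi> (P.x g k) else \<zero>\<^bsub>?S\<^esub>)"
      using g h P.x_mult_left[OF g h] by simp
  next
    show "(if k \<in> carrier G then ?\<Psi> (P.x u k) else \<zero>\<^bsub>?S\<^esub>) = \<zero>\<^bsub>?S\<^esub>" for k
      using S.hom_zero by (simp add: P.x_u)
  qed
  have nil: "?\<Psi> s = \<zero>\<^bsub>?S\<^esub>" if "s \<in> L.mpow n" for s
    using kern[of s "\<zero>\<^bsub>R\<^esub>"] S.hom_zero K.Icarr[OF that] that by (simp add: a_minus_def)
  obtain r where r: "r \<in> carrier R" "\<And>k. (if k \<in> carrier G then ?\<Psi> (P.x g k) else \<zero>\<^bsub>?S\<^esub>) =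
    ?\<Psi> r \<otimes>\<^bsub>?S\<^esub> (if k \<in> carrier G then ?\<Psi> (P.x r0 k) else \<zero>\<^bsub>?S\<^esub>)"
    using E.generation[OF nil g] by metis
  have "P.x g k \<ominus>\<^bsub>R\<^esub> r \<otimes>\<^bsub>R\<^esub> P.x r0 k \<in> L.mpow n" if k: "k \<in> carrier G" for k
  proof -
    have "?\<Psi> (P.x g k) = ?\<Psi> r \<otimes>\<^bsub>?S\<^esub> ?\<Psi> (P.x r0 k)" using r(2)[of k] k by simp
    also have "\<dots> = ?\<Psi> (r \<otimes>\<^bsub>R\<^esub> P.x r0 k)" using S.hom_mult[OF r(1), of "P.x r0 k"] k r0(1) by simp
    finally show ?thesis using kern[of "P.x g k" "r \<otimes>\<^bsub>R\<^esub> P.x r0 k"] g k r0(1) r(1) by simp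
  qed
  then show ?thesis using r(1) by blast
qed

text \<open>The multipliers that work modulo \<open>mpow n\<close> form decreasing sets stable under
  adding \<open>mpow n\<close>, so \<open>compactness\<close> provides one that works
  exactly.\<close>

lemma coefficient:
  assumes g: "g \<in> carrier G"
  shows "\<exists>r\<in>carrier R. \<forall>k\<in>carrier G. P.x g k = r \<otimes>\<^bsub>R\<^esub> P.x r0 k"
proof -
  define S where "S n = {r \<in> carrier R. \<forall>k\<in>carrier G. P.x g k \<ominus>\<^bsub>R\<^esub> r \<otimes>\<^bsub>R\<^esub> P.x r0 k \<in> L.mpow n}" for n
  have "\<exists>r. \<forall>n. r \<in> S n"
  proof (rule L.compactness[of S])
    show "S n \<subseteq> carrier R" for n by (auto simp: S_def)
    show "S n \<noteq> {}" for n using coefficient_mod[OF g, of n] by (auto simp: S_def)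
    show "S (Suc n) \<subseteq> S n" for n using L.mpow_antimono[of n "Suc n"] by (auto simp: S_def)
    show "\<exists>k. \<forall>r\<in>S n. \<forall>y\<in>L.mpow k. r \<oplus>\<^bsub>R\<^esub> y \<in> S n" for n
    proof (intro exI[of _ n] ballI)
      fix r y assume r: "r \<in> S n" and y: "y \<in> L.mpow n"
      interpret K: ideal "L.mpow n" R by (rule L.mpow_ideal)
      have yc: "y \<in> carrier R" using K.Icarr[OF y] .
      have rc: "r \<in> carrier R" using r by (simp add: S_def)
      have "P.x g k \<ominus>\<^bsub>R\<^esub> (r \<oplus>\<^bsub>R\<^esub> y) \<otimes>\<^bsub>R\<^esub> P.x r0 k \<in> L.mpow n" if k: "k \<in> carrier G" for k
      proof -
        have xc: "P.x g k \<in> carrier R" "P.x r0 k \<in> carrier R" using g k r0(1) by simp_all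
        have "P.x g k \<ominus>\<^bsub>R\<^esub> (r \<oplus>\<^bsub>R\<^esub> y) \<otimes>\<^bsub>R\<^esub> P.x r0 k = (P.x g k \<ominus>\<^bsub>R\<^esub> r \<otimes>\<^bsub>R\<^esub> P.x r0 k) \<ominus>\<^bsub>R\<^esub> y \<otimes>\<^bsub>R\<^esub> P.x r0 k"
          using xc rc yc by algebra
        also have "\<dots> \<in> L.mpow n" using r k y xc by (simp add: S_def K.diff_closed K.I_r_closed)
        finally show ?thesis .
      qed
      then show "r \<oplus>\<^bsub>R\<^esub> y \<in> S n" using rc yc by (simp add: S_def)
    qed
  qed blast
  then obtain r where r: "\<And>n. r \<in> S n" by blast
  have rc: "r \<in> carrier R" using r[of 0] by (simp add: S_def)
  have "P.x g k = r \<otimes>\<^bsub>R\<^esub> P.x r0 k" if k: "k \<in> carrier G" for k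
  proof -
    have "P.x g k \<ominus>\<^bsub>R\<^esub> r \<otimes>\<^bsub>R\<^esub> P.x r0 k = \<zero>\<^bsub>R\<^esub>"
      by (rule L.mpow_Inter) (use r k in \<open>simp add: S_def\<close>)
    then show ?thesis using g k r0(1) rc by simp
  qed
  then show ?thesis using rc by blast
qed

text \<open>A stand-in for the quotient of b(g) by b(r0). It is an arbitrary choice, determined only
  up to \<open>Ann\<close>, so its product rule and its continuity appear only after passing to a
  quotient that kills \<open>Ann\<close>.\<close>

definition "\<rho>c g = (SOME r. r \<in> carrier R \<and> (\<forall>k\<in>carrier G. P.x g k = r \<otimes>\<^bsub>R\<^esub> P.x r0 k))"

lemma rhoc: assumes g: "g \<in> carrier G"
  shows "\<rho>c g \<in> carrier R" "k \<in> carrier G \<Longrightarrow> P.x g k = \<rho>c g \<otimes>\<^bsub>R\<^esub> P.x r0 k"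
proof -
  have "\<exists>r. r \<in> carrier R \<and> (\<forall>k\<in>carrier G. P.x g k = r \<otimes>\<^bsub>R\<^esub> P.x r0 k)" using coefficient[OF g] by blast
  from someI_ex[OF this] have "\<rho>c g \<in> carrier R \<and> (\<forall>k\<in>carrier G. P.x g k = \<rho>c g \<otimes>\<^bsub>R\<^esub> P.x r0 k)"
    unfolding \<rho>c_def .
  then show "\<rho>c g \<in> carrier R" "k \<in> carrier G \<Longrightarrow> P.x g k = \<rho>c g \<otimes>\<^bsub>R\<^esub> P.x r0 k" by blast+
qed

definition "Ann = {r \<in> carrier R. \<forall>k\<in>carrier G. r \<otimes>\<^bsub>R\<^esub> P.x r0 k = \<zero>\<^bsub>R\<^esub>}"

lemma Ann_ideal: "ideal Ann R"
proof (rule idealI[OF L.R.ring_axioms])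
  show "subgroup Ann (add_monoid R)"
  proof (rule group.subgroupI)
    show "Group.group (add_monoid R)" by (rule L.R.add.is_group)
    show "Ann \<subseteq> carrier (add_monoid R)" by (auto simp: Ann_def)
    have "\<zero>\<^bsub>R\<^esub> \<in> Ann" using r0(1) by (simp add: Ann_def)
    then show "Ann \<noteq> {}" by blast
    fix a assume a: "a \<in> Ann"
    have "\<ominus>\<^bsub>R\<^esub> a \<in> Ann" using a r0(1) by (simp add: Ann_def L.R.l_minus)
    then show "inv\<^bsub>add_monoid R\<^esub> a \<in> Ann" by (simp add: a_inv_def)
    fix b assume b: "b \<in> Ann"
    show "a \<otimes>\<^bsub>add_monoid R\<^esub> b \<in> Ann" using a b r0(1) by (simp add: Ann_def L.R.l_distr)
  qed
  fix a x assume a: "a \<in> Ann" "x \<in> carrier R"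
  then show "x \<otimes>\<^bsub>R\<^esub> a \<in> Ann" using r0(1) by (simp add: Ann_def L.R.m_assoc)
  then show "a \<otimes>\<^bsub>R\<^esub> x \<in> Ann" using a L.R.m_comm[of a x] by (simp add: Ann_def)
qed

lemma Ann_x: assumes "r \<in> Ann" "g \<in> carrier G" "h \<in> carrier G" shows "r \<otimes>\<^bsub>R\<^esub> P.x g h = \<zero>\<^bsub>R\<^esub>"
  using assms rhoc[OF assms(2)] r0(1) L.R.m_lcomm[of r "\<rho>c g" "P.x r0 h"] by (simp add: Ann_def)

text \<open>Chevalley's theorem for the colon ideals of \<open>x r0\<close>.\<close>

lemma Ann_approx:
  "\<exists>N. \<forall>r\<in>carrier R. (\<forall>k\<in>carrier G. r \<otimes>\<^bsub>R\<^esub> P.x r0 k \<in> L.mpow N) \<longrightarrow> r \<in> set_add R Ann (L.mpow n)"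
proof (rule ccontr)
  assume neg: "\<not> ?thesis"
  let ?K = "set_add R Ann (L.mpow n)"
  interpret K: ideal ?K R by (rule L.R.add_ideals[OF Ann_ideal L.mpow_ideal])
  have mK: "L.mpow n \<subseteq> ?K" and AK: "Ann \<subseteq> ?K"
  proof -
    show "L.mpow n \<subseteq> ?K"
    proof
      fix y assume y: "y \<in> L.mpow n"
      have "\<zero>\<^bsub>R\<^esub> \<oplus>\<^bsub>R\<^esub> y \<in> ?K"
        unfolding set_add_def' using y additive_subgroup.zero_closed[OF ideal.axioms(1)[OF Ann_ideal]] by blast
      then show "y \<in> ?K" using ideal.Icarr[OF L.mpow_ideal y] by simp
    qed
    show "Ann \<subseteq> ?K"
    proof
      fix y assume y: "y \<in> Ann"
      have "y \<oplus>\<^bsub>R\<^esub> \<zero>\<^bsub>R\<^esub> \<in> ?K"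
        unfolding set_add_def' using y additive_subgroup.zero_closed[OF ideal.axioms(1)[OF L.mpow_ideal[of n]]] by blast
      then show "y \<in> ?K" using ideal.Icarr[OF Ann_ideal y] by simp
    qed
  qed
  \<comment> \<open>If the claim failed, these sets would be non-empty for all \<open>N\<close>. A
    common element annihilates every \<open>P.x r0 k\<close> exactly and yet lies outside
    \<open>Ann + mpow n\<close>.\<close>
  define S where "S N = {r \<in> carrier R. r \<notin> ?K \<and> (\<forall>k\<in>carrier G. r \<otimes>\<^bsub>R\<^esub> P.x r0 k \<in> L.mpow N)}" for N
  have "\<exists>r. \<forall>N. r \<in> S N"
  proof (rule L.compactness[of S])
    show "S N \<subseteq> carrier R" for N by (auto simp: S_def)
    show "S N \<noteq> {}" for N using neg by (auto simp: S_def)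
    show "S (Suc N) \<subseteq> S N" for N using L.mpow_antimono[of N "Suc N"] by (auto simp: S_def)
    show "\<exists>k. \<forall>r\<in>S N. \<forall>y\<in>L.mpow k. r \<oplus>\<^bsub>R\<^esub> y \<in> S N" for N
    proof (intro exI[of _ "max n N"] ballI)
      fix r y assume r: "r \<in> S N" and y: "y \<in> L.mpow (max n N)"
      have yn: "y \<in> L.mpow n" "y \<in> L.mpow N" using y L.mpow_antimono[of n "max n N"] L.mpow_antimono[of N "max n N"] by auto
      have yc: "y \<in> carrier R" using ideal.Icarr[OF L.mpow_ideal y] .
      have rc: "r \<in> carrier R" "r \<notin> ?K" using r by (simp_all add: S_def)
      have "r \<oplus>\<^bsub>R\<^esub> y \<notin> ?K"
      proof
        assume "r \<oplus>\<^bsub>R\<^esub> y \<in> ?K"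
        then have "r \<oplus>\<^bsub>R\<^esub> y \<ominus>\<^bsub>R\<^esub> y \<in> ?K" using yn(1) mK by (intro K.diff_closed) auto
        moreover have "r \<oplus>\<^bsub>R\<^esub> y \<ominus>\<^bsub>R\<^esub> y = r" using rc(1) yc by algebra
        ultimately show False using rc(2) by simp
      qed
      moreover have "(r \<oplus>\<^bsub>R\<^esub> y) \<otimes>\<^bsub>R\<^esub> P.x r0 k \<in> L.mpow N" if k: "k \<in> carrier G" for k
      proof -
        interpret N: ideal "L.mpow N" R by (rule L.mpow_ideal)
        have xc: "P.x r0 k \<in> carrier R" using k r0(1) by simp
        show ?thesis using r yn(2) k xc rc(1) yc by (simp add: L.R.l_distr S_def N.I_r_closed)
      qed
      ultimately show "r \<oplus>\<^bsub>R\<^esub> y \<in> S N" using rc(1) yc by (simp add: S_def)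
    qed
  qed blast
  then obtain r where r: "\<And>N. r \<in> S N" by blast
  have "r \<otimes>\<^bsub>R\<^esub> P.x r0 k = \<zero>\<^bsub>R\<^esub>" if "k \<in> carrier G" for k
    by (rule L.mpow_Inter) (use r that in \<open>simp add: S_def\<close>)
  then have "r \<in> Ann" using r[of 0] by (simp add: Ann_def S_def)
  then show False using AK r[of 0] by (auto simp: S_def)
qed

text \<open>Once \<open>Ann\<close> is killed, the multipliers become a function \<open>s\<close>
  with \<open>s r0 = 1\<close> that obeys the rule of an upper right entry. A lift \<open>w\<close>
  of \<open>\<beta> r0\<close> scales it to the required residue, and the inverse of
  \<open>w\<close> goes into the lower left entry, so that the products b(g) c(h) remain the images
  of \<open>P.x g h\<close>.\<close>

lemma irreducible_lift:
  fixes A :: "('a, 'b) ring_scheme"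
  assumes loc: "local_map A F \<pi>A" and q: "q \<in> ring_hom R A"
    and ker: "\<And>r. r \<in> carrier R \<Longrightarrow> q r = \<zero>\<^bsub>A\<^esub> \<longleftrightarrow> r \<in> set_add R Ann (L.mpow n)"
    and res: "\<And>r. r \<in> carrier R \<Longrightarrow> \<pi>A (q r) = \<pi> r"
  obtains \<sigma> where "\<sigma> \<in> hom G (GL2 A)" "near \<tau> (\<lambda>g h. \<sigma> h = \<sigma> g)"
    "\<And>g. g \<in> carrier G \<Longrightarrow> map_mat2 \<pi>A (\<sigma> g) = \<rho>bar g"
    "\<And>g. g \<in> carrier G \<Longrightarrow> mat2_tr A (\<sigma> g) = q (T g)"
    "\<And>g. g \<in> carrier G \<Longrightarrow> mat2_det A (\<sigma> g) = q (D g)"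
proof -
  interpret A: local_map A F \<pi>A by fact
  interpret q: ring_hom_cring R A q
    using q A.R.is_cring L.R.is_cring by (simp add: ring_hom_cring_def ring_hom_cring_axioms_def)
  let ?K = "set_add R Ann (L.mpow n)"
  have AK: "q y = \<zero>\<^bsub>A\<^esub>" if y: "y \<in> Ann" for y
  proof -
    have "y \<oplus>\<^bsub>R\<^esub> \<zero>\<^bsub>R\<^esub> \<in> ?K"
      unfolding set_add_def' using y additive_subgroup.zero_closed[OF ideal.axioms(1)[OF L.mpow_ideal[of n]]] by blast
    then show "q y = \<zero>\<^bsub>A\<^esub>" using ideal.Icarr[OF Ann_ideal y] ker[of y] by simp
  qed
  have mK: "q y = \<zero>\<^bsub>A\<^esub>" if y: "y \<in> L.mpow n" for y
  proof -
    have "\<zero>\<^bsub>R\<^esub> \<oplus>\<^bsub>R\<^esub> y \<in> ?K"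
      unfolding set_add_def' using y additive_subgroup.zero_closed[OF ideal.axioms(1)[OF Ann_ideal]] by blast
    then show "q y = \<zero>\<^bsub>A\<^esub>" using ideal.Icarr[OF L.mpow_ideal y] ker[of y] by simp
  qed
  have qeq: "q r = q s" if "r \<in> carrier R" "s \<in> carrier R" "q (r \<ominus>\<^bsub>R\<^esub> s) = \<zero>\<^bsub>A\<^esub>" for r s
    using that by simp
  obtain N where N: "\<And>r. r \<in> carrier R \<Longrightarrow> (\<And>k. k \<in> carrier G \<Longrightarrow> r \<otimes>\<^bsub>R\<^esub> P.x r0 k \<in> L.mpow N) \<Longrightarrow> q r = \<zero>\<^bsub>A\<^esub>"
    using Ann_approx[of n] ker by metis
  have annI: "q r = \<zero>\<^bsub>A\<^esub>" if "r \<in> carrier R" "\<And>k. k \<in> carrier G \<Longrightarrow> r \<otimes>\<^bsub>R\<^esub> P.x r0 k = \<zero>\<^bsub>R\<^esub>" for r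
    using AK[of r] that by (simp add: Ann_def)
  define s where "s g = q (\<rho>c g)" for g
  have sc: "s g \<in> carrier A" if "g \<in> carrier G" for g using rhoc[OF that] by (simp add: s_def)
  \<comment> \<open>Local constancy of \<open>P.x\<close> modulo \<open>mpow N\<close> says only
    that a difference of multipliers sends every \<open>P.x r0 k\<close> into \<open>mpow N\<close>;
    \<open>Ann_approx\<close> turns this into vanishing in \<open>A\<close>.\<close>
  have s_near: "near \<tau> (\<lambda>g h. s h = s g)"
  proof (rule near_mono[OF x_near[of N]])
    fix g h assume gh: "g \<in> topspace \<tau>" "h \<in> topspace \<tau>" and x: "\<forall>k\<in>carrier G. P.x h k \<ominus>\<^bsub>R\<^esub> P.x g k \<in> L.mpow N"
    have g: "g \<in> carrier G" "h \<in> carrier G" using gh top by simp_all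
    have rc: "\<rho>c g \<in> carrier R" "\<rho>c h \<in> carrier R" using rhoc g by simp_all
    have "q (\<rho>c h \<ominus>\<^bsub>R\<^esub> \<rho>c g) = \<zero>\<^bsub>A\<^esub>"
    proof (rule N)
      fix k assume k: "k \<in> carrier G"
      have xc: "P.x r0 k \<in> carrier R" using k r0(1) by simp
      have "(\<rho>c h \<ominus>\<^bsub>R\<^esub> \<rho>c g) \<otimes>\<^bsub>R\<^esub> P.x r0 k = \<rho>c h \<otimes>\<^bsub>R\<^esub> P.x r0 k \<ominus>\<^bsub>R\<^esub> \<rho>c g \<otimes>\<^bsub>R\<^esub> P.x r0 k" using xc rc by algebra
      then show "(\<rho>c h \<ominus>\<^bsub>R\<^esub> \<rho>c g) \<otimes>\<^bsub>R\<^esub> P.x r0 k \<in> L.mpow N" using x[rule_format, OF k] rhoc(2)[OF g(1) k] rhoc(2)[OF g(2) k] by simp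
    qed (use rc in simp)
    then show "s h = s g" unfolding s_def using rc by (intro qeq)
  qed
  have s_mult: "s (g \<otimes>\<^bsub>G\<^esub> h) = q (P.a g) \<otimes>\<^bsub>A\<^esub> s h \<oplus>\<^bsub>A\<^esub> q (P.d h) \<otimes>\<^bsub>A\<^esub> s g" if gh: "g \<in> carrier G" "h \<in> carrier G" for g h
  proof -
    define y where "y = P.a g \<otimes>\<^bsub>R\<^esub> \<rho>c h \<oplus>\<^bsub>R\<^esub> P.d h \<otimes>\<^bsub>R\<^esub> \<rho>c g"
    have c: "P.a g \<in> carrier R" "P.d h \<in> carrier R" "\<rho>c g \<in> carrier R" "\<rho>c h \<in> carrier R" "\<rho>c (g \<otimes>\<^bsub>G\<^esub> h) \<in> carrier R"
      using gh rhoc by simp_all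
    have yc: "y \<in> carrier R" using c by (simp add: y_def)
    have "q (\<rho>c (g \<otimes>\<^bsub>G\<^esub> h) \<ominus>\<^bsub>R\<^esub> y) = \<zero>\<^bsub>A\<^esub>"
    proof (rule annI)
      fix k assume k: "k \<in> carrier G"
      have xc: "P.x r0 k \<in> carrier R" using k r0(1) by simp
      have "(\<rho>c (g \<otimes>\<^bsub>G\<^esub> h) \<ominus>\<^bsub>R\<^esub> y) \<otimes>\<^bsub>R\<^esub> P.x r0 k = \<rho>c (g \<otimes>\<^bsub>G\<^esub> h) \<otimes>\<^bsub>R\<^esub> P.x r0 k \<ominus>\<^bsub>R\<^esub>
        (P.a g \<otimes>\<^bsub>R\<^esub> (\<rho>c h \<otimes>\<^bsub>R\<^esub> P.x r0 k) \<oplus>\<^bsub>R\<^esub> P.d h \<otimes>\<^bsub>R\<^esub> (\<rho>c g \<otimes>\<^bsub>R\<^esub> P.x r0 k))"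
        unfolding y_def using xc c by algebra
      also have "\<dots> = \<zero>\<^bsub>R\<^esub>"
        using P.x_mult_left[OF gh k] gh k c xc
        by (simp add: rhoc(2)[symmetric] a_minus_def L.R.r_neg)
      finally show "(\<rho>c (g \<otimes>\<^bsub>G\<^esub> h) \<ominus>\<^bsub>R\<^esub> y) \<otimes>\<^bsub>R\<^esub> P.x r0 k = \<zero>\<^bsub>R\<^esub>" .
    qed (use c yc in simp)
    then have "q (\<rho>c (g \<otimes>\<^bsub>G\<^esub> h)) = q y" using c yc by (intro qeq)
    then show ?thesis using c by (simp add: s_def y_def)
  qed
  have s_u: "s u = \<zero>\<^bsub>A\<^esub>"
    unfolding s_def by (rule annI) (use rhoc[OF u] P.x_u in simp_all)
  have s_r0: "s r0 = \<one>\<^bsub>A\<^esub>"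
  proof -
    note rc = rhoc(1)[OF r0(1)]
    have "q (\<rho>c r0 \<ominus>\<^bsub>R\<^esub> \<one>\<^bsub>R\<^esub>) = \<zero>\<^bsub>A\<^esub>"
    proof (rule annI)
      fix k assume k: "k \<in> carrier G"
      have xc: "P.x r0 k \<in> carrier R" using k r0(1) by simp
      have "(\<rho>c r0 \<ominus>\<^bsub>R\<^esub> \<one>\<^bsub>R\<^esub>) \<otimes>\<^bsub>R\<^esub> P.x r0 k = \<rho>c r0 \<otimes>\<^bsub>R\<^esub> P.x r0 k \<ominus>\<^bsub>R\<^esub> P.x r0 k" using xc rc by algebra
      then show "(\<rho>c r0 \<ominus>\<^bsub>R\<^esub> \<one>\<^bsub>R\<^esub>) \<otimes>\<^bsub>R\<^esub> P.x r0 k = \<zero>\<^bsub>R\<^esub>"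
        using rhoc(2)[OF r0(1) k] xc by (simp add: a_minus_def L.R.r_neg)
    qed (use rc in simp)
    then have "q (\<rho>c r0) = q \<one>\<^bsub>R\<^esub>" using rc by (intro qeq) simp_all
    then show ?thesis by (simp add: s_def)
  qed
  have pis: "near \<tau> (\<lambda>g h. \<pi>A (s h) = \<pi>A (s g))" "\<pi>A (s u) = \<zero>"
    "\<And>g. g \<in> carrier G \<Longrightarrow> \<pi>A (s g) \<in> carrier F"
    "\<And>g h. g \<in> carrier G \<Longrightarrow> h \<in> carrier G \<Longrightarrow>
      \<pi>A (s (g \<otimes>\<^bsub>G\<^esub> h)) = \<psi>1 g \<otimes> \<pi>A (s h) \<oplus> \<psi>2 h \<otimes> \<pi>A (s g)"
    using sc by (simp_all add: near_mono[OF s_near] s_u s_mult res ad_res)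
  \<comment> \<open>The residue of \<open>s\<close> is a cocycle vanishing at \<open>u\<close>,
    hence a multiple of \<open>\<beta>\<close>; the value at \<open>r0\<close> identifies the factor
    as the inverse of \<open>\<beta> r0\<close>.\<close>
  obtain t where t: "t \<in> carrier F" "\<And>g. g \<in> carrier G \<Longrightarrow> \<pi>A (s g) = t \<otimes> \<beta> g"
    using cocycle_multiple_beta[OF pis(3,1,4,2)] by metis
  have tr0: "t \<otimes> \<beta> r0 = \<one>" using t(2)[OF r0(1)] by (simp add: s_r0)
  obtain w where w: "w \<in> carrier A" "\<pi>A w = \<beta> r0" using A.lift_exists[OF beta_closed[OF r0(1)]] .
  have wu: "w \<in> Units A" using w r0(2) by (intro A.residue_unit) simp_all
  let ?i = "inv\<^bsub>A\<^esub> w"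
  have ic: "?i \<in> carrier A" "w \<otimes>\<^bsub>A\<^esub> ?i = \<one>\<^bsub>A\<^esub>" using wu by simp_all
  define b c where "b g = s g \<otimes>\<^bsub>A\<^esub> w" and "c g = q (P.x r0 g) \<otimes>\<^bsub>A\<^esub> ?i" for g
  have xs: "q (P.x g h) = s g \<otimes>\<^bsub>A\<^esub> q (P.x r0 h)" if "g \<in> carrier G" "h \<in> carrier G" for g h
    using rhoc[OF that(1)] that r0(1) by (simp add: s_def)
  have bc: "b g \<otimes>\<^bsub>A\<^esub> c h = q (P.x g h)" if gh: "g \<in> carrier G" "h \<in> carrier G" for g h
  proof -
    have "q (P.x r0 h) \<in> carrier A" using gh r0(1) by simp
    then have "b g \<otimes>\<^bsub>A\<^esub> c h = (s g \<otimes>\<^bsub>A\<^esub> q (P.x r0 h)) \<otimes>\<^bsub>A\<^esub> (w \<otimes>\<^bsub>A\<^esub> ?i)"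
      unfolding b_def c_def using sc[OF gh(1)] w(1) ic(1) by algebra
    then show ?thesis using ic xs[OF gh] sc[OF gh(1)] gh r0(1) by simp
  qed
  have ec: "q (P.a g) \<in> carrier A \<and> b g \<in> carrier A \<and> c g \<in> carrier A \<and> q (P.d g) \<in> carrier A" if "g \<in> carrier G" for g
    using that sc[OF that] w ic r0(1) by (simp add: b_def c_def)
  show ?thesis
  proof (rule lift_from_beta_entries[OF loc ec])
    fix g h assume gh: "g \<in> carrier G" "h \<in> carrier G"
    have 1: "q (P.a (g \<otimes>\<^bsub>G\<^esub> h)) = q (P.a g) \<otimes>\<^bsub>A\<^esub> q (P.a h) \<oplus>\<^bsub>A\<^esub> b g \<otimes>\<^bsub>A\<^esub> c h"
      using gh by (simp add: P.a_mult bc)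
    have 2: "b (g \<otimes>\<^bsub>G\<^esub> h) = q (P.a g) \<otimes>\<^bsub>A\<^esub> b h \<oplus>\<^bsub>A\<^esub> b g \<otimes>\<^bsub>A\<^esub> q (P.d h)"
    proof -
      have "q (P.a g) \<in> carrier A" "q (P.d h) \<in> carrier A" using gh by simp_all
      then show ?thesis unfolding b_def s_mult[OF gh] using sc[OF gh(1)] sc[OF gh(2)] w(1) by algebra
    qed
    have 3: "c (g \<otimes>\<^bsub>G\<^esub> h) = c g \<otimes>\<^bsub>A\<^esub> q (P.a h) \<oplus>\<^bsub>A\<^esub> q (P.d g) \<otimes>\<^bsub>A\<^esub> c h"
    proof -
      have cc: "q (P.a h) \<in> carrier A" "q (P.d g) \<in> carrier A" "q (P.x r0 g) \<in> carrier A" "q (P.x r0 h) \<in> carrier A"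
        using gh r0(1) by simp_all
      have "c (g \<otimes>\<^bsub>G\<^esub> h) = (q (P.a h) \<otimes>\<^bsub>A\<^esub> q (P.x r0 g) \<oplus>\<^bsub>A\<^esub> q (P.d g) \<otimes>\<^bsub>A\<^esub> q (P.x r0 h)) \<otimes>\<^bsub>A\<^esub> ?i"
        unfolding c_def P.x_mult_right[OF r0(1) gh] using gh r0(1) by simp
      also have "\<dots> = c g \<otimes>\<^bsub>A\<^esub> q (P.a h) \<oplus>\<^bsub>A\<^esub> q (P.d g) \<otimes>\<^bsub>A\<^esub> c h"
        unfolding c_def using cc ic(1) by algebra
      finally show ?thesis .
    qed
    have 4: "q (P.d (g \<otimes>\<^bsub>G\<^esub> h)) = c g \<otimes>\<^bsub>A\<^esub> b h \<oplus>\<^bsub>A\<^esub> q (P.d g) \<otimes>\<^bsub>A\<^esub> q (P.d h)"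
      using gh ec[OF gh(1)] ec[OF gh(2)] A.R.m_comm[of "c g" "b h"] by (simp add: P.d_mult bc A.R.a_comm)
    show "q (P.a (g \<otimes>\<^bsub>G\<^esub> h)) = q (P.a g) \<otimes>\<^bsub>A\<^esub> q (P.a h) \<oplus>\<^bsub>A\<^esub> b g \<otimes>\<^bsub>A\<^esub> c h \<and>
      b (g \<otimes>\<^bsub>G\<^esub> h) = q (P.a g) \<otimes>\<^bsub>A\<^esub> b h \<oplus>\<^bsub>A\<^esub> b g \<otimes>\<^bsub>A\<^esub> q (P.d h) \<and>
      c (g \<otimes>\<^bsub>G\<^esub> h) = c g \<otimes>\<^bsub>A\<^esub> q (P.a h) \<oplus>\<^bsub>A\<^esub> q (P.d g) \<otimes>\<^bsub>A\<^esub> c h \<and>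
      q (P.d (g \<otimes>\<^bsub>G\<^esub> h)) = c g \<otimes>\<^bsub>A\<^esub> b h \<oplus>\<^bsub>A\<^esub> q (P.d g) \<otimes>\<^bsub>A\<^esub> q (P.d h)"
      using 1 2 3 4 by simp
  next
    fix g assume g: "g \<in> carrier G"
    have "t \<otimes> \<beta> g \<otimes> \<beta> r0 = (t \<otimes> \<beta> r0) \<otimes> \<beta> g"
      using t(1) beta_closed[OF g] beta_closed[OF r0(1)] by algebra
    then have "\<pi>A (b g) = \<beta> g" using sc[OF g] w t(2)[OF g] tr0 g by (simp add: b_def)
    moreover have "\<pi>A (c g) = \<zero>"
      using g r0(1) ic x_mm[OF r0(1) g] by (simp add: c_def res L.mm_iff)
    ultimately show "\<pi>A (q (P.a g)) = \<psi>1 g \<and> \<pi>A (b g) = \<beta> g \<and> \<pi>A (c g) = \<zero> \<and> \<pi>A (q (P.d g)) = \<psi>2 g"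
      using g by (simp add: res ad_res)
  next
    have na: "near \<tau> (\<lambda>g h. q (P.a h) = q (P.a g))"
      by (rule near_mono[OF a_near[of n]], rule qeq) (simp_all add: top mK)
    have nd: "near \<tau> (\<lambda>g h. q (P.d h) = q (P.d g))"
      by (rule near_mono[OF d_near[of n]], rule qeq) (simp_all add: top mK)
    have nx: "near \<tau> (\<lambda>g h. q (P.x r0 h) = q (P.x r0 g))"
    proof (rule near_mono2[OF near_pull[OF a_near[of n] left_mult_cont[OF r0(1)]] a_near[of n]], rule qeq)
      fix g h assume gh: "g \<in> topspace \<tau>" "h \<in> topspace \<tau>"
        and 1: "P.a (r0 \<otimes>\<^bsub>G\<^esub> h) \<ominus>\<^bsub>R\<^esub> P.a (r0 \<otimes>\<^bsub>G\<^esub> g) \<in> L.mpow n" and 2: "P.a h \<ominus>\<^bsub>R\<^esub> P.a g \<in> L.mpow n"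
      have g: "g \<in> carrier G" "h \<in> carrier G" using gh top by simp_all
      show "P.x r0 h \<in> carrier R" "P.x r0 g \<in> carrier R" using g r0(1) by simp_all
      have "P.a r0 \<ominus>\<^bsub>R\<^esub> P.a r0 \<in> L.mpow n"
        using r0(1) additive_subgroup.zero_closed[OF ideal.axioms(1)[OF L.mpow_ideal[of n]]] by (simp add: a_minus_def L.R.r_neg)
      then have "P.x r0 h \<ominus>\<^bsub>R\<^esub> P.x r0 g \<in> L.mpow n"
        unfolding P.x_def using 1 2 g r0(1)
        by (intro L.R.ideal_diff_minus[OF L.mpow_ideal] L.R.ideal_diff_mult[OF L.mpow_ideal]) simp_all
      then show "q (P.x r0 h \<ominus>\<^bsub>R\<^esub> P.x r0 g) = \<zero>\<^bsub>A\<^esub>" by (rule mK)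
    qed
    show "near \<tau> (\<lambda>g h. q (P.a h) = q (P.a g) \<and> b h = b g \<and> c h = c g \<and> q (P.d h) = q (P.d g))"
      by (rule near_mono2[OF near_conj[OF na nd] near_conj[OF nx s_near]]) (simp add: b_def c_def)
  next
    fix \<sigma> assume \<sigma>: "\<sigma> \<in> hom G (GL2 A)" "near \<tau> (\<lambda>g h. \<sigma> h = \<sigma> g)"
      "\<And>g. g \<in> carrier G \<Longrightarrow> map_mat2 \<pi>A (\<sigma> g) = \<rho>bar g"
      "\<And>g. g \<in> carrier G \<Longrightarrow> mat2_tr A (\<sigma> g) = q (P.a g) \<oplus>\<^bsub>A\<^esub> q (P.d g)"
      "\<And>g. g \<in> carrier G \<Longrightarrow> mat2_det A (\<sigma> g) = q (P.a g) \<otimes>\<^bsub>A\<^esub> q (P.d g) \<ominus>\<^bsub>A\<^esub> b g \<otimes>\<^bsub>A\<^esub> c g"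
    show thesis
    proof (rule that[OF \<sigma>(1-3)])
      fix g assume g: "g \<in> carrier G"
      show "mat2_tr A (\<sigma> g) = q (T g)" using \<sigma>(4)[OF g] g by (simp add: P.a_plus_d[symmetric])
      show "mat2_det A (\<sigma> g) = q (D g)" using \<sigma>(5)[OF g] g by (simp add: bc P.D_eq)
    qed
  qed
qed

text \<open>Where the images of all \<open>P.x g h\<close> vanish, those of \<open>P.a\<close> and
  \<open>P.d\<close> are characters. A triangular lift then lacks only its upper right entry, which
  \<open>reducible_lift_entry\<close> supplies.\<close>

lemma reducible_lift:
  fixes A :: "('a, 'b) ring_scheme"
  assumes loc: "local_map A F \<pi>A" and q: "q \<in> ring_hom R A" and noeth: "noetherian_ring A"
    and nil: "ideal_power A (a_kernel A F \<pi>A) N = {\<zero>\<^bsub>A\<^esub>}"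
    and ker: "\<And>y. y \<in> L.mpow n \<Longrightarrow> q y = \<zero>\<^bsub>A\<^esub>"
    and x: "\<And>g h. g \<in> carrier G \<Longrightarrow> h \<in> carrier G \<Longrightarrow> q (P.x g h) = \<zero>\<^bsub>A\<^esub>"
    and res: "\<And>r. r \<in> carrier R \<Longrightarrow> \<pi>A (q r) = \<pi> r"
  obtains \<sigma> where "\<sigma> \<in> hom G (GL2 A)" "near \<tau> (\<lambda>g h. \<sigma> h = \<sigma> g)"
    "\<And>g. g \<in> carrier G \<Longrightarrow> map_mat2 \<pi>A (\<sigma> g) = \<rho>bar g"
    "\<And>g. g \<in> carrier G \<Longrightarrow> mat2_tr A (\<sigma> g) = q (T g)"
    "\<And>g. g \<in> carrier G \<Longrightarrow> mat2_det A (\<sigma> g) = q (D g)"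
proof -
  interpret A: local_map A F \<pi>A by fact
  interpret q: ring_hom_cring R A q
    using q A.R.is_cring L.R.is_cring by (simp add: ring_hom_cring_def ring_hom_cring_axioms_def)
  have qeq: "q r = q s" if "r \<in> carrier R" "s \<in> carrier R" "q (r \<ominus>\<^bsub>R\<^esub> s) = \<zero>\<^bsub>A\<^esub>" for r s
    using that by simp
  have c: "q (P.a g) \<in> carrier A \<and> q (P.d g) \<in> carrier A \<and> \<pi>A (q (P.a g)) = \<psi>1 g \<and> \<pi>A (q (P.d g)) = \<psi>2 g" if "g \<in> carrier G" for g
    using that by (simp add: res ad_res)
  have m: "q (P.a (g \<otimes>\<^bsub>G\<^esub> h)) = q (P.a g) \<otimes>\<^bsub>A\<^esub> q (P.a h) \<and> q (P.d (g \<otimes>\<^bsub>G\<^esub> h)) = q (P.d g) \<otimes>\<^bsub>A\<^esub> q (P.d h)"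
    if "g \<in> carrier G" "h \<in> carrier G" for g h
    using that by (simp add: P.a_mult P.d_mult x)
  have na: "near \<tau> (\<lambda>g h. q (P.a h) = q (P.a g))"
    by (rule near_mono[OF a_near[of n]], rule qeq) (simp_all add: top ker)
  have nd: "near \<tau> (\<lambda>g h. q (P.d h) = q (P.d g))"
    by (rule near_mono[OF d_near[of n]], rule qeq) (simp_all add: top ker)
  obtain b where b: "\<And>g. g \<in> carrier G \<Longrightarrow> b g \<in> carrier A \<and> \<pi>A (b g) = e g" "near \<tau> (\<lambda>g h. b h = b g)"
    "\<And>g h. g \<in> carrier G \<Longrightarrow> h \<in> carrier G \<Longrightarrow> b (g \<otimes>\<^bsub>G\<^esub> h) = q (P.a g) \<otimes>\<^bsub>A\<^esub> b h \<oplus>\<^bsub>A\<^esub> b g \<otimes>\<^bsub>A\<^esub> q (P.d h)"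
    using reducible_lift_entry[OF loc noeth nil c m near_conj[OF na nd]] by metis
  let ?\<sigma> = "\<lambda>g. Mat2 (q (P.a g)) (b g) \<zero>\<^bsub>A\<^esub> (q (P.d g))"
  have ec: "q (P.a g) \<in> carrier A \<and> b g \<in> carrier A \<and> \<zero>\<^bsub>A\<^esub> \<in> carrier A \<and> q (P.d g) \<in> carrier A" if "g \<in> carrier G" for g
    using c[OF that] b(1)[OF that] by simp
  have em: "q (P.a (g \<otimes>\<^bsub>G\<^esub> h)) = q (P.a g) \<otimes>\<^bsub>A\<^esub> q (P.a h) \<oplus>\<^bsub>A\<^esub> b g \<otimes>\<^bsub>A\<^esub> \<zero>\<^bsub>A\<^esub> \<and>
      b (g \<otimes>\<^bsub>G\<^esub> h) = q (P.a g) \<otimes>\<^bsub>A\<^esub> b h \<oplus>\<^bsub>A\<^esub> b g \<otimes>\<^bsub>A\<^esub> q (P.d h) \<and>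
      \<zero>\<^bsub>A\<^esub> = \<zero>\<^bsub>A\<^esub> \<otimes>\<^bsub>A\<^esub> q (P.a h) \<oplus>\<^bsub>A\<^esub> q (P.d g) \<otimes>\<^bsub>A\<^esub> \<zero>\<^bsub>A\<^esub> \<and>
      q (P.d (g \<otimes>\<^bsub>G\<^esub> h)) = \<zero>\<^bsub>A\<^esub> \<otimes>\<^bsub>A\<^esub> b h \<oplus>\<^bsub>A\<^esub> q (P.d g) \<otimes>\<^bsub>A\<^esub> q (P.d h)"
    if gh: "g \<in> carrier G" "h \<in> carrier G" for g h
    using ec[OF gh(1)] ec[OF gh(2)] m[OF gh] b(3)[OF gh] by simp
  have er: "\<pi>A (q (P.a g)) = \<psi>1 g \<and> \<pi>A (b g) = e g \<and> \<pi>A \<zero>\<^bsub>A\<^esub> = \<zero> \<and> \<pi>A (q (P.d g)) = \<psi>2 g" if "g \<in> carrier G" for g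
    using c[OF that] b(1)[OF that] by simp
  show ?thesis
  proof (rule that[of ?\<sigma>])
    show "?\<sigma> \<in> hom G (GL2 A)" by (rule lift_from_entries(1)[OF loc ec em er])
    show "\<And>g. g \<in> carrier G \<Longrightarrow> map_mat2 \<pi>A (?\<sigma> g) = \<rho>bar g" by (rule lift_from_entries(2)[OF loc ec em er])
    show "near \<tau> (\<lambda>g h. ?\<sigma> h = ?\<sigma> g)" by (rule near_mono2[OF near_conj[OF na nd] b(2)]) simp
    fix g assume g: "g \<in> carrier G"
    show "mat2_tr A (?\<sigma> g) = q (T g)" using g by (simp add: mat2_tr_def P.a_plus_d[symmetric])
    show "mat2_det A (?\<sigma> g) = q (D g)" using g ec[OF g] by (simp add: mat2_det_def P.D_eq x)
  qed
qed

end


section \<open>The kernel of \<open>\<Psi>\<close>\<close>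

context cring
begin

lemma GL2_det_mult:
  assumes "X \<in> carrier (GL2 R)" "Y \<in> carrier (GL2 R)"
  shows "mat2_det R (X \<otimes>\<^bsub>GL2 R\<^esub> Y) = mat2_det R X \<otimes> mat2_det R Y"
proof -
  obtain a b c d where Xe: "X = Mat2 a b c d" by (rule mat2_cases)
  obtain a' b' c' d' where Ye: "Y = Mat2 a' b' c' d'" by (rule mat2_cases)
  have x: "a \<in> carrier R" "b \<in> carrier R" "c \<in> carrier R" "d \<in> carrier R"
    using assms(1) unfolding Xe GL2_iff by simp_all
  have y: "a' \<in> carrier R" "b' \<in> carrier R" "c' \<in> carrier R" "d' \<in> carrier R"
    using assms(2) unfolding Ye GL2_iff by simp_all
  show ?thesis unfolding Xe Ye GL2_mult mat2_det_def mat2.sel using x y by algebra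
qed

lemma GL2_det_closed: "X \<in> carrier (GL2 R) \<Longrightarrow> mat2_det R X \<in> carrier R"
  by (auto simp: GL2_def)

lemma GL2_conj:
  assumes P: "P \<in> carrier (GL2 R)" and X: "X \<in> carrier (GL2 R)"
  shows "mat2_tr R (P \<otimes>\<^bsub>GL2 R\<^esub> X \<otimes>\<^bsub>GL2 R\<^esub> inv\<^bsub>GL2 R\<^esub> P) = mat2_tr R X"
    and "mat2_det R (P \<otimes>\<^bsub>GL2 R\<^esub> X \<otimes>\<^bsub>GL2 R\<^esub> inv\<^bsub>GL2 R\<^esub> P) = mat2_det R X"
proof -
  interpret GL: group "GL2 R" by (rule GL2_group)
  show "mat2_tr R (P \<otimes>\<^bsub>GL2 R\<^esub> X \<otimes>\<^bsub>GL2 R\<^esub> inv\<^bsub>GL2 R\<^esub> P) = mat2_tr R X"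
    using GL2_tr_conj[of "inv\<^bsub>GL2 R\<^esub> P" X] P X by simp
  have "mat2_det R (P \<otimes>\<^bsub>GL2 R\<^esub> inv\<^bsub>GL2 R\<^esub> P) = \<one>"
    using P by (simp add: GL2_one mat2_det_def a_minus_def)
  then have "mat2_det R P \<otimes> mat2_det R (inv\<^bsub>GL2 R\<^esub> P) = \<one>"
    unfolding GL2_det_mult[OF P GL.inv_closed[OF P]] .
  then have "mat2_det R X \<otimes> (mat2_det R P \<otimes> mat2_det R (inv\<^bsub>GL2 R\<^esub> P)) = mat2_det R X"
    using GL2_det_closed[OF X] by simp
  moreover have "mat2_det R P \<otimes> mat2_det R X \<otimes> mat2_det R (inv\<^bsub>GL2 R\<^esub> P) =
    mat2_det R X \<otimes> (mat2_det R P \<otimes> mat2_det R (inv\<^bsub>GL2 R\<^esub> P))"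
    using GL2_det_closed[OF X] GL2_det_closed[OF P] GL2_det_closed[OF GL.inv_closed[OF P]] by algebra
  ultimately show "mat2_det R (P \<otimes>\<^bsub>GL2 R\<^esub> X \<otimes>\<^bsub>GL2 R\<^esub> inv\<^bsub>GL2 R\<^esub> P) = mat2_det R X"
    using P X by (simp add: GL2_det_mult)
qed

end

lemma (in ring_hom_cring) GL2_map:
  assumes "X \<in> carrier (GL2 R)"
  shows "map_mat2 h X \<in> carrier (GL2 S)" and "mat2_tr S (map_mat2 h X) = h (mat2_tr R X)"
    and "mat2_det S (map_mat2 h X) = h (mat2_det R X)"
proof -
  obtain a b c d where Xe: "X = Mat2 a b c d" by (rule mat2_cases)
  have x: "a \<in> carrier R" "b \<in> carrier R" "c \<in> carrier R" "d \<in> carrier R" and u: "a \<otimes> d \<ominus> b \<otimes> c \<in> Units R"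
    using assms unfolding Xe R.GL2_iff by simp_all
  show "mat2_tr S (map_mat2 h X) = h (mat2_tr R X)" using x by (simp add: Xe mat2_tr_def)
  show "mat2_det S (map_mat2 h X) = h (mat2_det R X)" using x by (simp add: Xe mat2_det_def)
  have "h (a \<otimes> d \<ominus> b \<otimes> c) \<in> Units S"
  proof -
    have "h (a \<otimes> d \<ominus> b \<otimes> c) \<otimes>\<^bsub>S\<^esub> h (inv (a \<otimes> d \<ominus> b \<otimes> c)) = \<one>\<^bsub>S\<^esub>"
      using hom_mult[of "a \<otimes> d \<ominus> b \<otimes> c" "inv (a \<otimes> d \<ominus> b \<otimes> c)"] u x by simp
    moreover have "h (inv (a \<otimes> d \<ominus> b \<otimes> c)) \<in> carrier S" "h (a \<otimes> d \<ominus> b \<otimes> c) \<in> carrier S"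
      using u x by simp_all
    ultimately show ?thesis using S.m_comm unfolding Units_def by (smt (verit, best) mem_Collect_eq)
  qed
  then show "map_mat2 h X \<in> carrier (GL2 S)" unfolding Xe mat2.map S.GL2_iff using x by simp
qed

lemma (in ring_hom_cring) GL2_map_mult:
  assumes "X \<in> carrier (GL2 R)" "Y \<in> carrier (GL2 R)"
  shows "map_mat2 h (X \<otimes>\<^bsub>GL2 R\<^esub> Y) = map_mat2 h X \<otimes>\<^bsub>GL2 S\<^esub> map_mat2 h Y"
proof -
  obtain a b c d where Xe: "X = Mat2 a b c d" by (rule mat2_cases)
  obtain a' b' c' d' where Ye: "Y = Mat2 a' b' c' d'" by (rule mat2_cases)
  have x: "a \<in> carrier R" "b \<in> carrier R" "c \<in> carrier R" "d \<in> carrier R"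
    using assms(1) unfolding Xe R.GL2_iff by simp_all
  have y: "a' \<in> carrier R" "b' \<in> carrier R" "c' \<in> carrier R" "d' \<in> carrier R"
    using assms(2) unfolding Ye R.GL2_iff by simp_all
  show ?thesis unfolding Xe Ye R.GL2_mult S.GL2_mult mat2.map using x y by simp
qed

lemma coeff_hom_ring_hom_cring:
  assumes "\<phi> \<in> coeff_hom p F R S" "coeff_ring p F R" "coeff_ring p F S"
  shows "ring_hom_cring R S \<phi>"
  using assms by (simp add: coeff_hom_def coeff_ring_def local_ring_def ring_hom_cring_def ring_hom_cring_axioms_def)

text \<open>\<open>\<rho>0\<close> enters only through its trace and determinant, which are
  symmetric in the two characters. Hence both signs of the exponent are instances, with
  \<open>\<psi>1\<close> always the sub and \<open>\<psi>2\<close> the quotient of the residual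
  extension.\<close>

locale deformation_comparison = residual_extension F G \<tau> \<psi>1 \<psi>2 e u
  for F :: "'k ring" (structure) and G :: "'g monoid" (structure) and \<tau> \<psi>1 \<psi>2 e u +
  fixes p :: nat and \<rho>0 \<rho>x :: "'g \<Rightarrow> 'k mat2" and Rpd :: "(nat \<Rightarrow> 'k, 'r) module" and T D :: "'g \<Rightarrow> 'r"
    and Rdef :: "(nat \<Rightarrow> 'k, 's) module" and \<rho> :: "'g \<Rightarrow> 's mat2" and \<Psi> :: "'r \<Rightarrow> 's"
  assumes rho0: "g \<in> carrier G \<Longrightarrow> mat2_tr F (\<rho>0 g) = \<psi>1 g \<oplus> \<psi>2 g \<and> mat2_det F (\<rho>0 g) = \<psi>1 g \<otimes> \<psi>2 g"
    and rhox: "g \<in> carrier G \<Longrightarrow> \<rho>x g = \<rho>bar g"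
    and Rpd: "is_universal_pseudo_deformation p F G \<tau> \<rho>0 Rpd T D"
    and Rdef: "is_universal_deformation p F G \<tau> \<rho>x Rdef \<rho>"
    and Psi: "\<Psi> \<in> coeff_hom p F Rpd Rdef"
      "g \<in> carrier G \<Longrightarrow> \<Psi> (T g) = mat2_tr Rdef (\<rho> g) \<and> \<Psi> (D g) = mat2_det Rdef (\<rho> g)"
begin

abbreviation "\<pi> \<equiv> residue_map p F Rpd"
abbreviation "\<pi>S \<equiv> residue_map p F Rdef"

lemma coeff_rings: "coeff_ring p F Rpd" "coeff_ring p F Rdef"
  using Rpd Rdef by (simp_all add: is_universal_pseudo_deformation_def is_universal_deformation_def)

sublocale L: complete_local_map Rpd F \<pi>
  by (rule coeff_ring_complete_local_map[OF coeff_rings(1) F.field_axioms finite_F])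

sublocale S: complete_local_map Rdef F \<pi>S
  by (rule coeff_ring_complete_local_map[OF coeff_rings(2) F.field_axioms finite_F])

sublocale Psi: ring_hom_cring Rpd Rdef \<Psi>
  by (rule coeff_hom_ring_hom_cring[OF Psi(1) coeff_rings])

lemma pseudo:
  "g \<in> carrier G \<Longrightarrow> T g \<in> carrier Rpd" "D \<in> hom G (units_of Rpd)" "T \<one>\<^bsub>G\<^esub> = \<one>\<^bsub>Rpd\<^esub> \<oplus>\<^bsub>Rpd\<^esub> \<one>\<^bsub>Rpd\<^esub>"
  "g \<in> carrier G \<Longrightarrow> h \<in> carrier G \<Longrightarrow> T (g \<otimes>\<^bsub>G\<^esub> h) = T (h \<otimes>\<^bsub>G\<^esub> g)"
  "g \<in> carrier G \<Longrightarrow> h \<in> carrier G \<Longrightarrow> T g \<otimes>\<^bsub>Rpd\<^esub> T h = T (g \<otimes>\<^bsub>G\<^esub> h) \<oplus>\<^bsub>Rpd\<^esub> D g \<otimes>\<^bsub>Rpd\<^esub> T (inv\<^bsub>G\<^esub> g \<otimes>\<^bsub>G\<^esub> h)"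
  "near \<tau> (\<lambda>g h. T h \<ominus>\<^bsub>Rpd\<^esub> T g \<in> L.mpow n)" "near \<tau> (\<lambda>g h. D h \<ominus>\<^bsub>Rpd\<^esub> D g \<in> L.mpow n)"
  "g \<in> carrier G \<Longrightarrow> \<pi> (T g) = \<psi>1 g \<oplus> \<psi>2 g" "g \<in> carrier G \<Longrightarrow> \<pi> (D g) = \<psi>1 g \<otimes> \<psi>2 g"
proof -
  have pl: "is_pseudo_lift p F G \<tau> \<rho>0 Rpd T D" using Rpd by (simp add: is_universal_pseudo_deformation_def)
  then have c: "continuous_map \<tau> (adic_topology Rpd) T" "continuous_map \<tau> (adic_topology Rpd) D"
    by (simp_all add: is_pseudo_lift_def cont_pseudo_rep2_def)
  show "near \<tau> (\<lambda>g h. T h \<ominus>\<^bsub>Rpd\<^esub> T g \<in> L.mpow n)" "near \<tau> (\<lambda>g h. D h \<ominus>\<^bsub>Rpd\<^esub> D g \<in> L.mpow n)"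
    using c unfolding L.continuous_adic_near by simp_all
  show "g \<in> carrier G \<Longrightarrow> T g \<in> carrier Rpd" "D \<in> hom G (units_of Rpd)" "T \<one>\<^bsub>G\<^esub> = \<one>\<^bsub>Rpd\<^esub> \<oplus>\<^bsub>Rpd\<^esub> \<one>\<^bsub>Rpd\<^esub>"
    "g \<in> carrier G \<Longrightarrow> h \<in> carrier G \<Longrightarrow> T (g \<otimes>\<^bsub>G\<^esub> h) = T (h \<otimes>\<^bsub>G\<^esub> g)"
    "g \<in> carrier G \<Longrightarrow> h \<in> carrier G \<Longrightarrow> T g \<otimes>\<^bsub>Rpd\<^esub> T h = T (g \<otimes>\<^bsub>G\<^esub> h) \<oplus>\<^bsub>Rpd\<^esub> D g \<otimes>\<^bsub>Rpd\<^esub> T (inv\<^bsub>G\<^esub> g \<otimes>\<^bsub>G\<^esub> h)"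
    "g \<in> carrier G \<Longrightarrow> \<pi> (T g) = \<psi>1 g \<oplus> \<psi>2 g" "g \<in> carrier G \<Longrightarrow> \<pi> (D g) = \<psi>1 g \<otimes> \<psi>2 g"
    using pl rho0 by (auto simp: is_pseudo_lift_def cont_pseudo_rep2_def)
qed

lemma D_unit: "g \<in> carrier G \<Longrightarrow> D g \<in> Units Rpd"
  using hom_in_carrier[OF pseudo(2)] by (simp add: units_of_def)

lemma D_mult: "g \<in> carrier G \<Longrightarrow> h \<in> carrier G \<Longrightarrow> D (g \<otimes>\<^bsub>G\<^esub> h) = D g \<otimes>\<^bsub>Rpd\<^esub> D h"
  using hom_mult[OF pseudo(2)] by (simp add: units_of_def)

lemma rho_lift:
  "\<rho> \<in> hom G (GL2 Rdef)" "g \<in> carrier G \<Longrightarrow> map_mat2 \<pi>S (\<rho> g) = \<rho>bar g"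
  "near \<tau> (\<lambda>g h. m11 (\<rho> h) \<ominus>\<^bsub>Rdef\<^esub> m11 (\<rho> g) \<in> S.mpow n \<and> m12 (\<rho> h) \<ominus>\<^bsub>Rdef\<^esub> m12 (\<rho> g) \<in> S.mpow n \<and>
    m21 (\<rho> h) \<ominus>\<^bsub>Rdef\<^esub> m21 (\<rho> g) \<in> S.mpow n \<and> m22 (\<rho> h) \<ominus>\<^bsub>Rdef\<^esub> m22 (\<rho> g) \<in> S.mpow n)"
proof -
  have l: "is_lift p F G \<tau> \<rho>x Rdef \<rho>" using Rdef by (simp add: is_universal_deformation_def)
  then show "\<rho> \<in> hom G (GL2 Rdef)" "g \<in> carrier G \<Longrightarrow> map_mat2 \<pi>S (\<rho> g) = \<rho>bar g"
    using rhox by (simp_all add: is_lift_def cont_rep2_def)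
  have "near \<tau> (\<lambda>g h. e (\<rho> h) \<ominus>\<^bsub>Rdef\<^esub> e (\<rho> g) \<in> S.mpow n)" if "e \<in> {m11, m12, m21, m22}" for e
    using l that S.continuous_adic_near[of \<tau> "\<lambda>g. e (\<rho> g)"] unfolding is_lift_def cont_rep2_def by blast
  then show "near \<tau> (\<lambda>g h. m11 (\<rho> h) \<ominus>\<^bsub>Rdef\<^esub> m11 (\<rho> g) \<in> S.mpow n \<and> m12 (\<rho> h) \<ominus>\<^bsub>Rdef\<^esub> m12 (\<rho> g) \<in> S.mpow n \<and>
    m21 (\<rho> h) \<ominus>\<^bsub>Rdef\<^esub> m21 (\<rho> g) \<in> S.mpow n \<and> m22 (\<rho> h) \<ominus>\<^bsub>Rdef\<^esub> m22 (\<rho> g) \<in> S.mpow n)"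
    by (intro near_conj) simp_all
qed

lemma rho_carrier: "g \<in> carrier G \<Longrightarrow> \<rho> g \<in> carrier (GL2 Rdef)"
  using rho_lift(1) by (rule hom_in_carrier)

lemma is_lift_nilpotent:
  fixes A :: "(nat \<Rightarrow> 'k, 'a) module"
  assumes A: "coeff_ring p F A" and nil: "ideal_power A (max_ideal A) N = {\<zero>\<^bsub>A\<^esub>}"
    and \<sigma>: "\<sigma> \<in> hom G (GL2 A)" "near \<tau> (\<lambda>g h. \<sigma> h = \<sigma> g)"
    "\<And>g. g \<in> carrier G \<Longrightarrow> map_mat2 (residue_map p F A) (\<sigma> g) = \<rho>bar g"
  shows "is_lift p F G \<tau> \<rho>x A \<sigma>"
proof -
  interpret A: complete_local_map A F "residue_map p F A"
    by (rule coeff_ring_complete_local_map[OF A F.field_axioms finite_F])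
  have n: "A.mpow N = {\<zero>\<^bsub>A\<^esub>}" using nil A.max_ideal_eq by simp
  have "continuous_map \<tau> (adic_topology A) (\<lambda>g. f (\<sigma> g))" if f: "f \<in> {m11, m12, m21, m22}" for f
    unfolding A.nilpotent_continuous_iff[OF n]
  proof
    show "near \<tau> (\<lambda>x y. f (\<sigma> y) = f (\<sigma> x))" by (rule near_mono[OF \<sigma>(2)]) simp
    show "(\<lambda>g. f (\<sigma> g)) \<in> topspace \<tau> \<rightarrow> carrier A"
    proof
      fix g assume "g \<in> topspace \<tau>"
      then have g: "\<sigma> g \<in> carrier (GL2 A)" using hom_in_carrier[OF \<sigma>(1)] top by simp
      obtain a b c d where e: "\<sigma> g = Mat2 a b c d" by (rule mat2_cases)
      show "f (\<sigma> g) \<in> carrier A" using g f unfolding e A.R.GL2_iff by auto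
    qed
  qed
  then show ?thesis using \<sigma> rhox by (simp add: is_lift_def cont_rep2_def)
qed

text \<open>A lift over the quotient by \<open>K\<close> is classified by a morphism
  \<open>\<phi>\<close> out of \<open>Rdef\<close>. The composite of \<open>\<Psi>\<close> and
  \<open>\<phi>\<close> and the projection \<open>q\<close> give the same pseudo-representation, so
  they agree, and whatever \<open>\<Psi>\<close> kills lies in \<open>K\<close>. The premise
  \<open>lift\<close> speaks of every model \<open>A\<close> of the quotient because the one
  produced by \<open>coeff_ring_quotient\<close> is known only by its properties.\<close>

lemma kernel_subset:
  assumes K: "ideal K Rpd" "L.mpow n \<subseteq> K" "K \<subseteq> L.mm"
    and lift: "\<And>(A :: (nat \<Rightarrow> 'k, nat set) module) q \<pi>A. local_map A F \<pi>A \<Longrightarrow> noetherian_ring A \<Longrightarrow> q \<in> ring_hom Rpd A \<Longrightarrow>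
      ideal_power A (a_kernel A F \<pi>A) n = {\<zero>\<^bsub>A\<^esub>} \<Longrightarrow>
      (\<And>r. r \<in> carrier Rpd \<Longrightarrow> q r = \<zero>\<^bsub>A\<^esub> \<longleftrightarrow> r \<in> K) \<Longrightarrow> (\<And>r. r \<in> carrier Rpd \<Longrightarrow> \<pi>A (q r) = \<pi> r) \<Longrightarrow>
      \<exists>\<sigma>. \<sigma> \<in> hom G (GL2 A) \<and> near \<tau> (\<lambda>g h. \<sigma> h = \<sigma> g) \<and>
        (\<forall>g\<in>carrier G. map_mat2 \<pi>A (\<sigma> g) = \<rho>bar g \<and> mat2_tr A (\<sigma> g) = q (T g) \<and> mat2_det A (\<sigma> g) = q (D g))"
    and z: "z \<in> carrier Rpd" "\<Psi> z = \<zero>\<^bsub>Rdef\<^esub>"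
  shows "z \<in> K"
proof -
  obtain A :: "(nat \<Rightarrow> 'k, nat set) module" and q where A: "coeff_ring p F A" and q: "q \<in> coeff_hom p F Rpd A"
    and qs: "q ` carrier Rpd = carrier A" and qK: "\<And>r. r \<in> carrier Rpd \<Longrightarrow> q r = \<zero>\<^bsub>A\<^esub> \<longleftrightarrow> r \<in> K"
    and nil: "ideal_power A (max_ideal A) n = {\<zero>\<^bsub>A\<^esub>}"
    using coeff_ring_quotient[OF coeff_rings(1) F.field_axioms finite_F K(1), of n] K(2,3) L.max_ideal_eq by metis
  let ?\<pi>A = "residue_map p F A"
  interpret A: complete_local_map A F ?\<pi>A
    by (rule coeff_ring_complete_local_map[OF A F.field_axioms finite_F])
  interpret q: ring_hom_cring Rpd A q by (rule coeff_hom_ring_hom_cring[OF q coeff_rings(1) A])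
  have n: "A.mpow n = {\<zero>\<^bsub>A\<^esub>}" using nil A.max_ideal_eq by simp
  have res: "?\<pi>A (q r) = \<pi> r" if "r \<in> carrier Rpd" for r
    using coeff_hom_residue[OF coeff_rings(1) A F.is_cring q that] .
  obtain \<sigma> where \<sigma>: "\<sigma> \<in> hom G (GL2 A)" "near \<tau> (\<lambda>g h. \<sigma> h = \<sigma> g)"
    and \<sigma>g: "\<And>g. g \<in> carrier G \<Longrightarrow> map_mat2 ?\<pi>A (\<sigma> g) = \<rho>bar g"
    "\<And>g. g \<in> carrier G \<Longrightarrow> mat2_tr A (\<sigma> g) = q (T g)" "\<And>g. g \<in> carrier G \<Longrightarrow> mat2_det A (\<sigma> g) = q (D g)"
    using lift[OF A.local_map_axioms A.noeth q.homh n qK res] by metis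
  have "is_lift p F G \<tau> \<rho>x A \<sigma>" by (rule is_lift_nilpotent[OF A nil \<sigma> \<sigma>g(1)])
  then obtain \<phi> where \<phi>: "\<phi> \<in> coeff_hom p F Rdef A" and se: "strictly_equivalent p F G A (\<lambda>g. map_mat2 \<phi> (\<rho> g)) \<sigma>"
    using Rdef A unfolding is_universal_deformation_def by metis
  interpret f: ring_hom_cring Rdef A \<phi> by (rule coeff_hom_ring_hom_cring[OF \<phi> coeff_rings(2) A])
  obtain P where P: "P \<in> carrier (GL2 A)" "\<And>g. g \<in> carrier G \<Longrightarrow> \<sigma> g = P \<otimes>\<^bsub>GL2 A\<^esub> map_mat2 \<phi> (\<rho> g) \<otimes>\<^bsub>GL2 A\<^esub> inv\<^bsub>GL2 A\<^esub> P"
    using se unfolding strictly_equivalent_def by metis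
  \<comment> \<open>Strict equivalence is a conjugation, which trace and determinant do not
    see.\<close>
  have tr: "q (T g) = \<phi> (\<Psi> (T g))" and det: "q (D g) = \<phi> (\<Psi> (D g))" if g: "g \<in> carrier G" for g
    using A.R.GL2_conj[OF P(1) f.GL2_map(1)[OF rho_carrier[OF g]]] P(2)[OF g] \<sigma>g(2,3)[OF g]
      f.GL2_map(2,3)[OF rho_carrier[OF g]] Psi(2)[OF g] by simp_all
  have lift': "is_pseudo_lift p F G \<tau> \<rho>0 A (\<lambda>g. q (T g)) (\<lambda>g. q (D g))"
  proof -
    have qu: "q d \<in> Units A" if "d \<in> Units Rpd" for d
    proof -
      have dc: "d \<in> carrier Rpd" using that by (rule L.R.Units_closed)
      have "\<pi> d \<noteq> \<zero>" using that L.unit_iff[OF dc] by simp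
      then show ?thesis using A.residue_unit[of "q d"] res[OF dc] dc by simp
    qed
    have eq: "q r = q s" if "r \<in> carrier Rpd" "s \<in> carrier Rpd" "r \<ominus>\<^bsub>Rpd\<^esub> s \<in> L.mpow n" for r s
      using that qK[of "r \<ominus>\<^bsub>Rpd\<^esub> s"] K(2) by (simp add: subset_iff)
    have Dc: "D g \<in> carrier Rpd" if "g \<in> carrier G" for g using D_unit[OF that] by (rule L.R.Units_closed)
    have "continuous_map \<tau> (adic_topology A) (\<lambda>g. q (T g))"
      unfolding A.nilpotent_continuous_iff[OF n]
    proof
      show "(\<lambda>g. q (T g)) \<in> topspace \<tau> \<rightarrow> carrier A" using pseudo(1) top by simp
      show "near \<tau> (\<lambda>x y. q (T y) = q (T x))"
        by (rule near_mono[OF pseudo(6)[of n]], rule eq) (simp_all add: top pseudo(1))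
    qed
    moreover have "continuous_map \<tau> (adic_topology A) (\<lambda>g. q (D g))"
      unfolding A.nilpotent_continuous_iff[OF n]
    proof
      show "(\<lambda>g. q (D g)) \<in> topspace \<tau> \<rightarrow> carrier A" using Dc top by simp
      show "near \<tau> (\<lambda>x y. q (D y) = q (D x))"
        by (rule near_mono[OF pseudo(7)[of n]], rule eq) (simp_all add: top Dc)
    qed
    moreover have "(\<lambda>g. q (D g)) \<in> hom G (units_of A)"
      by (rule homI) (simp_all add: units_of_def D_unit qu D_mult Dc)
    moreover have "q (T g) \<otimes>\<^bsub>A\<^esub> q (T h) = q (T (g \<otimes>\<^bsub>G\<^esub> h)) \<oplus>\<^bsub>A\<^esub> q (D g) \<otimes>\<^bsub>A\<^esub> q (T (inv\<^bsub>G\<^esub> g \<otimes>\<^bsub>G\<^esub> h))"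
      if gh: "g \<in> carrier G" "h \<in> carrier G" for g h
    proof -
      have "q (T g \<otimes>\<^bsub>Rpd\<^esub> T h) = q (T (g \<otimes>\<^bsub>G\<^esub> h) \<oplus>\<^bsub>Rpd\<^esub> D g \<otimes>\<^bsub>Rpd\<^esub> T (inv\<^bsub>G\<^esub> g \<otimes>\<^bsub>G\<^esub> h))"
        using pseudo(5)[OF gh] by simp
      then show ?thesis using gh pseudo(1) Dc by simp
    qed
    moreover have "q (T \<one>\<^bsub>G\<^esub>) = \<one>\<^bsub>A\<^esub> \<oplus>\<^bsub>A\<^esub> \<one>\<^bsub>A\<^esub>" by (simp add: pseudo(3))
    moreover have "q (T (g \<otimes>\<^bsub>G\<^esub> h)) = q (T (h \<otimes>\<^bsub>G\<^esub> g))" if "g \<in> carrier G" "h \<in> carrier G" for g h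
      using pseudo(4)[OF that] by simp
    moreover have "(\<lambda>g. q (T g)) \<in> carrier G \<rightarrow> carrier A" using pseudo(1) by simp
    ultimately show ?thesis
      unfolding is_pseudo_lift_def cont_pseudo_rep2_def
      using rho0 res pseudo(1,8,9) Dc by simp
  qed
  let ?\<phi> = "compose (carrier Rpd) \<phi> \<Psi>"
  have alg: "algebra (witt_ring p F) Rpd" "algebra (witt_ring p F) Rdef" using coeff_rings by (simp_all add: coeff_ring_def)
  have "max_ideal Rpd \<subseteq> carrier Rpd" unfolding L.max_ideal_eq by (auto simp: L.mm_iff)
  then have comp: "?\<phi> \<in> coeff_hom p F Rpd A" by (rule coeff_hom_compose[OF Psi(1) \<phi> alg])
  have "?\<phi> = q"
  proof -
    have "\<exists>!\<phi>. \<phi> \<in> coeff_hom p F Rpd A \<and> (\<forall>g\<in>carrier G. \<phi> (T g) = q (T g) \<and> \<phi> (D g) = q (D g))"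
      using Rpd A lift' unfolding is_universal_pseudo_deformation_def by simp
    moreover have "\<forall>g\<in>carrier G. ?\<phi> (T g) = q (T g) \<and> ?\<phi> (D g) = q (D g)"
      using tr det pseudo(1) L.R.Units_closed[OF D_unit] by (simp add: compose_eq)
    ultimately show ?thesis using comp q by blast
  qed
  then have "q z = \<phi> (\<Psi> z)" using z(1) by (metis compose_eq)
  then show "z \<in> K" using z qK by simp
qed

text \<open>The lifts exist only over quotients by \<open>U.Ann + mpow (Suc n)\<close> and
  \<open>J + mpow (Suc n)\<close>, so membership of \<open>z\<close> is known up to a small error.
  Each error disappears because the powers of the maximal ideal intersect in zero; the exponent
  \<open>Suc n\<close> keeps the ideals proper.\<close>

lemma kernel_square_zero:
  assumes z: "z \<in> carrier Rpd" "\<Psi> z = \<zero>\<^bsub>Rdef\<^esub>"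
  shows "z \<otimes>\<^bsub>Rpd\<^esub> z = \<zero>\<^bsub>Rpd\<^esub>"
proof -
  obtain l1 l2 where l: "l1 \<in> carrier Rpd" "l2 \<in> carrier Rpd" "\<pi> l1 = \<psi>1 u" "\<pi> l2 = \<psi>2 u"
    "l1 \<oplus>\<^bsub>Rpd\<^esub> l2 = T u" "l1 \<otimes>\<^bsub>Rpd\<^esub> l2 = D u"
    using L.hensel_quadratic[of "T u" "D u" "\<psi>1 u" "\<psi>2 u"] pseudo(1,8,9)[OF u] L.R.Units_closed[OF D_unit[OF u]] psi_u u
    by (metis psi1_closed psi2_closed)
  interpret U: universal_split F G \<tau> \<psi>1 \<psi>2 e u Rpd \<pi> T D l1 l2
  proof (intro universal_split.intro universal_split_axioms.intro split_pseudo_rep.intro split_pseudo_rep_axioms.intro)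
    show "residual_extension F G \<tau> \<psi>1 \<psi>2 e u" by (rule residual_extension_axioms)
    show "complete_local_map Rpd F \<pi>" by (rule L.complete_local_map_axioms)
    show "cring Rpd" by (rule L.R.is_cring)
    show "group G" by (rule G.is_group)
    show "l1 \<ominus>\<^bsub>Rpd\<^esub> l2 \<in> Units Rpd" using l psi_u by (intro L.residue_unit) simp_all
  qed (use l pseudo D_mult D_unit L.R.Units_closed in simp_all)
  let ?x = U.P.x
  have n1: "L.mpow (Suc n) \<subseteq> L.mm" for n using L.mpow_antimono[of "Suc 0" "Suc n"] L.mpow_1 by simp
  have sum_sub: "set_add Rpd I (L.mpow (Suc n)) \<subseteq> L.mm" if I: "I \<subseteq> L.mm" for I n
  proof
    fix y assume "y \<in> set_add Rpd I (L.mpow (Suc n))"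
    then obtain a b where "a \<in> I" "b \<in> L.mpow (Suc n)" "y = a \<oplus>\<^bsub>Rpd\<^esub> b" unfolding set_add_def' by blast
    then show "y \<in> L.mm" using I n1 additive_subgroup.a_closed[OF ideal.axioms(1)[OF L.mm_ideal]] by blast
  qed
  have sup: "L.mpow k \<subseteq> set_add Rpd I (L.mpow k)" "I \<subseteq> set_add Rpd I (L.mpow k)" if I: "ideal I Rpd" for I k
  proof -
    have z: "\<zero>\<^bsub>Rpd\<^esub> \<in> I" "\<zero>\<^bsub>Rpd\<^esub> \<in> L.mpow k"
      using additive_subgroup.zero_closed[OF ideal.axioms(1)[OF I]]
        additive_subgroup.zero_closed[OF ideal.axioms(1)[OF L.mpow_ideal]] by simp_all
    show "L.mpow k \<subseteq> set_add Rpd I (L.mpow k)"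
    proof
      fix y assume y: "y \<in> L.mpow k"
      have "\<zero>\<^bsub>Rpd\<^esub> \<oplus>\<^bsub>Rpd\<^esub> y \<in> set_add Rpd I (L.mpow k)" unfolding set_add_def' using y z by blast
      then show "y \<in> set_add Rpd I (L.mpow k)" using ideal.Icarr[OF L.mpow_ideal y] by simp
    qed
    show "I \<subseteq> set_add Rpd I (L.mpow k)"
    proof
      fix y assume y: "y \<in> I"
      have "y \<oplus>\<^bsub>Rpd\<^esub> \<zero>\<^bsub>Rpd\<^esub> \<in> set_add Rpd I (L.mpow k)" unfolding set_add_def' using y z by blast
      then show "y \<in> set_add Rpd I (L.mpow k)" using ideal.Icarr[OF I y] by simp
    qed
  qed
  \<comment> \<open>If \<open>U.Ann\<close> is the whole ring, which happens when all
    \<open>?x r0 k\<close> vanish, the quotient would be the zero ring and would carry no residue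
    map; the claim is then trivial.\<close>
  have zAnn: "z \<in> U.Ann"
  proof (cases "U.Ann = carrier Rpd")
    case True
    then show ?thesis using z by simp
  next
    case False
    have sub: "U.Ann \<subseteq> L.mm" by (rule L.proper_ideal_subset_mm[OF U.Ann_ideal False])
    have zn: "z \<in> set_add Rpd U.Ann (L.mpow (Suc n))" for n
    proof (rule kernel_subset[OF _ sup(1)[OF U.Ann_ideal] sum_sub[OF sub] _ z])
      show "ideal (set_add Rpd U.Ann (L.mpow (Suc n))) Rpd" by (rule L.R.add_ideals[OF U.Ann_ideal L.mpow_ideal])
      fix A :: "(nat \<Rightarrow> 'k, nat set) module" and q \<pi>A
      assume a: "local_map A F \<pi>A" "q \<in> ring_hom Rpd A"
        "\<And>r. r \<in> carrier Rpd \<Longrightarrow> (q r = \<zero>\<^bsub>A\<^esub>) = (r \<in> set_add Rpd U.Ann (L.mpow (Suc n)))"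
        "\<And>r. r \<in> carrier Rpd \<Longrightarrow> \<pi>A (q r) = \<pi> r"
      show "\<exists>\<sigma>. \<sigma> \<in> hom G (GL2 A) \<and> near \<tau> (\<lambda>g h. \<sigma> h = \<sigma> g) \<and>
        (\<forall>g\<in>carrier G. map_mat2 \<pi>A (\<sigma> g) = \<rho>bar g \<and> mat2_tr A (\<sigma> g) = q (T g) \<and> mat2_det A (\<sigma> g) = q (D g))"
        using U.irreducible_lift[OF a] by metis
    qed
    have "z \<otimes>\<^bsub>Rpd\<^esub> ?x r0 k = \<zero>\<^bsub>Rpd\<^esub>" if k: "k \<in> carrier G" for k
    proof (rule L.mpow_Inter)
      fix n
      obtain a b where ab: "a \<in> U.Ann" "b \<in> L.mpow (Suc n)" "z = a \<oplus>\<^bsub>Rpd\<^esub> b" using zn[of n] unfolding set_add_def' by blast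
      have ac: "a \<in> carrier Rpd" "b \<in> carrier Rpd" using ideal.Icarr[OF U.Ann_ideal ab(1)] ideal.Icarr[OF L.mpow_ideal ab(2)] .
      have xc: "?x r0 k \<in> carrier Rpd" using k r0(1) by simp
      have "z \<otimes>\<^bsub>Rpd\<^esub> ?x r0 k = b \<otimes>\<^bsub>Rpd\<^esub> ?x r0 k"
        using U.Ann_x[OF ab(1) r0(1) k] ac xc by (simp add: ab(3) L.R.l_distr)
      also have "\<dots> \<in> L.mpow n"
        using ideal.I_r_closed[OF L.mpow_ideal ab(2) xc] L.mpow_antimono[of n "Suc n"] by auto
      finally show "z \<otimes>\<^bsub>Rpd\<^esub> ?x r0 k \<in> L.mpow n" .
    qed
    then show ?thesis using z(1) by (simp add: U.Ann_def)
  qed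
  \<comment> \<open>Intersecting with the maximal ideal keeps \<open>J\<close> proper even if
    \<open>U.Ann\<close> is zero. All \<open>?x g h\<close> still belong to \<open>J\<close>, since
    they have residue zero.\<close>
  define J where "J = {y \<in> L.mm. \<forall>r\<in>U.Ann. r \<otimes>\<^bsub>Rpd\<^esub> y = \<zero>\<^bsub>Rpd\<^esub>}"
  have Ac: "r \<in> carrier Rpd" if "r \<in> U.Ann" for r using ideal.Icarr[OF U.Ann_ideal that] .
  have Jm: "J \<subseteq> L.mm" by (auto simp: J_def)
  have Jc: "y \<in> carrier Rpd" if "y \<in> J" for y using that by (simp add: J_def L.mm_iff)
  have J: "ideal J Rpd"
  proof (rule idealI[OF L.R.ring_axioms])
    show "subgroup J (add_monoid Rpd)"
    proof (rule group.subgroupI)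
      show "Group.group (add_monoid Rpd)" by (rule L.R.a_group)
      show "J \<subseteq> carrier (add_monoid Rpd)" using Jc by auto
      have "\<zero>\<^bsub>Rpd\<^esub> \<in> J" using Ac by (simp add: J_def L.mm_iff)
      then show "J \<noteq> {}" by blast
      fix a assume a: "a \<in> J"
      have "\<ominus>\<^bsub>Rpd\<^esub> a \<in> J" using a Ac by (simp add: J_def L.mm_iff L.R.r_minus)
      then show "inv\<^bsub>add_monoid Rpd\<^esub> a \<in> J" by (simp add: a_inv_def)
      fix b assume b: "b \<in> J"
      show "a \<otimes>\<^bsub>add_monoid Rpd\<^esub> b \<in> J" using a b Ac by (simp add: J_def L.mm_iff L.R.r_distr)
    qed
    fix a x assume a: "a \<in> J" "x \<in> carrier Rpd"
    then show ax: "a \<otimes>\<^bsub>Rpd\<^esub> x \<in> J" using Ac by (simp add: J_def L.mm_iff L.R.m_assoc[symmetric])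
    then show "x \<otimes>\<^bsub>Rpd\<^esub> a \<in> J" using a L.R.m_comm[of a x] by (simp add: J_def L.mm_iff)
  qed
  have xJ: "?x g h \<in> J" if "g \<in> carrier G" "h \<in> carrier G" for g h
    using U.x_mm[OF that] U.Ann_x that by (simp add: J_def)
  have zJ: "z \<in> set_add Rpd J (L.mpow (Suc n))" for n
  proof (rule kernel_subset[OF _ sup(1)[OF J] sum_sub[OF Jm] _ z])
    show "ideal (set_add Rpd J (L.mpow (Suc n))) Rpd" by (rule L.R.add_ideals[OF J L.mpow_ideal])
    fix A :: "(nat \<Rightarrow> 'k, nat set) module" and q \<pi>A
    assume a: "local_map A F \<pi>A" "noetherian_ring A" "q \<in> ring_hom Rpd A"
      "ideal_power A (a_kernel A F \<pi>A) (Suc n) = {\<zero>\<^bsub>A\<^esub>}"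
      and ker: "\<And>r. r \<in> carrier Rpd \<Longrightarrow> (q r = \<zero>\<^bsub>A\<^esub>) = (r \<in> set_add Rpd J (L.mpow (Suc n)))"
      and res: "\<And>r. r \<in> carrier Rpd \<Longrightarrow> \<pi>A (q r) = \<pi> r"
    have k1: "q y = \<zero>\<^bsub>A\<^esub>" if "y \<in> L.mpow (Suc n)" for y
      using ker[OF ideal.Icarr[OF L.mpow_ideal that]] sup(1)[OF J] that by blast
    have k2: "q (?x g h) = \<zero>\<^bsub>A\<^esub>" if "g \<in> carrier G" "h \<in> carrier G" for g h
      using ker[OF Jc[OF xJ[OF that]]] sup(2)[OF J] xJ[OF that] by blast
    show "\<exists>\<sigma>. \<sigma> \<in> hom G (GL2 A) \<and> near \<tau> (\<lambda>g h. \<sigma> h = \<sigma> g) \<and>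
        (\<forall>g\<in>carrier G. map_mat2 \<pi>A (\<sigma> g) = \<rho>bar g \<and> mat2_tr A (\<sigma> g) = q (T g) \<and> mat2_det A (\<sigma> g) = q (D g))"
      using U.reducible_lift[OF a(1,3,2,4) k1 k2 res] by metis
  qed
  show ?thesis
  proof (rule L.mpow_Inter)
    fix n
    obtain a b where ab: "a \<in> J" "b \<in> L.mpow (Suc n)" "z = a \<oplus>\<^bsub>Rpd\<^esub> b" using zJ[of n] unfolding set_add_def' by blast
    have bc: "b \<in> carrier Rpd" using ideal.Icarr[OF L.mpow_ideal ab(2)] .
    have "z \<otimes>\<^bsub>Rpd\<^esub> a = \<zero>\<^bsub>Rpd\<^esub>" using ab(1) zAnn by (simp add: J_def)
    then have "z \<otimes>\<^bsub>Rpd\<^esub> z = z \<otimes>\<^bsub>Rpd\<^esub> b"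
      using ab(3) z(1) Jc[OF ab(1)] bc L.R.r_distr[of a b z] by simp
    also have "\<dots> \<in> L.mpow n"
      using ideal.I_l_closed[OF L.mpow_ideal ab(2) z(1)] L.mpow_antimono[of n "Suc n"] by auto
    finally show "z \<otimes>\<^bsub>Rpd\<^esub> z \<in> L.mpow n" .
  qed
qed

end


section \<open>Surjectivity of \<open>\<Psi>\<close>\<close>

context cring
begin

text \<open>A device for induction over a generated ideal: a bound on the generators extends to the
  whole \<open>genideal\<close> as soon as the bound describes an ideal. The extra factor
  \<open>s\<close> makes it one although \<open>H\<close> is merely an additive subgroup.\<close>

lemma multiplier_ideal:
  assumes H: "additive_subgroup H R" and T: "T \<subseteq> carrier R"
  shows "ideal {y \<in> carrier R. \<forall>s\<in>carrier R. \<forall>t\<in>T. (s \<otimes> y) \<otimes> t \<in> H} R" (is "ideal ?X R")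
proof -
  have Tc: "t \<in> carrier R" if "t \<in> T" for t using T that by blast
  show ?thesis
  proof (rule idealI[OF ring_axioms])
    show "subgroup ?X (add_monoid R)"
    proof (rule group.subgroupI)
      show "Group.group (add_monoid R)" by (rule a_group)
      show "?X \<subseteq> carrier (add_monoid R)" by auto
      have "\<zero> \<in> ?X" using Tc additive_subgroup.zero_closed[OF H] by simp
      then show "?X \<noteq> {}" by blast
      fix a assume a: "a \<in> ?X"
      have "(s \<otimes> \<ominus> a) \<otimes> t \<in> H" if "s \<in> carrier R" "t \<in> T" for s t
        using a that Tc[OF that(2)] additive_subgroup.a_inv_closed[OF H, of "(s \<otimes> a) \<otimes> t"] by (simp add: r_minus l_minus)
      then have "\<ominus> a \<in> ?X" using a by simp
      then show "inv\<^bsub>add_monoid R\<^esub> a \<in> ?X" by (simp add: a_inv_def)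
      fix b assume b: "b \<in> ?X"
      have "(s \<otimes> (a \<oplus> b)) \<otimes> t \<in> H" if "s \<in> carrier R" "t \<in> T" for s t
        using a b that Tc[OF that(2)] additive_subgroup.a_closed[OF H, of "(s \<otimes> a) \<otimes> t" "(s \<otimes> b) \<otimes> t"]
        by (simp add: r_distr l_distr)
      then show "a \<otimes>\<^bsub>add_monoid R\<^esub> b \<in> ?X" using a b by simp
    qed
    fix a x assume a: "a \<in> ?X" "x \<in> carrier R"
    have "(s \<otimes> (x \<otimes> a)) \<otimes> t \<in> H" if "s \<in> carrier R" "t \<in> T" for s t
      using a that by (simp flip: m_assoc)
    then show xa: "x \<otimes> a \<in> ?X" using a by simp
    then show "a \<otimes> x \<in> ?X" using a m_comm[of a x] by simp
  qed
qed

end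

text \<open>The set is \<open>h(R) + E\<close>, which need not be an ideal of \<open>S\<close>; this
  is the subgroup to which \<open>multiplier_ideal\<close> is applied.\<close>

lemma (in ring_hom_cring) image_add_ideal:
  assumes "ideal E S"
  shows "additive_subgroup {y \<in> carrier S. \<exists>r\<in>carrier R. y \<ominus>\<^bsub>S\<^esub> h r \<in> E} S" (is "additive_subgroup ?X S")
proof (rule additive_subgroup.intro, rule group.subgroupI)
  interpret E: ideal E S by fact
  show "Group.group (add_monoid S)" by (rule S.a_group)
  show "?X \<subseteq> carrier (add_monoid S)" by auto
  have "\<zero>\<^bsub>S\<^esub> \<ominus>\<^bsub>S\<^esub> h \<zero> \<in> E" by (simp add: a_minus_def)
  then have "\<zero>\<^bsub>S\<^esub> \<in> ?X" using R.zero_closed by blast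
  then show "?X \<noteq> {}" by blast
  fix a assume a: "a \<in> ?X"
  then obtain r where r: "r \<in> carrier R" "a \<ominus>\<^bsub>S\<^esub> h r \<in> E" "a \<in> carrier S" by blast
  have "\<ominus>\<^bsub>S\<^esub> a \<ominus>\<^bsub>S\<^esub> h (\<ominus> r) = \<ominus>\<^bsub>S\<^esub> (a \<ominus>\<^bsub>S\<^esub> h r)" using r by (simp add: a_minus_def S.minus_add)
  then have "\<ominus>\<^bsub>S\<^esub> a \<ominus>\<^bsub>S\<^esub> h (\<ominus> r) \<in> E" using E.a_inv_closed[OF r(2)] by simp
  then have "\<ominus>\<^bsub>S\<^esub> a \<in> ?X" using r R.a_inv_closed by blast
  then show "inv\<^bsub>add_monoid S\<^esub> a \<in> ?X" by (simp add: a_inv_def)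
  fix b assume b: "b \<in> ?X"
  then obtain s where s: "s \<in> carrier R" "b \<ominus>\<^bsub>S\<^esub> h s \<in> E" "b \<in> carrier S" by blast
  have "(a \<oplus>\<^bsub>S\<^esub> b) \<ominus>\<^bsub>S\<^esub> (h r \<oplus>\<^bsub>S\<^esub> h s) \<in> E"
    using S.ideal_diff_add[OF assms, of "h r" a "h s" b] r s by simp
  then have "(a \<oplus>\<^bsub>S\<^esub> b) \<ominus>\<^bsub>S\<^esub> h (r \<oplus> s) \<in> E" using r s by simp
  then have "a \<oplus>\<^bsub>S\<^esub> b \<in> ?X" using r s by (simp, metis R.a_closed)
  then show "a \<otimes>\<^bsub>add_monoid S\<^esub> b \<in> ?X" by simp
qed

text \<open>A form of Nakayama's lemma in which an ideal \<open>J\<close>, later a power of the maximal ideal of \<open>S\<close>,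
  takes the place of finite generation over \<open>R\<close>.\<close>

lemma (in ring_hom_cring) image_dense:
  assumes I: "ideal I R" and J: "ideal J S"
    and base: "\<And>s. s \<in> carrier S \<Longrightarrow> \<exists>r\<in>carrier R. s \<ominus>\<^bsub>S\<^esub> h r \<in> genideal S (h ` I \<union> J)"
    and s: "s \<in> carrier S"
  shows "\<exists>r\<in>carrier R. s \<ominus>\<^bsub>S\<^esub> h r \<in> genideal S (h ` ideal_power R I (Suc n) \<union> J)"
  using s
proof (induction n arbitrary: s)
  case 0
  then show ?case using base R.ideal_power_1[OF I] by simp
next
  case (Suc n)
  define E where "E k = genideal S (h ` ideal_power R I k \<union> J)" for k
  have Pc: "r \<in> carrier R" if "r \<in> ideal_power R I k" for r k
    using ideal.Icarr[OF R.ideal_power_ideal[OF I] that] .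
  have gen: "h ` ideal_power R I k \<union> J \<subseteq> carrier S" for k
  proof
    fix y assume "y \<in> h ` ideal_power R I k \<union> J"
    then show "y \<in> carrier S"
    proof
      assume "y \<in> h ` ideal_power R I k"
      then show ?thesis using Pc hom_closed by (elim imageE) simp
    qed (rule ideal.Icarr[OF J])
  qed
  have Ei: "ideal (E k) S" for k unfolding E_def by (rule S.genideal_ideal[OF gen])
  have Em: "y \<in> E k" if "y \<in> h ` ideal_power R I k \<union> J" for y k
    using S.genideal_self[OF gen] that unfolding E_def by blast
  define T where "T = h ` ideal_power R I (Suc n)"
  have Tc: "T \<subseteq> carrier S" using gen[of "Suc n"] unfolding T_def by simp
  let ?X = "{y \<in> carrier S. \<forall>s\<in>carrier S. \<forall>t\<in>T. (s \<otimes>\<^bsub>S\<^esub> y) \<otimes>\<^bsub>S\<^esub> t \<in> E (Suc (Suc n))}"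
  \<comment> \<open>The product of \<open>E (Suc 0)\<close> with the image of the power of exponent
    \<open>Suc n\<close> lies in \<open>E (Suc (Suc n))\<close>; by minimality of the generated
    ideal it is enough to check generators.\<close>
  have E1: "E (Suc 0) \<subseteq> ?X"
    unfolding E_def[of "Suc 0"]
  proof (rule S.genideal_minimal)
    show "ideal ?X S" by (rule S.multiplier_ideal[OF ideal.axioms(1)[OF Ei] Tc])
    have "(s \<otimes>\<^bsub>S\<^esub> y) \<otimes>\<^bsub>S\<^esub> t \<in> E (Suc (Suc n))"
      if y: "y \<in> h ` ideal_power R I (Suc 0) \<union> J" and st: "s \<in> carrier S" "t \<in> T" for y s t
    proof -
      have yc: "y \<in> carrier S" using gen y by blast
      have tc: "t \<in> carrier S" using Tc st(2) by blast
      have "y \<otimes>\<^bsub>S\<^esub> t \<in> E (Suc (Suc n))"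
      proof (cases "y \<in> J")
        case True
        then have "y \<in> E (Suc (Suc n))" using Em by blast
        then show ?thesis by (rule ideal.I_r_closed[OF Ei _ tc])
      next
        case False
        then obtain a where a: "a \<in> I" "y = h a" using y R.ideal_power_1[OF I] by auto
        obtain b where b: "b \<in> ideal_power R I (Suc n)" "t = h b" using st(2) unfolding T_def by auto
        have ac: "a \<in> carrier R" by (rule ideal.Icarr[OF I a(1)])
        have "b \<otimes> a \<in> ideal_power R I (Suc (Suc n))" by (rule R.ideal_power_Suc_mem[OF b(1) a(1)])
        then have "h (b \<otimes> a) \<in> E (Suc (Suc n))" using Em by blast
        then show ?thesis unfolding a(2) b(2) using ac Pc[OF b(1)] by (simp add: S.m_comm)
      qed
      then show ?thesis using ideal.I_l_closed[OF Ei _ st(1)] S.m_assoc[OF st(1) yc tc] by simp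
    qed
    then show "h ` ideal_power R I (Suc 0) \<union> J \<subseteq> ?X" using gen by blast
  qed
  define H where "H = {y \<in> carrier S. \<exists>r\<in>carrier R. y \<ominus>\<^bsub>S\<^esub> h r \<in> E (Suc (Suc n))}"
  let ?Y = "{y \<in> carrier S. \<forall>s\<in>carrier S. \<forall>t\<in>{\<one>\<^bsub>S\<^esub>}. (s \<otimes>\<^bsub>S\<^esub> y) \<otimes>\<^bsub>S\<^esub> t \<in> H}"
  have Ha: "additive_subgroup H S" unfolding H_def by (rule image_add_ideal[OF Ei])
  have EH: "E (Suc (Suc n)) \<subseteq> H"
  proof
    fix y assume y: "y \<in> E (Suc (Suc n))"
    then have "y \<in> carrier S" by (rule ideal.Icarr[OF Ei])
    moreover from this have "y \<ominus>\<^bsub>S\<^esub> h \<zero> \<in> E (Suc (Suc n))" using y by (simp add: a_minus_def)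
    ultimately show "y \<in> H" unfolding H_def using R.zero_closed by blast
  qed
  \<comment> \<open>\<open>E (Suc n)\<close> lies in \<open>h(R) + E (Suc (Suc n))\<close>: for a
    generator \<open>h b\<close> one writes \<open>s h(b) = h(r b) + (s - h(r)) h(b)\<close> with
    \<open>r\<close> from \<open>base\<close>, and \<open>E1\<close> places the last term.\<close>
  have E2: "E (Suc n) \<subseteq> ?Y"
    unfolding E_def[of "Suc n"]
  proof (rule S.genideal_minimal)
    show "ideal ?Y S" by (rule S.multiplier_ideal[OF Ha]) simp
    have "s \<otimes>\<^bsub>S\<^esub> y \<in> H" if y: "y \<in> h ` ideal_power R I (Suc n) \<union> J" and s: "s \<in> carrier S" for y s
    proof (cases "y \<in> J")
      case True
      then have "y \<in> E (Suc (Suc n))" using Em by blast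
      then have "s \<otimes>\<^bsub>S\<^esub> y \<in> E (Suc (Suc n))" by (rule ideal.I_l_closed[OF Ei _ s])
      then show ?thesis using EH by blast
    next
      case False
      then obtain b where b: "b \<in> ideal_power R I (Suc n)" "y = h b" using y by auto
      note bc = Pc[OF b(1)]
      obtain r where r: "r \<in> carrier R" "s \<ominus>\<^bsub>S\<^esub> h r \<in> genideal S (h ` I \<union> J)" using base[OF s] by blast
      then have "s \<ominus>\<^bsub>S\<^esub> h r \<in> E (Suc 0)" by (simp add: E_def R.ideal_power_1[OF I])
      then have "\<one>\<^bsub>S\<^esub> \<otimes>\<^bsub>S\<^esub> (s \<ominus>\<^bsub>S\<^esub> h r) \<otimes>\<^bsub>S\<^esub> y \<in> E (Suc (Suc n))"
        using E1 b unfolding T_def by blast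
      moreover have "\<one>\<^bsub>S\<^esub> \<otimes>\<^bsub>S\<^esub> (s \<ominus>\<^bsub>S\<^esub> h r) \<otimes>\<^bsub>S\<^esub> y = s \<otimes>\<^bsub>S\<^esub> y \<ominus>\<^bsub>S\<^esub> h (r \<otimes> b)"
        using s r bc b(2) by (simp add: a_minus_def S.l_distr S.l_minus)
      ultimately have "s \<otimes>\<^bsub>S\<^esub> y \<ominus>\<^bsub>S\<^esub> h (r \<otimes> b) \<in> E (Suc (Suc n))" by simp
      moreover have "s \<otimes>\<^bsub>S\<^esub> y \<in> carrier S" using s b(2) bc by simp
      ultimately show ?thesis unfolding H_def using R.m_closed[OF r(1) bc] by blast
    qed
    then show "h ` ideal_power R I (Suc n) \<union> J \<subseteq> ?Y"
      using gen[of "Suc n"] additive_subgroup.a_Hcarr[OF Ha] by (simp add: subset_iff)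
  qed
  obtain r where r: "r \<in> carrier R" "s \<ominus>\<^bsub>S\<^esub> h r \<in> E (Suc n)" using Suc.IH[OF Suc.prems] unfolding E_def by blast
  then have "(\<one>\<^bsub>S\<^esub> \<otimes>\<^bsub>S\<^esub> (s \<ominus>\<^bsub>S\<^esub> h r)) \<otimes>\<^bsub>S\<^esub> \<one>\<^bsub>S\<^esub> \<in> H" using E2 by blast
  then have "s \<ominus>\<^bsub>S\<^esub> h r \<in> H" using Suc.prems r(1) by simp
  then obtain r' where r': "r' \<in> carrier R" "(s \<ominus>\<^bsub>S\<^esub> h r) \<ominus>\<^bsub>S\<^esub> h r' \<in> E (Suc (Suc n))" unfolding H_def by blast
  have "(s \<ominus>\<^bsub>S\<^esub> h r) \<ominus>\<^bsub>S\<^esub> h r' = s \<ominus>\<^bsub>S\<^esub> h (r \<oplus> r')"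
    using Suc.prems r(1) r'(1) by (simp add: a_minus_def S.minus_add S.a_assoc)
  then show ?case using r(1) r' unfolding E_def by (metis R.a_closed)
qed

context deformation_comparison
begin

lemma universal_unique:
  fixes A :: "(nat \<Rightarrow> 'k, nat set) module"
  assumes "coeff_ring p F A" "is_lift p F G \<tau> \<rho>x A \<sigma>" "q \<in> coeff_hom p F Rdef A" "q' \<in> coeff_hom p F Rdef A"
    "strictly_equivalent p F G A (\<lambda>g. map_mat2 q (\<rho> g)) \<sigma>" "strictly_equivalent p F G A (\<lambda>g. map_mat2 q' (\<rho> g)) \<sigma>"
  shows "q = q'"
  using Rdef assms unfolding is_universal_deformation_def by blast

lemma Psi_mm: "\<Psi> ` L.mm \<subseteq> S.mm"
  using Psi(1) by (simp add: coeff_hom_def L.max_ideal_eq S.max_ideal_eq)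

lemma Psi_residue: "r \<in> carrier Rpd \<Longrightarrow> \<pi>S (\<Psi> r) = \<pi> r"
  by (rule coeff_hom_residue[OF coeff_rings F.is_cring Psi(1)])

text \<open>Modulo the ideal generated by \<open>\<Psi>(m)\<close> the trace and the determinant of \<open>\<rho>\<close> become constant,
  so the deformation becomes constant as well.\<close>

lemma tangent_surjective:
  assumes n: "0 < n" and s: "s \<in> carrier Rdef"
  shows "\<exists>r\<in>carrier Rpd. s \<ominus>\<^bsub>Rdef\<^esub> \<Psi> r \<in> genideal Rdef (\<Psi> ` L.mm \<union> S.mpow n)"
proof -
  \<comment> \<open>The power \<open>S.mpow n\<close> is included so that the quotient is finite and
    its adic topology discrete.\<close>
  define K where "K = genideal Rdef (\<Psi> ` L.mm \<union> S.mpow n)"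
  have n1: "S.mpow n \<subseteq> S.mm" using S.mpow_antimono[of "Suc 0" n] n S.mpow_1 by simp
  have sub: "\<Psi> ` L.mm \<union> S.mpow n \<subseteq> S.mm" using Psi_mm n1 by blast
  have mc: "S.mm \<subseteq> carrier Rdef" by (rule subsetI) (simp add: S.mm_iff)
  have gen: "\<Psi> ` L.mm \<union> S.mpow n \<subseteq> carrier Rdef" using sub mc by (rule subset_trans)
  have K: "ideal K Rdef" unfolding K_def by (rule S.R.genideal_ideal[OF gen])
  have gK: "\<Psi> ` L.mm \<union> S.mpow n \<subseteq> K" unfolding K_def by (rule S.R.genideal_self[OF gen])
  have Km: "K \<subseteq> S.mm" unfolding K_def by (rule S.R.genideal_minimal[OF S.mm_ideal sub])
  obtain A :: "(nat \<Rightarrow> 'k, nat set) module" and q where A: "coeff_ring p F A" and q: "q \<in> coeff_hom p F Rdef A"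
    and qs: "q ` carrier Rdef = carrier A" and qK: "\<And>r. r \<in> carrier Rdef \<Longrightarrow> q r = \<zero>\<^bsub>A\<^esub> \<longleftrightarrow> r \<in> K"
    and nil: "ideal_power A (max_ideal A) n = {\<zero>\<^bsub>A\<^esub>}"
  proof (rule coeff_ring_quotient[OF coeff_rings(2) F.field_axioms finite_F K, of n])
    show "ideal_power Rdef (max_ideal Rdef) n \<subseteq> K" "K \<subseteq> max_ideal Rdef"
      using gK Km S.max_ideal_eq by simp_all
  qed (rule that)
  let ?\<pi>A = "residue_map p F A"
  interpret A: complete_local_map A F ?\<pi>A
    by (rule coeff_ring_complete_local_map[OF A F.field_axioms finite_F])
  interpret q: ring_hom_cring Rdef A q by (rule coeff_hom_ring_hom_cring[OF q coeff_rings(2) A])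
  have res: "?\<pi>A (q r) = \<pi>S r" if "r \<in> carrier Rdef" for r
    using coeff_hom_residue[OF coeff_rings(2) A F.is_cring q that] .
  have eq: "q r = q s" if "r \<in> carrier Rdef" "s \<in> carrier Rdef" "r \<ominus>\<^bsub>Rdef\<^esub> s \<in> K" for r s
    using that qK[of "r \<ominus>\<^bsub>Rdef\<^esub> s"] by simp
  obtain l where l: "\<And>z. z \<in> carrier F \<Longrightarrow> l z \<in> carrier Rpd" "\<And>z. z \<in> carrier F \<Longrightarrow> \<pi> (l z) = z"
  proof -
    have "\<forall>z\<in>carrier F. \<exists>r. r \<in> carrier Rpd \<and> \<pi> r = z" using L.lift_exists by blast
    from bchoice[OF this] show ?thesis using that by blast
  qed
  \<comment> \<open>The composite of \<open>\<Psi>\<close> and \<open>q\<close> kills the maximal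
    ideal of \<open>Rpd\<close>, so it factors through the residue field. Thus the choice of the
    lifts \<open>l\<close> does not matter, and \<open>\<theta>\<close> is a ring homomorphism
    splitting the residue map of \<open>A\<close>.\<close>
  define \<theta> where "\<theta> z = q (\<Psi> (l z))" for z
  have q_Psi: "q (\<Psi> r) = \<theta> (\<pi> r)" if r: "r \<in> carrier Rpd" for r
  proof -
    have lr: "l (\<pi> r) \<in> carrier Rpd" "\<pi> (l (\<pi> r)) = \<pi> r" using l r by simp_all
    then have "r \<ominus>\<^bsub>Rpd\<^esub> l (\<pi> r) \<in> L.mm" using L.residue_eq_iff[OF r lr(1)] by simp
    then have "\<Psi> (r \<ominus>\<^bsub>Rpd\<^esub> l (\<pi> r)) \<in> K" using gK by blast
    then show ?thesis unfolding \<theta>_def using r lr by (intro eq) simp_all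
  qed
  have th: "\<theta> \<in> ring_hom F A"
  proof (rule ring_hom_memI)
    fix x assume x: "x \<in> carrier F"
    then show "\<theta> x \<in> carrier A" by (simp add: \<theta>_def l)
    fix y assume y: "y \<in> carrier F"
    show "\<theta> (x \<otimes> y) = \<theta> x \<otimes>\<^bsub>A\<^esub> \<theta> y" using q_Psi[of "l x \<otimes>\<^bsub>Rpd\<^esub> l y"] x y l by (simp add: \<theta>_def)
    show "\<theta> (x \<oplus> y) = \<theta> x \<oplus>\<^bsub>A\<^esub> \<theta> y" using q_Psi[of "l x \<oplus>\<^bsub>Rpd\<^esub> l y"] x y l by (simp add: \<theta>_def)
  next
    show "\<theta> \<one> = \<one>\<^bsub>A\<^esub>" using q_Psi[of "\<one>\<^bsub>Rpd\<^esub>"] by simp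
  qed
  interpret th: ring_hom_cring F A \<theta>
    using th A.R.is_cring F.is_cring by (simp add: ring_hom_cring_def ring_hom_cring_axioms_def)
  have \<pi>\<theta>: "?\<pi>A (\<theta> z) = z" if "z \<in> carrier F" for z
    using res[of "\<Psi> (l z)"] l[OF that] Psi_residue by (simp add: \<theta>_def)
  have rc: "\<rho> g \<in> carrier (GL2 Rdef)" if "g \<in> carrier G" for g by (rule rho_carrier[OF that])
  have rent: "m11 (\<rho> g) \<in> carrier Rdef" "m12 (\<rho> g) \<in> carrier Rdef" "m21 (\<rho> g) \<in> carrier Rdef" "m22 (\<rho> g) \<in> carrier Rdef"
    if "g \<in> carrier G" for g
    using rc[OF that] by (cases "\<rho> g"; simp add: S.R.GL2_iff)+
  define \<rho>' where "\<rho>' g = map_mat2 q (\<rho> g)" for g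
  have \<rho>'hom: "\<rho>' \<in> hom G (GL2 A)"
  proof (rule homI)
    fix g assume g: "g \<in> carrier G"
    show "\<rho>' g \<in> carrier (GL2 A)" unfolding \<rho>'_def by (rule q.GL2_map(1)[OF rc[OF g]])
    fix h assume h: "h \<in> carrier G"
    show "\<rho>' (g \<otimes>\<^bsub>G\<^esub> h) = \<rho>' g \<otimes>\<^bsub>GL2 A\<^esub> \<rho>' h"
      unfolding \<rho>'_def hom_mult[OF rho_lift(1) g h] by (rule q.GL2_map_mult[OF rc[OF g] rc[OF h]])
  qed
  have \<rho>'near: "near \<tau> (\<lambda>g h. \<rho>' h = \<rho>' g)"
  proof (rule near_mono[OF rho_lift(3)[of n]])
    fix g h assume gh: "g \<in> topspace \<tau>" "h \<in> topspace \<tau>"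
      and d: "m11 (\<rho> h) \<ominus>\<^bsub>Rdef\<^esub> m11 (\<rho> g) \<in> S.mpow n \<and> m12 (\<rho> h) \<ominus>\<^bsub>Rdef\<^esub> m12 (\<rho> g) \<in> S.mpow n \<and>
        m21 (\<rho> h) \<ominus>\<^bsub>Rdef\<^esub> m21 (\<rho> g) \<in> S.mpow n \<and> m22 (\<rho> h) \<ominus>\<^bsub>Rdef\<^esub> m22 (\<rho> g) \<in> S.mpow n"
    have g: "g \<in> carrier G" "h \<in> carrier G" using gh top by simp_all
    have k: "\<And>x. x \<in> S.mpow n \<Longrightarrow> x \<in> K" using gK by blast
    show "\<rho>' h = \<rho>' g" unfolding \<rho>'_def
      by (rule mat2.expand) (use d k rent[OF g(1)] rent[OF g(2)] eq in \<open>simp add: mat2.map_sel\<close>)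
  qed
  have \<rho>'res: "map_mat2 ?\<pi>A (\<rho>' g) = \<rho>bar g" if "g \<in> carrier G" for g
    unfolding rho_lift(2)[OF that, symmetric] \<rho>'_def
    by (rule mat2.expand) (use rent[OF that] res in \<open>simp add: mat2.map_sel\<close>)
  have \<rho>'tr: "mat2_tr A (\<rho>' g) = \<theta> (\<psi>1 g \<oplus> \<psi>2 g)" if g: "g \<in> carrier G" for g
    using q.GL2_map(2)[OF rc[OF g]] Psi(2)[OF g] q_Psi[OF pseudo(1)[OF g]] pseudo(8)[OF g] by (simp add: \<rho>'_def)
  have \<rho>'det: "mat2_det A (\<rho>' g) = \<theta> (\<psi>1 g \<otimes> \<psi>2 g)" if g: "g \<in> carrier G" for g
    using q.GL2_map(3)[OF rc[OF g]] Psi(2)[OF g] q_Psi[OF L.R.Units_closed[OF D_unit[OF g]]] pseudo(9)[OF g] by (simp add: \<rho>'_def)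
  \<comment> \<open>\<open>\<sigma>\<close> is the constant lift, and \<open>q'\<close> is the
    morphism through the residue field that induces it. The image of \<open>\<rho>\<close> under
    \<open>q\<close> will be strictly equivalent to \<open>\<sigma>\<close> as well, so uniqueness
    forces \<open>q = q'\<close>.\<close>
  define \<sigma> where "\<sigma> g = map_mat2 \<theta> (\<rho>bar g)" for g
  define q' where "q' = (\<lambda>s\<in>carrier Rdef. \<theta> (\<pi>S s))"
  have q'\<sigma>: "map_mat2 q' (\<rho> g) = \<sigma> g" if "g \<in> carrier G" for g
    unfolding \<sigma>_def rho_lift(2)[OF that, symmetric]
    by (rule mat2.expand) (use rent[OF that] in \<open>simp add: mat2.map_sel q'_def\<close>)
  have q'hom: "q' \<in> ring_hom Rdef A" by (rule ring_hom_memI) (simp_all add: q'_def)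
  interpret q': ring_hom_cring Rdef A q'
    using q'hom A.R.is_cring S.R.is_cring by (simp add: ring_hom_cring_def ring_hom_cring_axioms_def)
  have q': "q' \<in> coeff_hom p F Rdef A"
  proof -
    interpret WR: algebra "witt_ring p F" Rpd using coeff_rings by (simp add: coeff_ring_def)
    interpret WS: algebra "witt_ring p F" Rdef using coeff_rings by (simp add: coeff_ring_def)
    interpret WA: algebra "witt_ring p F" A using A by (simp add: coeff_ring_def)
    have "q' (a \<odot>\<^bsub>Rdef\<^esub> r) = a \<odot>\<^bsub>A\<^esub> q' r" if a: "a \<in> carrier (witt_ring p F)" and r: "r \<in> carrier Rdef" for a r
    proof -
      have w: "\<pi> (a \<odot>\<^bsub>Rpd\<^esub> \<one>\<^bsub>Rpd\<^esub>) = a 0" "\<pi>S (a \<odot>\<^bsub>Rdef\<^esub> \<one>\<^bsub>Rdef\<^esub>) = a 0"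
        using residue_map_is_residue_map[OF coeff_rings(1) F.is_cring] residue_map_is_residue_map[OF coeff_rings(2) F.is_cring] a
        unfolding is_residue_map_def by simp_all
      have c: "a \<odot>\<^bsub>Rdef\<^esub> \<one>\<^bsub>Rdef\<^esub> \<in> carrier Rdef" "a \<odot>\<^bsub>Rpd\<^esub> \<one>\<^bsub>Rpd\<^esub> \<in> carrier Rpd"
        using a WS.smult_closed[OF a S.R.one_closed] WR.smult_closed[OF a L.R.one_closed] by simp_all
      have "\<theta> (a 0) = q (\<Psi> (a \<odot>\<^bsub>Rpd\<^esub> \<one>\<^bsub>Rpd\<^esub>))" using q_Psi[OF c(2)] w(1) by simp
      also have "\<dots> = a \<odot>\<^bsub>A\<^esub> \<one>\<^bsub>A\<^esub>"
        using Psi(1) q a by (simp add: coeff_hom_def)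
      finally have t: "\<theta> (a 0) = a \<odot>\<^bsub>A\<^esub> \<one>\<^bsub>A\<^esub>" .
      have "a \<odot>\<^bsub>Rdef\<^esub> r = (a \<odot>\<^bsub>Rdef\<^esub> \<one>\<^bsub>Rdef\<^esub>) \<otimes>\<^bsub>Rdef\<^esub> r"
        using WS.smult_assoc2[OF a S.R.one_closed r] r by simp
      then have "q' (a \<odot>\<^bsub>Rdef\<^esub> r) = \<theta> (\<pi>S (a \<odot>\<^bsub>Rdef\<^esub> \<one>\<^bsub>Rdef\<^esub>)) \<otimes>\<^bsub>A\<^esub> q' r" using c(1) r by (simp add: q'_def)
      also have "\<dots> = a \<odot>\<^bsub>A\<^esub> q' r" unfolding w(2) t
        using WA.smult_assoc2[OF a A.R.one_closed q'.hom_closed[OF r]] q'.hom_closed[OF r] by simp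
      finally show ?thesis .
    qed
    moreover have "q' ` max_ideal Rdef \<subseteq> max_ideal A"
      unfolding S.max_ideal_eq A.max_ideal_eq by (rule image_subsetI) (simp add: S.mm_iff A.mm_iff q'_def)
    moreover have "q' \<in> extensional (carrier Rdef)" by (simp add: q'_def)
    ultimately show ?thesis using q'hom unfolding coeff_hom_def by blast
  qed
  have \<sigma>hom: "\<sigma> \<in> hom G (GL2 A)"
  proof (rule homI)
    fix g assume g: "g \<in> carrier G"
    show "\<sigma> g \<in> carrier (GL2 A)" unfolding q'\<sigma>[OF g, symmetric] by (rule q'.GL2_map(1)[OF rc[OF g]])
    fix h assume h: "h \<in> carrier G"
    show "\<sigma> (g \<otimes>\<^bsub>G\<^esub> h) = \<sigma> g \<otimes>\<^bsub>GL2 A\<^esub> \<sigma> h"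
      unfolding q'\<sigma>[OF g, symmetric] q'\<sigma>[OF h, symmetric] q'\<sigma>[OF G.m_closed[OF g h], symmetric] hom_mult[OF rho_lift(1) g h]
      by (rule q'.GL2_map_mult[OF rc[OF g] rc[OF h]])
  qed
  have "near \<tau> (\<lambda>g h. \<psi>1 h = \<psi>1 g \<and> e h = e g \<and> \<psi>2 h = \<psi>2 g)"
    by (intro near_conj psi1_near psi2_near e_near)
  then have \<sigma>near: "near \<tau> (\<lambda>g h. \<sigma> h = \<sigma> g)" by (rule near_mono) (simp add: \<sigma>_def \<rho>bar_def)
  have \<sigma>res: "map_mat2 ?\<pi>A (\<sigma> g) = \<rho>bar g" if "g \<in> carrier G" for g
    using that by (simp add: \<sigma>_def \<rho>bar_def \<pi>\<theta>)
  have lift: "is_lift p F G \<tau> \<rho>x A \<sigma>" by (rule is_lift_nilpotent[OF A nil \<sigma>hom \<sigma>near \<sigma>res])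
  have "strictly_equivalent p F G A (\<lambda>g. map_mat2 q (\<rho> g)) \<sigma>"
    using constant_pseudo_rep_lift[OF A.local_map_axioms th \<pi>\<theta> \<rho>'hom \<rho>'near \<rho>'res \<rho>'tr \<rho>'det[OF u]]
    unfolding strictly_equivalent_def \<sigma>_def \<rho>'_def .
  moreover have "strictly_equivalent p F G A (\<lambda>g. map_mat2 q' (\<rho> g)) \<sigma>"
  proof -
    interpret GL: group "GL2 A" by (rule A.R.GL2_group)
    have "map_mat2 ?\<pi>A \<one>\<^bsub>GL2 A\<^esub> = \<one>\<^bsub>GL2 F\<^esub>" by (simp add: GL2_def)
    moreover have "\<sigma> g = \<one>\<^bsub>GL2 A\<^esub> \<otimes>\<^bsub>GL2 A\<^esub> map_mat2 q' (\<rho> g) \<otimes>\<^bsub>GL2 A\<^esub> inv\<^bsub>GL2 A\<^esub> \<one>\<^bsub>GL2 A\<^esub>" if g: "g \<in> carrier G" for g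
      using q'.GL2_map(1)[OF rc[OF g]] q'\<sigma>[OF g] by simp
    ultimately show ?thesis unfolding strictly_equivalent_def using GL.one_closed by blast
  qed
  ultimately have "q = q'" by (rule universal_unique[OF A lift q q'])
  then have "q s = q' s" by simp
  then have "q s = q (\<Psi> (l (\<pi>S s)))" using s by (simp add: q'_def \<theta>_def)
  then have "q (s \<ominus>\<^bsub>Rdef\<^esub> \<Psi> (l (\<pi>S s))) = \<zero>\<^bsub>A\<^esub>" using s l by (simp add: a_minus_def A.R.r_neg)
  then have "s \<ominus>\<^bsub>Rdef\<^esub> \<Psi> (l (\<pi>S s)) \<in> K" using qK[of "s \<ominus>\<^bsub>Rdef\<^esub> \<Psi> (l (\<pi>S s))"] s l by simp
  then show ?thesis using l s unfolding K_def by (metis S.hom_closed)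
qed

text \<open>With \<open>J\<close> a power of the maximal ideal of \<open>Rdef\<close>, the error
  ideal in \<open>image_dense\<close> is absorbed by that power, because \<open>\<Psi>\<close> maps
  powers of the maximal ideal into powers. The approximate preimages then form decreasing closed
  sets in the compact ring \<open>Rpd\<close>.\<close>

lemma Psi_surj: "\<Psi> ` carrier Rpd = carrier Rdef"
proof
  show "\<Psi> ` carrier Rpd \<subseteq> carrier Rdef" by (rule image_subsetI) simp
  show "carrier Rdef \<subseteq> \<Psi> ` carrier Rpd"
  proof
    fix y assume y: "y \<in> carrier Rdef"
    have Pm: "\<Psi> x \<in> S.mpow n" if "x \<in> L.mpow n" for x n
      by (rule Psi.hom_ideal_power[OF Psi_mm that]) (rule subsetI, simp add: L.mm_iff)
    have approx: "\<exists>r\<in>carrier Rpd. y \<ominus>\<^bsub>Rdef\<^esub> \<Psi> r \<in> S.mpow (Suc n)" for n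
    proof -
      have "\<exists>r\<in>carrier Rpd. y \<ominus>\<^bsub>Rdef\<^esub> \<Psi> r \<in> genideal Rdef (\<Psi> ` L.mpow (Suc n) \<union> S.mpow (Suc n))"
        by (rule Psi.image_dense[OF L.mm_ideal S.mpow_ideal tangent_surjective[OF zero_less_Suc] y])
      moreover have "genideal Rdef (\<Psi> ` L.mpow (Suc n) \<union> S.mpow (Suc n)) \<subseteq> S.mpow (Suc n)"
        by (rule S.R.genideal_minimal[OF S.mpow_ideal]) (use Pm in blast)
      ultimately show ?thesis by blast
    qed
    define V where "V n = {r \<in> carrier Rpd. y \<ominus>\<^bsub>Rdef\<^esub> \<Psi> r \<in> S.mpow n}" for n
    obtain r where r: "\<And>n. r \<in> V n"
    proof (rule L.compactness[of V])
      show "V n \<subseteq> carrier Rpd" for n by (auto simp: V_def)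
      show dec: "V (Suc n) \<subseteq> V n" for n using S.mpow_antimono[of n "Suc n"] by (auto simp: V_def)
      show "V n \<noteq> {}" for n
      proof -
        obtain r where "r \<in> carrier Rpd" "y \<ominus>\<^bsub>Rdef\<^esub> \<Psi> r \<in> S.mpow (Suc n)" using approx[of n] by blast
        then have "r \<in> V (Suc n)" by (simp add: V_def)
        then show ?thesis using dec by blast
      qed
      have "r \<oplus>\<^bsub>Rpd\<^esub> x \<in> V n" if r: "r \<in> V n" and x: "x \<in> L.mpow n" for r x n
      proof -
        have xc: "x \<in> carrier Rpd" by (rule ideal.Icarr[OF L.mpow_ideal x])
        have rc: "r \<in> carrier Rpd" "y \<ominus>\<^bsub>Rdef\<^esub> \<Psi> r \<in> S.mpow n" using r by (simp_all add: V_def)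
        have "y \<ominus>\<^bsub>Rdef\<^esub> \<Psi> (r \<oplus>\<^bsub>Rpd\<^esub> x) = (y \<ominus>\<^bsub>Rdef\<^esub> \<Psi> r) \<ominus>\<^bsub>Rdef\<^esub> \<Psi> x"
          using y rc xc by (simp add: a_minus_def S.R.minus_add S.R.a_assoc)
        then show ?thesis using ideal.diff_closed[OF S.mpow_ideal rc(2) Pm[OF x]] rc xc by (simp add: V_def)
      qed
      then show "\<exists>k. \<forall>r\<in>V n. \<forall>x\<in>L.mpow k. r \<oplus>\<^bsub>Rpd\<^esub> x \<in> V n" for n by blast
      fix r assume "\<And>n. r \<in> V n"
      then show thesis by (rule that)
    qed
    have "y \<ominus>\<^bsub>Rdef\<^esub> \<Psi> r = \<zero>\<^bsub>Rdef\<^esub>" by (rule S.mpow_Inter) (use r in \<open>simp add: V_def\<close>)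
    then have "y = \<Psi> r" using y r[of 0] by (simp add: V_def)
    then show "y \<in> \<Psi> ` carrier Rpd" using r[of 0] by (simp add: V_def)
  qed
qed

end


section \<open>Reduced quotients\<close>

context cring
begin

text \<open>A replacement for the binomial expansion: each factor \<open>r + s\<close> is
  distributed to one of the two powers, so the total exponent is preserved until one of them is
  large enough. \<open>i\<close> and \<open>j\<close> are carried along for the induction; the
  application has both equal to zero.\<close>

lemma nilpotent_product_sum:
  fixes n m i j k :: nat
  assumes r: "r \<in> carrier R" "r [^] n = \<zero>" and s: "s \<in> carrier R" "s [^] m = \<zero>" and "n + m \<le> i + j + k"
  shows "r [^] i \<otimes> s [^] j \<otimes> (r \<oplus> s) [^] k = \<zero>"
  using assms(5)
proof (induction k arbitrary: i j)
  case 0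
  have pow_zero: "x [^] l = \<zero>" if "x \<in> carrier R" "x [^] t = \<zero>" "t \<le> l" for x and t l :: nat
  proof -
    have "x [^] t \<otimes> x [^] (l - t) = x [^] l" using nat_pow_mult[OF that(1), of t "l - t"] that(3) by simp
    then show ?thesis unfolding that(2) using that(1) by simp
  qed
  have "n \<le> i \<or> m \<le> j" using 0 by linarith
  then show ?case using pow_zero[OF r, of i] pow_zero[OF s, of j] r(1) s(1) by auto
next
  case (Suc k)
  have c: "r [^] i \<in> carrier R" "s [^] j \<in> carrier R" "(r \<oplus> s) [^] k \<in> carrier R" using r(1) s(1) by simp_all
  have "r [^] i \<otimes> s [^] j \<otimes> ((r \<oplus> s) [^] k \<otimes> (r \<oplus> s)) =
    (r [^] i \<otimes> r) \<otimes> s [^] j \<otimes> (r \<oplus> s) [^] k \<oplus> r [^] i \<otimes> (s [^] j \<otimes> s) \<otimes> (r \<oplus> s) [^] k"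
    using c r(1) s(1) by algebra
  then show ?case using Suc.IH[of "Suc i" j] Suc.IH[of i "Suc j"] Suc.prems by simp
qed

lemma nilradical_ideal: "ideal (nilradical R) R"
proof (rule idealI[OF ring_axioms])
  show "subgroup (nilradical R) (add_monoid R)"
  proof (rule group.subgroupI)
    show "Group.group (add_monoid R)" by (rule a_group)
    show "nilradical R \<subseteq> carrier (add_monoid R)" by (auto simp: nilradical_def)
    have "\<zero> [^] (1::nat) = \<zero>" by simp
    then have "\<zero> \<in> nilradical R" unfolding nilradical_def by blast
    then show "nilradical R \<noteq> {}" by blast
    fix a assume "a \<in> nilradical R"
    then obtain n :: nat where a: "a \<in> carrier R" "a [^] n = \<zero>" by (auto simp: nilradical_def)
    have "(\<ominus> a) [^] n = (\<ominus> \<one>) [^] n \<otimes> a [^] n"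
      using a(1) nat_pow_distrib[of "\<ominus> \<one>" a n] by (simp add: l_minus)
    then have "(\<ominus> a) [^] n = \<zero>" using a by simp
    then have "\<ominus> a \<in> nilradical R" using a unfolding nilradical_def by blast
    then show "inv\<^bsub>add_monoid R\<^esub> a \<in> nilradical R" by (simp add: a_inv_def)
    fix b assume "b \<in> nilradical R"
    then obtain m :: nat where b: "b \<in> carrier R" "b [^] m = \<zero>" by (auto simp: nilradical_def)
    have "(a \<oplus> b) [^] (n + m) = \<zero>"
      using nilpotent_product_sum[OF a b, of 0 0 "n + m"] a b by simp
    then show "a \<otimes>\<^bsub>add_monoid R\<^esub> b \<in> nilradical R" using a b by (auto simp: nilradical_def)
  qed
  fix a x assume "a \<in> nilradical R" and x: "x \<in> carrier R"
  then obtain n :: nat where a: "a \<in> carrier R" "a [^] n = \<zero>" by (auto simp: nilradical_def)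
  have "(x \<otimes> a) [^] n = \<zero>" using a x nat_pow_distrib[of x a n] by simp
  then show xa: "x \<otimes> a \<in> nilradical R" using a x by (auto simp: nilradical_def)
  then show "a \<otimes> x \<in> nilradical R" using a x by (simp add: m_comm)
qed

end

text \<open>The map from \<open>R\<close> to the reduced quotient of \<open>S\<close> has kernel
  \<open>nilradical R\<close>: if \<open>h r\<close> is nilpotent, some power of \<open>r\<close> is
  killed by \<open>h\<close> and hence nilpotent. The first isomorphism theorem gives the
  rest.\<close>

lemma (in ring_hom_cring) induced_reduced_map_iso:
  assumes surj: "h ` carrier R = carrier S"
    and ker: "\<And>z. z \<in> carrier R \<Longrightarrow> h z = \<zero>\<^bsub>S\<^esub> \<Longrightarrow> z \<in> nilradical R"
  shows "induced_reduced_map R S h \<in> ring_iso (reduced_quotient R) (reduced_quotient S)"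
proof -
  interpret N: ideal "nilradical S" S by (rule S.nilradical_ideal)
  let ?Q = "S Quot (nilradical S)"
  let ?f = "\<lambda>r. nilradical S +>\<^bsub>S\<^esub> h r"
  have hom_f: "?f \<in> ring_hom R ?Q"
    using ring_hom_trans[OF homh N.rcos_ring_hom] unfolding comp_def .
  interpret f: ring_hom_ring R ?Q ?f
    by (rule ring_hom_ringI2[OF R.ring_axioms N.quotient_is_ring hom_f])
  have ker_f: "a_kernel R ?Q ?f = nilradical R"
  proof -
    have "?f r = \<zero>\<^bsub>?Q\<^esub> \<longleftrightarrow> r \<in> nilradical R" if r: "r \<in> carrier R" for r
    proof
      assume "?f r = \<zero>\<^bsub>?Q\<^esub>"
      then have "nilradical S +>\<^bsub>S\<^esub> h r = nilradical S" unfolding FactRing_def by simp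
      then have "h r \<in> nilradical S" by (rule N.rcos_const_imp_mem[OF hom_closed[OF r]])
      then obtain n :: nat where "h r [^]\<^bsub>S\<^esub> n = \<zero>\<^bsub>S\<^esub>" unfolding nilradical_def by blast
      then have "h (r [^] n) = \<zero>\<^bsub>S\<^esub>" using r by simp
      then have "r [^] n \<in> nilradical R" using ker r by simp
      then obtain m :: nat where "(r [^] n) [^] m = \<zero>" unfolding nilradical_def by blast
      then have "r [^] (n * m) = \<zero>" using r by (simp add: R.nat_pow_pow)
      then show "r \<in> nilradical R" using r unfolding nilradical_def by blast
    next
      assume "r \<in> nilradical R"
      then obtain n :: nat where n: "r [^] n = \<zero>" unfolding nilradical_def by blast
      have "h (r [^] n) = h r [^]\<^bsub>S\<^esub> n" using r by simp
      then have "h r [^]\<^bsub>S\<^esub> n = \<zero>\<^bsub>S\<^esub>" unfolding n by simp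
      then have "h r \<in> nilradical S" using hom_closed[OF r] unfolding nilradical_def by blast
      then show "?f r = \<zero>\<^bsub>?Q\<^esub>" unfolding FactRing_def by (simp add: N.a_rcos_const)
    qed
    moreover have "nilradical R \<subseteq> carrier R" by (auto simp: nilradical_def)
    ultimately show ?thesis unfolding a_kernel_def' by blast
  qed
  have "?f ` carrier R = carrier ?Q"
    unfolding FactRing_def A_RCOSETS_def' surj[symmetric] by auto
  from f.FactRing_iso_set[OF this]
  have "(\<lambda>X. the_elem (?f ` X)) \<in> ring_iso (R Quot (nilradical R)) ?Q" unfolding ker_f .
  then show ?thesis by (simp add: induced_reduced_map_def[abs_def] reduced_quotient_def)
qed

theorem (in deformation_comparison) reduced_iso:
  "induced_reduced_map Rpd Rdef \<Psi> \<in> ring_iso (reduced_quotient Rpd) (reduced_quotient Rdef)"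
proof (rule Psi.induced_reduced_map_iso[OF Psi_surj])
  fix z assume z: "z \<in> carrier Rpd" "\<Psi> z = \<zero>\<^bsub>Rdef\<^esub>"
  have "z [^]\<^bsub>Rpd\<^esub> (2::nat) = \<zero>\<^bsub>Rpd\<^esub>"
    using kernel_square_zero[OF z] z by (simp add: numeral_2_eq_2)
  then show "z \<in> nilradical Rpd" using z(1) unfolding nilradical_def by blast
qed


section \<open>From cohomology classes to residual extensions\<close>

lemma cont_characterD:
  assumes \<psi>: "cont_character G \<tau> F \<psi>" and F: "field F" and G: "group G"
  shows "g \<in> carrier G \<Longrightarrow> \<psi> g \<in> carrier F" "g \<in> carrier G \<Longrightarrow> \<psi> g \<noteq> \<zero>\<^bsub>F\<^esub>"
    "g \<in> carrier G \<Longrightarrow> h \<in> carrier G \<Longrightarrow> \<psi> (g \<otimes>\<^bsub>G\<^esub> h) = \<psi> g \<otimes>\<^bsub>F\<^esub> \<psi> h"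
    "\<psi> \<one>\<^bsub>G\<^esub> = \<one>\<^bsub>F\<^esub>" "near \<tau> (\<lambda>g h. \<psi> h = \<psi> g)"
proof -
  interpret F: field F by fact
  interpret G: group G by fact
  have h: "\<psi> \<in> hom G (units_of F)" and "continuous_map \<tau> (discrete_topology (carrier F)) \<psi>"
    using \<psi> by (simp_all add: cont_character_def)
  then show "near \<tau> (\<lambda>g h. \<psi> h = \<psi> g)" by (simp add: continuous_map_discrete_near)
  show c: "\<psi> g \<in> carrier F" and "\<psi> g \<noteq> \<zero>\<^bsub>F\<^esub>" if "g \<in> carrier G" for g
    using hom_in_carrier[OF h that] by (simp_all add: units_of_def F.field_Units)
  show m: "\<psi> (g \<otimes>\<^bsub>G\<^esub> h) = \<psi> g \<otimes>\<^bsub>F\<^esub> \<psi> h" if "g \<in> carrier G" "h \<in> carrier G" for g h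
    using hom_mult[OF h that] by (simp add: units_of_def)
  have "\<psi> \<one>\<^bsub>G\<^esub> = \<one>\<^bsub>units_of F\<^esub>" by (rule hom_one[OF h G.is_group F.units_group])
  then show "\<psi> \<one>\<^bsub>G\<^esub> = \<one>\<^bsub>F\<^esub>" by (simp add: units_of_def)
qed

text \<open>Multiplication by \<open>\<psi>2\<close> turns inhomogeneous cochains with values in
  \<open>\<chi>\<close> into upper right entries: a 1-cocycle is multiplied by
  \<open>\<psi>2\<close>, a 2-cocycle by \<open>\<psi>2\<close> of both arguments. Coboundaries of
  degree one become multiples of \<open>\<psi>1 - \<psi>2\<close>.\<close>

lemma residual_extension_of_class:
  assumes F: "field F" "finite (carrier F)" and G: "profinite_group G \<tau>"
    and \<psi>1: "cont_character G \<tau> F \<psi>1" and \<psi>2: "cont_character G \<tau> F \<psi>2"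
    and u: "u \<in> carrier G" "\<psi>1 u \<noteq> \<psi>2 u"
    and \<chi>: "\<And>g. g \<in> carrier G \<Longrightarrow> \<chi> g = \<psi>1 g \<otimes>\<^bsub>F\<^esub> inv\<^bsub>F\<^esub> (\<psi>2 g)"
    and H1: "vectorspace.fin_dim F (H1 G \<tau> F \<chi>)" "vectorspace.dim F (H1 G \<tau> F \<chi>) = 1"
    and H2: "carrier (H2 G \<tau> F \<chi>) = {\<zero>\<^bsub>H2 G \<tau> F \<chi>\<^esub>}"
    and x: "x \<in> carrier (H1 G \<tau> F \<chi>)" "x \<noteq> \<zero>\<^bsub>H1 G \<tau> F \<chi>\<^esub>" "c \<in> x"
  shows "residual_extension F G \<tau> \<psi>1 \<psi>2 (\<lambda>g. \<psi>2 g \<otimes>\<^bsub>F\<^esub> c g) u"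
proof -
  interpret F: field F by fact
  have top: "topspace \<tau> = carrier G" and comp: "compact_space \<tau>" and grp: "group G"
    and cont: "continuous_map (prod_topology \<tau> \<tau>) \<tau> (\<lambda>(g, h). g \<otimes>\<^bsub>G\<^esub> h)"
    using G by (simp_all add: profinite_group_def topological_group_def)
  interpret G: group G by fact
  note p1 = cont_characterD[OF \<psi>1 F(1) grp] and p2 = cont_characterD[OF \<psi>2 F(1) grp]
  \<comment> \<open>The inverse of \<open>\<psi>2\<close> as a symbol of its own, tied to
    \<open>\<psi>2\<close> by one relation, makes the identities below polynomial.\<close>
  define k where "k g = inv\<^bsub>F\<^esub> (\<psi>2 g)" for g
  have k: "k g \<in> carrier F" "\<psi>2 g \<otimes>\<^bsub>F\<^esub> k g = \<one>\<^bsub>F\<^esub>" if "g \<in> carrier G" for g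
  proof -
    have "\<psi>2 g \<in> Units F" using p2(1,2)[OF that] by (simp add: F.field_Units)
    then show "k g \<in> carrier F" "\<psi>2 g \<otimes>\<^bsub>F\<^esub> k g = \<one>\<^bsub>F\<^esub>" by (simp_all add: k_def)
  qed
  have k_mult: "k (g \<otimes>\<^bsub>G\<^esub> h) = k g \<otimes>\<^bsub>F\<^esub> k h" if gh: "g \<in> carrier G" "h \<in> carrier G" for g h
  proof -
    have m: "\<psi>2 g \<otimes>\<^bsub>F\<^esub> \<psi>2 h \<otimes>\<^bsub>F\<^esub> k (g \<otimes>\<^bsub>G\<^esub> h) = \<one>\<^bsub>F\<^esub>" using k(2)[of "g \<otimes>\<^bsub>G\<^esub> h"] p2(3)[OF gh] gh by simp
    have "k g \<otimes>\<^bsub>F\<^esub> k h \<otimes>\<^bsub>F\<^esub> (\<psi>2 g \<otimes>\<^bsub>F\<^esub> \<psi>2 h \<otimes>\<^bsub>F\<^esub> k (g \<otimes>\<^bsub>G\<^esub> h)) = (\<psi>2 g \<otimes>\<^bsub>F\<^esub> k g) \<otimes>\<^bsub>F\<^esub> ((\<psi>2 h \<otimes>\<^bsub>F\<^esub> k h) \<otimes>\<^bsub>F\<^esub> k (g \<otimes>\<^bsub>G\<^esub> h))"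
      using k(1)[OF gh(1)] k(1)[OF gh(2)] k(1)[OF G.m_closed[OF gh]] p2(1)[OF gh(1)] p2(1)[OF gh(2)] by algebra
    then show ?thesis unfolding m using k gh G.m_closed[OF gh] by simp
  qed
  have \<chi>k: "\<chi> g = \<psi>1 g \<otimes>\<^bsub>F\<^esub> k g" if "g \<in> carrier G" for g using \<chi>[OF that] by (simp add: k_def)
  interpret C: char_cohomology F G \<tau> \<chi>
  proof (intro char_cohomology.intro char_cohomology_axioms.intro F(1) grp top)
    fix g h assume gh: "g \<in> carrier G" "h \<in> carrier G"
    show "\<chi> (g \<otimes>\<^bsub>G\<^esub> h) = \<chi> g \<otimes>\<^bsub>F\<^esub> \<chi> h"
      using gh p1(1) k(1) by (simp add: \<chi>k k_mult p1(3) F.m_ac)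
  next
    show "near \<tau> (\<lambda>g h. \<chi> h = \<chi> g)"
      by (rule near_mono2[OF p1(5) p2(5)]) (simp add: top \<chi>)
  qed (use k(1) p1(1) in \<open>simp add: \<chi>k\<close>)
  note one_dim = C.H1_one_dimensional[OF H1 x]
  have c: "c g \<in> carrier F" if "g \<in> carrier G" for g
    using one_dim(1) that unfolding C.cocycles1_iff by blast
  have c_near: "near \<tau> (\<lambda>g h. c h = c g)" using one_dim(1) unfolding C.cocycles1_iff by blast
  have c_mult: "c (g \<otimes>\<^bsub>G\<^esub> h) = \<chi> g \<otimes>\<^bsub>F\<^esub> c h \<oplus>\<^bsub>F\<^esub> c g" if "g \<in> carrier G" "h \<in> carrier G" for g h
    using one_dim(1) that unfolding C.cocycles1_iff by blast
  show ?thesis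
  proof (intro residual_extension.intro residual_extension_axioms.intro)
    show "near \<tau> (\<lambda>g h. \<psi>2 h \<otimes>\<^bsub>F\<^esub> c h = \<psi>2 g \<otimes>\<^bsub>F\<^esub> c g)"
      by (rule near_mono2[OF p2(5) c_near]) simp
  next
    fix g h assume gh: "g \<in> carrier G" "h \<in> carrier G"
    show "\<psi>2 (g \<otimes>\<^bsub>G\<^esub> h) \<otimes>\<^bsub>F\<^esub> c (g \<otimes>\<^bsub>G\<^esub> h) = \<psi>1 g \<otimes>\<^bsub>F\<^esub> (\<psi>2 h \<otimes>\<^bsub>F\<^esub> c h) \<oplus>\<^bsub>F\<^esub> \<psi>2 h \<otimes>\<^bsub>F\<^esub> (\<psi>2 g \<otimes>\<^bsub>F\<^esub> c g)"
    proof -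
      have "\<psi>2 g \<otimes>\<^bsub>F\<^esub> \<psi>2 h \<otimes>\<^bsub>F\<^esub> (\<psi>1 g \<otimes>\<^bsub>F\<^esub> k g \<otimes>\<^bsub>F\<^esub> c h \<oplus>\<^bsub>F\<^esub> c g) = \<psi>1 g \<otimes>\<^bsub>F\<^esub> ((\<psi>2 g \<otimes>\<^bsub>F\<^esub> k g) \<otimes>\<^bsub>F\<^esub> (\<psi>2 h \<otimes>\<^bsub>F\<^esub> c h)) \<oplus>\<^bsub>F\<^esub> \<psi>2 h \<otimes>\<^bsub>F\<^esub> (\<psi>2 g \<otimes>\<^bsub>F\<^esub> c g)"
        using k(1)[OF gh(1)] p1(1)[OF gh(1)] p2(1)[OF gh(1)] p2(1)[OF gh(2)] c[OF gh(1)] c[OF gh(2)] by algebra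
      then show ?thesis
        unfolding c_mult[OF gh] p2(3)[OF gh] \<chi>k[OF gh(1)] k(2)[OF gh(1)] using p2(1) c gh by simp
    qed
  next
    fix v assume v: "v \<in> carrier F"
    obtain g where g: "g \<in> carrier G" "c g \<noteq> \<chi> g \<otimes>\<^bsub>F\<^esub> v \<ominus>\<^bsub>F\<^esub> v" using one_dim(2)[OF v] by blast
    have "c g = \<chi> g \<otimes>\<^bsub>F\<^esub> v \<ominus>\<^bsub>F\<^esub> v" if e: "\<psi>2 g \<otimes>\<^bsub>F\<^esub> c g = v \<otimes>\<^bsub>F\<^esub> (\<psi>1 g \<ominus>\<^bsub>F\<^esub> \<psi>2 g)"
    proof -
      have "(\<psi>2 g \<otimes>\<^bsub>F\<^esub> k g) \<otimes>\<^bsub>F\<^esub> c g = k g \<otimes>\<^bsub>F\<^esub> (\<psi>2 g \<otimes>\<^bsub>F\<^esub> c g)"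
        and "k g \<otimes>\<^bsub>F\<^esub> (v \<otimes>\<^bsub>F\<^esub> (\<psi>1 g \<ominus>\<^bsub>F\<^esub> \<psi>2 g)) = \<psi>1 g \<otimes>\<^bsub>F\<^esub> k g \<otimes>\<^bsub>F\<^esub> v \<ominus>\<^bsub>F\<^esub> (\<psi>2 g \<otimes>\<^bsub>F\<^esub> k g) \<otimes>\<^bsub>F\<^esub> v"
        using k(1)[OF g(1)] p1(1)[OF g(1)] p2(1)[OF g(1)] c[OF g(1)] v by algebra+
      then show ?thesis unfolding e \<chi>k[OF g(1)] k(2)[OF g(1)] using c[OF g(1)] v by simp
    qed
    then show "\<exists>g\<in>carrier G. \<psi>2 g \<otimes>\<^bsub>F\<^esub> c g \<noteq> v \<otimes>\<^bsub>F\<^esub> (\<psi>1 g \<ominus>\<^bsub>F\<^esub> \<psi>2 g)" using g by blast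
  next
    fix f assume f: "\<And>g. g \<in> carrier G \<Longrightarrow> f g \<in> carrier F" and fn: "near \<tau> (\<lambda>g h. f h = f g)"
      and fm: "\<And>g h. g \<in> carrier G \<Longrightarrow> h \<in> carrier G \<Longrightarrow> f (g \<otimes>\<^bsub>G\<^esub> h) = \<psi>1 g \<otimes>\<^bsub>F\<^esub> f h \<oplus>\<^bsub>F\<^esub> \<psi>2 h \<otimes>\<^bsub>F\<^esub> f g"
    define z where "z = (\<lambda>g\<in>carrier G. k g \<otimes>\<^bsub>F\<^esub> f g)"
    have "z (g \<otimes>\<^bsub>G\<^esub> h) = \<chi> g \<otimes>\<^bsub>F\<^esub> z h \<oplus>\<^bsub>F\<^esub> z g" if gh: "g \<in> carrier G" "h \<in> carrier G" for g h
    proof -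
      have "k g \<otimes>\<^bsub>F\<^esub> k h \<otimes>\<^bsub>F\<^esub> (\<psi>1 g \<otimes>\<^bsub>F\<^esub> f h \<oplus>\<^bsub>F\<^esub> \<psi>2 h \<otimes>\<^bsub>F\<^esub> f g) =
        \<psi>1 g \<otimes>\<^bsub>F\<^esub> k g \<otimes>\<^bsub>F\<^esub> (k h \<otimes>\<^bsub>F\<^esub> f h) \<oplus>\<^bsub>F\<^esub> k g \<otimes>\<^bsub>F\<^esub> ((\<psi>2 h \<otimes>\<^bsub>F\<^esub> k h) \<otimes>\<^bsub>F\<^esub> f g)"
        using k(1)[OF gh(1)] k(1)[OF gh(2)] p1(1)[OF gh(1)] p2(1)[OF gh(2)] f[OF gh(1)] f[OF gh(2)] by algebra
      then show ?thesis unfolding k(2)[OF gh(2)] using gh f by (simp add: z_def k_mult fm \<chi>k)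
    qed
    moreover have "near \<tau> (\<lambda>g h. z h = z g)"
      by (rule near_mono2[OF p2(5) fn]) (simp add: z_def k_def top)
    moreover have "z \<in> carrier G \<rightarrow>\<^sub>E carrier F" using k(1) f by (simp add: z_def)
    ultimately have "z \<in> cocycles1 G \<tau> F \<chi>" unfolding C.cocycles1_iff by blast
    from one_dim(3)[OF this] obtain s w where s: "s \<in> carrier F" "w \<in> carrier F"
      and zg: "\<And>g. g \<in> carrier G \<Longrightarrow> z g = s \<otimes>\<^bsub>F\<^esub> c g \<oplus>\<^bsub>F\<^esub> (\<chi> g \<otimes>\<^bsub>F\<^esub> w \<ominus>\<^bsub>F\<^esub> w)" by blast
    have "f g = s \<otimes>\<^bsub>F\<^esub> (\<psi>2 g \<otimes>\<^bsub>F\<^esub> c g) \<oplus>\<^bsub>F\<^esub> w \<otimes>\<^bsub>F\<^esub> (\<psi>1 g \<ominus>\<^bsub>F\<^esub> \<psi>2 g)" if g: "g \<in> carrier G" for g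
    proof -
      have e: "k g \<otimes>\<^bsub>F\<^esub> f g = s \<otimes>\<^bsub>F\<^esub> c g \<oplus>\<^bsub>F\<^esub> (\<psi>1 g \<otimes>\<^bsub>F\<^esub> k g \<otimes>\<^bsub>F\<^esub> w \<ominus>\<^bsub>F\<^esub> w)"
        using zg[OF g] g by (simp add: z_def \<chi>k)
      have "(\<psi>2 g \<otimes>\<^bsub>F\<^esub> k g) \<otimes>\<^bsub>F\<^esub> f g = \<psi>2 g \<otimes>\<^bsub>F\<^esub> (k g \<otimes>\<^bsub>F\<^esub> f g)"
        and "\<psi>2 g \<otimes>\<^bsub>F\<^esub> (s \<otimes>\<^bsub>F\<^esub> c g \<oplus>\<^bsub>F\<^esub> (\<psi>1 g \<otimes>\<^bsub>F\<^esub> k g \<otimes>\<^bsub>F\<^esub> w \<ominus>\<^bsub>F\<^esub> w)) = s \<otimes>\<^bsub>F\<^esub> (\<psi>2 g \<otimes>\<^bsub>F\<^esub> c g) \<oplus>\<^bsub>F\<^esub> (\<psi>1 g \<otimes>\<^bsub>F\<^esub> (\<psi>2 g \<otimes>\<^bsub>F\<^esub> k g) \<otimes>\<^bsub>F\<^esub> w \<ominus>\<^bsub>F\<^esub> \<psi>2 g \<otimes>\<^bsub>F\<^esub> w)"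
        and "w \<otimes>\<^bsub>F\<^esub> (\<psi>1 g \<ominus>\<^bsub>F\<^esub> \<psi>2 g) = \<psi>1 g \<otimes>\<^bsub>F\<^esub> w \<ominus>\<^bsub>F\<^esub> \<psi>2 g \<otimes>\<^bsub>F\<^esub> w"
        using k(1)[OF g] p1(1)[OF g] p2(1)[OF g] f[OF g] c[OF g] s by algebra+
      then show ?thesis unfolding e k(2)[OF g] using f[OF g] p1(1)[OF g] by simp
    qed
    then show "\<exists>s\<in>carrier F. \<exists>v\<in>carrier F. \<forall>g\<in>carrier G.
        f g = s \<otimes>\<^bsub>F\<^esub> (\<psi>2 g \<otimes>\<^bsub>F\<^esub> c g) \<oplus>\<^bsub>F\<^esub> v \<otimes>\<^bsub>F\<^esub> (\<psi>1 g \<ominus>\<^bsub>F\<^esub> \<psi>2 g)" using s by blast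
  next
    fix z assume z: "\<And>g h. g \<in> carrier G \<Longrightarrow> h \<in> carrier G \<Longrightarrow> z g h \<in> carrier F"
      and zn: "near (prod_topology \<tau> \<tau>) (\<lambda>s s'. z (fst s') (snd s') = z (fst s) (snd s))"
      and zm: "\<And>g h l. g \<in> carrier G \<Longrightarrow> h \<in> carrier G \<Longrightarrow> l \<in> carrier G \<Longrightarrow>
        z g (h \<otimes>\<^bsub>G\<^esub> l) \<oplus>\<^bsub>F\<^esub> \<psi>1 g \<otimes>\<^bsub>F\<^esub> z h l = z (g \<otimes>\<^bsub>G\<^esub> h) l \<oplus>\<^bsub>F\<^esub> z g h \<otimes>\<^bsub>F\<^esub> \<psi>2 l"
    define y where "y = (\<lambda>s\<in>topspace (prod_topology \<tau> \<tau>). k (fst s) \<otimes>\<^bsub>F\<^esub> k (snd s) \<otimes>\<^bsub>F\<^esub> z (fst s) (snd s))"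
    have y: "y (g, h) = k g \<otimes>\<^bsub>F\<^esub> k h \<otimes>\<^bsub>F\<^esub> z g h" if "g \<in> carrier G" "h \<in> carrier G" for g h
      using that by (simp add: y_def top)
    have "y \<in> cocycles2 G \<tau> F \<chi>"
    proof -
      have "near (prod_topology \<tau> \<tau>) (\<lambda>s s'. (\<psi>2 (fst s') = \<psi>2 (fst s) \<and> \<psi>2 (snd s') = \<psi>2 (snd s)) \<and>
          z (fst s') (snd s') = z (fst s) (snd s))"
        by (intro near_conj zn near_pull[OF p2(5) continuous_map_fst] near_pull[OF p2(5) continuous_map_snd])
      then have "near (prod_topology \<tau> \<tau>) (\<lambda>s s'. k (fst s') \<otimes>\<^bsub>F\<^esub> k (snd s') \<otimes>\<^bsub>F\<^esub> z (fst s') (snd s') =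
          k (fst s) \<otimes>\<^bsub>F\<^esub> k (snd s) \<otimes>\<^bsub>F\<^esub> z (fst s) (snd s))"
        by (rule near_mono) (simp add: k_def)
      then have "y \<in> cochains F (prod_topology \<tau> \<tau>)"
        unfolding y_def by (intro cochainsI) (auto simp: top k(1) z)
      moreover have "cobound2 G F \<chi> y s = \<zero>\<^bsub>F\<^esub>" if s: "s \<in> carrier G \<times> carrier G \<times> carrier G" for s
      proof -
        obtain g h l where s: "s = (g, h, l)" and g: "g \<in> carrier G" and h: "h \<in> carrier G" and l: "l \<in> carrier G"
          using s by auto
        define k1 k2 k3 q1 q2 z1 z2 z3 z4 where defs: "k1 = k g" "k2 = k h" "k3 = k l" "q1 = \<psi>1 g" "q2 = \<psi>2 l"
          "z1 = z h l" "z2 = z (g \<otimes>\<^bsub>G\<^esub> h) l" "z3 = z g (h \<otimes>\<^bsub>G\<^esub> l)" "z4 = z g h"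
        have cl: "k1 \<in> carrier F" "k2 \<in> carrier F" "k3 \<in> carrier F" "q1 \<in> carrier F" "q2 \<in> carrier F"
          "z1 \<in> carrier F" "z2 \<in> carrier F" "z3 \<in> carrier F" "z4 \<in> carrier F"
          using g h l k(1) p1(1) p2(1) z by (simp_all add: defs)
        have r: "z3 \<oplus>\<^bsub>F\<^esub> q1 \<otimes>\<^bsub>F\<^esub> z1 = z2 \<oplus>\<^bsub>F\<^esub> z4 \<otimes>\<^bsub>F\<^esub> q2" "q2 \<otimes>\<^bsub>F\<^esub> k3 = \<one>\<^bsub>F\<^esub>"
          using zm[OF g h l] k(2)[OF l] by (simp_all add: defs)
        \<comment> \<open>The coboundary is a combination of the two relations in \<open>r\<close>:
          the twisted cocycle identity, and \<open>q2 k3 = 1\<close>.\<close>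
        have "((q1 \<otimes>\<^bsub>F\<^esub> k1 \<otimes>\<^bsub>F\<^esub> (k2 \<otimes>\<^bsub>F\<^esub> k3 \<otimes>\<^bsub>F\<^esub> z1) \<ominus>\<^bsub>F\<^esub> k1 \<otimes>\<^bsub>F\<^esub> k2 \<otimes>\<^bsub>F\<^esub> k3 \<otimes>\<^bsub>F\<^esub> z2) \<oplus>\<^bsub>F\<^esub> k1 \<otimes>\<^bsub>F\<^esub> (k2 \<otimes>\<^bsub>F\<^esub> k3) \<otimes>\<^bsub>F\<^esub> z3) \<ominus>\<^bsub>F\<^esub> k1 \<otimes>\<^bsub>F\<^esub> k2 \<otimes>\<^bsub>F\<^esub> z4 =
            k1 \<otimes>\<^bsub>F\<^esub> k2 \<otimes>\<^bsub>F\<^esub> k3 \<otimes>\<^bsub>F\<^esub> ((z3 \<oplus>\<^bsub>F\<^esub> q1 \<otimes>\<^bsub>F\<^esub> z1) \<ominus>\<^bsub>F\<^esub> (z2 \<oplus>\<^bsub>F\<^esub> z4 \<otimes>\<^bsub>F\<^esub> q2)) \<oplus>\<^bsub>F\<^esub> k1 \<otimes>\<^bsub>F\<^esub> k2 \<otimes>\<^bsub>F\<^esub> z4 \<otimes>\<^bsub>F\<^esub> (q2 \<otimes>\<^bsub>F\<^esub> k3 \<ominus>\<^bsub>F\<^esub> \<one>\<^bsub>F\<^esub>)"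
          using cl F.one_closed by algebra
        then have "((q1 \<otimes>\<^bsub>F\<^esub> k1 \<otimes>\<^bsub>F\<^esub> (k2 \<otimes>\<^bsub>F\<^esub> k3 \<otimes>\<^bsub>F\<^esub> z1) \<ominus>\<^bsub>F\<^esub> k1 \<otimes>\<^bsub>F\<^esub> k2 \<otimes>\<^bsub>F\<^esub> k3 \<otimes>\<^bsub>F\<^esub> z2) \<oplus>\<^bsub>F\<^esub> k1 \<otimes>\<^bsub>F\<^esub> (k2 \<otimes>\<^bsub>F\<^esub> k3) \<otimes>\<^bsub>F\<^esub> z3) \<ominus>\<^bsub>F\<^esub> k1 \<otimes>\<^bsub>F\<^esub> k2 \<otimes>\<^bsub>F\<^esub> z4 = \<zero>\<^bsub>F\<^esub>"
          unfolding r using cl by (simp add: a_minus_def F.r_neg)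
        then show ?thesis using g h l by (simp add: s cobound2_def y \<chi>k k_mult defs)
      qed
      ultimately show ?thesis unfolding cocycles2_def by blast
    qed
    then obtain f where f: "\<And>g. g \<in> carrier G \<Longrightarrow> f g \<in> carrier F" and fn: "near \<tau> (\<lambda>g h. f h = f g)"
      and yf: "\<And>g h. g \<in> carrier G \<Longrightarrow> h \<in> carrier G \<Longrightarrow> y (g, h) = \<chi> g \<otimes>\<^bsub>F\<^esub> f h \<ominus>\<^bsub>F\<^esub> f (g \<otimes>\<^bsub>G\<^esub> h) \<oplus>\<^bsub>F\<^esub> f g"
      by (rule C.H2_trivial[OF H2]) (rule that)
    have "z g h = \<psi>1 g \<otimes>\<^bsub>F\<^esub> (\<psi>2 h \<otimes>\<^bsub>F\<^esub> f h) \<oplus>\<^bsub>F\<^esub> \<psi>2 h \<otimes>\<^bsub>F\<^esub> (\<psi>2 g \<otimes>\<^bsub>F\<^esub> f g) \<ominus>\<^bsub>F\<^esub> \<psi>2 (g \<otimes>\<^bsub>G\<^esub> h) \<otimes>\<^bsub>F\<^esub> f (g \<otimes>\<^bsub>G\<^esub> h)"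
      if g: "g \<in> carrier G" and h: "h \<in> carrier G" for g h
    proof -
      have e: "k g \<otimes>\<^bsub>F\<^esub> k h \<otimes>\<^bsub>F\<^esub> z g h = \<psi>1 g \<otimes>\<^bsub>F\<^esub> k g \<otimes>\<^bsub>F\<^esub> f h \<ominus>\<^bsub>F\<^esub> f (g \<otimes>\<^bsub>G\<^esub> h) \<oplus>\<^bsub>F\<^esub> f g"
        using yf[OF g h] g h by (simp add: y \<chi>k)
      have "(\<psi>2 g \<otimes>\<^bsub>F\<^esub> k g) \<otimes>\<^bsub>F\<^esub> ((\<psi>2 h \<otimes>\<^bsub>F\<^esub> k h) \<otimes>\<^bsub>F\<^esub> z g h) = \<psi>2 g \<otimes>\<^bsub>F\<^esub> \<psi>2 h \<otimes>\<^bsub>F\<^esub> (k g \<otimes>\<^bsub>F\<^esub> k h \<otimes>\<^bsub>F\<^esub> z g h)"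
        and "\<psi>2 g \<otimes>\<^bsub>F\<^esub> \<psi>2 h \<otimes>\<^bsub>F\<^esub> (\<psi>1 g \<otimes>\<^bsub>F\<^esub> k g \<otimes>\<^bsub>F\<^esub> f h \<ominus>\<^bsub>F\<^esub> f (g \<otimes>\<^bsub>G\<^esub> h) \<oplus>\<^bsub>F\<^esub> f g) =
          \<psi>1 g \<otimes>\<^bsub>F\<^esub> ((\<psi>2 g \<otimes>\<^bsub>F\<^esub> k g) \<otimes>\<^bsub>F\<^esub> (\<psi>2 h \<otimes>\<^bsub>F\<^esub> f h)) \<oplus>\<^bsub>F\<^esub> \<psi>2 h \<otimes>\<^bsub>F\<^esub> (\<psi>2 g \<otimes>\<^bsub>F\<^esub> f g) \<ominus>\<^bsub>F\<^esub> \<psi>2 g \<otimes>\<^bsub>F\<^esub> \<psi>2 h \<otimes>\<^bsub>F\<^esub> f (g \<otimes>\<^bsub>G\<^esub> h)"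
        using k(1)[OF g] k(1)[OF h] p1(1)[OF g] p2(1)[OF g] p2(1)[OF h] z[OF g h] f[OF g] f[OF h] f[OF G.m_closed[OF g h]] by algebra+
      then show ?thesis unfolding e p2(3)[OF g h] k(2)[OF g] k(2)[OF h] using z[OF g h] f[OF h] p2(1)[OF h] by simp
    qed
    moreover have "near \<tau> (\<lambda>g h. \<psi>2 h \<otimes>\<^bsub>F\<^esub> f h = \<psi>2 g \<otimes>\<^bsub>F\<^esub> f g)"
      by (rule near_mono2[OF p2(5) fn]) simp
    ultimately show "\<exists>f. (\<forall>g\<in>carrier G. f g \<in> carrier F) \<and> near \<tau> (\<lambda>g h. f h = f g) \<and>
        (\<forall>g\<in>carrier G. \<forall>h\<in>carrier G. z g h = \<psi>1 g \<otimes>\<^bsub>F\<^esub> f h \<oplus>\<^bsub>F\<^esub> \<psi>2 h \<otimes>\<^bsub>F\<^esub> f g \<ominus>\<^bsub>F\<^esub> f (g \<otimes>\<^bsub>G\<^esub> h))"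
      using f p2(1) by (intro exI[of _ "\<lambda>g. \<psi>2 g \<otimes>\<^bsub>F\<^esub> f g"]) simp
  qed (simp_all add: F grp comp top cont p1 p2 u c)
qed

lemma reduced_deformation_iso:
  fixes F :: "'k ring" and Rpd :: "(nat \<Rightarrow> 'k, 'r) module" and Rdef :: "(nat \<Rightarrow> 'k, 's) module"
  assumes res: "residual_extension F G \<tau> \<psi>1 \<psi>2 (\<lambda>g. \<psi>2 g \<otimes>\<^bsub>F\<^esub> c g) u"
    and rho0: "\<And>g. g \<in> carrier G \<Longrightarrow> mat2_tr F (\<rho>0 g) = \<psi>1 g \<oplus>\<^bsub>F\<^esub> \<psi>2 g \<and> mat2_det F (\<rho>0 g) = \<psi>1 g \<otimes>\<^bsub>F\<^esub> \<psi>2 g"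
    and Rpd: "is_universal_pseudo_deformation p F G \<tau> \<rho>0 Rpd T D"
    and Rdef: "is_universal_deformation p F G \<tau> (extension_rep F \<psi>1 \<psi>2 c) Rdef \<rho>"
    and Psi: "\<Psi> \<in> coeff_hom p F Rpd Rdef"
      "\<forall>g\<in>carrier G. \<Psi> (T g) = mat2_tr Rdef (\<rho> g) \<and> \<Psi> (D g) = mat2_det Rdef (\<rho> g)"
  shows "induced_reduced_map Rpd Rdef \<Psi> \<in> ring_iso (reduced_quotient Rpd) (reduced_quotient Rdef)"
proof -
  interpret residual_extension F G \<tau> \<psi>1 \<psi>2 "\<lambda>g. \<psi>2 g \<otimes>\<^bsub>F\<^esub> c g" u by (rule res)
  interpret deformation_comparison F G \<tau> \<psi>1 \<psi>2 "\<lambda>g. \<psi>2 g \<otimes>\<^bsub>F\<^esub> c g" u p \<rho>0 "extension_rep F \<psi>1 \<psi>2 c" Rpd T D Rdef \<rho> \<Psi>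
    by (intro deformation_comparison.intro deformation_comparison_axioms.intro res rho0 Rpd Rdef Psi(1))
      (use Psi(2) in \<open>simp_all add: extension_rep_def \<rho>bar_def\<close>)
  show ?thesis by (rule reduced_iso)
qed

theorem theorem3p5:
  fixes p :: nat and F :: "'k ring" and G :: "'g monoid" and \<tau> :: "'g topology"
    and chi\<^sub>1 chi\<^sub>2 chi c :: "'g \<Rightarrow> 'k" and x :: "('g \<Rightarrow> 'k) set" and i :: int
    and \<rho>\<^sub>0 \<rho>\<^sub>x :: "'g \<Rightarrow> 'k mat2"
    and Rpd :: "(nat \<Rightarrow> 'k, 'r) module" and Tuniv Duniv :: "'g \<Rightarrow> 'r"
    and Rdef :: "(nat \<Rightarrow> 'k, 's) module" and \<rho>univ :: "'g \<Rightarrow> 's mat2"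
    and \<Psi> :: "'r \<Rightarrow> 's"
  assumes p: "normalization_semidom_class.prime p" "odd p"
    and F: "field F" "finite (carrier F)" "add_pow F p \<one>\<^bsub>F\<^esub> = \<zero>\<^bsub>F\<^esub>"
    and G: "profinite_group G \<tau>" "mazur_finiteness p G \<tau>"
    and chars: "cont_character G \<tau> F chi\<^sub>1" "cont_character G \<tau> F chi\<^sub>2"
      "\<exists>g\<in>carrier G. chi\<^sub>1 g \<noteq> chi\<^sub>2 g"
    and rho0: "\<rho>\<^sub>0 = direct_sum_rep F chi\<^sub>1 chi\<^sub>2"
    and chi_def: "chi = char_ratio F chi\<^sub>1 chi\<^sub>2"
    and H1_nonzero: "carrier (H1 G \<tau> F chi) \<noteq> {\<zero>\<^bsub>H1 G \<tau> F chi\<^esub>}"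
      "carrier (H1 G \<tau> F (char_pow F chi (- 1))) \<noteq> {\<zero>\<^bsub>H1 G \<tau> F (char_pow F chi (- 1))\<^esub>}"
    and i: "i \<in> {1, - 1}"
    and H1_dim: "vectorspace.fin_dim F (H1 G \<tau> F (char_pow F chi i))"
      "vectorspace.dim F (H1 G \<tau> F (char_pow F chi i)) = 1"
    and H2_zero: "carrier (H2 G \<tau> F (char_pow F chi i)) = {\<zero>\<^bsub>H2 G \<tau> F (char_pow F chi i)\<^esub>}"
    and x: "x \<in> carrier (H1 G \<tau> F (char_pow F chi i))" "x \<noteq> \<zero>\<^bsub>H1 G \<tau> F (char_pow F chi i)\<^esub>" "c \<in> x"
    and rhox: "\<rho>\<^sub>x = (if i = 1 then extension_rep F chi\<^sub>1 chi\<^sub>2 c else extension_rep F chi\<^sub>2 chi\<^sub>1 c)"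
    and Rpd: "is_universal_pseudo_deformation p F G \<tau> \<rho>\<^sub>0 Rpd Tuniv Duniv"
    and Rdef: "is_universal_deformation p F G \<tau> \<rho>\<^sub>x Rdef \<rho>univ"
    and Psi: "\<Psi> \<in> coeff_hom p F Rpd Rdef"
      "\<forall>g\<in>carrier G. \<Psi> (Tuniv g) = mat2_tr Rdef (\<rho>univ g) \<and> \<Psi> (Duniv g) = mat2_det Rdef (\<rho>univ g)"
  shows "induced_reduced_map Rpd Rdef \<Psi> \<in> ring_iso (reduced_quotient Rpd) (reduced_quotient Rdef)"
proof -
  interpret F: field F by (rule F(1))
  have grp: "group G" using G(1) by (simp add: profinite_group_def topological_group_def)
  note c1 = cont_characterD[OF chars(1) F(1) grp] and c2 = cont_characterD[OF chars(2) F(1) grp]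
  \<comment> \<open>An element at which the characters differ; it is the one to be diagonalised in
    all later arguments.\<close>
  obtain u where u: "u \<in> carrier G" "chi\<^sub>1 u \<noteq> chi\<^sub>2 u" using chars(3) by blast
  have un: "chi\<^sub>1 g \<in> Units F" "chi\<^sub>2 g \<in> Units F" if "g \<in> carrier G" for g
    using c1(1,2)[OF that] c2(1,2)[OF that] by (simp_all add: F.field_Units)
  consider "i = 1" | "i = - 1" using i by blast
  then show ?thesis
  proof cases
    case 1
    have chi: "char_pow F chi i g = chi\<^sub>1 g \<otimes>\<^bsub>F\<^esub> inv\<^bsub>F\<^esub> (chi\<^sub>2 g)" if g: "g \<in> carrier G" for g
      using un[OF g] c1(1)[OF g] c2(1)[OF g] by (simp add: 1 char_pow_def chi_def char_ratio_def int_pow_def2)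
    show ?thesis
    proof (rule reduced_deformation_iso[OF _ _ Rpd _ Psi])
      show "residual_extension F G \<tau> chi\<^sub>1 chi\<^sub>2 (\<lambda>g. chi\<^sub>2 g \<otimes>\<^bsub>F\<^esub> c g) u"
        by (rule residual_extension_of_class[OF F(1,2) G(1) chars(1,2) u chi H1_dim H2_zero x])
      show "is_universal_deformation p F G \<tau> (extension_rep F chi\<^sub>1 chi\<^sub>2 c) Rdef \<rho>univ"
        using Rdef 1 by (simp add: rhox)
      show "mat2_tr F (\<rho>\<^sub>0 g) = chi\<^sub>1 g \<oplus>\<^bsub>F\<^esub> chi\<^sub>2 g \<and> mat2_det F (\<rho>\<^sub>0 g) = chi\<^sub>1 g \<otimes>\<^bsub>F\<^esub> chi\<^sub>2 g" if "g \<in> carrier G" for g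
        using c1(1)[OF that] c2(1)[OF that] by (simp add: rho0 direct_sum_rep_def mat2_tr_def mat2_det_def a_minus_def)
    qed
  next
    case 2
    \<comment> \<open>For the exponent -1 the coefficient character is the inverse ratio, so
      \<open>chi\<^sub>1\<close> and \<open>chi\<^sub>2\<close> exchange roles, while the trace and
      determinant of \<open>\<rho>\<^sub>0\<close> stay the same.\<close>
    have chi: "char_pow F chi i g = chi\<^sub>2 g \<otimes>\<^bsub>F\<^esub> inv\<^bsub>F\<^esub> (chi\<^sub>1 g)" if g: "g \<in> carrier G" for g
    proof -
      have "inv\<^bsub>F\<^esub> (chi\<^sub>1 g \<otimes>\<^bsub>F\<^esub> inv\<^bsub>F\<^esub> (chi\<^sub>2 g)) = chi\<^sub>2 g \<otimes>\<^bsub>F\<^esub> inv\<^bsub>F\<^esub> (chi\<^sub>1 g)"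
      proof (rule F.comm_inv_char)
        note cl = un[OF g] c1(1)[OF g] c2(1)[OF g]
        have "(chi\<^sub>1 g \<otimes>\<^bsub>F\<^esub> inv\<^bsub>F\<^esub> (chi\<^sub>2 g)) \<otimes>\<^bsub>F\<^esub> (chi\<^sub>2 g \<otimes>\<^bsub>F\<^esub> inv\<^bsub>F\<^esub> (chi\<^sub>1 g)) =
          (chi\<^sub>1 g \<otimes>\<^bsub>F\<^esub> inv\<^bsub>F\<^esub> (chi\<^sub>1 g)) \<otimes>\<^bsub>F\<^esub> (chi\<^sub>2 g \<otimes>\<^bsub>F\<^esub> inv\<^bsub>F\<^esub> (chi\<^sub>2 g))"
          using cl F.Units_inv_closed[OF cl(1)] F.Units_inv_closed[OF cl(2)] by algebra
        then show "(chi\<^sub>1 g \<otimes>\<^bsub>F\<^esub> inv\<^bsub>F\<^esub> (chi\<^sub>2 g)) \<otimes>\<^bsub>F\<^esub> (chi\<^sub>2 g \<otimes>\<^bsub>F\<^esub> inv\<^bsub>F\<^esub> (chi\<^sub>1 g)) = \<one>\<^bsub>F\<^esub>"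
          using cl by simp
      qed (use un[OF g] c1(1)[OF g] c2(1)[OF g] in simp_all)
      then show ?thesis using un[OF g] c1(1)[OF g] c2(1)[OF g] by (simp add: 2 char_pow_def chi_def char_ratio_def int_pow_def2)
    qed
    show ?thesis
    proof (rule reduced_deformation_iso[OF _ _ Rpd _ Psi])
      show "residual_extension F G \<tau> chi\<^sub>2 chi\<^sub>1 (\<lambda>g. chi\<^sub>1 g \<otimes>\<^bsub>F\<^esub> c g) u"
        by (rule residual_extension_of_class[OF F(1,2) G(1) chars(2,1) u(1) u(2)[symmetric] chi H1_dim H2_zero x])
      show "is_universal_deformation p F G \<tau> (extension_rep F chi\<^sub>2 chi\<^sub>1 c) Rdef \<rho>univ"
        using Rdef 2 by (simp add: rhox)
      show "mat2_tr F (\<rho>\<^sub>0 g) = chi\<^sub>2 g \<oplus>\<^bsub>F\<^esub> chi\<^sub>1 g \<and> mat2_det F (\<rho>\<^sub>0 g) = chi\<^sub>2 g \<otimes>\<^bsub>F\<^esub> chi\<^sub>1 g" if "g \<in> carrier G" for g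
        using c1(1)[OF that] c2(1)[OF that]
        by (simp add: rho0 direct_sum_rep_def mat2_tr_def mat2_det_def a_minus_def F.a_comm F.m_comm)
    qed
  qed
qed

end
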